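(* For any $v_0\in H^{-s}_{r,c}$ with $0<s<1/2$ and $c\in\mathbb{R}$, the solution $t\mapsto\mathcal{S}(t,v_0)$ of the Benjamin-Ono equation has the following properties: (i) The orbit $\{\mathcal{S}(t,v_0) : t\in\mathbb{R}\}$ is relatively compact in $H^{-s}_{r,c}$. (ii) The solution $t\mapsto\mathcal{S}(t,v_0)$ is almost periodic in $H^{-s}_{r,c}$.
   Context: Let $\mathbb{T} = \mathbb{R}/2\pi\mathbb{Z}$, $\widehat f(n) = \frac{1}{2\pi}\int_0^{2\pi} f(x)e^{-inx}dx$ (extended to distributions), $\langle n\rangle = \max\{1,|n|\}$. For $\sigma\in\mathbb{R}$, $H^\sigma_r = H^\sigma(\mathbb{T},\mathbb{R})$ is the Sobolev space of real valued distributions with norm $\|v\|_\sigma = (\sum_{n\in\mathbb{Z}} \langle n\rangle^{2\sigma}|\widehat v(n)|^2)^{1/2}$, and $H^\sigma_{r,c} = \{w\in H^\sigma_r : \widehat w(0) = c\}$. The Benjamin-Ono (BO) equation on $\mathbb{T}$ is $\partial_t v = H\partial_x^2 v - \partial_x(v^2)$ with $v(t,x)$ real valued, where $Hf(x) = \sum_{n\in\mathbb{Z}} -i\,\mathrm{sign}(n)\widehat f(n)e^{inx}$, $\mathrm{sign}(0)=0$. For $\sigma>3/2$ and $v_0\in H^\sigma_r$ there is a unique (classical) solution $\mathcal{S}(\cdot,v_0)\in C(\mathbb{R},H^\sigma_r)\cap C^1(\mathbb{R},H^{\sigma-2}_r)$ of the BO equation with initial data $v_0$. For $0\le s<1/2$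 and $v_0\in H^{-s}_r$, $\mathcal{S}(\cdot,v_0)$ denotes the global in time solution, i.e. the continuous curve $\gamma:\mathbb{R}\to H^{-s}_r$ with $\gamma(0) = v_0$ such that for any sequence $(v_0^{(k)})_{k\ge1}$ in $H^\sigma_r$ with $\sigma>3/2$ converging to $v_0$ in $H^{-s}_r$, the classical solutions $\mathcal{S}(\cdot,v_0^{(k)})$ converge to $\gamma$ in $C(\mathbb{R},H^{-s}_r)$ (uniformly on compact time intervals). Such a solution exists for every $v_0 \in H^{-s}_r$, and it stays in $H^{-s}_{r,c}$ if $v_0\in H^{-s}_{r,c}$. A bounded continuous function $f:\mathbb{R}\to X$ with values in a Banach space $X$ is almost periodic if (by Bochner's characterization) the set of translates $\{f_\tau:\tau\in\mathbb{R}\}$, $f_\tau(t):=f(t+\tau)$, is relatively compact in the space $\mathcal{C}_b(\mathbb{R},X)$ of bounded continuous functions with the supremum norm. Almost periodicity in the affine space $H^{-s}_{r,c}$ is understood as almost periodicity as a function with values in the Banach space $H^{-s}_r$. *)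

theory Defs
  imports "HOL-Analysis.Analysis"
begin

section \<open>Distributions on the circle\<close>

definition vderiv :: "(real \<Rightarrow> complex) \<Rightarrow> real \<Rightarrow> complex" where
  "vderiv f = (\<lambda>x. vector_derivative f (at x))"

definition test_fun :: "(real \<Rightarrow> complex) set" where
  "test_fun = {f. (\<forall>x. f (x + 2 * pi) = f x) \<and> (\<forall>k x. (vderiv ^^ k) f differentiable at x)}"

definition sup_deriv :: "nat \<Rightarrow> (real \<Rightarrow> complex) \<Rightarrow> real" where
  "sup_deriv k f = (SUP x\<in>{0..2 * pi}. cmod ((vderiv ^^ k) f x))"

lemma test_fun_derivative:
  assumes "f \<in> test_fun"
  shows "((vderiv ^^ k) f has_vector_derivative (vderiv ^^ Suc k) f x) (at x)"
  using assms by (simp add: test_fun_def vderiv_def vector_derivative_works)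

lemma test_fun_derivative0:
  assumes "f \<in> test_fun"
  shows "(f has_vector_derivative vderiv f x) (at x)"
  using test_fun_derivative[OF assms, of 0] by simp

lemma test_fun_periodic: "f \<in> test_fun \<Longrightarrow> f (x + 2 * pi) = f x"
  by (simp add: test_fun_def)

lemma vderiv_eqI: "(\<And>x. (f has_vector_derivative g x) (at x)) \<Longrightarrow> vderiv f = g"
  by (auto simp: vderiv_def vector_derivative_at)

lemma test_fun_continuous: "f \<in> test_fun \<Longrightarrow> continuous_on S ((vderiv ^^ k) f)"
  by (meson test_fun_derivative continuous_at_imp_continuous_on has_vector_derivative_continuous)

lemma test_fun_continuous0: "f \<in> test_fun \<Longrightarrow> continuous_on S f"
  using test_fun_continuous[of f S 0] by simp

lemma test_funI:
  assumes "\<And>x. f (x + 2 * pi) = f x" "D 0 = f"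
    and "\<And>k x. (D k has_vector_derivative D (Suc k) x) (at x)"
  shows "f \<in> test_fun" "(vderiv ^^ k) f = D k"
proof -
  have *: "(vderiv ^^ k) f = D k" for k
    by (induction k) (use assms in \<open>auto intro!: vderiv_eqI\<close>)
  then show "(vderiv ^^ k) f = D k" .
  show "f \<in> test_fun"
    unfolding test_fun_def using assms * by (auto intro: differentiableI_vector)
qed

lemma test_fun_vderiv:
  assumes "f \<in> test_fun" shows "vderiv f \<in> test_fun"
proof (rule test_funI(1)[where D = "\<lambda>k. (vderiv ^^ Suc k) f"])
  show "((vderiv ^^ Suc k) f has_vector_derivative (vderiv ^^ Suc (Suc k)) f x) (at x)" for k x
    by (rule test_fun_derivative[OF assms])
  show "vderiv f (x + 2 * pi) = vderiv f x" for x
  proof -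
    have "(f has_vector_derivative vderiv f (x + 2 * pi)) (at (x + 2 * pi))"
      by (rule test_fun_derivative0[OF assms])
    then have "((f \<circ> (\<lambda>x. x + 2 * pi)) has_vector_derivative (1 *\<^sub>R vderiv f (x + 2 * pi))) (at x)"
      by (intro vector_diff_chain_at) (auto intro!: derivative_eq_intros)
    moreover have "f \<circ> (\<lambda>x. x + 2 * pi) = f"
      using assms by (auto simp: test_fun_periodic)
    ultimately show ?thesis
      using vector_derivative_at test_fun_derivative0[OF assms, of x] by (metis scaleR_one)
  qed
qed auto

lemma test_fun_add:
  assumes "f \<in> test_fun" "g \<in> test_fun"
  shows "(\<lambda>x. f x + g x) \<in> test_fun"
    and "(vderiv ^^ k) (\<lambda>x. f x + g x) = (\<lambda>x. (vderiv ^^ k) f x + (vderiv ^^ k) g x)"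
  by (rule test_funI[where D = "\<lambda>k x. (vderiv ^^ k) f x + (vderiv ^^ k) g x"];
      use assms in \<open>auto simp: test_fun_periodic
        intro!: has_vector_derivative_add test_fun_derivative[simplified]\<close>)+

lemma test_fun_cmult:
  assumes "f \<in> test_fun"
  shows "(\<lambda>x. c * f x) \<in> test_fun"
    and "(vderiv ^^ k) (\<lambda>x. c * f x) = (\<lambda>x. c * (vderiv ^^ k) f x)"
  by (rule test_funI[where D = "\<lambda>k x. c * (vderiv ^^ k) f x"];
      use assms in \<open>auto simp: test_fun_periodic
        intro!: has_vector_derivative_mult_right test_fun_derivative[simplified]\<close>)+

lemma cis_2pi_int: "cis (of_int n * (x + 2 * pi)) = cis (of_int n * x)"
proof -
  have "cis (of_int n * (x + 2 * pi)) = cis (of_int n * x) * cis (2 * pi * of_int n)"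
    by (simp add: cis_mult algebra_simps)
  then show ?thesis by simp
qed

lemma test_fun_cis:
  shows "(\<lambda>x. c * cis (of_int n * x)) \<in> test_fun"
    and "(vderiv ^^ k) (\<lambda>x. c * cis (of_int n * x)) = (\<lambda>x. (\<i> * of_int n) ^ k * c * cis (of_int n * x))"
proof -
  have *: "((\<lambda>x. (\<i> * of_int n) ^ k * c * cis (of_int n * x)) has_vector_derivative
      (\<i> * of_int n) ^ Suc k * c * cis (of_int n * x)) (at x)" for k x
    unfolding cis_conv_exp
    by (auto intro!: derivative_eq_intros has_vector_derivative_real_field simp: field_simps)
  show "(\<lambda>x. c * cis (of_int n * x)) \<in> test_fun"
    and "(vderiv ^^ k) (\<lambda>x. c * cis (of_int n * x)) = (\<lambda>x. (\<i> * of_int n) ^ k * c * cis (of_int n * x))"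
    by (rule test_funI[where D = "\<lambda>k x. (\<i> * of_int n) ^ k * c * cis (of_int n * x)"];
        use * cis_2pi_int in \<open>auto\<close>)+
qed

lemma test_fun_cis1: "(\<lambda>x. cis (of_int n * x)) \<in> test_fun"
  using test_fun_cis(1)[of 1 n] by simp

lemma test_fun_zero: "(\<lambda>x. 0) \<in> test_fun"
  using test_fun_cis(1)[of 0 0] by simp

lemma sup_deriv_ge:
  assumes "f \<in> test_fun" "x \<in> {0..2 * pi}"
  shows "cmod ((vderiv ^^ k) f x) \<le> sup_deriv k f"
proof -
  have "compact ((\<lambda>x. cmod ((vderiv ^^ k) f x)) ` {0..2 * pi})"
    by (intro compact_continuous_image continuous_intros test_fun_continuous assms compact_Icc)
  then have "bdd_above ((\<lambda>x. cmod ((vderiv ^^ k) f x)) ` {0..2 * pi})"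
    by (simp add: bounded_imp_bdd_above compact_imp_bounded)
  then show ?thesis
    unfolding sup_deriv_def using assms(2) by (rule cSUP_upper[rotated])
qed

lemma sup_deriv_le:
  assumes "\<And>x. x \<in> {0..2 * pi} \<Longrightarrow> cmod ((vderiv ^^ k) f x) \<le> B"
  shows "sup_deriv k f \<le> B"
  unfolding sup_deriv_def using assms by (intro cSUP_least) auto

lemma sup_deriv_nonneg: "f \<in> test_fun \<Longrightarrow> 0 \<le> sup_deriv k f"
  by (rule order_trans[OF norm_ge_zero sup_deriv_ge[of f 0 k]]) auto

text \<open>
  A distribution is a linear functional on the smooth \<open>2 * pi\<close>-periodic functions, continuous for
  the seminorms \<^const>\<open>sup_deriv\<close>; it is set to \<open>0\<close> on all other arguments to make equality of
  functionals the equality of distributions.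
\<close>

definition is_distr :: "((real \<Rightarrow> complex) \<Rightarrow> complex) \<Rightarrow> bool" where
  "is_distr u \<longleftrightarrow>
     (\<forall>f\<in>test_fun. \<forall>g\<in>test_fun. u (\<lambda>x. f x + g x) = u f + u g) \<and>
     (\<forall>c. \<forall>f\<in>test_fun. u (\<lambda>x. c * f x) = c * u f) \<and>
     (\<exists>C N. \<forall>f\<in>test_fun. cmod (u f) \<le> C * (\<Sum>k\<le>N. sup_deriv k f)) \<and>
     (\<forall>f. f \<notin> test_fun \<longrightarrow> u f = 0)"

typedef distr = "{u. is_distr u}" morphisms pairing Abs_distr
proof -
  have "is_distr (\<lambda>_. 0)"
    unfolding is_distr_def by (auto intro!: exI[of _ "0::real"])
  then show ?thesis by blast
qed

setup_lifting type_definition_distr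

lemma is_distrI:
  assumes "\<And>f g. f \<in> test_fun \<Longrightarrow> g \<in> test_fun \<Longrightarrow> u (\<lambda>x. f x + g x) = u f + u g"
    and "\<And>c f. f \<in> test_fun \<Longrightarrow> u (\<lambda>x. c * f x) = c * u f"
    and "\<And>f. f \<in> test_fun \<Longrightarrow> cmod (u f) \<le> C * (\<Sum>k\<le>N. sup_deriv k f)"
    and "\<And>f. f \<notin> test_fun \<Longrightarrow> u f = 0"
  shows "is_distr u"
  using assms unfolding is_distr_def by blast

lemma is_distrD:
  assumes "is_distr u"
  shows "f \<in> test_fun \<Longrightarrow> g \<in> test_fun \<Longrightarrow> u (\<lambda>x. f x + g x) = u f + u g"
    and "f \<in> test_fun \<Longrightarrow> u (\<lambda>x. c * f x) = c * u f"
    and "f \<notin> test_fun \<Longrightarrow> u f = 0"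
  using assms unfolding is_distr_def by blast+

lemma is_distr_boundE:
  assumes "is_distr u"
  obtains C N where "C \<ge> 0"
    "\<And>f M. f \<in> test_fun \<Longrightarrow> M \<ge> N \<Longrightarrow> cmod (u f) \<le> C * (\<Sum>k\<le>M. sup_deriv k f)"
proof -
  from assms obtain C N where *: "\<And>f. f \<in> test_fun \<Longrightarrow> cmod (u f) \<le> C * (\<Sum>k\<le>N. sup_deriv k f)"
    unfolding is_distr_def by blast
  show thesis
  proof (rule that[of "\<bar>C\<bar>" N])
    fix f M assume f: "f \<in> test_fun" "M \<ge> N"
    have "cmod (u f) \<le> \<bar>C\<bar> * (\<Sum>k\<le>N. sup_deriv k f)"
      by (rule order_trans[OF *[OF f(1)] mult_right_mono]) (auto intro!: sum_nonneg sup_deriv_nonneg f)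
    also have "\<dots> \<le> \<bar>C\<bar> * (\<Sum>k\<le>M. sup_deriv k f)"
      using f by (intro mult_left_mono sum_mono2 sup_deriv_nonneg) auto
    finally show "cmod (u f) \<le> \<bar>C\<bar> * (\<Sum>k\<le>M. sup_deriv k f)" .
  qed auto
qed

lemma is_distr_add: "is_distr u \<Longrightarrow> is_distr v \<Longrightarrow> is_distr (\<lambda>f. u f + v f)"
proof -
  assume u: "is_distr u" and v: "is_distr v"
  from is_distr_boundE[OF u] obtain C N where C:
    "\<And>f M. f \<in> test_fun \<Longrightarrow> M \<ge> N \<Longrightarrow> cmod (u f) \<le> C * (\<Sum>k\<le>M. sup_deriv k f)" by metis
  from is_distr_boundE[OF v] obtain D K where D:
    "\<And>f M. f \<in> test_fun \<Longrightarrow> M \<ge> K \<Longrightarrow> cmod (v f) \<le> D * (\<Sum>k\<le>M. sup_deriv k f)" by metis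
  have "cmod (u f + v f) \<le> (C + D) * (\<Sum>k\<le>max N K. sup_deriv k f)" if "f \<in> test_fun" for f
    unfolding distrib_right
    by (rule order_trans[OF norm_triangle_ineq add_mono[OF C[OF that] D[OF that]]]) auto
  with u v show ?thesis
    by (intro is_distrI[where C = "C + D" and N = "max N K"]) (simp_all add: is_distrD distrib_left)
qed

lemma is_distr_cmult: "is_distr u \<Longrightarrow> is_distr (\<lambda>f. a * u f)"
proof -
  assume u: "is_distr u"
  from is_distr_boundE[OF u] obtain C N where C:
    "\<And>f M. f \<in> test_fun \<Longrightarrow> M \<ge> N \<Longrightarrow> cmod (u f) \<le> C * (\<Sum>k\<le>M. sup_deriv k f)" by metis
  have "cmod (a * u f) \<le> cmod a * C * (\<Sum>k\<le>N. sup_deriv k f)" if "f \<in> test_fun" for f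
    unfolding mult.assoc norm_mult by (intro mult_left_mono C that) auto
  with u show ?thesis
    by (intro is_distrI[where C = "cmod a * C" and N = N]) (simp_all add: is_distrD distrib_left)
qed

instantiation distr :: real_vector
begin

lift_definition zero_distr :: distr is "\<lambda>f. 0"
  by (rule is_distrI[where C = 0]) auto

lift_definition plus_distr :: "distr \<Rightarrow> distr \<Rightarrow> distr" is "\<lambda>u v f. u f + v f"
  by (rule is_distr_add)

lift_definition uminus_distr :: "distr \<Rightarrow> distr" is "\<lambda>u f. - u f"
  using is_distr_cmult[of _ "-1"] by simp

lift_definition minus_distr :: "distr \<Rightarrow> distr \<Rightarrow> distr" is "\<lambda>u v f. u f - v f"
  using is_distr_add is_distr_cmult[of _ "-1"] by fastforce

lift_definition scaleR_distr :: "real \<Rightarrow> distr \<Rightarrow> distr" is "\<lambda>r u f. r *\<^sub>R u f"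
  unfolding scaleR_conv_of_real by (rule is_distr_cmult)

instance
  by standard (transfer; simp add: fun_eq_iff algebra_simps)+

end

text \<open>
  A function \<open>h\<close> acts on \<open>f\<close> as the integral of \<open>h * f\<close> over a period, without the factor \<open>1 / (2 * pi)\<close>
  (see \<open>distr_of_fun\<close> below), so the factor appears in the Fourier coefficients.
\<close>

definition fourier :: "distr \<Rightarrow> int \<Rightarrow> complex" where
  "fourier u n = pairing u (\<lambda>x. cis (- of_int n * x)) / (2 * pi)"

definition real_valued :: "distr \<Rightarrow> bool" where
  "real_valued u \<longleftrightarrow> (\<forall>f\<in>test_fun. pairing u (\<lambda>x. cnj (f x)) = cnj (pairing u f))"

lift_definition distr_deriv :: "distr \<Rightarrow> distr" is
  "\<lambda>u f. if f \<in> test_fun then - u (vderiv f) else 0"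
proof -
  fix u assume u: "is_distr u"
  from is_distr_boundE[OF u] obtain C N where C: "C \<ge> 0"
    "\<And>f M. f \<in> test_fun \<Longrightarrow> M \<ge> N \<Longrightarrow> cmod (u f) \<le> C * (\<Sum>k\<le>M. sup_deriv k f)" by metis
  show "is_distr (\<lambda>f. if f \<in> test_fun then - u (vderiv f) else 0)"
  proof (rule is_distrI[where C = C and N = "Suc N"])
    fix f assume f: "f \<in> test_fun"
    have "cmod (u (vderiv f)) \<le> C * (\<Sum>k\<le>N. sup_deriv k (vderiv f))"
      by (rule C(2)) (simp_all add: test_fun_vderiv f)
    also have "\<dots> = C * (\<Sum>k\<le>N. sup_deriv (Suc k) f)"
      by (simp add: sup_deriv_def funpow_swap1)
    also have "\<dots> \<le> C * (\<Sum>k\<le>Suc N. sup_deriv k f)"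
      unfolding sum.atMost_Suc_shift
      by (intro mult_left_mono C(1)) (simp add: sup_deriv_nonneg f)
    finally show "cmod (if f \<in> test_fun then - u (vderiv f) else 0) \<le> C * (\<Sum>k\<le>Suc N. sup_deriv k f)"
      using f by simp
  next
    fix f g assume *: "f \<in> test_fun" "g \<in> test_fun"
    then show "(if (\<lambda>x. f x + g x) \<in> test_fun then - u (vderiv (\<lambda>x. f x + g x)) else 0) =
      (if f \<in> test_fun then - u (vderiv f) else 0) + (if g \<in> test_fun then - u (vderiv g) else 0)"
      using u test_fun_add(2)[OF *, of 1] by (simp add: is_distrD test_fun_add test_fun_vderiv)
  next
    fix c f assume *: "f \<in> test_fun"
    then show "(if (\<lambda>x. c * f x) \<in> test_fun then - u (vderiv (\<lambda>x. c * f x)) else 0) =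
      c * (if f \<in> test_fun then - u (vderiv f) else 0)"
      using u test_fun_cmult(2)[OF *, of 1 c] by (simp add: is_distrD test_fun_cmult test_fun_vderiv)
  qed auto
qed

lemma test_pairing_integrable:
  assumes "continuous_on UNIV h" "f \<in> test_fun"
  shows "(\<lambda>x. h x * f x) integrable_on {0..2 * pi}"
  by (intro integrable_continuous_interval continuous_intros test_fun_continuous0
      continuous_on_subset[OF assms(1)] assms(2)) auto

definition periodic_continuous :: "(real \<Rightarrow> complex) \<Rightarrow> bool" where
  "periodic_continuous h \<longleftrightarrow> continuous_on UNIV h \<and> (\<forall>x. h (x + 2 * pi) = h x)"

lemma periodic_continuousD:
  assumes "periodic_continuous h"
  shows "continuous_on UNIV h" "h (x + 2 * pi) = h x"
  using assms by (auto simp: periodic_continuous_def)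

lemma is_distr_integral:
  assumes h: "continuous_on UNIV h"
  shows "is_distr (\<lambda>f. if f \<in> test_fun then integral {0..2 * pi} (\<lambda>x. h x * f x) else 0)"
proof -
  have "compact (h ` {0..2 * pi})"
    by (intro compact_continuous_image continuous_on_subset[OF h]) auto
  then obtain B where B: "\<And>x. x \<in> {0..2 * pi} \<Longrightarrow> cmod (h x) \<le> B"
    by (metis bounded_iff compact_imp_bounded image_eqI)
  have "cmod (integral {0..2 * pi} (\<lambda>x. h x * f x)) \<le> (2 * pi * B) * (\<Sum>k\<le>0. sup_deriv k f)"
    if f: "f \<in> test_fun" for f
  proof -
    have "cmod (h x * f x) \<le> B * sup_deriv 0 f" if "x \<in> {0..2 * pi}" for x
      unfolding norm_mult
      using B[OF that] sup_deriv_ge[OF f that, of 0] order_trans[OF norm_ge_zero B[OF that]]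
      by (intro mult_mono) simp_all
    then have "cmod (integral {0..2 * pi} (\<lambda>x. h x * f x)) \<le> B * sup_deriv 0 f * (2 * pi - 0)"
      by (intro integral_bound continuous_intros test_fun_continuous0 continuous_on_subset[OF h] f) auto
    then show ?thesis by (simp add: mult_ac)
  qed
  then show ?thesis
    by (intro is_distrI[where C = "2 * pi * B" and N = 0])
      (auto simp: test_fun_add test_fun_cmult distrib_left integral_add
        test_pairing_integrable[OF h] mult.left_commute[of "h _"])
qed

lift_definition distr_of_fun :: "(real \<Rightarrow> complex) \<Rightarrow> distr" is
  "\<lambda>h f. if periodic_continuous h \<and> f \<in> test_fun
         then integral {0..2 * pi} (\<lambda>x. h x * f x) else 0"
proof -
  fix h :: "real \<Rightarrow> complex"
  have "is_distr (\<lambda>f. 0)"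
    using pairing[of 0] by (simp add: zero_distr.rep_eq)
  then show "is_distr (\<lambda>f. if periodic_continuous h \<and> f \<in> test_fun
         then integral {0..2 * pi} (\<lambda>x. h x * f x) else 0)"
    using is_distr_integral[OF periodic_continuousD(1)] by (cases "periodic_continuous h") simp_all
qed


section \<open>Density of trigonometric polynomials\<close>

inductive_set trig_poly :: "(real \<Rightarrow> complex) set" where
  monom: "(\<lambda>x. c * cis (of_int n * x)) \<in> trig_poly"
| add: "p \<in> trig_poly \<Longrightarrow> q \<in> trig_poly \<Longrightarrow> (\<lambda>x. p x + q x) \<in> trig_poly"

lemma trig_poly_test_fun: "p \<in> trig_poly \<Longrightarrow> p \<in> test_fun"
  by (induction rule: trig_poly.induct) (rule test_fun_cis test_fun_add; assumption?)+

lemma trig_poly_const: "(\<lambda>x. c) \<in> trig_poly"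
  using trig_poly.monom[of c 0] by simp

lemma trig_poly_mult_monom:
  "q \<in> trig_poly \<Longrightarrow> (\<lambda>x. c * cis (of_int n * x) * q x) \<in> trig_poly"
proof (induction rule: trig_poly.induct)
  case (monom d m)
  have "(\<lambda>x. c * cis (of_int n * x) * (d * cis (of_int m * x))) =
        (\<lambda>x. (c * d) * cis (of_int (n + m) * x))"
    by (simp add: fun_eq_iff cis_mult[symmetric] distrib_right)
  then show ?case using trig_poly.monom by presburger
next
  case (add p q)
  then show ?case unfolding distrib_left by (rule_tac trig_poly.add)
qed

lemma trig_poly_mult:
  "p \<in> trig_poly \<Longrightarrow> q \<in> trig_poly \<Longrightarrow> (\<lambda>x. p x * q x) \<in> trig_poly"
proof (induction rule: trig_poly.induct)
  case (monom c n)
  then show ?case by (rule trig_poly_mult_monom)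
next
  case (add p1 p2)
  then show ?case unfolding distrib_right by (intro trig_poly.add) auto
qed

lemma trig_poly_real_polynomial:
  fixes g :: "complex \<Rightarrow> real"
  assumes "real_polynomial_function g"
  shows "(\<lambda>x. complex_of_real (g (cis x))) \<in> trig_poly"
  using assms
proof (induction rule: real_polynomial_function.induct)
  case (linear f)
  interpret bounded_linear f by fact
  have "complex_of_real (f (cis x)) =
      (f 1 - \<i> * f \<i>) / 2 * cis (of_int 1 * x) + (f 1 + \<i> * f \<i>) / 2 * cis (of_int (-1) * x)" for x
  proof -
    have "cis x = cos x *\<^sub>R 1 + sin x *\<^sub>R \<i>"
      by (simp add: complex_eq_iff)
    then have "f (cis x) = cos x * f 1 + sin x * f \<i>"
      by (metis add scaleR real_scaleR_def)
    then show ?thesis by (simp add: complex_eq_iff field_simps)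
  qed
  then show ?case by (simp only: trig_poly.intros)
next
  case (const c)
  then show ?case by (rule trig_poly_const)
next
  case (add f g)
  then show ?case unfolding of_real_add by (intro trig_poly.add)
next
  case (mult f g)
  then show ?case unfolding of_real_mult by (intro trig_poly_mult)
qed

lemma periodic_int:
  fixes f :: "real \<Rightarrow> 'a"
  assumes "\<And>x. f (x + 2 * pi) = f x"
  shows "f (x + 2 * pi * of_int n) = f x"
proof -
  have nat: "f (x + 2 * pi * of_nat m) = f x" for m x
  proof (induction m)
    case (Suc m)
    then show ?case using assms[of "x + 2 * pi * of_nat m"] by (simp add: algebra_simps)
  qed auto
  show ?thesis
  proof (cases "n \<ge> 0")
    case True
    then show ?thesis using nat[of x "nat n"] by simp
  next
    case False
    then show ?thesis using nat[of "x + 2 * pi * of_int n" "nat (- n)"] by simp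
  qed
qed

lemma periodic_cis_cong:
  fixes f :: "real \<Rightarrow> 'a"
  assumes "\<And>x. f (x + 2 * pi) = f x" "cis a = cis b"
  shows "f a = f b"
proof -
  have "sin a = sin b \<and> cos a = cos b"
    using assms(2) by (metis cis.simps)
  then obtain n :: int where "a = b + 2 * pi * n"
    using sin_cos_eq_iff[of a b] by auto
  then show ?thesis using periodic_int[of f, OF assms(1)] by simp
qed

lemma trig_poly_approx_uniform:
  assumes h: "periodic_continuous h" and "e > 0"
  obtains p where "p \<in> trig_poly" "\<And>x. cmod (h x - p x) < e"
proof -
  note per = periodic_continuousD(2)[OF h]
  have cont: "isCont h x" for x
    using periodic_continuousD(1)[OF h] by (simp add: continuous_on_eq_continuous_at)
  define F where "F = (\<lambda>z. h (Arg z))"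
  have F2: "F z = h (Arg2pi z)" if "z \<in> sphere 0 1" for z
    unfolding F_def
  proof (rule periodic_cis_cong[where f = h, OF per])
    have z: "cmod z = 1" using that by simp
    then have "cis (Arg z) = z" using rcis_cmod_Arg[of z] by (simp add: rcis_def)
    moreover have "cis (Arg2pi z) = z"
      using complex_norm_eq_1_exp[of z] z by (simp add: cis_conv_exp)
    ultimately show "cis (Arg z) = cis (Arg2pi z)" by simp
  qed
  have "continuous (at z within sphere 0 1) F" if z: "z \<in> sphere 0 1" for z
  proof (cases "z \<in> \<real>\<^sub>\<le>\<^sub>0")
    case False
    then show ?thesis
      unfolding F_def
      by (rule continuous_within_compose3[OF cont continuous_at_imp_continuous_at_within[OF continuous_at_Arg]])
  next
    case True
    have "z \<notin> \<real>\<^sub>\<ge>\<^sub>0"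
    proof
      assume "z \<in> \<real>\<^sub>\<ge>\<^sub>0"
      with True have "z = 0" by (simp add: complex_nonpos_Reals_iff complex_nonneg_Reals_iff complex_eq_iff)
      with z show False by simp
    qed
    then have "continuous (at z within sphere 0 1) (\<lambda>z. h (Arg2pi z))"
      by (rule continuous_within_compose3[OF cont continuous_at_imp_continuous_at_within[OF continuous_at_Arg2pi]])
    then show ?thesis
      by (rule continuous_transform_within[OF _ zero_less_one z]) (rule F2[symmetric])
  qed
  then have cF: "continuous_on (sphere 0 1) F"
    by (simp add: continuous_on_eq_continuous_within)
  obtain g where g: "polynomial_function g" "\<And>z. z \<in> sphere 0 1 \<Longrightarrow> cmod (F z - g z) < e"
    using Stone_Weierstrass_polynomial_function[OF compact_sphere cF \<open>e > 0\<close>] by metis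
  have reim: "real_polynomial_function (\<lambda>z. Re (g z))" "real_polynomial_function (\<lambda>z. Im (g z))"
    using g(1)[unfolded polynomial_function_def, rule_format, OF bounded_linear_Re]
      g(1)[unfolded polynomial_function_def, rule_format, OF bounded_linear_Im]
    by (simp_all only: o_def)
  have "(\<lambda>x. complex_of_real (Re (g (cis x))) + \<i> * complex_of_real (Im (g (cis x)))) \<in> trig_poly"
    by (intro trig_poly.add trig_poly_mult trig_poly_const trig_poly_real_polynomial[OF reim(1)]
        trig_poly_real_polynomial[OF reim(2)])
  then have "(\<lambda>x. g (cis x)) \<in> trig_poly"
    by (simp only: complex_eq[symmetric])
  moreover have "cmod (h x - g (cis x)) < e" for x
  proof -
    have "F (cis x) = h x"
      unfolding F_def
    proof (rule periodic_cis_cong[where f = h, OF per])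
      show "cis (Arg (cis x)) = cis x" using rcis_cmod_Arg[of "cis x"] by (simp add: rcis_def)
    qed
    then show ?thesis using g(2)[of "cis x"] by simp
  qed
  ultimately show thesis by (rule that)
qed

lemma trig_poly_antiderivative:
  assumes "p \<in> trig_poly"
  shows "\<exists>q\<in>trig_poly. \<exists>m. \<forall>x. (q has_vector_derivative p x - m) (at x)"
  using assms
proof (induction rule: trig_poly.induct)
  case (monom c n)
  show ?case
  proof (cases "n = 0")
    case True
    then show ?thesis
      by (intro bexI[OF _ trig_poly_const[of 0]] exI[of _ c]) auto
  next
    case False
    have "((\<lambda>x. c / (\<i> * of_int n) * cis (of_int n * x)) has_vector_derivative c * cis (of_int n * x) - 0) (at x)" for x
      using test_fun_derivative0[OF test_fun_cis(1)[of "c / (\<i> * of_int n)" n], of x]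
        test_fun_cis(2)[of 1 "c / (\<i> * of_int n)" n] False
      by (simp add: field_simps)
    then show ?thesis using trig_poly.monom by blast
  qed
next
  case (add p q)
  then obtain P m Q k where "P \<in> trig_poly" "Q \<in> trig_poly"
    "\<And>x. (P has_vector_derivative p x - m) (at x)" "\<And>x. (Q has_vector_derivative q x - k) (at x)"
    by blast
  then show ?case
    by (intro bexI[where x = "\<lambda>x. P x + Q x"] exI[where x = "m + k"] trig_poly.add)
      (auto simp: add_diff_add intro: has_vector_derivative_add)
qed

lemma vector_derivative_bound:
  fixes f :: "real \<Rightarrow> complex"
  assumes "\<And>x. (f has_vector_derivative f' x) (at x)"
    and "\<And>x. x \<in> {0..2 * pi} \<Longrightarrow> cmod (f' x) \<le> B" "x \<in> {0..2 * pi}"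
  shows "cmod (f x - f 0) \<le> B * (2 * pi)"
proof -
  have B: "0 \<le> B" using order_trans[OF norm_ge_zero assms(2)[OF assms(3)]] .
  have "cmod (f x - f 0) \<le> B * norm (x - 0)"
  proof (rule differentiable_bound[of "{0..2 * pi}" f "\<lambda>x h. h *\<^sub>R f' x"])
    show "(f has_derivative (\<lambda>h. h *\<^sub>R f' x)) (at x within {0..2 * pi})" for x
      using assms(1)[of x] by (simp add: has_vector_derivative_def has_derivative_at_withinI)
    show "onorm (\<lambda>h. h *\<^sub>R f' x) \<le> B" if "x \<in> {0..2 * pi}" for x
      by (rule onorm_le) (use assms(2)[OF that] in \<open>auto simp: mult.commute[of B] intro!: mult_left_mono\<close>)
  qed (use assms(3) in auto)
  also have "\<dots> \<le> B * (2 * pi)"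
    using B assms(3) by (intro mult_left_mono) auto
  finally show ?thesis .
qed

lemma trig_poly_dense:
  "f \<in> test_fun \<Longrightarrow> e > 0 \<Longrightarrow> \<exists>p\<in>trig_poly. \<forall>k\<le>N. sup_deriv k (\<lambda>x. f x + (-1) * p x) \<le> e"
proof (induction N arbitrary: f e)
  case 0
  have "periodic_continuous f"
    using 0 by (simp add: periodic_continuous_def test_fun_continuous0 test_fun_periodic)
  then obtain p where "p \<in> trig_poly" "\<And>x. cmod (f x - p x) < e"
    using trig_poly_approx_uniform[OF _ 0(2)] by blast
  then show ?case
    by (intro bexI[of _ p]) (auto intro!: sup_deriv_le intro: less_imp_le)
next
  case (Suc N)
  define d where "d = e / (4 * pi)"
  have d: "d > 0" "d * (4 * pi) = e" using Suc.prems by (auto simp: d_def)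
  obtain p where p: "p \<in> trig_poly" "\<And>k. k \<le> N \<Longrightarrow> sup_deriv k (\<lambda>x. vderiv f x + (-1) * p x) \<le> d"
    using Suc.IH[OF test_fun_vderiv[OF Suc.prems(1)] d(1)] by blast
  obtain P m where P: "P \<in> trig_poly" "\<And>x. (P has_vector_derivative p x - m) (at x)"
    using trig_poly_antiderivative[OF p(1)] by blast
  note T = test_fun_vderiv[OF Suc.prems(1)] trig_poly_test_fun[OF p(1)] trig_poly_test_fun[OF P(1)]
  note T' = test_fun_add(1)[OF T(1) test_fun_cmult(1)[OF T(2), of "-1"]]
  have pd: "cmod ((vderiv ^^ k) (\<lambda>x. vderiv f x + (-1) * p x) x) \<le> d" if "k \<le> N" "x \<in> {0..2 * pi}" for k x
    using sup_deriv_ge[OF T' that(2), of k] p(2)[OF that(1)] by linarith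
  have m: "cmod m \<le> d"
  proof -
    define g where "g x = f x - P x - x *\<^sub>R m" for x
    have "(g has_vector_derivative vderiv f x + (-1) * p x) (at x)" for x
      unfolding g_def
      by (rule derivative_eq_intros test_fun_derivative0 Suc.prems P(2) refl | simp)+
    then have "cmod (g (2 * pi) - g 0) \<le> d * (2 * pi)"
      by (rule vector_derivative_bound) (use pd[of 0] in auto)
    moreover have "g (2 * pi) - g 0 = - ((2 * pi) *\<^sub>R m)"
      using test_fun_periodic[OF Suc.prems(1), of 0] test_fun_periodic[OF T(3), of 0] by (simp add: g_def)
    ultimately show ?thesis by simp
  qed
  define q where "q = (\<lambda>x. P x + (f 0 - P 0))"
  have q: "q \<in> trig_poly" unfolding q_def by (intro trig_poly.add P(1) trig_poly_const)
  note Tq = test_fun_add[OF Suc.prems(1) test_fun_cmult(1)[OF trig_poly_test_fun[OF q], of "-1"]]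
  have dq: "((\<lambda>x. f x + (-1) * q x) has_vector_derivative (vderiv f x + (-1) * p x) + m) (at x)" for x
    unfolding q_def
    by (rule derivative_eq_intros test_fun_derivative0 Suc.prems P(2) refl | simp)+
  have vdq: "vderiv (\<lambda>x. f x + (-1) * q x) = (\<lambda>x. (vderiv f x + (-1) * p x) + m)"
    by (rule vderiv_eqI[OF dq])
  have *: "cmod (vderiv f x + (-1) * p x + m) \<le> 2 * d" if "x \<in> {0..2 * pi}" for x
    using pd[of 0 x] that m norm_triangle_ineq[of "vderiv f x + (-1) * p x" m] by simp
  have pi: "2 * d \<le> e"
    using mult_left_mono[of 2 "4 * pi" d] d pi_gt3 by linarith
  have "sup_deriv k (\<lambda>x. f x + (-1) * q x) \<le> e" if k: "k \<le> Suc N" for k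
  proof (rule sup_deriv_le)
    fix x :: real assume x: "x \<in> {0..2 * pi}"
    consider "k = 0" | "k = 1" | j where "k = Suc (Suc j)"
      by (metis One_nat_def not0_implies_Suc)
    then show "cmod ((vderiv ^^ k) (\<lambda>x. f x + (-1) * q x) x) \<le> e"
    proof cases
      case 1
      have "cmod ((f x + (-1) * q x) - (f 0 + (-1) * q 0)) \<le> 2 * d * (2 * pi)"
        by (rule vector_derivative_bound[OF dq *]) (use x in auto)
      then show ?thesis using 1 d by (simp add: q_def)
    next
      case 2
      then show ?thesis using *[OF x] pi vdq by simp
    next
      case 3
      have c: "(\<lambda>x. m) \<in> test_fun" by (rule trig_poly_test_fun[OF trig_poly_const])
      have "(vderiv ^^ k) (\<lambda>x. f x + (-1) * q x) = (vderiv ^^ Suc j) (\<lambda>x. (vderiv f x + (-1) * p x) + m)"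
        using vdq by (simp add: 3 funpow_swap1 del: mult_minus1)
      also have "\<dots> = (\<lambda>x. (vderiv ^^ Suc j) (\<lambda>x. vderiv f x + (-1) * p x) x + (vderiv ^^ Suc j) (\<lambda>x. m) x)"
        by (rule test_fun_add(2)[OF T' c])
      also have "(vderiv ^^ Suc j) (\<lambda>x. m) = (\<lambda>x. 0)"
        using test_fun_cis(2)[of "Suc j" m 0] by simp
      finally show ?thesis
        using pd[of "Suc j" x] x k 3 d pi by auto
    qed
  qed
  then show ?case using q by blast
qed

lemma distr_trig_poly_zero:
  assumes "\<And>n. fourier u n = 0" "p \<in> trig_poly"
  shows "pairing u p = 0"
  using assms(2)
proof (induction rule: trig_poly.induct)
  case (monom c n)
  have "pairing u (\<lambda>x. cis (of_int n * x)) = 0"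
    using assms(1)[of "- n"] by (simp add: fourier_def)
  then show ?case
    using is_distrD(2)[of "pairing u" "\<lambda>x. cis (of_int n * x)" c] test_fun_cis1 pairing[of u] by simp
next
  case (add p q)
  then show ?case
    using is_distrD(1)[of "pairing u" p q] trig_poly_test_fun pairing[of u] by simp
qed

lemma fourier_eq_zero:
  assumes "\<And>n. fourier u n = 0" shows "u = 0"
proof -
  have u: "is_distr (pairing u)" using pairing by simp
  have "pairing u f = 0" if f: "f \<in> test_fun" for f
  proof -
    obtain C N where C: "C \<ge> 0"
      "\<And>f M. f \<in> test_fun \<Longrightarrow> M \<ge> N \<Longrightarrow> cmod (pairing u f) \<le> C * (\<Sum>k\<le>M. sup_deriv k f)"
      using is_distr_boundE[OF u] by metis
    have "cmod (pairing u f) \<le> 0 + e" if "e > 0" for e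
    proof -
      define d where "d = e / ((C + 1) * (N + 1))"
      have d: "d > 0" "d * ((C + 1) * (N + 1)) = e" using that C(1) by (auto simp: d_def)
      obtain p where p: "p \<in> trig_poly" "\<And>k. k \<le> N \<Longrightarrow> sup_deriv k (\<lambda>x. f x + (-1) * p x) \<le> d"
        using trig_poly_dense[OF f d(1)] by metis
      note P = trig_poly_test_fun[OF p(1)]
      have "pairing u f = pairing u (\<lambda>x. f x + (-1) * p x)"
        using is_distrD(1)[OF u f test_fun_cmult(1)[OF P, of "-1"]] is_distrD(2)[OF u P, of "-1"]
          distr_trig_poly_zero[OF assms p(1)] by simp
      also have "cmod \<dots> \<le> C * (\<Sum>k\<le>N. sup_deriv k (\<lambda>x. f x + (-1) * p x))"
        by (intro C(2) test_fun_add test_fun_cmult f P) simp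
      also have "\<dots> \<le> C * (\<Sum>k\<le>N. d)"
        by (intro mult_left_mono sum_mono C(1)) (use p(2) in auto)
      also have "\<dots> \<le> d * ((C + 1) * (N + 1))"
        using d(1) C(1) by (simp add: algebra_simps)
      finally show ?thesis using d by simp
    qed
    then show ?thesis using field_le_epsilon by (metis norm_le_zero_iff)
  qed
  moreover have "pairing u f = 0" if "f \<notin> test_fun" for f
    using is_distrD(3)[OF u that] .
  ultimately show ?thesis
    by (intro pairing_inject[THEN iffD1]) (auto simp: zero_distr.rep_eq)
qed

lemma fourier_diff: "fourier (u - v) n = fourier u n - fourier v n"
  by (simp add: fourier_def minus_distr.rep_eq diff_divide_distrib)

lemma fourier_inject:
  assumes "\<And>n. fourier u n = fourier v n" shows "u = v"
  using fourier_eq_zero[of "u - v"] assms by (simp add: fourier_diff)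


lemma distr_of_fun_inject:
  assumes g: "periodic_continuous g" and h: "periodic_continuous h"
    and eq: "distr_of_fun g = distr_of_fun h"
  shows "g = h"
proof -
  define w where "w x = g x - h x" for x
  have w: "periodic_continuous w"
    using g h unfolding w_def by (auto simp: periodic_continuous_def intro!: continuous_intros)
  note cont = continuous_on_subset[OF periodic_continuousD(1)[OF w] subset_UNIV]
  have zero: "integral {0..2 * pi} (\<lambda>x. w x * f x) = 0" if f: "f \<in> test_fun" for f
  proof -
    have "integral {0..2 * pi} (\<lambda>x. g x * f x) = integral {0..2 * pi} (\<lambda>x. h x * f x)"
      using arg_cong[OF eq, of "\<lambda>u. pairing u f"] f g h by (simp add: distr_of_fun.rep_eq)
    then show ?thesis
      using test_pairing_integrable[OF periodic_continuousD(1)[OF g] f]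
        test_pairing_integrable[OF periodic_continuousD(1)[OF h] f]
      by (simp add: w_def left_diff_distrib integral_diff)
  qed
  have "periodic_continuous (\<lambda>x. cnj (w x))"
    using w by (auto simp: periodic_continuous_def intro!: continuous_intros)
  note approx = trig_poly_approx_uniform[OF this]
  obtain B where B: "\<And>x. x \<in> {0..2 * pi} \<Longrightarrow> cmod (w x) \<le> B"
    using compact_imp_bounded[OF compact_continuous_image[OF cont compact_Icc, of 0 "2 * pi"]]
    by (metis bounded_iff image_eqI)
  have B0: "B \<ge> 0" using order_trans[OF norm_ge_zero B[of 0]] by simp
  define I where "I = integral {0..2 * pi} (\<lambda>x. w x * cnj (w x))"
  have "cmod I \<le> 0 + e" if "e > 0" for e
  proof -
    define d where "d = e / ((B + 1) * (2 * pi))"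
    have d: "d > 0" "d * ((B + 1) * (2 * pi)) = e" using that B0 by (auto simp: d_def)
    obtain p where p: "p \<in> trig_poly" "\<And>x. cmod (cnj (w x) - p x) < d"
      using approx[OF d(1)] by blast
    note P = trig_poly_test_fun[OF p(1)]
    have cp: "continuous_on S p" for S by (rule test_fun_continuous0[OF P])
    have "I = integral {0..2 * pi} (\<lambda>x. w x * (cnj (w x) - p x))"
    proof -
      have "integral {0..2 * pi} (\<lambda>x. w x * cnj (w x) - w x * p x) = I - 0"
        unfolding I_def zero[OF P, symmetric]
        by (intro integral_diff integrable_continuous_interval continuous_intros cont cp)
      then show ?thesis by (simp add: right_diff_distrib)
    qed
    also have "cmod \<dots> \<le> (B * d) * (2 * pi - 0)"
    proof (rule integral_bound)
      show "cmod (w x * (cnj (w x) - p x)) \<le> B * d" if "x \<in> {0..2 * pi}" for x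
        unfolding norm_mult using B[OF that] p(2)[of x] B0 by (intro mult_mono) auto
    qed (use cont cp in \<open>auto intro!: continuous_intros\<close>)
    also have "\<dots> \<le> d * ((B + 1) * (2 * pi))"
      using d(1) by (simp add: algebra_simps)
    finally show ?thesis using d by simp
  qed
  then have "I = 0" using field_le_epsilon by (metis norm_le_zero_iff)
  have "((\<lambda>x. w x * cnj (w x)) has_integral I) {0..2 * pi}"
    unfolding I_def by (intro integrable_integral integrable_continuous_interval continuous_intros cont)
  from has_integral_Re[OF this] have "((\<lambda>x. (cmod (w x))\<^sup>2) has_integral 0) {0..2 * pi}"
    using \<open>I = 0\<close> by (simp add: complex_norm_square[symmetric])
  moreover have "continuous_on {0..2 * pi} (\<lambda>x. (cmod (w x))\<^sup>2)"
    by (intro continuous_intros cont)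
  ultimately have "(cmod (w x))\<^sup>2 = 0" if "x \<in> {0..2 * pi}" for x
    using has_integral_0_cbox_imp_0[of 0 "2 * pi" "\<lambda>x. (cmod (w x))\<^sup>2" x] that pi_gt_zero by (auto simp: not_le)
  then have 0: "w x = 0" if "x \<in> {0..2 * pi}" for x using that by simp
  have "w x = 0" for x
  proof -
    have "cis (Arg2pi (cis x)) = cis x"
      using complex_norm_eq_1_exp[of "cis x"] by (simp add: cis_conv_exp)
    then have "w (Arg2pi (cis x)) = w x"
      by (rule periodic_cis_cong[where f = w, OF periodic_continuousD(2)[OF w]])
    then show ?thesis using 0[of "Arg2pi (cis x)"] Arg2pi[of "cis x"] by auto
  qed
  then show ?thesis by (auto simp: w_def)
qed


section \<open>Sobolev spaces\<close>

definition japanese :: "int \<Rightarrow> real" where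
  "japanese n = max 1 \<bar>of_int n\<bar>"

definition sobolev_norm :: "real \<Rightarrow> distr \<Rightarrow> real" where
  "sobolev_norm \<sigma> u = sqrt (\<Sum>\<^sub>\<infinity>n. japanese n powr (2 * \<sigma>) * (cmod (fourier u n))\<^sup>2)"

definition sobolev :: "real \<Rightarrow> distr set" where
  "sobolev \<sigma> = {u. real_valued u \<and>
     (\<lambda>n. japanese n powr (2 * \<sigma>) * (cmod (fourier u n))\<^sup>2) summable_on UNIV}"

lemma weighted_triangle:
  fixes a b c :: "int \<Rightarrow> complex" and \<omega> :: "int \<Rightarrow> real"
  assumes a: "(\<lambda>n. \<omega> n * (cmod (a n))\<^sup>2) summable_on UNIV"
    and b: "(\<lambda>n. \<omega> n * (cmod (b n))\<^sup>2) summable_on UNIV"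
    and \<omega>: "\<And>n. \<omega> n \<ge> 0" and c: "\<And>n. cmod (c n) \<le> cmod (a n) + cmod (b n)"
  shows "(\<lambda>n. \<omega> n * (cmod (c n))\<^sup>2) summable_on UNIV"
    and "sqrt (\<Sum>\<^sub>\<infinity>n. \<omega> n * (cmod (c n))\<^sup>2) \<le>
         sqrt (\<Sum>\<^sub>\<infinity>n. \<omega> n * (cmod (a n))\<^sup>2) + sqrt (\<Sum>\<^sub>\<infinity>n. \<omega> n * (cmod (b n))\<^sup>2)"
      (is "_ \<le> ?A + ?B")
proof -
  have L2: "L2_set (\<lambda>n. sqrt (\<omega> n) * cmod (f n)) F = sqrt (\<Sum>n\<in>F. \<omega> n * (cmod (f n))\<^sup>2)" for f :: "int \<Rightarrow> complex" and F
    by (simp add: L2_set_def power_mult_distrib \<omega>)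
  have le: "sqrt (\<Sum>n\<in>F. \<omega> n * (cmod (f n))\<^sup>2) \<le> sqrt (\<Sum>\<^sub>\<infinity>n. \<omega> n * (cmod (f n))\<^sup>2)"
    if "(\<lambda>n. \<omega> n * (cmod (f n))\<^sup>2) summable_on UNIV" "finite F" for f :: "int \<Rightarrow> complex" and F
    by (intro real_sqrt_le_mono finite_sum_le_infsum that) (use \<omega> in auto)
  have fin: "(\<Sum>n\<in>F. \<omega> n * (cmod (c n))\<^sup>2) \<le> (?A + ?B)\<^sup>2" if F: "finite F" for F
  proof -
    have "sqrt (\<Sum>n\<in>F. \<omega> n * (cmod (c n))\<^sup>2) \<le>
        L2_set (\<lambda>n. sqrt (\<omega> n) * cmod (a n) + sqrt (\<omega> n) * cmod (b n)) F"
      unfolding L2[symmetric] distrib_left[symmetric]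
      by (intro L2_set_mono mult_left_mono c) (auto simp: \<omega>)
    also have "\<dots> \<le> ?A + ?B"
      using L2_set_triangle_ineq[of "\<lambda>n. sqrt (\<omega> n) * cmod (a n)" "\<lambda>n. sqrt (\<omega> n) * cmod (b n)" F]
        le[OF a F] le[OF b F] unfolding L2 by linarith
    finally show ?thesis by (rule sqrt_le_D)
  qed
  show s: "(\<lambda>n. \<omega> n * (cmod (c n))\<^sup>2) summable_on UNIV"
    by (rule nonneg_bdd_above_summable_on) (use fin \<omega> in \<open>auto intro!: bdd_aboveI\<close>)
  have "?A + ?B \<ge> 0" by (intro add_nonneg_nonneg real_sqrt_ge_zero infsum_nonneg) (use \<omega> in auto)
  moreover have "(\<Sum>\<^sub>\<infinity>n. \<omega> n * (cmod (c n))\<^sup>2) \<le> (?A + ?B)\<^sup>2"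
    by (rule infsum_le_finite_sums[OF s]) (use fin in auto)
  ultimately show "sqrt (\<Sum>\<^sub>\<infinity>n. \<omega> n * (cmod (c n))\<^sup>2) \<le> ?A + ?B"
    by (rule real_le_lsqrt)
qed

lemma japanese_pos: "japanese n > 0"
  by (simp add: japanese_def)

lemma sobolev_Metric_space: "Metric_space (sobolev \<sigma>) (\<lambda>u v. sobolev_norm \<sigma> (u - v))"
proof
  fix u v
  show "0 \<le> sobolev_norm \<sigma> (u - v)"
    by (simp add: sobolev_norm_def infsum_nonneg)
  show "sobolev_norm \<sigma> (u - v) = sobolev_norm \<sigma> (v - u)"
    by (simp add: sobolev_norm_def fourier_diff norm_minus_commute)
next
  have summ: "(\<lambda>n. japanese n powr (2 * \<sigma>) * (cmod (fourier u n - fourier v n))\<^sup>2) summable_on UNIV"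
    if "u \<in> sobolev \<sigma>" "v \<in> sobolev \<sigma>" for u v
    by (rule weighted_triangle(1)[where a = "fourier u" and b = "fourier v"])
      (use that norm_triangle_ineq4 in \<open>auto simp: sobolev_def\<close>)
  fix u v assume uv: "u \<in> sobolev \<sigma>" "v \<in> sobolev \<sigma>"
  show "sobolev_norm \<sigma> (u - v) = 0 \<longleftrightarrow> u = v"
  proof
    assume "sobolev_norm \<sigma> (u - v) = 0"
    then have *: "(\<Sum>\<^sub>\<infinity>n. japanese n powr (2 * \<sigma>) * (cmod (fourier u n - fourier v n))\<^sup>2) \<le> 0"
      by (simp add: sobolev_norm_def fourier_diff)
    show "u = v"
    proof (rule fourier_inject)
      fix n
      have "japanese n powr (2 * \<sigma>) * (cmod (fourier u n - fourier v n))\<^sup>2 = 0"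
        by (rule nonneg_infsum_le_0D[OF * summ[OF uv]]) auto
      then show "fourier u n = fourier v n"
        using japanese_pos[of n] by simp
    qed
  next
    assume "u = v"
    then show "sobolev_norm \<sigma> (u - v) = 0"
      unfolding sobolev_norm_def fourier_diff by simp
  qed
  have tri: "cmod (a - c) \<le> cmod (a - b) + cmod (b - c)" for a b c :: complex
    using norm_triangle_ineq[of "a - b" "b - c"] by simp
  fix w assume "w \<in> sobolev \<sigma>"
  then show "sobolev_norm \<sigma> (u - w) \<le> sobolev_norm \<sigma> (u - v) + sobolev_norm \<sigma> (v - w)"
    unfolding sobolev_norm_def fourier_diff
    by (intro weighted_triangle(2) summ uv tri) simp_all
qed

definition sobolev_metric :: "real \<Rightarrow> distr metric" where
  "sobolev_metric \<sigma> = metric (sobolev \<sigma>, \<lambda>u v. sobolev_norm \<sigma> (u - v))"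

lemma mspace_sobolev [simp]: "mspace (sobolev_metric \<sigma>) = sobolev \<sigma>"
  and mdist_sobolev [simp]: "mdist (sobolev_metric \<sigma>) = (\<lambda>u v. sobolev_norm \<sigma> (u - v))"
  by (simp_all add: sobolev_metric_def sobolev_Metric_space
      Metric_space.mspace_metric Metric_space.mdist_metric)

abbreviation sobolev_top :: "real \<Rightarrow> distr topology" where
  "sobolev_top \<sigma> \<equiv> mtopology_of (sobolev_metric \<sigma>)"

definition sobolev_mean :: "real \<Rightarrow> real \<Rightarrow> distr set" where
  "sobolev_mean \<sigma> c = {u \<in> sobolev \<sigma>. fourier u 0 = of_real c}"


section \<open>The Hilbert transform\<close>

text \<open>
  The Hilbert transform is given by its Fourier coefficients, which determine a distribution
  uniquely (\<open>fourier_inject\<close>) and are realised by a distribution (\<open>hilbert_exists\<close>).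
\<close>

definition hilbert :: "distr \<Rightarrow> distr" where
  "hilbert u = (THE v. \<forall>n. fourier v n = - \<i> * of_int (sgn n) * fourier u n)"

definition mode_integral :: "int \<Rightarrow> (real \<Rightarrow> complex) \<Rightarrow> complex" where
  "mode_integral m f = integral {0..2 * pi} (\<lambda>x. cis (of_int m * x) * f x)"

lemma mode_integrable:
  "f \<in> test_fun \<Longrightarrow> (\<lambda>x. cis (of_int m * x) * f x) integrable_on {0..2 * pi}"
  by (rule test_pairing_integrable[OF test_fun_continuous0[OF test_fun_cis1]])

lemma mode_integral_vderiv:
  assumes f: "f \<in> test_fun"
  shows "mode_integral m (vderiv f) = - (\<i> * of_int m) * mode_integral m f"
proof -
  have 1: "((\<lambda>x. cis (of_int m * x)) has_vector_derivative \<i> * of_int m * cis (of_int m * x)) (at x)" for x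
    using test_fun_derivative0[OF test_fun_cis1, of m x] test_fun_cis(2)[of 1 1 m] by simp
  have "((\<lambda>x. cis (of_int m * x) * f x) has_vector_derivative
      cis (of_int m * x) * vderiv f x + \<i> * of_int m * cis (of_int m * x) * f x) (at x)" for x
    by (rule has_vector_derivative_mult[OF 1 test_fun_derivative0[OF f]])
  then have "((\<lambda>x. cis (of_int m * x) * vderiv f x + \<i> * of_int m * cis (of_int m * x) * f x) has_integral
      cis (of_int m * (2 * pi)) * f (2 * pi) - cis (of_int m * 0) * f 0) {0..2 * pi}"
    by (intro fundamental_theorem_of_calculus) (auto intro: has_vector_derivative_at_within)
  moreover have "cis (of_int m * (2 * pi)) = 1" "f (2 * pi) = f 0"
    using cis_2pi_int[of m 0] test_fun_periodic[OF f, of 0] by simp_all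
  ultimately have "((\<lambda>x. cis (of_int m * x) * vderiv f x + \<i> * of_int m * (cis (of_int m * x) * f x))
      has_integral 0) {0..2 * pi}"
    by (simp add: mult.assoc)
  moreover have "((\<lambda>x. cis (of_int m * x) * vderiv f x + \<i> * of_int m * (cis (of_int m * x) * f x))
      has_integral mode_integral m (vderiv f) + \<i> * of_int m * mode_integral m f) {0..2 * pi}"
    unfolding mode_integral_def
    by (intro has_integral_add has_integral_mult_right integrable_integral mode_integrable test_fun_vderiv f)
  ultimately have "mode_integral m (vderiv f) + \<i> * of_int m * mode_integral m f = 0"
    by (rule has_integral_unique[symmetric])
  then show ?thesis by (simp add: add_eq_0_iff)
qed

lemma mode_integral_decay:
  assumes "f \<in> test_fun"
  shows "\<bar>of_int m\<bar> ^ k * cmod (mode_integral m f) \<le> 2 * pi * sup_deriv k f"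
  using assms
proof (induction k arbitrary: f)
  case 0
  have "cmod (mode_integral m f) \<le> sup_deriv 0 f * (2 * pi - 0)"
    unfolding mode_integral_def
    using sup_deriv_ge[OF 0, of _ 0]
    by (intro integral_bound continuous_on_mult test_fun_continuous0 test_fun_cis1 0) (auto simp: norm_mult)
  then show ?case by (simp add: mult_ac)
next
  case (Suc k)
  have "\<bar>of_int m\<bar> ^ Suc k * cmod (mode_integral m f) = \<bar>of_int m\<bar> ^ k * cmod (mode_integral m (vderiv f))"
    by (simp add: mode_integral_vderiv[OF Suc.prems] norm_mult)
  also have "\<dots> \<le> 2 * pi * sup_deriv (Suc k) f"
    using Suc.IH[OF test_fun_vderiv[OF Suc.prems]] by (simp add: sup_deriv_def funpow_swap1)
  finally show ?case .
qed

lemma mode_integral_cis: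
  "mode_integral m (\<lambda>x. cis (- of_int k * x)) = (if m = k then 2 * pi else 0)"
proof -
  have eq: "(\<lambda>x. cis (of_int m * x) * cis (- of_int k * x)) = (\<lambda>x. cis (of_int (m - k) * x) * 1)"
    by (auto simp: cis_mult algebra_simps)
  have *: "mode_integral m (\<lambda>x. cis (- of_int k * x)) = mode_integral (m - k) (\<lambda>x. 1)"
    unfolding mode_integral_def eq ..
  show ?thesis
  proof (cases "m = k")
    case True
    then show ?thesis unfolding * by (simp add: mode_integral_def scaleR_conv_of_real)
  next
    case False
    have one: "(\<lambda>x. 1) \<in> test_fun" "vderiv (\<lambda>x. 1) = (\<lambda>x. 0)"
      using test_fun_cis(1)[of 1 0] test_fun_cis(2)[of 1 1 0] by simp_all
    show ?thesis
      using mode_integral_vderiv[OF one(1), of "m - k"] False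
      unfolding * one(2) by (simp add: mode_integral_def)
  qed
qed

lemma mode_integral_add:
  "f \<in> test_fun \<Longrightarrow> g \<in> test_fun \<Longrightarrow>
    mode_integral m (\<lambda>x. f x + g x) = mode_integral m f + mode_integral m g"
  unfolding mode_integral_def distrib_left by (intro integral_add mode_integrable)

lemma mode_integral_cmult: "mode_integral m (\<lambda>x. c * f x) = c * mode_integral m f"
  unfolding mode_integral_def by (simp add: mult.left_commute[of _ c])

lemma fourier_growth:
  obtains C N where "C \<ge> 0" "\<And>m. m \<noteq> 0 \<Longrightarrow> cmod (fourier u m) \<le> C * \<bar>of_int m\<bar> ^ N"
proof -
  obtain C N where C: "C \<ge> 0"
    "\<And>f M. f \<in> test_fun \<Longrightarrow> M \<ge> N \<Longrightarrow> cmod (pairing u f) \<le> C * (\<Sum>k\<le>M. sup_deriv k f)"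
    using is_distr_boundE[of "pairing u"] pairing[of u] by auto
  have "cmod (fourier u m) \<le> (C * (N + 1)) * \<bar>of_int m\<bar> ^ N" if "m \<noteq> 0" for m
  proof -
    have m: "\<bar>real_of_int m\<bar> \<ge> 1" using that by linarith
    have d: "(vderiv ^^ k) (\<lambda>x. cis (- of_int m * x)) = (\<lambda>x. (\<i> * of_int (- m)) ^ k * cis (- of_int m * x))" for k
      using test_fun_cis(2)[of k 1 "- m"] by simp
    have "cmod (pairing u (\<lambda>x. cis (- of_int m * x))) \<le> C * (\<Sum>k\<le>N. sup_deriv k (\<lambda>x. cis (- of_int m * x)))"
      using test_fun_cis1[of "- m"] by (intro C(2)) auto
    also have "\<dots> \<le> C * (\<Sum>k\<le>N. \<bar>of_int m\<bar> ^ N)"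
    proof (intro mult_left_mono sum_mono C(1) sup_deriv_le)
      fix k x assume "k \<in> {..N}"
      then show "cmod ((vderiv ^^ k) (\<lambda>x. cis (- of_int m * x)) x) \<le> \<bar>of_int m\<bar> ^ N"
        unfolding d using power_increasing[OF _ m, of k N] by (simp add: norm_mult norm_power)
    qed
    finally have *: "cmod (pairing u (\<lambda>x. cis (- of_int m * x))) \<le> (C * (N + 1)) * \<bar>of_int m\<bar> ^ N"
      by (simp add: algebra_simps)
    have "cmod (fourier u m) = cmod (pairing u (\<lambda>x. cis (- of_int m * x))) / (2 * pi)"
      by (simp add: fourier_def norm_divide norm_mult)
    also have "\<dots> \<le> cmod (pairing u (\<lambda>x. cis (- of_int m * x))) / 1"
      using pi_gt3 by (intro divide_left_mono) auto
    finally show ?thesis using * by simp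
  qed
  then show thesis using C(1) by (intro that[of "C * (N + 1)" N]) auto
qed

lemma hilbert_exists: "\<exists>v. \<forall>n. fourier v n = - \<i> * of_int (sgn n) * fourier u n"
proof -
  obtain C N where C: "C \<ge> 0" "\<And>m. m \<noteq> 0 \<Longrightarrow> cmod (fourier u m) \<le> C * \<bar>of_int m\<bar> ^ N"
    using fourier_growth by metis
  define t where "t f n = \<i> * fourier u (- int (Suc n)) * mode_integral (- int (Suc n)) f
      - \<i> * fourier u (int (Suc n)) * mode_integral (int (Suc n)) f" for f n
  have one: "cmod (fourier u m * mode_integral m f) \<le> C * (2 * pi * sup_deriv (N + 2) f) * inverse (\<bar>of_int m\<bar>\<^sup>2)"
    if f: "f \<in> test_fun" and m: "m \<noteq> 0" for f m
  proof -
    define a where "a = \<bar>real_of_int m\<bar>"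
    have a: "a > 0" using m by (simp add: a_def)
    have "cmod (fourier u m * mode_integral m f) \<le> C * a ^ N * cmod (mode_integral m f)"
      unfolding norm_mult a_def by (intro mult_right_mono C(2) m) auto
    also have "\<dots> = C * (a ^ (N + 2) * cmod (mode_integral m f)) * inverse (a\<^sup>2)"
      using a by (simp add: power_add power2_eq_square field_simps)
    also have "\<dots> \<le> C * (2 * pi * sup_deriv (N + 2) f) * inverse (a\<^sup>2)"
      unfolding a_def by (intro mult_right_mono mult_left_mono C(1) mode_integral_decay f) auto
    finally show ?thesis by (simp add: a_def)
  qed
  define K where "K = C * (4 * pi)"
  have tb: "cmod (t f n) \<le> K * sup_deriv (N + 2) f * inverse ((real (Suc n))\<^sup>2)" if f: "f \<in> test_fun" for f n
  proof -
    have "cmod (t f n) \<le> cmod (fourier u (- int (Suc n)) * mode_integral (- int (Suc n)) f)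
        + cmod (fourier u (int (Suc n)) * mode_integral (int (Suc n)) f)"
      unfolding t_def by (rule order_trans[OF norm_triangle_ineq4]) (simp add: norm_mult mult.assoc)
    also have "\<dots> \<le> C * (2 * pi * sup_deriv (N + 2) f) * inverse (\<bar>of_int (- int (Suc n))\<bar>\<^sup>2)
        + C * (2 * pi * sup_deriv (N + 2) f) * inverse (\<bar>of_int (int (Suc n))\<bar>\<^sup>2)"
      by (intro add_mono one f) auto
    also have "\<dots> = K * sup_deriv (N + 2) f * inverse ((real (Suc n))\<^sup>2)"
    proof -
      have "\<bar>real_of_int (- int (Suc n))\<bar> = real (Suc n)" "\<bar>real_of_int (int (Suc n))\<bar> = real (Suc n)"
        by simp_all
      then show ?thesis by (simp only: K_def)
    qed
    finally show ?thesis .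
  qed
  have inv: "summable (\<lambda>n. inverse ((real (Suc n))\<^sup>2))"
    using inverse_power_summable[of 2, where 'a = real] by (subst summable_Suc_iff) simp
  define S where "S = (\<Sum>n. inverse ((real (Suc n))\<^sup>2))"
  have sn: "summable (\<lambda>n. cmod (t f n))" if "f \<in> test_fun" for f
    by (rule summable_comparison_test'[OF summable_mult[OF inv, of "K * sup_deriv (N + 2) f"], of 0])
      (use tb[OF that] in simp)
  note st = summable_norm_cancel[OF sn]
  define v where "v f = (if f \<in> test_fun then \<Sum>n. t f n else 0)" for f
  have "is_distr v"
  proof (rule is_distrI[where C = "K * S" and N = "N + 2"])
    fix f g assume fg: "f \<in> test_fun" "g \<in> test_fun"
    have "t (\<lambda>x. f x + g x) = (\<lambda>n. t f n + t g n)"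
      by (simp add: fun_eq_iff t_def mode_integral_add[OF fg] algebra_simps)
    then show "v (\<lambda>x. f x + g x) = v f + v g"
      using suminf_add[OF st[OF fg(1)] st[OF fg(2)]] fg by (simp add: v_def test_fun_add)
  next
    fix c f assume f: "f \<in> test_fun"
    have "t (\<lambda>x. c * f x) = (\<lambda>n. c * t f n)"
      by (simp add: fun_eq_iff t_def mode_integral_cmult algebra_simps)
    then show "v (\<lambda>x. c * f x) = c * v f"
      using suminf_mult[OF st[OF f], of c] f by (simp add: v_def test_fun_cmult)
  next
    fix f assume f: "f \<in> test_fun"
    have "cmod (v f) \<le> (\<Sum>n. cmod (t f n))"
      using summable_norm[OF sn[OF f]] f by (simp add: v_def)
    also have "\<dots> \<le> (\<Sum>n. K * sup_deriv (N + 2) f * inverse ((real (Suc n))\<^sup>2))"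
      by (rule suminf_le[OF tb[OF f] sn[OF f] summable_mult[OF inv]])
    also have "\<dots> = K * S * sup_deriv (N + 2) f"
      unfolding S_def suminf_mult[OF inv] by (simp add: mult_ac)
    also have "\<dots> \<le> K * S * (\<Sum>k\<le>N + 2. sup_deriv k f)"
    proof (rule mult_left_mono)
      show "sup_deriv (N + 2) f \<le> (\<Sum>k\<le>N + 2. sup_deriv k f)"
        by (rule member_le_sum) (auto simp: sup_deriv_nonneg f)
      show "0 \<le> K * S"
        unfolding K_def S_def using C(1) by (intro mult_nonneg_nonneg suminf_nonneg inv) auto
    qed
    finally show "cmod (v f) \<le> K * S * (\<Sum>k\<le>N + 2. sup_deriv k f)" .
  qed (simp add: v_def)
  then have pv: "pairing (Abs_distr v) = v" by (simp add: Abs_distr_inverse)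
  have "fourier (Abs_distr v) k = - \<i> * of_int (sgn k) * fourier u k" for k
  proof -
    have "t (\<lambda>x. cis (- of_int k * x)) n =
        (if n = nat \<bar>k\<bar> - 1 then - \<i> * of_int (sgn k) * fourier u k * (2 * pi) else 0)" for n
    proof -
      consider "k = int (Suc n)" | "k = - int (Suc n)" | "k = 0" | "k \<noteq> 0" "nat \<bar>k\<bar> - 1 \<noteq> n"
        by linarith
      then show ?thesis
        unfolding t_def mode_integral_cis by cases auto
    qed
    then have "(\<lambda>n. t (\<lambda>x. cis (- of_int k * x)) n) sums (- \<i> * of_int (sgn k) * fourier u k * (2 * pi))"
      using sums_single[of "nat \<bar>k\<bar> - 1" "\<lambda>_. - \<i> * of_int (sgn k) * fourier u k * (2 * pi)"]
      by (simp only:)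
    then have "v (\<lambda>x. cis (- of_int k * x)) = - \<i> * of_int (sgn k) * fourier u k * (2 * pi)"
      using test_fun_cis1[of "- k"] by (simp add: v_def sums_iff)
    then show ?thesis by (simp add: fourier_def[of "Abs_distr v"] pv)
  qed
  then show ?thesis by blast
qed

lemma fourier_hilbert: "fourier (hilbert u) n = - \<i> * of_int (sgn n) * fourier u n"
proof -
  have "\<exists>!v. \<forall>n. fourier v n = - \<i> * of_int (sgn n) * fourier u n"
    using hilbert_exists[of u] by (metis fourier_inject)
  from theI'[OF this] show ?thesis unfolding hilbert_def by blast
qed


section \<open>The Benjamin-Ono equation\<close>

text \<open>
  Only used for \<open>u \<in> sobolev \<sigma>\<close> with \<open>\<sigma> > 1/2\<close>, where \<open>u\<close> is given by a continuous function; that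
  function is unique by \<open>distr_of_fun_inject\<close>.
\<close>

definition distr_density :: "distr \<Rightarrow> real \<Rightarrow> complex" where
  "distr_density u = (THE h. periodic_continuous h \<and> distr_of_fun h = u)"

lemma distr_density_of_fun:
  "periodic_continuous h \<Longrightarrow> distr_density (distr_of_fun h) = h"
  unfolding distr_density_def by (blast intro: distr_of_fun_inject)

definition distr_square :: "distr \<Rightarrow> distr" where
  "distr_square u = distr_of_fun (\<lambda>x. (distr_density u x)\<^sup>2)"

definition bo_classical_solution :: "real \<Rightarrow> (real \<Rightarrow> distr) \<Rightarrow> bool" where
  "bo_classical_solution \<sigma> v \<longleftrightarrow>
     continuous_map euclideanreal (sobolev_top \<sigma>) v \<and>
     (\<exists>v'. continuous_map euclideanreal (sobolev_top (\<sigma> - 2)) v' \<and>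
       (\<forall>t. limitin (sobolev_top (\<sigma> - 2)) (\<lambda>h. (v (t + h) - v t) /\<^sub>R h) (v' t) (at 0)) \<and>
       (\<forall>t. v' t = hilbert (distr_deriv (distr_deriv (v t))) - distr_deriv (distr_square (v t))))"

text \<open>
  The solution with rough data: the limit, locally uniformly in time, of the classical solutions
  \<open>w k\<close> for every choice of smoother data \<open>w k 0\<close> converging to \<open>v0\<close>.
\<close>

definition bo_solution :: "real \<Rightarrow> distr \<Rightarrow> (real \<Rightarrow> distr) \<Rightarrow> bool" where
  "bo_solution s v0 \<gamma> \<longleftrightarrow>
     continuous_map euclideanreal (sobolev_top (- s)) \<gamma> \<and> \<gamma> 0 = v0 \<and>
     (\<forall>\<sigma> w. \<sigma> > 3 / 2 \<longrightarrow> (\<forall>k::nat. bo_classical_solution \<sigma> (w k)) \<longrightarrow>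
        limitin (sobolev_top (- s)) (\<lambda>k. w k 0) v0 sequentially \<longrightarrow>
        (\<forall>T>0. \<forall>\<epsilon>>0. \<forall>\<^sub>F k in sequentially. \<forall>t\<in>{- T..T}. sobolev_norm (- s) (w k t - \<gamma> t) < \<epsilon>))"


section \<open>Relative compactness and almost periodicity\<close>

definition relatively_compact_in :: "'a topology \<Rightarrow> 'a set \<Rightarrow> bool" where
  "relatively_compact_in X S \<longleftrightarrow> S \<subseteq> topspace X \<and> compactin X (X closure_of S)"

text \<open>\<^const>\<open>cfunspace\<close> is the space of bounded continuous functions with the supremum metric.\<close>

definition almost_periodic :: "'a metric \<Rightarrow> (real \<Rightarrow> 'a) \<Rightarrow> bool" where
  "almost_periodic m f \<longleftrightarrow>
     f \<in> mspace (cfunspace euclideanreal m) \<and>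
     relatively_compact_in (mtopology_of (cfunspace euclideanreal m)) (range (\<lambda>\<tau> t. f (t + \<tau>)))"

end

theory Submission
  imports Defs "HOL-Library.Diagonal_Subsequence"
begin

text \<open>
  Let \<open>L = D - T\<close> be the Lax operator on the Hardy space, where \<open>T\<close> is the Toeplitz operator of the
  initial datum with projection \<open>X\<close>, and let \<open>K(t) = e\<^sup>i\<^sup>t e\<^sup>2\<^sup>i\<^sup>t\<^sup>L S\<^sup>*\<close> with the backward shift \<open>S\<^sup>*\<close>. By the
  explicit formula of Gerard, for trigonometric polynomials the numbers \<open>\<langle>K(t)\<^sup>n X, 1\<rangle>\<close> are the
  nonnegative Fourier coefficients of a classical solution \<open>u(t)\<close>, and \<open>f \<mapsto> (\<langle>K(t)\<^sup>n f, 1\<rangle>)\<^sub>n\<close> is a unitary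
  equivalence between \<open>L\<close> and the Lax operator of \<open>u(t)\<close>.

  Hence \<open>\<langle>(L + k)\<^sup>-\<^sup>1 u, u\<rangle>\<close> is conserved for all large \<open>k\<close>. It is comparable to the sum of
  \<open>|u\<^sub>n|\<^sup>2 / (n + k)\<close>, and summing over dyadic \<open>k\<close> bounds the sums of \<open>(|n| + k)\<^sup>-\<^sup>2\<^sup>s |u\<^sub>n|\<^sup>2\<close> uniformly
  in time; so in \<open>H\<^sup>-\<^sup>s\<close> the orbit of a rough datum is precompact. Passing to the limit, the matrix
  \<open>\<langle>K\<^sup>*(t)\<^sup>m 1, (L + k)\<^sup>-\<^sup>1 K\<^sup>*(t)\<^sup>n 1\<rangle>\<close> of the initial datum is the matrix of the resolvent of
  the Lax operator of \<open>u(t)\<close>, which determines \<open>u(t)\<close>. It depends on \<open>t\<close> only through the numbers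
  \<open>e\<^sup>i\<^sup>t\<close> and \<open>e\<^sup>2\<^sup>i\<^sup>t\<^sup>\<nu>\<close>, \<open>\<nu>\<close> an eigenvalue of \<open>L\<close>, and depends on them continuously. So a shift of time that is
  small on the infinite torus of these numbers moves the whole orbit by little.
\<close>

section \<open>Square-summable families\<close>

text \<open>The obstacle is that rough solutions are known only as limits of classical ones, locally
  uniformly in time, so whatever is uniform over the whole time axis has to come from conserved
  quantities. Since \<open>bo_solution\<close> speaks of every approximating family, one family
  suffices: truncated data, evolved by the explicit formula, which is checked to solve the equation
  by differentiating it. The formula itself does not survive the limit: X need not be
  square-summable for rough data, and the inner products with it lose their meaning. The resolvent
  matrix survives, since \<open>Rs\<close> asks only for a small Hilbert-Schmidt matrix, and data in
  H^(-s) with s < 1/2 provide one. Large k takes the place of small data: the weighted norm of a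
  fixed datum tends to 0 as k grows, so the Neumann series converges, and by tightness it does so
  along the whole orbit with the same k. That the orbit depends continuously on the torus point is
  not estimated but deduced: two limit points with the same torus point have the same resolvent
  matrix, hence coincide, and precompactness does the rest.\<close>

typedef 'a ell2 = "{f :: 'a \<Rightarrow> complex. (\<lambda>i. (cmod (f i))\<^sup>2) summable_on UNIV}"
  morphisms coef Abs_ell2
  by (intro exI[of _ "\<lambda>_. 0"]) simp

setup_lifting type_definition_ell2

lemma ell2_eqI: "(\<And>i. coef f i = coef g i) \<Longrightarrow> f = g"
  by (simp add: coef_inject[symmetric] ext)

lemma coef_Abs_ell2: "(\<lambda>i. (cmod (f i))\<^sup>2) summable_on UNIV \<Longrightarrow> coef (Abs_ell2 f) = f"
  by (simp add: Abs_ell2_inverse)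

lemma coef_summable: "(\<lambda>i. (cmod (coef f i))\<^sup>2) summable_on A"
  using coef[of f] summable_on_subset[of _ UNIV A] by auto

lemma sq_sum_le: "(cmod (a + b))\<^sup>2 \<le> 2 * (cmod a)\<^sup>2 + 2 * (cmod b)\<^sup>2"
proof -
  have "(cmod (a + b))\<^sup>2 \<le> (cmod a + cmod b)\<^sup>2"
    by (intro power_mono norm_triangle_ineq) auto
  also have "\<dots> \<le> 2 * (cmod a)\<^sup>2 + 2 * (cmod b)\<^sup>2"
    using sum_squares_bound[of "cmod a" "cmod b"] by (simp add: power2_sum)
  finally show ?thesis .
qed

lemma summable_on_le:
  fixes f g :: "'a \<Rightarrow> real"
  assumes "g summable_on A" "\<And>i. i \<in> A \<Longrightarrow> 0 \<le> f i" "\<And>i. i \<in> A \<Longrightarrow> f i \<le> g i"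
  shows "f summable_on A"
  using summable_on_comparison_test[OF assms(1), of f] assms by auto

instantiation ell2 :: (type) real_vector
begin

lift_definition zero_ell2 :: "'a ell2" is "\<lambda>_. 0" by simp

lift_definition plus_ell2 :: "'a ell2 \<Rightarrow> 'a ell2 \<Rightarrow> 'a ell2" is "\<lambda>f g i. f i + g i"
proof -
  fix f g :: "'a \<Rightarrow> complex"
  assume "(\<lambda>i. (cmod (f i))\<^sup>2) summable_on UNIV" "(\<lambda>i. (cmod (g i))\<^sup>2) summable_on UNIV"
  then have "(\<lambda>i. 2 * (cmod (f i))\<^sup>2 + 2 * (cmod (g i))\<^sup>2) summable_on UNIV"
    by (intro summable_on_add summable_on_cmult_right)
  then show "(\<lambda>i. (cmod (f i + g i))\<^sup>2) summable_on UNIV"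
    by (rule summable_on_le) (auto intro: sq_sum_le)
qed

lift_definition uminus_ell2 :: "'a ell2 \<Rightarrow> 'a ell2" is "\<lambda>f i. - f i" by simp

definition minus_ell2 :: "'a ell2 \<Rightarrow> 'a ell2 \<Rightarrow> 'a ell2" where "minus_ell2 f g = f + - g"

lift_definition scaleR_ell2 :: "real \<Rightarrow> 'a ell2 \<Rightarrow> 'a ell2" is "\<lambda>r f i. r *\<^sub>R f i"
  by (simp add: power_mult_distrib summable_on_cmult_right)

instance
  by standard (simp_all add: coef_inject[symmetric] fun_eq_iff minus_ell2_def plus_ell2.rep_eq
      uminus_ell2.rep_eq zero_ell2.rep_eq scaleR_ell2.rep_eq algebra_simps)

end

lift_definition cmul :: "complex \<Rightarrow> 'a ell2 \<Rightarrow> 'a ell2" is "\<lambda>c f i. c * f i"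
  by (simp add: norm_mult power_mult_distrib summable_on_cmult_right)

lift_definition bas :: "'a \<Rightarrow> 'a ell2" is "\<lambda>i j. if j = i then 1 else 0"
proof -
  fix i :: 'a
  show "(\<lambda>j. (cmod (if j = i then 1 else 0))\<^sup>2) summable_on UNIV"
    by (rule finite_nonzero_values_imp_summable_on) (rule finite_subset[of _ "{i}"], auto)
qed

lemma coef_diff [simp]: "coef (f - g) i = coef f i - coef g i"
  unfolding minus_ell2_def plus_ell2.rep_eq uminus_ell2.rep_eq by simp

lemma coef_simps [simp]:
  "coef 0 i = 0" "coef (f + g) i = coef f i + coef g i" "coef (- f) i = - coef f i"
  "coef (r *\<^sub>R f) i = of_real r * coef f i"
  "coef (cmul c f) i = c * coef f i"
  "coef (bas i) j = (if j = i then 1 else 0)"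
  by (simp_all add: zero_ell2.rep_eq plus_ell2.rep_eq uminus_ell2.rep_eq
      scaleR_ell2.rep_eq cmul.rep_eq bas.rep_eq scaleR_conv_of_real)

text \<open>Antilinear in the second argument. The type class instances below see only the real
  structure, with the real part of \<open>cin\<close> as inner product; complex scalars enter
  through \<open>cmul\<close>.\<close>

definition cin :: "'a ell2 \<Rightarrow> 'a ell2 \<Rightarrow> complex" where
  "cin f g = (\<Sum>\<^sub>\<infinity>i. coef f i * cnj (coef g i))"

lemma cin_abs_summable: "(\<lambda>i. cmod (coef f i * coef g i)) summable_on A"
proof -
  have "(\<lambda>i. (cmod (coef f i))\<^sup>2 + (cmod (coef g i))\<^sup>2) summable_on A"
    by (intro summable_on_add coef_summable)
  then show ?thesis
  proof (rule summable_on_le)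
    fix i
    have "0 \<le> cmod (coef f i) * cmod (coef g i)" by simp
    then show "cmod (coef f i * coef g i) \<le> (cmod (coef f i))\<^sup>2 + (cmod (coef g i))\<^sup>2"
      unfolding norm_mult using sum_squares_bound[of "cmod (coef f i)" "cmod (coef g i)"] by linarith
  qed auto
qed

lemma cin_summable: "(\<lambda>i. coef f i * cnj (coef g i)) summable_on A"
  by (rule abs_summable_summable) (use cin_abs_summable[of f g A] in \<open>simp add: norm_mult\<close>)

lemma cin_add_left: "cin (f + g) h = cin f h + cin g h"
  unfolding cin_def by (simp add: distrib_right infsum_add cin_summable)

lemma cin_add_right: "cin h (f + g) = cin h f + cin h g"
  unfolding cin_def by (simp add: distrib_left infsum_add cin_summable)

lemma cin_cmul_left [simp]: "cin (cmul c f) g = c * cin f g"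
  unfolding cin_def by (simp add: mult.assoc infsum_cmult_right')

lemma cin_cmul_right [simp]: "cin f (cmul c g) = cnj c * cin f g"
  unfolding cin_def by (simp add: mult.left_commute infsum_cmult_right')

lemma cin_commute: "cin f g = cnj (cin g f)"
  unfolding cin_def by (simp add: mult.commute flip: infsum_cnj)

lemma scaleR_cmul: "r *\<^sub>R f = cmul (of_real r) f"
  by (rule ell2_eqI) simp

lemma uminus_cmul: "- f = cmul (- 1) f"
  by (rule ell2_eqI) simp

lemma cin_minus_left: "cin (- f) g = - cin f g" by (simp add: uminus_cmul)
lemma cin_minus_right: "cin f (- g) = - cin f g" by (simp add: uminus_cmul)

lemma cin_diff_left: "cin (f - g) h = cin f h - cin g h"
  using cin_add_left[of f "- g" h] by (simp add: cin_minus_left)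

lemma cin_diff_right: "cin h (f - g) = cin h f - cin h g"
  using cin_add_right[of h f "- g"] by (simp add: cin_minus_right)

lemma cin_zero [simp]: "cin 0 f = 0" "cin f 0 = 0"
  by (simp_all add: cin_def)

lemma infsum_single:
  fixes f :: "'a \<Rightarrow> 'b :: {topological_comm_monoid_add, t2_space}"
  shows "(\<And>j. j \<noteq> i \<Longrightarrow> f j = 0) \<Longrightarrow> infsum f UNIV = f i"
  using infsum_cong_neutral[of "{i}" UNIV f f] by simp

lemma cin_bas [simp]: "cin f (bas i) = coef f i" "cin (bas i) f = cnj (coef f i)"
  unfolding cin_def by (subst infsum_single[of i]; simp)+

lemma cin_self: "cin f f = of_real (\<Sum>\<^sub>\<infinity>i. (cmod (coef f i))\<^sup>2)"
proof -
  have "((\<lambda>i. complex_of_real ((cmod (coef f i))\<^sup>2)) has_sum of_real (\<Sum>\<^sub>\<infinity>i. (cmod (coef f i))\<^sup>2)) UNIV"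
    by (intro has_sum_of_real has_sum_infsum coef_summable)
  then show ?thesis
    unfolding cin_def complex_norm_square by (rule infsumI)
qed

instantiation ell2 :: (type) real_inner
begin

definition inner_ell2 :: "'a ell2 \<Rightarrow> 'a ell2 \<Rightarrow> real" where "inner_ell2 f g = Re (cin f g)"
definition norm_ell2 :: "'a ell2 \<Rightarrow> real" where "norm_ell2 f = sqrt (inner f f)"
definition dist_ell2 :: "'a ell2 \<Rightarrow> 'a ell2 \<Rightarrow> real" where "dist_ell2 f g = norm (f - g)"
definition sgn_ell2 :: "'a ell2 \<Rightarrow> 'a ell2" where "sgn_ell2 f = f /\<^sub>R norm f"
definition uniformity_ell2 :: "('a ell2 \<times> 'a ell2) filter" where
  "uniformity_ell2 = (INF e\<in>{0 <..}. principal {(x, y). dist x y < e})"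
definition open_ell2 :: "'a ell2 set \<Rightarrow> bool" where
  "open_ell2 U = (\<forall>x\<in>U. \<forall>\<^sub>F (x', y) in uniformity. x' = x \<longrightarrow> y \<in> U)"

instance
proof
  fix x y z :: "'a ell2" and r :: real
  show "dist x y = norm (x - y)" "sgn x = x /\<^sub>R norm x" "norm x = sqrt (inner x x)"
    by (simp_all add: dist_ell2_def sgn_ell2_def norm_ell2_def)
  show "inner x y = inner y x"
    unfolding inner_ell2_def by (subst cin_commute) simp
  show "inner (x + y) z = inner x z + inner y z"
    by (simp add: inner_ell2_def cin_add_left)
  show "inner (r *\<^sub>R x) y = r * inner x y"
    by (simp add: inner_ell2_def scaleR_cmul)
  show "0 \<le> inner x x"
    by (simp add: inner_ell2_def cin_self infsum_nonneg)
  show "inner x x = 0 \<longleftrightarrow> x = 0"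
  proof
    assume "inner x x = 0"
    then have "(\<Sum>\<^sub>\<infinity>i. (cmod (coef x i))\<^sup>2) \<le> 0" by (simp add: inner_ell2_def cin_self)
    then have "(cmod (coef x i))\<^sup>2 = 0" for i
      by (rule nonneg_infsum_le_0D) (auto intro: coef_summable)
    then show "x = 0" by (intro ell2_eqI) simp
  qed (simp add: inner_ell2_def)
qed (rule uniformity_ell2_def open_ell2_def)+

end

lemma norm_sq_infsum: "(norm f)\<^sup>2 = (\<Sum>\<^sub>\<infinity>i. (cmod (coef f i))\<^sup>2)"
  by (simp add: norm_ell2_def inner_ell2_def cin_self infsum_nonneg)

lemma norm_infsum: "norm f = sqrt (\<Sum>\<^sub>\<infinity>i. (cmod (coef f i))\<^sup>2)"
  by (simp add: norm_ell2_def inner_ell2_def cin_self)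

lemma cin_self_norm: "cin f f = of_real ((norm f)\<^sup>2)"
  by (simp only: cin_self norm_sq_infsum)

lemma finite_sum_le_norm: "finite F \<Longrightarrow> (\<Sum>i\<in>F. (cmod (coef f i))\<^sup>2) \<le> (norm f)\<^sup>2"
  unfolding norm_sq_infsum by (intro finite_sum_le_infsum coef_summable) auto

lemma coef_le_norm: "cmod (coef f i) \<le> norm f"
  by (rule power2_le_imp_le) (use finite_sum_le_norm[of "{i}" f] in auto)

lemma norm_le_finite:
  assumes "\<And>F. finite F \<Longrightarrow> (\<Sum>i\<in>F. (cmod (coef f i))\<^sup>2) \<le> b\<^sup>2" "0 \<le> b"
  shows "norm f \<le> b"
proof (rule power2_le_imp_le[OF _ assms(2)])
  show "(norm f)\<^sup>2 \<le> b\<^sup>2"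
    unfolding norm_sq_infsum by (rule infsum_le_finite_sums[OF coef_summable]) (rule assms(1))
qed

lemma norm_bas [simp]: "norm (bas i) = 1"
  by (simp add: norm_ell2_def inner_ell2_def)

lemma norm_cmul [simp]: "norm (cmul c f) = cmod c * norm f"
  by (simp add: norm_infsum norm_mult power_mult_distrib infsum_cmult_right' real_sqrt_mult)

lemma cmul_add: "cmul c (f + g) = cmul c f + cmul c g"
  and cmul_diff: "cmul c (f - g) = cmul c f - cmul c g"
  and cmul_add_left: "cmul (c + d) f = cmul c f + cmul d f"
  and cmul_cmul [simp]: "cmul c (cmul d f) = cmul (c * d) f"
  and cmul_1 [simp]: "cmul 1 f = f"
  and cmul_0 [simp]: "cmul 0 f = 0" "cmul c 0 = 0"
  by (rule ell2_eqI; simp add: algebra_simps)+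

lemma cin_le: "cmod (cin f g) \<le> norm f * norm g"
proof (cases "cin f g = 0")
  case False
  \<comment> \<open>The phase that makes \<open>cin (cmul c f) g\<close> real and nonnegative, so
    that the real Cauchy-Schwarz inequality applies.\<close>
  define c where "c = cnj (cin f g) / cmod (cin f g)"
  have c: "cmod c = 1" using False by (simp add: c_def norm_divide)
  have "c * cin f g = of_real (cmod (cin f g))"
    using False by (simp add: c_def complex_norm_square[symmetric] power2_eq_square mult.commute)
  then have "cmod (cin f g) = inner (cmul c f) g"
    by (simp add: inner_ell2_def)
  also have "\<dots> \<le> norm f * norm g"
    using norm_cauchy_schwarz[of "cmul c f" g] c by simp
  finally show ?thesis .
qed simp

lemma bounded_linear_coef: "bounded_linear (\<lambda>f. coef f i)"
  by (rule bounded_linear_intro[where K = 1]) (auto simp: scaleR_conv_of_real coef_le_norm)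

lemma bounded_linear_cin_left: "bounded_linear (\<lambda>f. cin f g)"
  by (rule bounded_linear_intro[where K = "norm g"])
    (auto simp: cin_add_left scaleR_cmul scaleR_conv_of_real cin_le)

lemma bounded_linear_cmul: "bounded_linear (cmul c)"
  by (rule bounded_linear_intro[where K = "cmod c"])
    (auto simp: cmul_add scaleR_cmul mult.commute)

lemmas tendsto_coef [tendsto_intros] = bounded_linear.tendsto[OF bounded_linear_coef]

lemma tendsto_cin [tendsto_intros]:
  assumes "(f \<longlongrightarrow> a) F" "(g \<longlongrightarrow> b) F"
  shows "((\<lambda>x. cin (f x) (g x)) \<longlongrightarrow> cin a b) F"
proof -
  have 1: "((\<lambda>x. norm (f x) * norm (g x - b)) \<longlongrightarrow> norm a * norm (b - b)) F"
    by (intro tendsto_intros assms)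
  have "((\<lambda>x. cin (f x) (g x - b)) \<longlongrightarrow> 0) F"
    by (rule Lim_null_comparison[OF always_eventually]) (use 1 in \<open>auto intro: cin_le\<close>)
  moreover have "((\<lambda>x. cin (f x) b) \<longlongrightarrow> cin a b) F"
    by (rule bounded_linear.tendsto[OF bounded_linear_cin_left assms(1)])
  ultimately have "((\<lambda>x. cin (f x) (g x - b) + cin (f x) b) \<longlongrightarrow> 0 + cin a b) F"
    by (intro tendsto_add)
  then show ?thesis by (simp add: cin_diff_right)
qed

lemma tendsto_cmul [tendsto_intros]:
  assumes "(c \<longlongrightarrow> d) F" "(f \<longlongrightarrow> g) F"
  shows "((\<lambda>x. cmul (c x) (f x)) \<longlongrightarrow> cmul d g) F"
proof -
  have 1: "((\<lambda>x. cmod (c x - d) * norm (f x)) \<longlongrightarrow> cmod (d - d) * norm g) F"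
    by (intro tendsto_intros assms)
  have "((\<lambda>x. cmul (c x - d) (f x)) \<longlongrightarrow> 0) F"
    by (rule Lim_null_comparison[OF always_eventually]) (use 1 in auto)
  moreover have "((\<lambda>x. cmul d (f x)) \<longlongrightarrow> cmul d g) F"
    by (rule bounded_linear.tendsto[OF bounded_linear_cmul assms(2)])
  ultimately have "((\<lambda>x. cmul (c x - d) (f x) + cmul d (f x)) \<longlongrightarrow> 0 + cmul d g) F"
    by (intro tendsto_add)
  then show ?thesis by (simp flip: cmul_add_left)
qed

instance ell2 :: (type) complete_space
proof
  fix X :: "nat \<Rightarrow> 'a ell2"
  assume X: "Cauchy X"
  have "Cauchy (\<lambda>n. coef (X n) i)" for i
    by (rule bounded_linear.Cauchy[OF bounded_linear_coef X])
  then have "\<exists>l. (\<lambda>n. coef (X n) i) \<longlonglongrightarrow> l" for i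
    using Cauchy_convergent convergent_def by blast
  then obtain l where l: "\<And>i. (\<lambda>n. coef (X n) i) \<longlonglongrightarrow> l i" by metis
  have bd: "(\<Sum>i\<in>F. (cmod (l i - coef (X n) i))\<^sup>2) \<le> e\<^sup>2"
    if "finite F" "e > 0" "\<And>m. m \<ge> M \<Longrightarrow> norm (X m - X n) < e" for F e n M
  proof (rule LIMSEQ_le_const2)
    show "(\<lambda>m. \<Sum>i\<in>F. (cmod (coef (X m) i - coef (X n) i))\<^sup>2) \<longlonglongrightarrow> (\<Sum>i\<in>F. (cmod (l i - coef (X n) i))\<^sup>2)"
      by (intro tendsto_intros l)
    have "(\<Sum>i\<in>F. (cmod (coef (X m) i - coef (X n) i))\<^sup>2) \<le> e\<^sup>2" if "m \<ge> M" for m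
      using finite_sum_le_norm[OF \<open>finite F\<close>, of "X m - X n"] power_mono[of "norm (X m - X n)" e 2]
        \<open>\<And>m. m \<ge> M \<Longrightarrow> norm (X m - X n) < e\<close>[OF that] by simp
    then show "\<exists>N. \<forall>m\<ge>N. (\<Sum>i\<in>F. (cmod (coef (X m) i - coef (X n) i))\<^sup>2) \<le> e\<^sup>2" by blast
  qed
  have sm: "(\<lambda>i. (cmod (l i))\<^sup>2) summable_on UNIV"
  proof -
    obtain M where M: "\<And>m n. m \<ge> M \<Longrightarrow> n \<ge> M \<Longrightarrow> norm (X m - X n) < 1"
      using CauchyD[OF X, of 1] by auto
    have "(\<lambda>i. (cmod (l i - coef (X M) i))\<^sup>2) summable_on UNIV"
    proof (rule nonneg_bdd_above_summable_on)
      show "bdd_above (sum (\<lambda>i. (cmod (l i - coef (X M) i))\<^sup>2) ` {F. F \<subseteq> UNIV \<and> finite F})"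
        by (rule bdd_aboveI[of _ "1\<^sup>2"]) (use bd[of _ 1 M M] M in force)
    qed simp
    then have "(\<lambda>i. 2 * (cmod (l i - coef (X M) i))\<^sup>2 + 2 * (cmod (coef (X M) i))\<^sup>2) summable_on UNIV"
      by (intro summable_on_add summable_on_cmult_right coef_summable)
    then show ?thesis
      by (rule summable_on_le) (use sq_sum_le[of "l i - coef (X M) i" "coef (X M) i" for i] in auto)
  qed
  have "X \<longlonglongrightarrow> Abs_ell2 l"
  proof (rule LIMSEQ_I)
    fix e :: real assume e: "e > 0"
    obtain M where M: "\<And>m n. m \<ge> M \<Longrightarrow> n \<ge> M \<Longrightarrow> norm (X m - X n) < e / 2"
      using CauchyD[OF X, of "e / 2"] e by auto
    have "norm (X n - Abs_ell2 l) < e" if "n \<ge> M" for n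
    proof -
      have "norm (Abs_ell2 l - X n) \<le> e / 2"
        by (rule norm_le_finite) (use bd[of _ "e / 2" M n] M that e in \<open>auto simp: coef_Abs_ell2[OF sm]\<close>)
      then show ?thesis using e by (simp add: norm_minus_commute)
    qed
    then show "\<exists>no. \<forall>n\<ge>no. norm (X n - Abs_ell2 l) < e" by blast
  qed
  then show "convergent X" by (auto simp: convergent_def)
qed

lemma tail_small:
  assumes "e > 0"
  obtains F where "finite F" "\<And>A. A \<inter> F = {} \<Longrightarrow> (\<Sum>\<^sub>\<infinity>i\<in>A. (cmod (coef f i))\<^sup>2) \<le> e"
proof -
  obtain F where F: "finite F" "dist (\<Sum>i\<in>F. (cmod (coef f i))\<^sup>2) (\<Sum>\<^sub>\<infinity>i. (cmod (coef f i))\<^sup>2) \<le> e"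
    using infsum_finite_approximation[OF coef_summable[of f UNIV] assms] by auto
  have "(\<Sum>\<^sub>\<infinity>i\<in>A. (cmod (coef f i))\<^sup>2) \<le> e" if "A \<inter> F = {}" for A
  proof -
    have "(\<Sum>\<^sub>\<infinity>i\<in>A. (cmod (coef f i))\<^sup>2) + (\<Sum>i\<in>F. (cmod (coef f i))\<^sup>2) = (\<Sum>\<^sub>\<infinity>i\<in>A \<union> F. (cmod (coef f i))\<^sup>2)"
      using F(1) that by (subst infsum_Un_disjoint) (auto intro: coef_summable)
    also have "\<dots> \<le> (\<Sum>\<^sub>\<infinity>i. (cmod (coef f i))\<^sup>2)"
      by (rule infsum_mono2) (auto intro: coef_summable)
    finally show ?thesis using F(2) by (simp add: dist_real_def abs_le_iff)
  qed
  then show thesis using F(1) that by blast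
qed

text \<open>Coordinatewise convergence becomes norm convergence once no mass escapes to infinity.
  Only the tails of the family are controlled; the tail of the limit is small because the limit is
  one fixed vector.\<close>

lemma tendsto_ell2_tails:
  fixes f :: "'b \<Rightarrow> 'a ell2"
  assumes co: "\<And>i. ((\<lambda>x. coef (f x) i) \<longlongrightarrow> coef l i) F"
    and tails: "\<And>e. e > 0 \<Longrightarrow> \<exists>A. finite A \<and> (\<forall>\<^sub>F x in F. (\<Sum>\<^sub>\<infinity>i\<in>- A. (cmod (coef (f x) i))\<^sup>2) \<le> e)"
  shows "(f \<longlongrightarrow> l) F"
proof (rule tendstoI)
  fix e :: real assume e: "e > 0"
  \<comment> \<open>Outside \<open>A \<union> B\<close> the squared distance costs at most 2 d + 2
    d, inside it less than d, and 5 d < 8 d = \<open>e\<^sup>2\<close>.\<close>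
  define d where "d = e\<^sup>2 / 8"
  have d: "d > 0" using e by (simp add: d_def)
  obtain A where A: "finite A" "\<forall>\<^sub>F x in F. (\<Sum>\<^sub>\<infinity>i\<in>- A. (cmod (coef (f x) i))\<^sup>2) \<le> d"
    using tails[OF d] by blast
  obtain B where B: "finite B" "\<And>C. C \<inter> B = {} \<Longrightarrow> (\<Sum>\<^sub>\<infinity>i\<in>C. (cmod (coef l i))\<^sup>2) \<le> d"
    using tail_small[OF d] by blast
  have "((\<lambda>x. \<Sum>i\<in>A \<union> B. (cmod (coef (f x) i - coef l i))\<^sup>2) \<longlongrightarrow> (\<Sum>i\<in>A \<union> B. (cmod (coef l i - coef l i))\<^sup>2)) F"
    by (intro tendsto_intros co)
  then have "((\<lambda>x. \<Sum>i\<in>A \<union> B. (cmod (coef (f x) i - coef l i))\<^sup>2) \<longlongrightarrow> 0) F" by simp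
  then have "\<forall>\<^sub>F x in F. (\<Sum>i\<in>A \<union> B. (cmod (coef (f x) i - coef l i))\<^sup>2) < d"
    using d by (rule order_tendstoD)
  with A(2) show "\<forall>\<^sub>F x in F. dist (f x) l < e"
  proof eventually_elim
    case (elim x)
    let ?C = "- (A \<union> B)"
    have "(\<Sum>\<^sub>\<infinity>i\<in>?C. (cmod (coef (f x - l) i))\<^sup>2) \<le> (\<Sum>\<^sub>\<infinity>i\<in>?C. 2 * (cmod (coef (f x) i))\<^sup>2 + 2 * (cmod (coef l i))\<^sup>2)"
      using sq_sum_le[of "coef (f x) i" "- coef l i" for i]
      by (intro infsum_mono coef_summable summable_on_add summable_on_cmult_right) simp
    also have "\<dots> = 2 * (\<Sum>\<^sub>\<infinity>i\<in>?C. (cmod (coef (f x) i))\<^sup>2) + 2 * (\<Sum>\<^sub>\<infinity>i\<in>?C. (cmod (coef l i))\<^sup>2)"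
      by (subst infsum_add) (auto intro: coef_summable summable_on_cmult_right simp: infsum_cmult_right')
    also have "\<dots> \<le> 2 * d + 2 * d"
    proof -
      have "(\<Sum>\<^sub>\<infinity>i\<in>?C. (cmod (coef (f x) i))\<^sup>2) \<le> (\<Sum>\<^sub>\<infinity>i\<in>- A. (cmod (coef (f x) i))\<^sup>2)"
        by (rule infsum_mono2) (auto intro: coef_summable)
      then show ?thesis using elim B(2)[of ?C] by auto
    qed
    finally have 1: "(\<Sum>\<^sub>\<infinity>i\<in>?C. (cmod (coef (f x - l) i))\<^sup>2) \<le> 4 * d" by simp
    have "(norm (f x - l))\<^sup>2 = (\<Sum>\<^sub>\<infinity>i\<in>(A \<union> B) \<union> ?C. (cmod (coef (f x - l) i))\<^sup>2)"
      by (simp only: norm_sq_infsum Compl_partition)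
    also have "\<dots> = (\<Sum>i\<in>A \<union> B. (cmod (coef (f x - l) i))\<^sup>2) + (\<Sum>\<^sub>\<infinity>i\<in>?C. (cmod (coef (f x - l) i))\<^sup>2)"
      using A(1) B(1) by (subst infsum_Un_disjoint) (auto simp del: coef_diff intro: coef_summable)
    also have "\<dots> < e\<^sup>2"
    proof -
      have "(\<Sum>i\<in>A \<union> B. (cmod (coef (f x - l) i))\<^sup>2) < d" using elim(2) by simp
      moreover have "8 * d = e\<^sup>2" by (simp add: d_def)
      ultimately show ?thesis using 1 d by linarith
    qed
    finally show ?case
      unfolding dist_norm by (rule power_less_imp_less_base) (use e in simp)
  qed
qed

text \<open>Dominated convergence: the tails of the fixed majorant \<open>h\<close> control those of
  the whole family.\<close>

lemma tendsto_ell2_dominated: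
  fixes f :: "'b \<Rightarrow> 'a ell2"
  assumes co: "\<And>i. ((\<lambda>x. coef (f x) i) \<longlongrightarrow> coef l i) F"
    and dom: "\<forall>\<^sub>F x in F. \<forall>i. cmod (coef (f x) i) \<le> C * cmod (coef h i)"
  shows "(f \<longlongrightarrow> l) F"
proof (rule tendsto_ell2_tails[OF co])
  fix e :: real assume e: "e > 0"
  have c: "C\<^sup>2 + 1 > 0" by (simp add: add_nonneg_pos)
  have "e / (C\<^sup>2 + 1) > 0" using e c by simp
  then obtain A where A: "finite A" "\<And>B. B \<inter> A = {} \<Longrightarrow> (\<Sum>\<^sub>\<infinity>i\<in>B. (cmod (coef h i))\<^sup>2) \<le> e / (C\<^sup>2 + 1)"
    using tail_small by blast
  have "\<forall>\<^sub>F x in F. (\<Sum>\<^sub>\<infinity>i\<in>- A. (cmod (coef (f x) i))\<^sup>2) \<le> e"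
    using dom
  proof eventually_elim
    case (elim x)
    have "(\<Sum>\<^sub>\<infinity>i\<in>- A. (cmod (coef (f x) i))\<^sup>2) \<le> (\<Sum>\<^sub>\<infinity>i\<in>- A. C\<^sup>2 * (cmod (coef h i))\<^sup>2)"
      using power_mono[OF elim[rule_format] norm_ge_zero, where n = 2]
      by (intro infsum_mono coef_summable summable_on_cmult_right) (simp add: power_mult_distrib)
    also have "\<dots> = C\<^sup>2 * (\<Sum>\<^sub>\<infinity>i\<in>- A. (cmod (coef h i))\<^sup>2)" by (rule infsum_cmult_right')
    also have "\<dots> \<le> (C\<^sup>2 + 1) * (e / (C\<^sup>2 + 1))"
      using A(2)[of "- A"] by (intro mult_mono infsum_nonneg) auto
    finally show ?case using c by simp
  qed
  with A(1) show "\<exists>A. finite A \<and> (\<forall>\<^sub>F x in F. (\<Sum>\<^sub>\<infinity>i\<in>- A. (cmod (coef (f x) i))\<^sup>2) \<le> e)" by blast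
qed

section \<open>Operators on square-summable families\<close>

text \<open>Bounded and complex-linear; \<open>bounded_linear\<close> by itself expresses only real
  linearity.\<close>

definition bcl :: "('a ell2 \<Rightarrow> 'b ell2) \<Rightarrow> bool" where
  "bcl T \<longleftrightarrow> bounded_linear T \<and> (\<forall>c f. T (cmul c f) = cmul c (T f))"

lemma bclI:
  assumes "\<And>f g. T (f + g) = T f + T g" "\<And>c f. T (cmul c f) = cmul c (T f)"
    and "\<And>f. norm (T f) \<le> K * norm f"
  shows "bcl T"
  unfolding bcl_def
proof (intro conjI allI bounded_linear_intro[where K = K])
  show "T (r *\<^sub>R x) = r *\<^sub>R T x" for r x by (simp add: scaleR_cmul assms(2))
qed (use assms in \<open>auto simp: mult.commute[of _ K]\<close>)

lemma bclD:
  assumes "bcl T"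
  shows "bounded_linear T" "T (f + g) = T f + T g" "T (f - g) = T f - T g" "T (cmul c f) = cmul c (T f)" "T 0 = 0"
  using assms unfolding bcl_def
  by (auto simp: linear_add linear_diff linear_0 bounded_linear.linear)

lemma bcl_sum: "bcl T \<Longrightarrow> T (\<Sum>i\<in>A. f i) = (\<Sum>i\<in>A. T (f i))"
  by (simp add: bclD(1) bounded_linear.linear linear_sum)

lemma bcl_tendsto: "bcl T \<Longrightarrow> (f \<longlongrightarrow> l) F \<Longrightarrow> ((\<lambda>x. T (f x)) \<longlongrightarrow> T l) F"
  using bclD(1) bounded_linear.tendsto by blast

lemma bcl_comp: "bcl T \<Longrightarrow> bcl U \<Longrightarrow> bcl (\<lambda>f. T (U f))"
  unfolding bcl_def using bounded_linear_compose by auto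

lemma bcl_id: "bcl (\<lambda>f. f)"
  by (auto simp: bcl_def)

lemma bcl_cmul: "bcl (cmul c)"
  by (auto simp: bcl_def bounded_linear_cmul mult.commute)

lemma bcl_funpow:
  fixes T :: "'a ell2 \<Rightarrow> 'a ell2"
  assumes "bcl T" shows "bcl (T ^^ n)"
proof (induction n)
  case 0
  have "T ^^ 0 = (\<lambda>f. f)" by (rule ext) simp
  then show ?case using bcl_id by (simp only:)
next
  case (Suc n)
  have "T ^^ Suc n = (\<lambda>f. T ((T ^^ n) f))" by (rule ext) simp
  then show ?case using bcl_comp[OF assms Suc] by simp
qed

lemma norm_funpow_le:
  fixes T :: "'a::real_normed_vector \<Rightarrow> 'a"
  shows "(\<And>f. norm (T f) \<le> norm f) \<Longrightarrow> norm ((T ^^ n) f) \<le> norm f"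
  by (induction n) (auto intro: order_trans)

subsection \<open>Diagonal operators\<close>

text \<open>Meaningful for bounded symbols, hence the bound assumed in the lemmas about its
  coefficients.\<close>

definition dmul :: "('a \<Rightarrow> complex) \<Rightarrow> 'a ell2 \<Rightarrow> 'a ell2" where
  "dmul \<theta> f = Abs_ell2 (\<lambda>i. \<theta> i * coef f i)"

lemma dmul_summable:
  assumes "\<And>i. cmod (\<theta> i) \<le> C"
  shows "(\<lambda>i. (cmod (\<theta> i * coef f i))\<^sup>2) summable_on UNIV"
proof (rule summable_on_le)
  show "(\<lambda>i. C\<^sup>2 * (cmod (coef f i))\<^sup>2) summable_on UNIV"
    by (intro summable_on_cmult_right coef_summable)
  show "(cmod (\<theta> i * coef f i))\<^sup>2 \<le> C\<^sup>2 * (cmod (coef f i))\<^sup>2" for i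
    unfolding norm_mult power_mult_distrib by (intro mult_right_mono power_mono assms) auto
qed auto

lemma coef_dmul: "(\<And>i. cmod (\<theta> i) \<le> C) \<Longrightarrow> coef (dmul \<theta> f) i = \<theta> i * coef f i"
  unfolding dmul_def using coef_Abs_ell2[OF dmul_summable[of \<theta> C f]] by simp

lemma norm_mono:
  assumes "\<And>i. cmod (coef f i) \<le> C * cmod (coef g i)" "0 \<le> C"
  shows "norm f \<le> C * norm g"
proof (rule norm_le_finite)
  fix F :: "'a set" assume "finite F"
  have "(\<Sum>i\<in>F. (cmod (coef f i))\<^sup>2) \<le> (\<Sum>i\<in>F. C\<^sup>2 * (cmod (coef g i))\<^sup>2)"
    using power_mono[OF assms(1) norm_ge_zero, where n = 2] by (intro sum_mono) (simp add: power_mult_distrib)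
  also have "\<dots> \<le> C\<^sup>2 * (norm g)\<^sup>2"
    unfolding sum_distrib_left[symmetric] by (intro mult_left_mono finite_sum_le_norm \<open>finite F\<close>) auto
  finally show "(\<Sum>i\<in>F. (cmod (coef f i))\<^sup>2) \<le> (C * norm g)\<^sup>2" by (simp add: power_mult_distrib)
qed (use assms in auto)

lemma norm_dmul:
  assumes "\<And>i. cmod (\<theta> i) \<le> C" shows "norm (dmul \<theta> f) \<le> C * norm f"
proof (rule norm_mono)
  show "0 \<le> C" using order_trans[OF norm_ge_zero assms] .
  show "cmod (coef (dmul \<theta> f) i) \<le> C * cmod (coef f i)" for i
    by (simp add: coef_dmul[OF assms] norm_mult mult_right_mono assms)
qed

lemma bcl_dmul:
  assumes "\<And>i. cmod (\<theta> i) \<le> C" shows "bcl (dmul \<theta>)"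
  by (rule bclI[where K = C])
    (auto intro!: ell2_eqI simp: coef_dmul[OF assms] distrib_left mult.left_commute norm_dmul[OF assms])

subsection \<open>Hilbert-Schmidt matrices\<close>

definition hsm :: "('a \<Rightarrow> 'b \<Rightarrow> complex) \<Rightarrow> bool" where
  "hsm A \<longleftrightarrow> (\<lambda>(n, m). (cmod (A n m))\<^sup>2) summable_on UNIV"

text \<open>The square of the Hilbert-Schmidt norm, so it bounds the square of the operator
  norm.\<close>

definition hs :: "('a \<Rightarrow> 'b \<Rightarrow> complex) \<Rightarrow> real" where
  "hs A = (\<Sum>\<^sub>\<infinity>(n, m). (cmod (A n m))\<^sup>2)"

definition matop :: "('a \<Rightarrow> 'b \<Rightarrow> complex) \<Rightarrow> 'b ell2 \<Rightarrow> 'a ell2" where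
  "matop A f = Abs_ell2 (\<lambda>n. \<Sum>\<^sub>\<infinity>m. A n m * coef f m)"

lemma hs_nonneg: "0 \<le> hs A"
  unfolding hs_def by (rule infsum_nonneg) auto

lemma hsm_Sigma: "hsm A \<longleftrightarrow> (\<lambda>(n, m). (cmod (A n m))\<^sup>2) summable_on (UNIV \<times> UNIV)"
  by (simp add: hsm_def)

lemma hsm_row: "hsm A \<Longrightarrow> (\<lambda>m. (cmod (A n m))\<^sup>2) summable_on UNIV"
  using summable_on_SigmaD1[of "\<lambda>n m. (cmod (A n m))\<^sup>2" UNIV "\<lambda>_. UNIV" n]
  by (simp add: hsm_def)

lemma hs_rows:
  assumes "hsm A"
  shows "(\<lambda>n. \<Sum>\<^sub>\<infinity>m. (cmod (A n m))\<^sup>2) summable_on UNIV" "hs A = (\<Sum>\<^sub>\<infinity>n. \<Sum>\<^sub>\<infinity>m. (cmod (A n m))\<^sup>2)"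
  using summable_on_Sigma_banach[of "\<lambda>n m. (cmod (A n m))\<^sup>2" UNIV "\<lambda>_. UNIV"]
    infsum_Sigma'_banach[of "\<lambda>n m. (cmod (A n m))\<^sup>2" UNIV "\<lambda>_. UNIV"] assms
  by (simp_all add: hsm_Sigma hs_def)

lemma hsmI:
  assumes "\<And>n. (\<lambda>m. (cmod (A n m))\<^sup>2) summable_on UNIV"
    and "(\<lambda>n. \<Sum>\<^sub>\<infinity>m. (cmod (A n m))\<^sup>2) summable_on UNIV"
  shows "hsm A"
  unfolding hsm_Sigma
  by (rule summable_on_SigmaI[where g = "\<lambda>n. \<Sum>\<^sub>\<infinity>m. (cmod (A n m))\<^sup>2"]) (use assms in \<open>auto intro: has_sum_infsum\<close>)

lemma row_prod_summable:
  assumes "(\<lambda>m. (cmod (a m))\<^sup>2) summable_on UNIV"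
  shows "(\<lambda>m. cmod (a m * coef f m)) summable_on UNIV" "(\<lambda>m. a m * coef f m) summable_on UNIV"
    "(cmod (\<Sum>\<^sub>\<infinity>m. a m * coef f m))\<^sup>2 \<le> (\<Sum>\<^sub>\<infinity>m. (cmod (a m))\<^sup>2) * (norm f)\<^sup>2"
proof -
  define r where "r = Abs_ell2 (\<lambda>m. cnj (a m))"
  have r: "coef r = (\<lambda>m. cnj (a m))" unfolding r_def using assms by (intro coef_Abs_ell2) simp
  show "(\<lambda>m. cmod (a m * coef f m)) summable_on UNIV"
    using cin_abs_summable[of r f UNIV] by (simp add: r norm_mult)
  then show "(\<lambda>m. a m * coef f m) summable_on UNIV" by (rule abs_summable_summable)
  have "(\<Sum>\<^sub>\<infinity>m. a m * coef f m) = cin f r" by (simp add: cin_def r mult.commute)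
  then have "cmod (\<Sum>\<^sub>\<infinity>m. a m * coef f m) \<le> norm f * norm r" using cin_le by simp
  then have "(cmod (\<Sum>\<^sub>\<infinity>m. a m * coef f m))\<^sup>2 \<le> (norm f * norm r)\<^sup>2" by (intro power_mono) auto
  also have "\<dots> = (\<Sum>\<^sub>\<infinity>m. (cmod (a m))\<^sup>2) * (norm f)\<^sup>2"
    by (simp add: power_mult_distrib norm_sq_infsum[of r] r)
  finally show "(cmod (\<Sum>\<^sub>\<infinity>m. a m * coef f m))\<^sup>2 \<le> (\<Sum>\<^sub>\<infinity>m. (cmod (a m))\<^sup>2) * (norm f)\<^sup>2" .
qed

lemma matop_summable:
  assumes "hsm A"
  shows "(\<lambda>n. (cmod (\<Sum>\<^sub>\<infinity>m. A n m * coef f m))\<^sup>2) summable_on UNIV"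
  by (rule summable_on_le[OF summable_on_cmult_left[OF hs_rows(1)[OF assms], of "(norm f)\<^sup>2"]])
    (auto intro: row_prod_summable(3) hsm_row assms)

lemma coef_matop: "hsm A \<Longrightarrow> coef (matop A f) n = (\<Sum>\<^sub>\<infinity>m. A n m * coef f m)"
  unfolding matop_def by (subst coef_Abs_ell2[OF matop_summable]) simp_all

lemma norm_matop:
  assumes "hsm A" shows "(norm (matop A f))\<^sup>2 \<le> hs A * (norm f)\<^sup>2"
proof -
  have "(norm (matop A f))\<^sup>2 = (\<Sum>\<^sub>\<infinity>n. (cmod (\<Sum>\<^sub>\<infinity>m. A n m * coef f m))\<^sup>2)"
    by (simp add: norm_sq_infsum coef_matop[OF assms])
  also have "\<dots> \<le> (\<Sum>\<^sub>\<infinity>n. (\<Sum>\<^sub>\<infinity>m. (cmod (A n m))\<^sup>2) * (norm f)\<^sup>2)"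
    by (intro infsum_mono matop_summable summable_on_cmult_left hs_rows row_prod_summable(3) hsm_row assms)
  also have "\<dots> = hs A * (norm f)\<^sup>2"
    by (simp add: infsum_cmult_left' hs_rows(2)[OF assms])
  finally show ?thesis .
qed

lemma norm_matop_le:
  assumes "hsm A" "hs A \<le> c\<^sup>2" "0 \<le> c" shows "norm (matop A f) \<le> c * norm f"
proof (rule power2_le_imp_le)
  show "(norm (matop A f))\<^sup>2 \<le> (c * norm f)\<^sup>2"
    using order_trans[OF norm_matop[OF assms(1)] mult_right_mono[OF assms(2)]] by (simp add: power_mult_distrib)
qed (use assms in auto)

lemma matop_add: "hsm A \<Longrightarrow> matop A (f + g) = matop A f + matop A g"
  by (rule ell2_eqI) (simp add: coef_matop distrib_left infsum_add row_prod_summable(2) hsm_row)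

lemma matop_cmul: "hsm A \<Longrightarrow> matop A (cmul c f) = cmul c (matop A f)"
  by (rule ell2_eqI) (simp add: coef_matop mult.left_commute infsum_cmult_right')

lemma bcl_matop: "hsm A \<Longrightarrow> bcl (matop A)"
  by (rule bclI[where K = "sqrt (hs A)"]) (auto simp: matop_add matop_cmul hs_nonneg intro!: norm_matop_le)

lemma matop_adjoint:
  assumes "hsm A" and herm: "\<And>n m. A n m = cnj (A m n)"
  shows "cin (matop A f) g = cin f (matop A g)"
proof -
  have "(\<lambda>n. (cmod (coef g n))\<^sup>2 * (norm f)\<^sup>2) summable_on UNIV"
    by (intro summable_on_cmult_left coef_summable)
  then have 1: "hsm (\<lambda>n m. coef g n * coef f m)"
    by (intro hsmI) (simp_all add: norm_mult power_mult_distrib norm_sq_infsum infsum_cmult_right'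
        coef_summable summable_on_cmult_right)
  have "(\<lambda>(n, m). (cmod (A n m))\<^sup>2 + (cmod (coef g n * coef f m))\<^sup>2) summable_on UNIV"
    using summable_on_add[OF assms(1)[unfolded hsm_def] 1[unfolded hsm_def]]
    by (simp add: case_prod_unfold)
  then have "(\<lambda>p. norm ((\<lambda>(n, m). A n m * coef f m * cnj (coef g n)) p)) summable_on UNIV"
  proof (rule summable_on_le)
    have *: "x * y \<le> x\<^sup>2 + y\<^sup>2" if "0 \<le> x" "0 \<le> y" for x y :: real
      using sum_squares_bound[of x y] mult_nonneg_nonneg[OF that] by linarith
    show "norm ((\<lambda>(n, m). A n m * coef f m * cnj (coef g n)) p) \<le>
        (case p of (n, m) \<Rightarrow> (cmod (A n m))\<^sup>2 + (cmod (coef g n * coef f m))\<^sup>2)" for p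
      using *[of "cmod (A (fst p) (snd p))" "cmod (coef g (fst p) * coef f (snd p))"]
      by (simp add: case_prod_unfold norm_mult mult_ac)
  qed auto
  then have s: "(\<lambda>(n, m). A n m * coef f m * cnj (coef g n)) summable_on (UNIV \<times> UNIV)"
    using abs_summable_summable by fastforce
  have "cin (matop A f) g = (\<Sum>\<^sub>\<infinity>n. \<Sum>\<^sub>\<infinity>m. A n m * coef f m * cnj (coef g n))"
    by (simp add: cin_def coef_matop assms(1) infsum_cmult_left')
  also have "\<dots> = (\<Sum>\<^sub>\<infinity>m. \<Sum>\<^sub>\<infinity>n. A n m * coef f m * cnj (coef g n))"
    by (rule infsum_swap_banach[OF s])
  also have "\<dots> = (\<Sum>\<^sub>\<infinity>m. \<Sum>\<^sub>\<infinity>n. coef f m * cnj (A m n * coef g n))"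
  proof -
    have "A n m * coef f m * cnj (coef g n) = coef f m * cnj (A m n * coef g n)" for n m
      by (subst herm) simp
    then show ?thesis by presburger
  qed
  also have "\<dots> = cin f (matop A g)"
    by (simp only: cin_def coef_matop[OF assms(1)] infsum_cmult_right' infsum_cnj)
  finally show ?thesis .
qed

text \<open>The inverse of 1 - A, as the fixed point of \<phi> -> \<psi> + A \<phi>. With
  \<open>hs A \<le> 1 / 9\<close> this map contracts by 1/3, which is the source of the constants
  3/2 and 4/3 in \<open>norm_neu\<close>.\<close>

definition neu :: "('a \<Rightarrow> 'a \<Rightarrow> complex) \<Rightarrow> 'a ell2 \<Rightarrow> 'a ell2" where
  "neu A \<psi> = (THE \<phi>. \<phi> = \<psi> + matop A \<phi>)"

definition small :: "('a \<Rightarrow> 'a \<Rightarrow> complex) \<Rightarrow> bool" where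
  "small A \<longleftrightarrow> hsm A \<and> hs A \<le> 1 / 9"

lemma small_norm: "small A \<Longrightarrow> norm (matop A f) \<le> norm f / 3"
  using norm_matop_le[of A "1 / 3" f] by (simp add: small_def power2_eq_square)

lemma neu_ex1:
  assumes "small A" shows "\<exists>!\<phi>. \<phi> = \<psi> + matop A \<phi>"
proof -
  have "\<exists>!\<phi>\<in>UNIV. \<psi> + matop A \<phi> = \<phi>"
  proof (rule Banach_fix[where c = "1 / 3"])
    show "dist (\<psi> + matop A x) (\<psi> + matop A y) \<le> 1 / 3 * dist x y" for x y
    proof -
      have "matop A (x - y) = matop A x - matop A y"
        using bclD(3)[OF bcl_matop] assms by (auto simp: small_def)
      then show "dist (\<psi> + matop A x) (\<psi> + matop A y) \<le> 1 / 3 * dist x y"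
        using small_norm[OF assms, of "x - y"] by (simp add: dist_norm)
    qed
  qed (auto simp: complete_UNIV)
  then show ?thesis by (auto simp: eq_commute)
qed

lemma neu_eq: "small A \<Longrightarrow> neu A \<psi> = \<psi> + matop A (neu A \<psi>)"
  unfolding neu_def by (rule theI'[OF neu_ex1])

lemma neu_unique: "small A \<Longrightarrow> \<phi> = \<psi> + matop A \<phi> \<Longrightarrow> \<phi> = neu A \<psi>"
  using neu_ex1 neu_eq by metis

lemma norm_neu: assumes "small A" shows "norm (neu A \<psi>) \<le> 3 / 2 * norm \<psi>" "norm \<psi> \<le> 4 / 3 * norm (neu A \<psi>)"
proof -
  have "norm (neu A \<psi>) \<le> norm \<psi> + norm (matop A (neu A \<psi>))"
    by (subst neu_eq[OF assms]) (rule norm_triangle_ineq)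
  then show "norm (neu A \<psi>) \<le> 3 / 2 * norm \<psi>" using small_norm[OF assms, of "neu A \<psi>"] by simp
  have "norm \<psi> \<le> norm (neu A \<psi>) + norm (matop A (neu A \<psi>))"
    using norm_triangle_ineq4[of "neu A \<psi>" "matop A (neu A \<psi>)"] neu_eq[OF assms, of \<psi>]
    by (metis add_diff_cancel_right')
  then show "norm \<psi> \<le> 4 / 3 * norm (neu A \<psi>)" using small_norm[OF assms, of "neu A \<psi>"] by simp
qed

lemma neu_add:
  assumes "small A" shows "neu A (f + g) = neu A f + neu A g"
proof (rule neu_unique[OF assms, symmetric])
  have "matop A (neu A f + neu A g) = matop A (neu A f) + matop A (neu A g)"
    using assms by (simp add: small_def matop_add)
  then show "neu A f + neu A g = f + g + matop A (neu A f + neu A g)"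
    using neu_eq[OF assms, of f] neu_eq[OF assms, of g] by (metis add.assoc add.left_commute)
qed

lemma neu_cmul:
  assumes "small A" shows "neu A (cmul c f) = cmul c (neu A f)"
proof (rule neu_unique[OF assms, symmetric])
  have "matop A (cmul c (neu A f)) = cmul c (matop A (neu A f))"
    using assms by (simp add: small_def matop_cmul)
  then show "cmul c (neu A f) = cmul c f + matop A (cmul c (neu A f))"
    using neu_eq[OF assms, of f] by (metis cmul_add)
qed

lemma bcl_neu: "small A \<Longrightarrow> bcl (neu A)"
  by (rule bclI[where K = "3 / 2"]) (simp_all only: neu_add neu_cmul norm_neu(1))

lemma neu_adjoint:
  assumes "small A" "\<And>n m. A n m = cnj (A m n)"
  shows "cin (neu A f) g = cin f (neu A g)"
proof -
  have h: "hsm A" using assms(1) by (simp add: small_def)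
  let ?a = "neu A f" let ?b = "neu A g"
  have "f = ?a - matop A ?a" "g = ?b - matop A ?b"
    using neu_eq[OF assms(1), of f] neu_eq[OF assms(1), of g] by (metis add_diff_cancel_right')+
  then show ?thesis
    using matop_adjoint[OF h assms(2), of ?a ?b] by (metis cin_diff_left cin_diff_right)
qed

text \<open>With a = \<open>neu A f\<close> one has f = a - A a, so the real part of <a, f> is at
  least (1 - 1/3) |a|^2, and |f| is at most 4/3 |a|; 2/3 * 9/16 = 3/8. The quotient 4 of the bounds
  3/2 and 3/8 is the loss that reappears in \<open>dyadic_comparison\<close>.\<close>

lemma neu_form_bounds:
  assumes "small A"
  shows "Re (cin (neu A f) f) \<ge> 3 / 8 * (norm f)\<^sup>2" "cmod (cin (neu A f) f) \<le> 3 / 2 * (norm f)\<^sup>2"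
    "Re (cin (neu A f) f) \<ge> 2 / 3 * (norm (neu A f))\<^sup>2"
proof -
  let ?a = "neu A f"
  have f: "f = ?a - matop A ?a" using neu_eq[OF assms(1), of f] by (metis add_diff_cancel_right')
  have "cmod (cin ?a (matop A ?a)) \<le> norm ?a * (norm ?a / 3)"
    by (rule order_trans[OF cin_le mult_left_mono[OF small_norm[OF assms]]]) auto
  then have "Re (cin ?a (matop A ?a)) \<le> (norm ?a)\<^sup>2 / 3"
    using complex_Re_le_cmod[of "cin ?a (matop A ?a)"] by (simp add: power2_eq_square)
  moreover have "Re (cin ?a f) = (norm ?a)\<^sup>2 - Re (cin ?a (matop A ?a))"
    using arg_cong[OF f, of "\<lambda>x. cin ?a x"] by (simp add: cin_diff_right cin_self_norm)
  ultimately show *: "Re (cin ?a f) \<ge> 2 / 3 * (norm ?a)\<^sup>2" by simp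
  have "(norm f)\<^sup>2 \<le> (4 / 3 * norm ?a)\<^sup>2" by (intro power_mono norm_neu assms) auto
  then show "Re (cin ?a f) \<ge> 3 / 8 * (norm f)\<^sup>2" using * by (simp add: power_mult_distrib power2_eq_square)
  show "cmod (cin ?a f) \<le> 3 / 2 * (norm f)\<^sup>2"
    using order_trans[OF cin_le[of ?a f] mult_right_mono[OF norm_neu(1)[OF assms, of f]]]
    by (simp add: power2_eq_square)
qed

lemma infsum_diff_complex:
  fixes f g :: "'a \<Rightarrow> complex"
  assumes "f summable_on A" "g summable_on A"
  shows "(\<Sum>\<^sub>\<infinity>i\<in>A. f i - g i) = infsum f A - infsum g A"
  using infsum_add[OF assms(1), of "\<lambda>i. - g i"] assms(2) by (simp add: infsum_uminus summable_on_uminus)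

text \<open>The difference of the two solutions satisfies x = A x + (A - B) \<open>neu B f\<close>.
  Absorbing A x, of norm at most |x|/3, costs a factor 3/2, and the norm of \<open>neu B f\<close>
  another 3/2.\<close>

lemma neu_perturb:
  assumes "small A" "small B" "hsm (\<lambda>n m. A n m - B n m)" "hs (\<lambda>n m. A n m - B n m) \<le> c\<^sup>2" "c \<ge> 0"
  shows "norm (neu A f - neu B f) \<le> 9 / 4 * c * norm f"
proof -
  let ?a = "neu A f" let ?b = "neu B f"
  have h: "hsm A" "hsm B" using assms by (auto simp: small_def)
  have diff: "matop (\<lambda>n m. A n m - B n m) ?b = matop A ?b - matop B ?b"
    by (rule ell2_eqI) (simp add: coef_matop h assms(3) left_diff_distrib
        infsum_diff_complex row_prod_summable(2) hsm_row)
  have *: "a - b = X + Y" if "Y = P - Q" "a = f + P'" "b = f + Q" "X = P' - P" for a b f P P' Q X Y :: "'a ell2"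
    using that by simp
  have "?a - ?b = matop A (?a - ?b) + matop (\<lambda>n m. A n m - B n m) ?b"
    by (rule *[OF diff neu_eq[OF assms(1), of f] neu_eq[OF assms(2), of f] bclD(3)[OF bcl_matop[OF h(1)], of ?a ?b]])
  then have "norm (?a - ?b) \<le> norm (matop A (?a - ?b)) + norm (matop (\<lambda>n m. A n m - B n m) ?b)"
    by (metis norm_triangle_ineq)
  also have "\<dots> \<le> norm (?a - ?b) / 3 + c * (3 / 2 * norm f)"
    by (intro add_mono small_norm assms order_trans[OF norm_matop_le[OF assms(3-5)]] mult_left_mono norm_neu)
  finally show ?thesis by simp
qed

subsection \<open>Shifts\<close>

text \<open>Multiplication by e^(ix) on the Hardy space in terms of Fourier coefficients;
  \<open>shl\<close> is its adjoint, the backward shift.\<close>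

definition shr :: "nat ell2 \<Rightarrow> nat ell2" where
  "shr f = Abs_ell2 (\<lambda>n. case n of 0 \<Rightarrow> 0 | Suc m \<Rightarrow> coef f m)"

definition shl :: "nat ell2 \<Rightarrow> nat ell2" where
  "shl f = Abs_ell2 (\<lambda>n. coef f (Suc n))"

lemma has_sum_nat_shift:
  fixes g :: "nat \<Rightarrow> 'b :: real_normed_vector"
  assumes "((\<lambda>n. g (Suc n)) has_sum s) UNIV"
  shows "(g has_sum (g 0 + s)) UNIV"
proof -
  have "(g has_sum s) (Suc ` UNIV)"
    using has_sum_reindex[of Suc UNIV g s] assms by (simp add: o_def)
  then have "(g has_sum (g 0 + s)) (insert 0 (Suc ` UNIV))"
    by (intro has_sum_insert) auto
  then show ?thesis by (simp flip: UNIV_nat_eq)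
qed

lemma coef_shl: "coef (shl f) n = coef f (Suc n)"
proof -
  have "(\<lambda>n. (cmod (coef f (Suc n)))\<^sup>2) summable_on UNIV"
    using summable_on_reindex[of Suc UNIV "\<lambda>n. (cmod (coef f n))\<^sup>2"] coef_summable[of f "range Suc"] by (simp add: o_def)
  then show ?thesis unfolding shl_def by (simp add: coef_Abs_ell2)
qed

lemma coef_shr [simp]: "coef (shr f) 0 = 0" "coef (shr f) (Suc n) = coef f n"
proof -
  have "(\<lambda>n. (cmod (case n of 0 \<Rightarrow> 0 | Suc m \<Rightarrow> coef f m))\<^sup>2) summable_on UNIV"
    using has_sum_nat_shift[of "\<lambda>n. (cmod (case n of 0 \<Rightarrow> 0 | Suc m \<Rightarrow> coef f m))\<^sup>2"]
      has_sum_infsum[OF coef_summable[of f UNIV]] has_sum_imp_summable by fastforce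
  then show "coef (shr f) 0 = 0" "coef (shr f) (Suc n) = coef f n"
    unfolding shr_def by (simp_all add: coef_Abs_ell2)
qed

lemma shl_shr [simp]: "shl (shr f) = f"
  by (rule ell2_eqI) (simp add: coef_shl)

lemma shr_shl: "shr (shl f) = f - cmul (coef f 0) (bas 0)"
proof (rule ell2_eqI)
  show "coef (shr (shl f)) i = coef (f - cmul (coef f 0) (bas 0)) i" for i
    by (cases i) (auto simp: coef_shl)
qed

lemma cin_shr: "cin (shr f) g = cin f (shl g)"
proof -
  have "((\<lambda>n. coef f n * cnj (coef (shl g) n)) has_sum cin f (shl g)) UNIV"
    unfolding cin_def by (rule has_sum_infsum[OF cin_summable])
  then have "((\<lambda>n. coef (shr f) n * cnj (coef g n)) has_sum (coef (shr f) 0 * cnj (coef g 0) + cin f (shl g))) UNIV"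
    by (intro has_sum_nat_shift) (simp add: coef_shl)
  then show ?thesis unfolding cin_def by (simp add: infsumI)
qed

lemma norm_shr [simp]: "norm (shr f) = norm f"
proof -
  have "cin (shr f) (shr f) = cin f f" by (simp add: cin_shr)
  then have "(norm (shr f))\<^sup>2 = (norm f)\<^sup>2" by (simp add: cin_self_norm flip: of_real_eq_iff[where 'a = complex])
  then show ?thesis by (simp add: power2_eq_iff_nonneg)
qed

lemma norm_shl: "(norm (shl f))\<^sup>2 = (norm f)\<^sup>2 - (cmod (coef f 0))\<^sup>2"
proof -
  have "cin (shl f) (shl f) = cin (shr (shl f)) f" by (simp add: cin_shr)
  also have "\<dots> = cin f f - coef f 0 * cnj (coef f 0)"
    by (simp add: shr_shl cin_diff_left)
  finally have "complex_of_real ((norm (shl f))\<^sup>2) = of_real ((norm f)\<^sup>2 - (cmod (coef f 0))\<^sup>2)"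
    by (simp add: cin_self_norm complex_norm_square del: of_real_power)
  then show ?thesis by (simp only: of_real_eq_iff)
qed

lemma norm_shl_le: "norm (shl f) \<le> norm f"
  by (rule power2_le_imp_le) (auto simp: norm_shl)

lemma bcl_shr: "bcl shr"
proof (rule bclI[where K = 1])
  show "shr (f + g) = shr f + shr g" for f g
  proof (rule ell2_eqI)
    show "coef (shr (f + g)) i = coef (shr f + shr g) i" for i by (cases i) auto
  qed
  show "shr (cmul c f) = cmul c (shr f)" for c f
  proof (rule ell2_eqI)
    show "coef (shr (cmul c f)) i = coef (cmul c (shr f)) i" for i by (cases i) auto
  qed
qed auto

lemma bcl_shl: "bcl shl"
  by (rule bclI[where K = 1]) (auto intro!: ell2_eqI simp: coef_shl norm_shl_le)

section \<open>Compactness and the spectral theorem\<close>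

lemma coordinatewise_subsequence:
  fixes x :: "nat \<Rightarrow> 'i::countable \<Rightarrow> 'a::heine_borel"
  assumes "\<And>i. bounded (range (\<lambda>j. x j i))"
  obtains r where "strict_mono r" "\<And>i. convergent (\<lambda>j. x (r j) i)"
proof -
  let ?P = "\<lambda>n s. convergent (\<lambda>j. x (s j) (from_nat n))"
  interpret subseqs ?P
  proof
    fix n and s :: "nat \<Rightarrow> nat"
    assume "strict_mono s"
    have "bounded (range (\<lambda>j. x (s j) (from_nat n)))"
      by (rule bounded_subset[OF assms[of "from_nat n"]]) auto
    from bounded_imp_convergent_subsequence[OF this]
    obtain l r where "strict_mono r" "((\<lambda>j. x (s j) (from_nat n)) \<circ> r) \<longlonglongrightarrow> l" by blast
    then show "\<exists>r'. strict_mono r' \<and> ?P n (s \<circ> r')"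
      by (auto simp: convergent_def o_def)
  qed
  have "convergent (\<lambda>j. x (diagseq j) i)" for i
  proof -
    have "?P (to_nat i) (diagseq \<circ> ((+) (Suc (to_nat i))))"
    proof (rule diagseq_holds)
      fix r s :: "nat \<Rightarrow> nat" and n
      assume "strict_mono r" "?P n s"
      then show "?P n (s \<circ> r)"
        using convergent_subseq_convergent[of "\<lambda>j. x (s j) (from_nat n)" r] by (simp add: o_def)
    qed
    then have "convergent (\<lambda>j. x (diagseq (j + Suc (to_nat i))) i)"
      by (simp add: o_def add.commute)
    then show ?thesis
      by (rule convergent_ignore_initial_segment[THEN iffD1])
  qed
  then show thesis using subseq_diagseq that by blast
qed

lemma ell2_limitI:
  fixes f :: "nat \<Rightarrow> 'a ell2"
  assumes "\<And>i. (\<lambda>j. coef (f j) i) \<longlonglongrightarrow> l i" "\<And>j. norm (f j) \<le> B"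
  shows "(\<lambda>i. (cmod (l i))\<^sup>2) summable_on UNIV"
proof (rule nonneg_bdd_above_summable_on)
  have "(\<Sum>i\<in>F. (cmod (l i))\<^sup>2) \<le> B\<^sup>2" if F: "finite F" for F
  proof (rule LIMSEQ_le_const2)
    show "(\<lambda>j. \<Sum>i\<in>F. (cmod (coef (f j) i))\<^sup>2) \<longlonglongrightarrow> (\<Sum>i\<in>F. (cmod (l i))\<^sup>2)"
      by (intro tendsto_intros assms(1))
    show "\<exists>N. \<forall>j\<ge>N. (\<Sum>i\<in>F. (cmod (coef (f j) i))\<^sup>2) \<le> B\<^sup>2"
      using order_trans[OF finite_sum_le_norm[OF F] power_mono[OF assms(2) norm_ge_zero]] by blast
  qed
  then show "bdd_above (sum (\<lambda>i. (cmod (l i))\<^sup>2) ` {F. F \<subseteq> UNIV \<and> finite F})"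
    by (intro bdd_aboveI[of _ "B\<^sup>2"]) auto
qed simp

lemma ell2_precompact:
  fixes f :: "nat \<Rightarrow> 'a::countable ell2"
  assumes B: "\<And>j. norm (f j) \<le> B"
    and tails: "\<And>e. e > 0 \<Longrightarrow> \<exists>A. finite A \<and> (\<forall>j. (\<Sum>\<^sub>\<infinity>i\<in>- A. (cmod (coef (f j) i))\<^sup>2) \<le> e)"
  obtains r l where "strict_mono r" "(\<lambda>j. f (r j)) \<longlonglongrightarrow> l"
proof -
  have "bounded (range (\<lambda>j. coef (f j) i))" for i
    unfolding bounded_iff using order_trans[OF coef_le_norm B] by blast
  then obtain r where r: "strict_mono r" "\<And>i. convergent (\<lambda>j. coef (f (r j)) i)"
    using coordinatewise_subsequence[of "\<lambda>j. coef (f j)"] by blast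
  then obtain l where l: "\<And>i. (\<lambda>j. coef (f (r j)) i) \<longlonglongrightarrow> l i"
    unfolding convergent_def by metis
  have cl: "coef (Abs_ell2 l) = l"
    by (rule coef_Abs_ell2[OF ell2_limitI[OF l]]) (rule B)
  have "(\<lambda>j. f (r j)) \<longlonglongrightarrow> Abs_ell2 l"
  proof (rule tendsto_ell2_tails)
    show "(\<lambda>j. coef (f (r j)) i) \<longlonglongrightarrow> coef (Abs_ell2 l) i" for i
      unfolding cl by (rule l)
    fix e :: real assume "e > 0"
    then obtain A where "finite A" "\<forall>j. (\<Sum>\<^sub>\<infinity>i\<in>- A. (cmod (coef (f j) i))\<^sup>2) \<le> e"
      using tails by blast
    then show "\<exists>A. finite A \<and> (\<forall>\<^sub>F j in sequentially. (\<Sum>\<^sub>\<infinity>i\<in>- A. (cmod (coef (f (r j)) i))\<^sup>2) \<le> e)"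
      by (intro exI[of _ A]) simp
  qed
  then show thesis using r(1) that by blast
qed

definition cpt :: "('a::real_normed_vector \<Rightarrow> 'b::real_normed_vector) \<Rightarrow> bool" where
  "cpt T \<longleftrightarrow> (\<forall>(f :: nat \<Rightarrow> 'a) B. (\<forall>j. norm (f j) \<le> B) \<longrightarrow>
     (\<exists>r l. strict_mono r \<and> (\<lambda>j. T (f (r j))) \<longlonglongrightarrow> l))"

lemma cpt_dmul:
  fixes \<theta> :: "'a::countable \<Rightarrow> complex"
  assumes C: "\<And>i. cmod (\<theta> i) \<le> C" and dec: "\<And>e. e > 0 \<Longrightarrow> finite {i. cmod (\<theta> i) > e}"
  shows "cpt (dmul \<theta>)"
  unfolding cpt_def
proof (intro allI impI)
  fix f :: "nat \<Rightarrow> 'a ell2" and B assume B: "\<forall>j. norm (f j) \<le> B"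
  have B0: "0 \<le> B" using order_trans[OF norm_ge_zero B[rule_format, of 0]] .
  show "\<exists>r l. strict_mono r \<and> (\<lambda>j. dmul \<theta> (f (r j))) \<longlonglongrightarrow> l"
  proof (rule ell2_precompact[of "\<lambda>j. dmul \<theta> (f j)" "C * B"])
    show "norm (dmul \<theta> (f j)) \<le> C * B" for j
    proof -
      have "norm (dmul \<theta> (f j)) \<le> C * norm (f j)" by (rule norm_dmul[OF C])
      also have "\<dots> \<le> C * B"
        using B order_trans[OF norm_ge_zero C] by (intro mult_left_mono) auto
      finally show ?thesis .
    qed
    fix e :: real assume e: "e > 0"
    define d where "d = sqrt (e / (B\<^sup>2 + 1))"
    have p: "B\<^sup>2 + 1 > 0" by (simp add: add_nonneg_pos)
    have d: "d > 0" "d\<^sup>2 = e / (B\<^sup>2 + 1)" using e p by (auto simp: d_def)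
    let ?A = "{i. cmod (\<theta> i) > d}"
    have "(\<Sum>\<^sub>\<infinity>i\<in>- ?A. (cmod (coef (dmul \<theta> (f j)) i))\<^sup>2) \<le> e" for j
    proof -
      have "(\<Sum>\<^sub>\<infinity>i\<in>- ?A. (cmod (coef (dmul \<theta> (f j)) i))\<^sup>2) \<le> (\<Sum>\<^sub>\<infinity>i\<in>- ?A. d\<^sup>2 * (cmod (coef (f j) i))\<^sup>2)"
        by (intro infsum_mono coef_summable summable_on_cmult_right)
          (auto simp: coef_dmul[OF C] norm_mult power_mult_distrib not_less intro!: mult_right_mono power_mono)
      also have "\<dots> = d\<^sup>2 * (\<Sum>\<^sub>\<infinity>i\<in>- ?A. (cmod (coef (f j) i))\<^sup>2)" by (rule infsum_cmult_right')
      also have "\<dots> \<le> d\<^sup>2 * (norm (f j))\<^sup>2"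
        unfolding norm_sq_infsum by (intro mult_left_mono infsum_mono2 coef_summable) auto
      also have "\<dots> \<le> d\<^sup>2 * B\<^sup>2" using B by (intro mult_left_mono power_mono) auto
      also have "\<dots> \<le> e" using p e unfolding d(2) by (simp add: field_simps)
      finally show ?thesis .
    qed
    then show "\<exists>A. finite A \<and> (\<forall>j. (\<Sum>\<^sub>\<infinity>i\<in>- A. (cmod (coef (dmul \<theta> (f j)) i))\<^sup>2) \<le> e)"
      using dec[OF d(1)] by blast
  qed blast
qed

lemma cpt_comp_right:
  fixes U :: "'a::real_normed_vector \<Rightarrow> 'b::real_normed_vector"
  assumes "\<And>f. norm (U f) \<le> K * norm f" "0 \<le> K" "cpt T" shows "cpt (\<lambda>f. T (U f))"
  unfolding cpt_def
proof (intro allI impI)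
  fix f :: "nat \<Rightarrow> 'a" and B assume B: "\<forall>j. norm (f j) \<le> B"
  have "\<forall>j. norm (U (f j)) \<le> K * B"
    using order_trans[OF assms(1) mult_left_mono[OF B[rule_format] assms(2)]] by blast
  then show "\<exists>r l. strict_mono r \<and> (\<lambda>j. T (U (f (r j)))) \<longlonglongrightarrow> l"
    using assms(3)[unfolded cpt_def, rule_format, of "\<lambda>j. U (f j)"] by blast
qed

text \<open>Strict positivity excludes a kernel, so that eigenvectors with positive eigenvalues can
  be complete.\<close>

definition posdef :: "('a ell2 \<Rightarrow> 'a ell2) \<Rightarrow> bool" where
  "posdef T \<longleftrightarrow> bcl T \<and> (\<forall>f g. cin (T f) g = cin f (T g)) \<and> (\<forall>f. f \<noteq> 0 \<longrightarrow> Re (cin (T f) f) > 0)"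

lemma posdefD:
  assumes "posdef T"
  shows "bcl T" "cin (T f) g = cin f (T g)" "f \<noteq> 0 \<Longrightarrow> Re (cin (T f) f) > 0" "Re (cin (T f) f) \<ge> 0"
  using assms unfolding posdef_def by (auto, cases "f = 0", auto intro: less_imp_le)

lemma posdef_cauchy_schwarz:
  assumes "posdef T"
  shows "(inner (T f) g)\<^sup>2 \<le> inner (T f) f * inner (T g) g"
proof (cases "g = 0")
  case False
  define b c where "b = inner (T f) g" and "c = inner (T g) g"
  have c: "c > 0" using posdefD(3)[OF assms False] by (simp add: c_def inner_ell2_def)
  define t where "t = - b / c"
  have sym: "inner (T g) f = b"
    unfolding b_def inner_ell2_def posdefD(2)[OF assms, of g f] by (subst cin_commute) simp
  have "0 \<le> inner (T (f + t *\<^sub>R g)) (f + t *\<^sub>R g)"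
    using posdefD(4)[OF assms] by (simp add: inner_ell2_def)
  also have "T (f + t *\<^sub>R g) = T f + t *\<^sub>R T g"
    using posdefD(1)[OF assms] by (simp add: scaleR_cmul bclD)
  also have "inner (T f + t *\<^sub>R T g) (f + t *\<^sub>R g) = inner (T f) f + 2 * t * b + t\<^sup>2 * c"
    by (simp add: inner_add_left inner_add_right sym b_def[symmetric] c_def[symmetric] power2_eq_square algebra_simps)
  also have "\<dots> = inner (T f) f - b\<^sup>2 / c"
    using c by (simp add: t_def power2_eq_square field_simps)
  finally show ?thesis using c by (simp add: b_def[symmetric] c_def[symmetric] field_simps)
qed (simp add: posdefD bclD)

text \<open>The supremum m of the quadratic form on the unit sphere of V is attained. Cauchy-Schwarz
  for the form of T gives |T h|^2 \<le> m <T h, h>, hence |T x - m x|^2 \<le> m (m - <T x, x>) for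
  unit x. Along a maximizing sequence this tends to 0, and compactness of T makes a subsequence of x
  itself converge.\<close>

lemma top_eigenvector:
  assumes T: "posdef T" "cpt T"
    and V: "\<And>f g. f \<in> V \<Longrightarrow> g \<in> V \<Longrightarrow> f + g \<in> V" "\<And>c f. f \<in> V \<Longrightarrow> cmul c f \<in> V"
      "\<And>f. f \<in> V \<Longrightarrow> T f \<in> V" "closed V" "h0 \<in> V" "h0 \<noteq> 0"
  obtains f \<mu> where "f \<in> V" "norm f = 1" "\<mu> > 0" "T f = \<mu> *\<^sub>R f"
    "\<And>h. h \<in> V \<Longrightarrow> Re (cin (T h) h) \<le> \<mu> * (norm h)\<^sup>2"
proof -
  define q where "q h = inner (T h) h" for h
  have q_cin: "q h = Re (cin (T h) h)" for h by (simp add: q_def inner_ell2_def)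
  obtain K where K: "\<And>h. norm (T h) \<le> norm h * K"
    using bounded_linear.bounded[OF bclD(1)[OF posdefD(1)[OF T(1)]]] by blast
  have V2: "r *\<^sub>R f \<in> V" if "f \<in> V" for f r using V(2)[OF that] by (simp add: scaleR_cmul)
  have qs: "q (r *\<^sub>R h) = r\<^sup>2 * q h" for r h
  proof -
    have "T (r *\<^sub>R h) = r *\<^sub>R T h" using posdefD(1)[OF T(1)] by (simp add: scaleR_cmul bclD)
    then show ?thesis by (simp add: q_def power2_eq_square)
  qed
  define U where "U = {h \<in> V. norm h = 1}"
  define m where "m = (SUP h\<in>U. q h)"
  have bd: "bdd_above (q ` U)"
  proof (rule bdd_aboveI2[where M = K])
    fix h assume "h \<in> U"
    then have "norm h = 1" by (simp add: U_def)
    then show "q h \<le> K" using norm_cauchy_schwarz[of "T h" h] K[of h] by (simp add: q_def)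
  qed
  have h0: "(1 / norm h0) *\<^sub>R h0 \<in> U" using V(5,6) V2 by (simp add: U_def)
  have le_unit: "q h \<le> m" if "h \<in> U" for h
    unfolding m_def by (rule cSUP_upper[OF that bd])
  have le: "q h \<le> m * (norm h)\<^sup>2" if "h \<in> V" for h
  proof (cases "h = 0")
    case False
    then have "(1 / norm h) *\<^sub>R h \<in> U" using that V2 by (simp add: U_def)
    then have "(1 / norm h)\<^sup>2 * q h \<le> m" using le_unit qs by metis
    then show ?thesis using False by (simp add: power_divide field_simps)
  qed (simp add: q_def)
  have "q ((1 / norm h0) *\<^sub>R h0) > 0"
    using posdefD(3)[OF T(1), of "(1 / norm h0) *\<^sub>R h0"] V(6) by (simp add: q_cin)
  then have m: "m > 0" using le_unit[OF h0] by linarith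
  have Tsq: "(norm (T h))\<^sup>2 \<le> m * q h" if "h \<in> V" for h
  proof (cases "T h = 0")
    case False
    have "(norm (T h))\<^sup>2 * (norm (T h))\<^sup>2 \<le> q h * q (T h)"
      using posdef_cauchy_schwarz[OF T(1), of h "T h"] unfolding q_def power2_norm_eq_inner by (simp add: power2_eq_square)
    also have "\<dots> \<le> q h * (m * (norm (T h))\<^sup>2)"
      using le[OF V(3)[OF that]] posdefD(4)[OF T(1)] by (intro mult_left_mono) (auto simp: q_cin)
    finally have "(norm (T h))\<^sup>2 * (norm (T h))\<^sup>2 \<le> (m * q h) * (norm (T h))\<^sup>2" by (simp add: mult_ac)
    then show ?thesis by (rule mult_right_le_imp_le) (use False in simp)
  qed (use m posdefD(4)[OF T(1)] in \<open>simp add: q_cin\<close>)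
  have "\<exists>h\<in>U. m - 1 / real (Suc j) < q h" for j
    using less_cSUP_iff[OF _ bd, of "m - 1 / real (Suc j)"] h0 by (auto simp: m_def)
  then obtain x where x: "\<And>j. x j \<in> U" "\<And>j. m - 1 / real (Suc j) < q (x j)" by metis
  have xV: "x j \<in> V" "norm (x j) = 1" for j using x(1)[of j] by (auto simp: U_def)
  have bnd: "(norm (T (x j) - m *\<^sub>R x j))\<^sup>2 \<le> m * (1 / real (Suc j))" for j
  proof -
    have "(norm (T (x j) - m *\<^sub>R x j))\<^sup>2 = (norm (T (x j)))\<^sup>2 - 2 * m * q (x j) + m\<^sup>2 * (norm (x j))\<^sup>2"
      unfolding power2_norm_eq_inner q_def
      by (simp add: inner_diff_left inner_diff_right inner_commute[of "x j" "T (x j)"] power2_eq_square algebra_simps)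
    also have "\<dots> \<le> m * (m - q (x j))"
      using Tsq[OF xV(1)[of j]] xV(2)[of j] by (simp add: power2_eq_square algebra_simps)
    also have "\<dots> \<le> m * (1 / real (Suc j))"
      using x(2)[of j] m by (intro mult_left_mono) linarith+
    finally show ?thesis .
  qed
  have "(\<lambda>j. m * (1 / real (Suc j))) \<longlonglongrightarrow> m * 0"
    by (intro tendsto_intros LIMSEQ_Suc[OF lim_1_over_n])
  then have lim0: "(\<lambda>j. m * (1 / real (Suc j))) \<longlonglongrightarrow> 0" by simp
  have "(\<lambda>j. (norm (T (x j) - m *\<^sub>R x j))\<^sup>2) \<longlonglongrightarrow> 0"
  proof (rule Lim_null_comparison[OF always_eventually lim0])
    show "\<forall>j. norm ((norm (T (x j) - m *\<^sub>R x j))\<^sup>2) \<le> m * (1 / real (Suc j))"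
      unfolding real_norm_def abs_power2 using bnd by blast
  qed
  then have "(\<lambda>j. sqrt ((norm (T (x j) - m *\<^sub>R x j))\<^sup>2)) \<longlonglongrightarrow> sqrt 0"
    by (rule tendsto_real_sqrt)
  then have z: "(\<lambda>j. T (x j) - m *\<^sub>R x j) \<longlonglongrightarrow> 0"
    by (simp add: tendsto_norm_zero_iff)
  obtain r l where r: "strict_mono r" "(\<lambda>j. T (x (r j))) \<longlonglongrightarrow> l"
    using T(2)[unfolded cpt_def, rule_format, of x 1] xV(2) by auto
  have "(\<lambda>j. (1 / m) *\<^sub>R (T (x (r j)) - (T (x (r j)) - m *\<^sub>R x (r j)))) \<longlonglongrightarrow> (1 / m) *\<^sub>R (l - 0)"
    using LIMSEQ_subseq_LIMSEQ[OF z r(1)] r(2) by (intro tendsto_intros) (simp_all add: o_def)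
  then have lim: "(\<lambda>j. x (r j)) \<longlonglongrightarrow> (1 / m) *\<^sub>R l" using m by simp
  have "(\<lambda>j. T (x (r j))) \<longlonglongrightarrow> T ((1 / m) *\<^sub>R l)"
    by (rule bcl_tendsto[OF posdefD(1)[OF T(1)] lim])
  then have "T ((1 / m) *\<^sub>R l) = l" using r(2) LIMSEQ_unique by blast
  then have ev: "T ((1 / m) *\<^sub>R l) = m *\<^sub>R ((1 / m) *\<^sub>R l)" using m by simp
  have "(\<lambda>j. norm (x (r j))) \<longlonglongrightarrow> norm ((1 / m) *\<^sub>R l)" by (rule tendsto_norm[OF lim])
  moreover have "(\<lambda>j. norm (x (r j))) \<longlonglongrightarrow> 1" by (simp add: xV(2))
  ultimately have n: "norm ((1 / m) *\<^sub>R l) = 1" by (rule LIMSEQ_unique)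
  have "(1 / m) *\<^sub>R l \<in> V" using closed_sequentially[OF V(4) _ lim] xV(1) by blast
  from that[OF this n m ev] le show thesis by (simp add: q_cin)
qed

text \<open>Guarantees that the choice of eigenvectors below never runs out of room. Two solutions
  for p vectors with separated supports have a nonzero combination that is also orthogonal to the
  next vector; the lower end M of the support is there to separate them in the induction.\<close>

lemma orthogonal_nonzero:
  fixes \<phi> :: "nat \<Rightarrow> nat ell2"
  shows "\<exists>h N. h \<noteq> 0 \<and> (\<forall>j<p. cin h (\<phi> j) = 0) \<and> (\<forall>i<M. coef h i = 0) \<and> (\<forall>i\<ge>N. coef h i = 0)"
proof (induction p arbitrary: M)
  case 0
  have "bas M \<noteq> (0 :: nat ell2)" by (metis norm_bas norm_zero zero_neq_one)
  then show ?case by (intro exI[of _ "bas M"] exI[of _ "Suc M"]) auto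
next
  case (Suc p)
  obtain h N where h: "h \<noteq> 0" "\<forall>j<p. cin h (\<phi> j) = 0" "\<forall>i<M. coef h i = 0" "\<forall>i\<ge>N. coef h i = 0"
    using Suc[of M] by blast
  obtain g L where g: "g \<noteq> 0" "\<forall>j<p. cin g (\<phi> j) = 0" "\<forall>i<max M N. coef g i = 0" "\<forall>i\<ge>L. coef g i = 0"
    using Suc[of "max M N"] by blast
  show ?case
  proof (cases "cin h (\<phi> p) = 0")
    case True
    then show ?thesis using h by (metis less_Suc_eq)
  next
    case False
    define k where "k = cmul (cin h (\<phi> p)) g - cmul (cin g (\<phi> p)) h"
    obtain i where i: "coef g i \<noteq> 0" using g(1) ell2_eqI[of g 0] by auto
    then have "i \<ge> N" using g(3) by (meson leI max_less_iff_conj less_max_iff_disj)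
    then have "coef k i \<noteq> 0" using i h(4) False by (simp add: k_def)
    then have "k \<noteq> 0" by auto
    moreover have "\<forall>j<Suc p. cin k (\<phi> j) = 0"
      using h(2) g(2) by (auto simp: k_def cin_diff_left less_Suc_eq)
    moreover have "\<forall>i<M. coef k i = 0" using h(3) g(3) by (simp add: k_def)
    moreover have "\<forall>i\<ge>max N L. coef k i = 0" using h(4) g(4) by (simp add: k_def)
    ultimately show ?thesis by blast
  qed
qed

text \<open>Each eigenpair maximizes the form on the complement of the earlier ones. This
  maximality, kept in the invariant \<open>P\<close>, yields completeness: a vector f orthogonal to
  all of them satisfies <T f, f> \<le> \<mu> p |f|^2 for every p, and the \<mu> p become arbitrarily
  small.\<close>

theorem spectral_theorem:
  fixes T :: "nat ell2 \<Rightarrow> nat ell2"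
  assumes T: "posdef T" "cpt T"
  obtains \<phi> :: "nat \<Rightarrow> nat ell2" and \<mu> :: "nat \<Rightarrow> real" where "\<And>p. \<mu> p > 0" "\<And>p. T (\<phi> p) = \<mu> p *\<^sub>R \<phi> p"
    "\<And>p q. cin (\<phi> p) (\<phi> q) = (if p = q then 1 else 0)"
    "\<And>f. (\<And>p. cin f (\<phi> p) = 0) \<Longrightarrow> f = 0"
proof -
  define P where "P F n z \<longleftrightarrow> snd z > 0 \<and> norm (fst z) = 1 \<and> T (fst z) = snd z *\<^sub>R fst z \<and>
      (\<forall>j<n. cin (fst z) (fst (F j)) = 0) \<and>
      (\<forall>h. (\<forall>j<n. cin h (fst (F j)) = 0) \<longrightarrow> Re (cin (T h) h) \<le> snd z * (norm h)\<^sup>2)"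
    for F :: "nat \<Rightarrow> nat ell2 \<times> real" and n :: nat and z
  have "\<exists>F. \<forall>n. P F n (F n)"
  proof (rule dependent_wellorder_choice)
    show "P F n z = P G n z" if "\<And>y. y < n \<Longrightarrow> F y = G y" for z F G n
      using that unfolding P_def by simp
    fix n F assume IH: "\<And>y. y < n \<Longrightarrow> P F y (F y)"
    define V where "V = {h. \<forall>j<n. cin h (fst (F j)) = 0}"
    obtain h0 where h0: "h0 \<noteq> 0" "h0 \<in> V"
      using orthogonal_nonzero[of n "\<lambda>j. fst (F j)" 0] by (auto simp: V_def)
    have TV: "T h \<in> V" if "h \<in> V" for h
    proof -
      have "cin (T h) (fst (F j)) = 0" if "j < n" for j
      proof -
        have "cin (T h) (fst (F j)) = cin h (T (fst (F j)))" by (rule posdefD(2)[OF T(1)])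
        also have "T (fst (F j)) = cmul (of_real (snd (F j))) (fst (F j))"
          using IH[OF that] by (simp add: P_def scaleR_cmul)
        finally show ?thesis using \<open>h \<in> V\<close> that by (simp add: V_def)
      qed
      then show ?thesis by (simp add: V_def)
    qed
    have "V = (\<Inter>j\<in>{..<n}. {h. cin h (fst (F j)) = 0})" by (auto simp: V_def)
    moreover have "closed {h. cin h g = 0}" for g :: "nat ell2"
      by (intro closed_Collect_eq continuous_on_const linear_continuous_on bounded_linear_cin_left)
    ultimately have clV: "closed V" by (metis closed_INT)
    have addV: "f + g \<in> V" if "f \<in> V" "g \<in> V" for f g
      using that by (simp add: V_def cin_add_left)
    have cmulV: "cmul c f \<in> V" if "f \<in> V" for c f
      using that by (simp add: V_def)
    have "\<exists>f \<mu>. f \<in> V \<and> norm f = 1 \<and> \<mu> > 0 \<and> T f = \<mu> *\<^sub>R f \<and> (\<forall>h\<in>V. Re (cin (T h) h) \<le> \<mu> * (norm h)\<^sup>2)"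
      by (rule top_eigenvector[of T V h0]) (use T addV cmulV TV clV h0 in blast)+
    then obtain f \<mu> where "f \<in> V" "norm f = 1" "\<mu> > 0" "T f = \<mu> *\<^sub>R f"
      "\<forall>h\<in>V. Re (cin (T h) h) \<le> \<mu> * (norm h)\<^sup>2" by blast
    then have "P F n (f, \<mu>)" by (simp add: P_def V_def)
    then show "\<exists>z. P F n z" by blast
  qed
  then obtain F where F: "\<And>n. P F n (F n)" by blast
  define \<phi> where "\<phi> p = fst (F p)" for p
  define \<mu> where "\<mu> p = snd (F p)" for p
  have pos: "\<mu> p > 0" and ev: "T (\<phi> p) = \<mu> p *\<^sub>R \<phi> p" and n1: "norm (\<phi> p) = 1"
    and orth: "\<And>j. j < p \<Longrightarrow> cin (\<phi> p) (\<phi> j) = 0"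
    and max: "\<And>h. (\<And>j. j < p \<Longrightarrow> cin h (\<phi> j) = 0) \<Longrightarrow> Re (cin (T h) h) \<le> \<mu> p * (norm h)\<^sup>2" for p
    using F[of p] by (auto simp: P_def \<phi>_def \<mu>_def)
  have ortho: "cin (\<phi> p) (\<phi> q) = (if p = q then 1 else 0)" for p q
  proof (cases p q rule: linorder_cases)
    case less
    then show ?thesis using orth[OF less] cin_commute[of "\<phi> p" "\<phi> q"] by simp
  next
    case equal
    then show ?thesis by (simp add: cin_self_norm n1)
  next
    case greater
    then show ?thesis using orth by simp
  qed
  \<comment> \<open>If all eigenvalues were at least e, orthonormality would keep the vectors T
    (\<phi> p) at distance at least e from each other, so no subsequence could converge.\<close>
  have small: "\<exists>p. \<mu> p < e" if e: "e > 0" for e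
  proof (rule ccontr)
    assume "\<not> ?thesis"
    then have ge: "\<mu> p \<ge> e" for p by (meson leI)
    obtain r l where r: "strict_mono r" "(\<lambda>j. T (\<phi> (r j))) \<longlonglongrightarrow> l"
      using T(2)[unfolded cpt_def, rule_format, of \<phi> 1] n1 by auto
    obtain M where M: "\<And>i j. i \<ge> M \<Longrightarrow> j \<ge> M \<Longrightarrow> norm (T (\<phi> (r i)) - T (\<phi> (r j))) < e"
      using CauchyD[OF LIMSEQ_imp_Cauchy[OF r(2)] e] by auto
    define a b where "a = r M" and "b = r (Suc M)"
    have ab: "a \<noteq> b" using strict_mono_less[OF r(1), of M "Suc M"] by (simp add: a_def b_def)
    have "cmul (\<mu> a) (\<phi> a) - cmul (\<mu> b) (\<phi> b) = T (\<phi> a) - T (\<phi> b)"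
      by (simp add: ev scaleR_cmul)
    then have "norm (cmul (\<mu> a) (\<phi> a) - cmul (\<mu> b) (\<phi> b)) < e"
      using M[of M "Suc M"] by (simp add: a_def b_def)
    moreover have "cin (cmul (\<mu> a) (\<phi> a) - cmul (\<mu> b) (\<phi> b)) (\<phi> a) = \<mu> a"
      using ab by (simp add: cin_diff_left ortho)
    ultimately show False
      using cin_le[of "cmul (\<mu> a) (\<phi> a) - cmul (\<mu> b) (\<phi> b)" "\<phi> a"] ge[of a] e n1[of a] pos[of a] by simp
  qed
  have comp: "f = 0" if f: "\<And>p. cin f (\<phi> p) = 0" for f
  proof (rule ccontr)
    assume f0: "f \<noteq> 0"
    define e where "e = Re (cin (T f) f) / (norm f)\<^sup>2"
    have "e > 0" using posdefD(3)[OF T(1) f0] f0 by (simp add: e_def)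
    then obtain p where "\<mu> p < e" using small by blast
    then have "\<mu> p * (norm f)\<^sup>2 < Re (cin (T f) f)" using f0 by (simp add: e_def field_simps)
    then show False using max[of p f] f by simp
  qed
  show thesis
  proof (rule that[of \<mu> \<phi>])
    show "f = 0" if "\<And>p. cin f (\<phi> p) = 0" for f using that by (rule comp)
  qed (fact pos ev ortho)+
qed

section \<open>Functions of an operator with an orthonormal eigenbasis\<close>

locale onb =
  fixes \<phi> :: "nat \<Rightarrow> 'a ell2"
  assumes ortho: "cin (\<phi> p) (\<phi> q) = (if p = q then 1 else 0)"
    and complete: "(\<And>p. cin f (\<phi> p) = 0) \<Longrightarrow> f = 0"
begin

text \<open>Analysis and synthesis: \<open>ana\<close> takes a vector to its coordinates in the
  basis \<phi>, and \<open>syn\<close> inverts it as the limit of the partial sums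
  \<open>part\<close>.\<close>

definition ana :: "'a ell2 \<Rightarrow> nat ell2" where "ana f = Abs_ell2 (\<lambda>p. cin f (\<phi> p))"

definition part :: "nat ell2 \<Rightarrow> nat set \<Rightarrow> 'a ell2" where "part a A = (\<Sum>p\<in>A. cmul (coef a p) (\<phi> p))"

definition syn :: "nat ell2 \<Rightarrow> 'a ell2" where "syn a = lim (\<lambda>n. part a {..<n})"

lemma cin_sum_left: "cin (\<Sum>p\<in>A. f p) g = (\<Sum>p\<in>A. cin (f p) g)"
  by (induction A rule: infinite_finite_induct) (auto simp: cin_add_left)

lemma cin_part: "finite A \<Longrightarrow> cin (part a A) (\<phi> q) = (if q \<in> A then coef a q else 0)"
  by (simp add: part_def cin_sum_left ortho if_distrib[of "\<lambda>x. _ * x"] cong: if_cong)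

lemma norm_part:
  assumes "finite A" shows "(norm (part a A))\<^sup>2 = (\<Sum>p\<in>A. (cmod (coef a p))\<^sup>2)"
proof -
  have "cin (part a A) (part a A) = (\<Sum>p\<in>A. coef a p * cnj (cin (part a A) (\<phi> p)))"
    by (subst part_def) (simp add: cin_sum_left, subst cin_commute, rule refl)
  also have "\<dots> = (\<Sum>p\<in>A. of_real ((cmod (coef a p))\<^sup>2))"
    by (rule sum.cong) (auto simp: cin_part[OF assms] complex_norm_square simp del: of_real_power)
  finally have "complex_of_real ((norm (part a A))\<^sup>2) = of_real (\<Sum>p\<in>A. (cmod (coef a p))\<^sup>2)"
    by (simp only: cin_self_norm of_real_sum)
  then show ?thesis by (simp only: of_real_eq_iff)
qed

lemma coef_ana: "coef (ana f) p = cin f (\<phi> p)"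
proof -
  have "(\<Sum>p\<in>A. (cmod (cin f (\<phi> p)))\<^sup>2) \<le> (norm f)\<^sup>2" if A: "finite A" for A
  proof -
    define g where "g = (\<Sum>p\<in>A. cmul (cin f (\<phi> p)) (\<phi> p))"
    have gf: "cin g f = of_real (\<Sum>p\<in>A. (cmod (cin f (\<phi> p)))\<^sup>2)"
      unfolding g_def cin_sum_left of_real_sum
      by (rule sum.cong) (simp_all add: cin_commute[of "\<phi> _" f] complex_norm_square del: of_real_power)
    have "cin g (\<phi> q) = (if q \<in> A then cin f (\<phi> q) else 0)" for q
      using A by (simp add: g_def cin_sum_left ortho if_distrib[of "\<lambda>x. _ * x"] cong: if_cong)
    then have "cin g g = (\<Sum>p\<in>A. cin f (\<phi> p) * cnj (cin f (\<phi> p)))"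
      by (subst g_def) (simp add: cin_sum_left cin_commute[of "\<phi> _" g])
    then have gg: "cin g g = cin g f"
      by (simp only: gf of_real_sum complex_norm_square)
    have "(norm (f - g))\<^sup>2 = (norm f)\<^sup>2 - (\<Sum>p\<in>A. (cmod (cin f (\<phi> p)))\<^sup>2)"
    proof -
      have "cin (f - g) (f - g) = cin f f - cnj (cin g f)"
        using gg by (simp add: cin_diff_left cin_diff_right cin_commute[of f g])
      then have "complex_of_real ((norm (f - g))\<^sup>2) = of_real ((norm f)\<^sup>2 - (\<Sum>p\<in>A. (cmod (cin f (\<phi> p)))\<^sup>2))"
        by (simp add: cin_self_norm gf)
      then show ?thesis by (simp only: of_real_eq_iff)
    qed
    then show ?thesis by (metis diff_ge_0_iff_ge zero_le_power2)
  qed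
  then have "bdd_above (sum (\<lambda>p. (cmod (cin f (\<phi> p)))\<^sup>2) ` {F. F \<subseteq> UNIV \<and> finite F})"
    by (intro bdd_aboveI[of _ "(norm f)\<^sup>2"]) auto
  then have "(\<lambda>p. (cmod (cin f (\<phi> p)))\<^sup>2) summable_on UNIV"
    by (intro nonneg_bdd_above_summable_on) auto
  then show ?thesis by (simp add: ana_def coef_Abs_ell2)
qed

lemma part_tendsto: "(\<lambda>n. part a {..<n}) \<longlonglongrightarrow> syn a"
proof -
  have "Cauchy (\<lambda>n. part a {..<n})"
  proof (rule metric_CauchyI)
    fix e :: real assume e: "e > 0"
    then have "(e / 2)\<^sup>2 > 0" by simp
    then obtain F where F: "finite F" "\<And>A. A \<inter> F = {} \<Longrightarrow> (\<Sum>\<^sub>\<infinity>i\<in>A. (cmod (coef a i))\<^sup>2) \<le> (e / 2)\<^sup>2"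
      using tail_small by blast
    obtain M where M: "F \<subseteq> {..<M}" using finite_nat_iff_bounded F(1) by blast
    have *: "dist (part a {..<m}) (part a {..<n}) < e" if "M \<le> m" "m \<le> n" for m n
    proof -
      have "{..<n} = {..<m} \<union> {m..<n}" using that by auto
      then have "part a {..<n} = part a ({..<m} \<union> {m..<n})" by (rule arg_cong)
      also have "\<dots> = part a {..<m} + part a {m..<n}"
        unfolding part_def by (rule sum.union_disjoint) auto
      finally have "part a {..<n} = part a {..<m} + part a {m..<n}" .
      then have "dist (part a {..<m}) (part a {..<n}) = norm (part a {m..<n})"
        by (simp add: dist_norm)
      also have "\<dots> \<le> e / 2"
      proof (rule power2_le_imp_le)
        have "(\<Sum>\<^sub>\<infinity>i\<in>{m..<n}. (cmod (coef a i))\<^sup>2) \<le> (e / 2)\<^sup>2"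
          by (rule F(2)) (use M that in auto)
        then show "(norm (part a {m..<n}))\<^sup>2 \<le> (e / 2)\<^sup>2" by (simp add: norm_part)
      qed (use e in simp)
      finally show ?thesis using e by simp
    qed
    show "\<exists>M. \<forall>m\<ge>M. \<forall>n\<ge>M. dist (part a {..<m}) (part a {..<n}) < e"
      by (rule exI[of _ M]) (metis * dist_commute nat_le_linear)
  qed
  then show ?thesis unfolding syn_def by (simp add: Cauchy_convergent_iff convergent_LIMSEQ_iff)
qed

lemma cin_syn: "cin (syn a) (\<phi> q) = coef a q"
proof (rule LIMSEQ_unique)
  show "(\<lambda>n. cin (part a {..<n}) (\<phi> q)) \<longlonglongrightarrow> cin (syn a) (\<phi> q)"
    by (intro tendsto_intros part_tendsto)
  show "(\<lambda>n. cin (part a {..<n}) (\<phi> q)) \<longlonglongrightarrow> coef a q"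
    by (rule tendsto_eventually, rule eventually_sequentiallyI[of "Suc q"]) (simp add: cin_part)
qed

lemma ana_syn [simp]: "ana (syn a) = a"
  by (rule ell2_eqI) (simp add: coef_ana cin_syn)

lemma ana_inj: assumes "ana f = ana g" shows "f = g"
proof -
  have "cin f (\<phi> p) = cin g (\<phi> p)" for p
    using assms by (metis coef_ana)
  then show ?thesis using complete[of "f - g"] by (simp add: cin_diff_left)
qed

lemma syn_ana [simp]: "syn (ana f) = f"
  by (rule ana_inj) simp

lemma ana_add: "ana (f + g) = ana f + ana g"
  and ana_cmul: "ana (cmul c f) = cmul c (ana f)"
  by (rule ell2_eqI; simp add: coef_ana cin_add_left)+

lemma cin_syn_left: "cin (syn a) g = cin a (ana g)"
proof (rule LIMSEQ_unique)
  show "(\<lambda>n. cin (part a {..<n}) g) \<longlonglongrightarrow> cin (syn a) g"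
    by (intro tendsto_intros part_tendsto)
  have "((\<lambda>p. coef a p * cnj (coef (ana g) p)) has_sum cin a (ana g)) UNIV"
    unfolding cin_def by (rule has_sum_infsum[OF cin_summable])
  then have "(\<lambda>n. \<Sum>p<n. coef a p * cnj (coef (ana g) p)) \<longlonglongrightarrow> cin a (ana g)"
    using has_sum_imp_sums by (auto simp: sums_def)
  moreover have "(\<Sum>p<n. coef a p * cnj (coef (ana g) p)) = cin (part a {..<n}) g" for n
    by (simp add: part_def cin_sum_left coef_ana flip: cin_commute)
  ultimately show "(\<lambda>n. cin (part a {..<n}) g) \<longlonglongrightarrow> cin a (ana g)" by simp
qed

lemma cin_ana: "cin (ana f) (ana g) = cin f g"
  using cin_syn_left[of "ana f" g] by simp

lemma norm_ana [simp]: "norm (ana f) = norm f"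
proof -
  have "(norm (ana f))\<^sup>2 = (norm f)\<^sup>2"
    using cin_ana[of f f] by (simp only: cin_self_norm of_real_eq_iff)
  then show ?thesis by (simp add: power2_eq_iff_nonneg)
qed

definition fn :: "(nat \<Rightarrow> complex) \<Rightarrow> 'a ell2 \<Rightarrow> 'a ell2" where
  "fn \<theta> f = syn (dmul \<theta> (ana f))"

lemma ana_fn: "ana (fn \<theta> f) = dmul \<theta> (ana f)"
  by (simp add: fn_def)

lemma cin_fn: "(\<And>p. cmod (\<theta> p) \<le> C) \<Longrightarrow> cin (fn \<theta> f) (\<phi> p) = \<theta> p * cin f (\<phi> p)"
  by (simp add: ana_fn coef_dmul[of \<theta> C] flip: coef_ana)

lemma bcl_fn:
  assumes "\<And>p. cmod (\<theta> p) \<le> C" shows "bcl (fn \<theta>)"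
proof (rule bclI[where K = C])
  note b = bclD[OF bcl_dmul[of \<theta>, OF assms]]
  show "fn \<theta> (f + g) = fn \<theta> f + fn \<theta> g" for f g
    by (rule ana_inj) (simp add: ana_fn ana_add b)
  show "fn \<theta> (cmul c f) = cmul c (fn \<theta> f)" for c f
    by (rule ana_inj) (simp add: ana_fn ana_cmul b)
  show "norm (fn \<theta> f) \<le> C * norm f" for f
    using norm_dmul[of \<theta>, OF assms, of "ana f"] by (simp flip: norm_ana add: ana_fn)
qed

lemma norm_fn: "(\<And>p. cmod (\<theta> p) \<le> C) \<Longrightarrow> norm (fn \<theta> f) \<le> C * norm f"
  using norm_dmul[of \<theta> C "ana f"] norm_ana[of "fn \<theta> f"] by (simp add: ana_fn del: norm_ana) simp

lemma fn_fn:
  assumes "\<And>p. cmod (\<theta> p) \<le> C" "\<And>p. cmod (\<eta> p) \<le> D"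
  shows "fn \<theta> (fn \<eta> f) = fn (\<lambda>p. \<theta> p * \<eta> p) f"
proof -
  have b: "cmod (\<theta> p * \<eta> p) \<le> C * D" for p
    unfolding norm_mult using order_trans[OF norm_ge_zero assms(1)] by (intro mult_mono assms) auto
  then show ?thesis
    by (intro ana_inj ell2_eqI) (simp add: coef_ana cin_fn[OF assms(1)] cin_fn[OF assms(2)] cin_fn[OF b] mult.assoc)
qed

lemma fn_cong_1: "(\<And>p. \<theta> p = 1) \<Longrightarrow> fn \<theta> f = f"
  by (intro ana_inj ell2_eqI) (simp add: coef_ana cin_fn[of \<theta> 1])

lemma fn_adjoint:
  assumes "\<And>p. cmod (\<theta> p) \<le> C"
  shows "cin (fn \<theta> f) g = cin f (fn (\<lambda>p. cnj (\<theta> p)) g)"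
proof -
  have "cin (fn \<theta> f) g = cin (dmul \<theta> (ana f)) (ana g)"
    by (simp add: fn_def cin_syn_left)
  also have "\<dots> = cin (ana f) (dmul (\<lambda>p. cnj (\<theta> p)) (ana g))"
    unfolding cin_def using assms by (simp add: coef_dmul[of _ C] mult_ac)
  also have "\<dots> = cin f (fn (\<lambda>p. cnj (\<theta> p)) g)"
    by (simp flip: cin_ana add: ana_fn)
  finally show ?thesis .
qed

text \<open>Bounded symbols need to converge only pointwise. This is convergence in the product
  topology, the one in which an infinite torus is compact, and it yields strong convergence of the
  operators.\<close>

lemma fn_tendsto:
  assumes "\<And>p. ((\<lambda>x. \<theta> x p) \<longlongrightarrow> \<eta> p) F" "\<And>x p. cmod (\<theta> x p) \<le> C" "\<And>p. cmod (\<eta> p) \<le> C"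
    "(f \<longlongrightarrow> g) F"
  shows "((\<lambda>x. fn (\<theta> x) (f x)) \<longlongrightarrow> fn \<eta> g) F"
proof -
  have "((\<lambda>x. dmul (\<theta> x) (ana g)) \<longlongrightarrow> dmul \<eta> (ana g)) F"
  proof (rule tendsto_ell2_dominated[where C = C and h = "ana g"])
    show "((\<lambda>x. coef (dmul (\<theta> x) (ana g)) i) \<longlongrightarrow> coef (dmul \<eta> (ana g)) i) F" for i
      by (simp add: coef_dmul[OF assms(2)] coef_dmul[OF assms(3)] tendsto_intros assms(1))
    show "\<forall>\<^sub>F x in F. \<forall>i. cmod (coef (dmul (\<theta> x) (ana g)) i) \<le> C * cmod (coef (ana g) i)"
      by (intro always_eventually allI) (simp add: coef_dmul[OF assms(2)] norm_mult mult_right_mono assms(2))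
  qed
  then have "((\<lambda>x. norm (dmul (\<theta> x) (ana g) - dmul \<eta> (ana g))) \<longlongrightarrow> 0) F"
    by (simp add: tendsto_norm_zero_iff LIM_zero_iff)
  moreover have "norm (dmul (\<theta> x) (ana g) - dmul \<eta> (ana g)) = norm (fn (\<theta> x) g - fn \<eta> g)" for x
  proof -
    have "ana (fn (\<theta> x) g - fn \<eta> g) = dmul (\<theta> x) (ana g) - dmul \<eta> (ana g)"
      using ana_add[of "fn (\<theta> x) g - fn \<eta> g" "fn \<eta> g"] by (simp add: ana_fn)
    then show ?thesis by (metis norm_ana)
  qed
  ultimately have 1: "((\<lambda>x. fn (\<theta> x) g - fn \<eta> g) \<longlongrightarrow> 0) F"
    by (simp add: tendsto_norm_zero_iff)
  have "((\<lambda>x. C * norm (f x - g)) \<longlongrightarrow> C * norm (g - g)) F"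
    by (intro tendsto_intros assms)
  then have "((\<lambda>x. C * norm (f x - g)) \<longlongrightarrow> 0) F" by simp
  then have 2: "((\<lambda>x. fn (\<theta> x) (f x - g)) \<longlongrightarrow> 0) F"
    by (rule Lim_null_comparison[OF always_eventually, rotated]) (use norm_fn[OF assms(2)] in auto)
  have "((\<lambda>x. fn (\<theta> x) (f x - g) + (fn (\<theta> x) g - fn \<eta> g) + fn \<eta> g) \<longlongrightarrow> 0 + 0 + fn \<eta> g) F"
    by (intro tendsto_add 1 2 tendsto_const)
  then show ?thesis using bclD(3)[OF bcl_fn[OF assms(2)]] by simp
qed

end

section \<open>The Lax operator\<close>

definition herm :: "(int \<Rightarrow> complex) \<Rightarrow> bool" where
  "herm a \<longleftrightarrow> (\<forall>n. a (- n) = cnj (a n))"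

definition gd :: "real \<Rightarrow> nat \<Rightarrow> complex" where
  "gd \<kappa> n = of_real (1 / sqrt (real n + \<kappa>))"

definition qmat :: "(int \<Rightarrow> complex) \<Rightarrow> real \<Rightarrow> nat \<Rightarrow> nat \<Rightarrow> complex" where
  "qmat a \<kappa> n m = gd \<kappa> n * a (int n - int m) * gd \<kappa> m"

definition good :: "(int \<Rightarrow> complex) \<Rightarrow> real \<Rightarrow> bool" where
  "good a \<kappa> \<longleftrightarrow> herm a \<and> 1 \<le> \<kappa> \<and> small (qmat a \<kappa>)"

text \<open>
  The resolvent of the Lax operator \<open>L = D - T\<close> with \<open>D = diag n\<close> and \<open>T\<close> the Toeplitz operator of \<open>a\<close>:
  since \<open>L + \<kappa> = G\<^sup>-\<^sup>1 (1 - Q) G\<^sup>-\<^sup>1\<close> with \<open>G = (D + \<kappa>)\<^sup>-\<^sup>1\<^sup>/\<^sup>2\<close> and \<open>Q = G T G\<close>,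
  it makes sense as soon as \<open>Q\<close> is a small Hilbert-Schmidt matrix.
\<close>

definition Rs :: "(int \<Rightarrow> complex) \<Rightarrow> real \<Rightarrow> nat ell2 \<Rightarrow> nat ell2" where
  "Rs a \<kappa> f = dmul (gd \<kappa>) (neu (qmat a \<kappa>) (dmul (gd \<kappa>) f))"

lemma goodD:
  assumes "good a \<kappa>"
  shows "herm a" "1 \<le> \<kappa>" "small (qmat a \<kappa>)" "hsm (qmat a \<kappa>)" "hs (qmat a \<kappa>) \<le> 1 / 9"
  using assms by (auto simp: good_def small_def)

lemma cmod_gd: "1 \<le> \<kappa> \<Longrightarrow> cmod (gd \<kappa> n) = 1 / sqrt (real n + \<kappa>)"
  by (simp add: gd_def norm_divide)

lemma gd_le1: "1 \<le> \<kappa> \<Longrightarrow> cmod (gd \<kappa> n) \<le> 1"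
  by (simp add: cmod_gd)

lemma gd_le: "1 \<le> \<kappa> \<Longrightarrow> cmod (gd \<kappa> n) \<le> 1 / sqrt \<kappa>"
  by (simp add: cmod_gd frac_le)

lemma gd_nz: "1 \<le> \<kappa> \<Longrightarrow> gd \<kappa> n \<noteq> 0"
  by (simp add: gd_def add_nonneg_eq_0_iff)

lemma gd_sq: "1 \<le> \<kappa> \<Longrightarrow> gd \<kappa> n * gd \<kappa> n = 1 / of_real (real n + \<kappa>)"
  unfolding gd_def of_real_mult[symmetric] by (simp add: real_sqrt_mult_self)

lemma cnj_gd [simp]: "cnj (gd \<kappa> n) = gd \<kappa> n"
  by (simp add: gd_def)

lemma coef_G: "1 \<le> \<kappa> \<Longrightarrow> coef (dmul (gd \<kappa>) f) n = gd \<kappa> n * coef f n"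
  by (rule coef_dmul[where C = 1]) (rule gd_le1)

lemma bcl_G: "1 \<le> \<kappa> \<Longrightarrow> bcl (dmul (gd \<kappa>))"
  by (rule bcl_dmul[where C = 1]) (rule gd_le1)

lemma G_adjoint: "1 \<le> \<kappa> \<Longrightarrow> cin (dmul (gd \<kappa>) f) g = cin f (dmul (gd \<kappa>) g)"
  by (simp add: cin_def coef_G mult_ac)

lemma G_inj: "1 \<le> \<kappa> \<Longrightarrow> dmul (gd \<kappa>) f = 0 \<Longrightarrow> f = 0"
  by (rule ell2_eqI) (metis coef_G coef_simps(1) gd_nz mult_eq_0_iff)

lemma norm_G: "1 \<le> \<kappa> \<Longrightarrow> norm (dmul (gd \<kappa>) f) \<le> norm f"
  using norm_dmul[of "gd \<kappa>" 1 f] by (simp add: gd_le1)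

lemma norm_G_sq: "1 \<le> \<kappa> \<Longrightarrow> (norm (dmul (gd \<kappa>) f))\<^sup>2 = (\<Sum>\<^sub>\<infinity>n. (cmod (coef f n))\<^sup>2 / (real n + \<kappa>))"
  by (simp add: norm_sq_infsum coef_G norm_mult cmod_gd power_mult_distrib power_divide)

lemma cpt_G:
  assumes "1 \<le> \<kappa>" shows "cpt (dmul (gd \<kappa>))"
proof (rule cpt_dmul[where C = 1])
  fix e :: real assume e: "e > 0"
  obtain N where N: "real N > 1 / e\<^sup>2" using reals_Archimedean2 by blast
  have "n < N" if "cmod (gd \<kappa> n) > e" for n
  proof -
    have "e < 1 / sqrt (real n + \<kappa>)" using that by (simp add: cmod_gd assms)
    then have "e\<^sup>2 < (1 / sqrt (real n + \<kappa>))\<^sup>2" using e by (intro power_strict_mono) auto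
    then have "e\<^sup>2 < 1 / (real n + \<kappa>)" using assms by (simp add: power_divide)
    then have "real n + \<kappa> < 1 / e\<^sup>2" using assms e by (simp add: field_simps)
    then show ?thesis using N assms by simp
  qed
  then show "finite {n. cmod (gd \<kappa> n) > e}" by (auto intro: finite_subset[of _ "{..<N}"])
qed (rule gd_le1[OF assms])

lemma qmat_herm: "herm a \<Longrightarrow> qmat a \<kappa> n m = cnj (qmat a \<kappa> m n)"
  using minus_diff_eq[of "int m" "int n"] unfolding herm_def qmat_def
  by (metis (no_types, lifting) cnj_gd complex_cnj_mult mult.assoc mult.commute)

lemma bcl_Rs: "good a \<kappa> \<Longrightarrow> bcl (Rs a \<kappa>)"
  unfolding Rs_def[abs_def]
  by (rule bcl_comp[OF bcl_G bcl_comp[OF bcl_neu bcl_G]]) (erule goodD)+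

lemma Rs_adjoint: "good a \<kappa> \<Longrightarrow> cin (Rs a \<kappa> f) g = cin f (Rs a \<kappa> g)"
  unfolding Rs_def
  by (simp only: G_adjoint[OF goodD(2)] neu_adjoint[OF goodD(3) qmat_herm[OF goodD(1)]])

lemma cin_Rs: "good a \<kappa> \<Longrightarrow> cin (Rs a \<kappa> f) f = cin (neu (qmat a \<kappa>) (dmul (gd \<kappa>) f)) (dmul (gd \<kappa>) f)"
  unfolding Rs_def by (rule G_adjoint[OF goodD(2)])

text \<open>As the resolvent is G (1 - Q)^(-1) G, its form is comparable to that of (D +
  \<kappa>)^(-1), with constants independent of a and \<kappa>. This turns a conserved resolvent
  form into a bound on the solution.\<close>

lemma Rs_form:
  assumes "good a \<kappa>"
  shows "3 / 8 * (norm (dmul (gd \<kappa>) f))\<^sup>2 \<le> Re (cin (Rs a \<kappa> f) f)"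
    "cmod (cin (Rs a \<kappa> f) f) \<le> 3 / 2 * (norm (dmul (gd \<kappa>) f))\<^sup>2"
  unfolding cin_Rs[OF assms] using neu_form_bounds[OF goodD(3)[OF assms]] by auto

lemma norm_Rs:
  assumes "good a \<kappa>" shows "norm (Rs a \<kappa> f) \<le> 3 / 2 / \<kappa> * norm f"
proof -
  note g = goodD[OF assms]
  have G: "norm (dmul (gd \<kappa>) h) \<le> 1 / sqrt \<kappa> * norm h" for h
    by (rule norm_dmul) (rule gd_le[OF g(2)])
  have "norm (Rs a \<kappa> f) \<le> 1 / sqrt \<kappa> * (3 / 2 * (1 / sqrt \<kappa> * norm f))"
    unfolding Rs_def using g(2)
    by (intro order_trans[OF G] mult_left_mono order_trans[OF norm_neu(1)[OF g(3)]] G) auto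
  also have "\<dots> = 3 / 2 / \<kappa> * norm f"
    using g(2) by (simp add: field_simps)
  finally show ?thesis .
qed

lemma posdef_Rs:
  assumes "good a \<kappa>" shows "posdef (Rs a \<kappa>)"
  unfolding posdef_def
proof (intro conjI allI impI)
  fix f :: "nat ell2" assume "f \<noteq> 0"
  then have "dmul (gd \<kappa>) f \<noteq> 0" using G_inj goodD(2)[OF assms] by blast
  then have "0 < 3 / 8 * (norm (dmul (gd \<kappa>) f))\<^sup>2" by simp
  then show "0 < Re (cin (Rs a \<kappa> f) f)" using Rs_form(1)[OF assms, of f] by linarith
qed (rule bcl_Rs[OF assms] Rs_adjoint[OF assms])+

lemma cpt_Rs:
  assumes "good a \<kappa>" shows "cpt (Rs a \<kappa>)"
  unfolding Rs_def[abs_def]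
proof (rule cpt_comp_right[where U = "\<lambda>f. neu (qmat a \<kappa>) (dmul (gd \<kappa>) f)" and K = "3 / 2"])
  note g = goodD[OF assms]
  show "norm (neu (qmat a \<kappa>) (dmul (gd \<kappa>) f)) \<le> 3 / 2 * norm f" for f
    using order_trans[OF norm_neu(1)[OF g(3)] mult_left_mono[OF norm_G[OF g(2)]]] by simp
qed (use cpt_G goodD(2)[OF assms] in auto)

lemma qmat_diff: "qmat (\<lambda>n. a n - b n) \<kappa> = (\<lambda>n m. qmat a \<kappa> n m - qmat b \<kappa> n m)"
  by (simp add: qmat_def fun_eq_iff algebra_simps)

lemma Rs_perturb:
  assumes "good a \<kappa>" "good b \<kappa>" "hsm (qmat (\<lambda>n. a n - b n) \<kappa>)" "hs (qmat (\<lambda>n. a n - b n) \<kappa>) \<le> c\<^sup>2" "0 \<le> c"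
  shows "norm (Rs a \<kappa> f - Rs b \<kappa> f) \<le> 9 / 4 * c * norm f"
proof -
  note k = goodD(2)[OF assms(1)]
  let ?g = "dmul (gd \<kappa>) f"
  have "Rs a \<kappa> f - Rs b \<kappa> f = dmul (gd \<kappa>) (neu (qmat a \<kappa>) ?g - neu (qmat b \<kappa>) ?g)"
    by (simp add: Rs_def bclD(3)[OF bcl_G[OF k]])
  also have "norm \<dots> \<le> norm (neu (qmat a \<kappa>) ?g - neu (qmat b \<kappa>) ?g)" by (rule norm_G[OF k])
  also have "\<dots> \<le> 9 / 4 * c * norm ?g"
    by (rule neu_perturb) (use assms goodD in \<open>auto simp: qmat_diff\<close>)
  also have "\<dots> \<le> 9 / 4 * c * norm f"
    using assms(5) by (intro mult_left_mono norm_G[OF k]) auto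
  finally show ?thesis .
qed

text \<open>The nonvanishing diagonal G cancels, leaving the matrix of (1 - Q)^(-1); this determines
  Q, whose entries are multiples of a (n - m), and every integer is such a difference.\<close>

lemma Rs_determines:
  assumes "good a \<kappa>" "good b \<kappa>" "\<And>m n. coef (Rs a \<kappa> (bas m)) n = coef (Rs b \<kappa> (bas m)) n"
  shows "a = b"
proof -
  note k = goodD(2)[OF assms(1)]
  have *: "dmul (gd \<kappa>) (bas m) = cmul (gd \<kappa> m) (bas m)" for m
    by (rule ell2_eqI) (simp add: coef_G k)
  have R: "Rs c \<kappa> (bas m) = cmul (gd \<kappa> m) (dmul (gd \<kappa>) (neu (qmat c \<kappa>) (bas m)))" if "good c \<kappa>" for c m
    by (simp add: Rs_def * neu_cmul goodD[OF that] bclD(4)[OF bcl_G[OF k]])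
  have neu_eq': "neu (qmat a \<kappa>) (bas m) = neu (qmat b \<kappa>) (bas m)" for m
  proof (rule ell2_eqI)
    fix n
    have "gd \<kappa> m * (gd \<kappa> n * coef (neu (qmat a \<kappa>) (bas m)) n) = gd \<kappa> m * (gd \<kappa> n * coef (neu (qmat b \<kappa>) (bas m)) n)"
      using assms(3)[of m n] by (simp add: R assms(1,2) coef_G k)
    then show "coef (neu (qmat a \<kappa>) (bas m)) n = coef (neu (qmat b \<kappa>) (bas m)) n"
      using gd_nz[OF k] by simp
  qed
  \<comment> \<open>Agreement on basis vectors passes to all f by symmetry: coordinate n of
    \<open>neu A f\<close> is the inner product of f with \<open>neu A (bas n)\<close>.\<close>
  have neu: "neu (qmat a \<kappa>) f = neu (qmat b \<kappa>) f" for f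
  proof (rule ell2_eqI)
    fix n
    have "cin f (neu (qmat a \<kappa>) (bas n)) = cin (neu (qmat a \<kappa>) f) (bas n)" if "good a \<kappa>" for a
      by (rule neu_adjoint[OF goodD(3)[OF that] qmat_herm[OF goodD(1)[OF that]], symmetric])
    from this[OF assms(1)] this[OF assms(2)]
    show "coef (neu (qmat a \<kappa>) f) n = coef (neu (qmat b \<kappa>) f) n" by (simp add: neu_eq')
  qed
  have mat: "matop (qmat a \<kappa>) f = matop (qmat b \<kappa>) f" for f
  proof -
    define h where "h = f - matop (qmat a \<kappa>) f"
    have "f = neu (qmat a \<kappa>) h"
      by (rule neu_unique[OF goodD(3)[OF assms(1)]]) (simp only: h_def diff_add_cancel)
    then have "f = h + matop (qmat b \<kappa>) f"
      using neu_eq[OF goodD(3)[OF assms(2)], of h] neu by metis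
    then show ?thesis unfolding h_def by (metis add.commute add_diff_cancel_left' diff_add_cancel)
  qed
  have ent: "qmat a \<kappa> n m = qmat b \<kappa> n m" for n m
  proof -
    have "coef (matop (qmat c \<kappa>) (bas m)) n = qmat c \<kappa> n m" if "good c \<kappa>" for c
      by (simp add: coef_matop goodD[OF that]) (subst infsum_single[of m]; simp)
    then show ?thesis using mat[of "bas m"] assms(1,2) by metis
  qed
  have diff: "a (int n - int m) = b (int n - int m)" for n m
    using ent[of n m] gd_nz[OF k] by (simp add: qmat_def)
  show ?thesis
  proof
    fix j :: int
    show "a j = b j"
      using diff[of "nat j" 0] diff[of 0 "nat (- j)"] by (cases "0 \<le> j") auto
  qed
qed

section \<open>Raising the spectral parameter; the unbounded operator as a relation\<close>

lemma hsm_mono: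
  assumes "hsm B" "\<And>n m. cmod (A n m) \<le> cmod (B n m)"
  shows "hsm A" "hs A \<le> hs B"
proof -
  have le: "(cmod (A n m))\<^sup>2 \<le> (cmod (B n m))\<^sup>2" for n m by (intro power_mono assms) auto
  show h: "hsm A" unfolding hsm_def
    by (rule summable_on_le[OF assms(1)[unfolded hsm_def]]) (use le in auto)
  show "hs A \<le> hs B" unfolding hs_def
    by (rule infsum_mono) (use h assms(1) le in \<open>auto simp: hsm_def\<close>)
qed

text \<open>A larger \<kappa> shrinks every entry of Q. One threshold thus serves all larger
  parameters: \<kappa>, \<kappa> + 1, \<kappa> + 2, ... in the proof of purity and
  \<open>2 ^ j * \<kappa>\<close> in the dyadic sums.\<close>

lemma good_mono:
  assumes "good a \<kappa>" "\<kappa> \<le> \<kappa>'" shows "good a \<kappa>'"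
proof -
  note g = goodD[OF assms(1)]
  have gd: "cmod (gd \<kappa>' n) \<le> cmod (gd \<kappa> n)" for n
    using g(2) assms(2) by (simp add: cmod_gd frac_le)
  have "cmod (qmat a \<kappa>' n m) \<le> cmod (qmat a \<kappa> n m)" for n m
    unfolding qmat_def norm_mult by (intro mult_mono gd) auto
  from hsm_mono[OF g(4) this] show ?thesis
    using g assms(2) by (auto simp: good_def small_def)
qed

text \<open>The form domain, H^(1/2) of the Hardy space. By \<open>hh_iff\<close> it is the range of
  G, the same for all parameters at least 1.\<close>

definition hh :: "nat ell2 \<Rightarrow> bool" where
  "hh f \<longleftrightarrow> (\<lambda>n. real (Suc n) * (cmod (coef f n))\<^sup>2) summable_on UNIV"

text \<open>\<open>Lr a f g\<close> says that \<open>f\<close> lies in the form domain and \<open>L f = g\<close>.\<close>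

definition Lr :: "(int \<Rightarrow> complex) \<Rightarrow> nat ell2 \<Rightarrow> nat ell2 \<Rightarrow> bool" where
  "Lr a f g \<longleftrightarrow> hh f \<and> (\<forall>n. of_nat n * coef f n - (\<Sum>\<^sub>\<infinity>m. a (int n - int m) * coef f m) = coef g n)"

lemma hh_iff:
  assumes k: "1 \<le> \<kappa>" shows "hh f \<longleftrightarrow> (\<exists>\<psi>. f = dmul (gd \<kappa>) \<psi>)"
proof
  assume "hh f"
  then have s: "(\<lambda>n. (\<kappa> + 1) * (real (Suc n) * (cmod (coef f n))\<^sup>2)) summable_on UNIV"
    unfolding hh_def by (rule summable_on_cmult_right)
  have "(\<lambda>n. (cmod (coef f n / gd \<kappa> n))\<^sup>2) summable_on UNIV"
  proof (rule summable_on_le[OF s])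
    fix n
    have "(cmod (coef f n / gd \<kappa> n))\<^sup>2 = (real n + \<kappa>) * (cmod (coef f n))\<^sup>2"
      using k by (simp add: norm_divide cmod_gd power_mult_distrib)
    also have "\<dots> \<le> ((\<kappa> + 1) * real (Suc n)) * (cmod (coef f n))\<^sup>2"
      using k by (intro mult_right_mono) (auto simp: algebra_simps)
    finally show "(cmod (coef f n / gd \<kappa> n))\<^sup>2 \<le> (\<kappa> + 1) * (real (Suc n) * (cmod (coef f n))\<^sup>2)"
      by (simp add: mult.assoc)
  qed auto
  then have "coef (Abs_ell2 (\<lambda>n. coef f n / gd \<kappa> n)) = (\<lambda>n. coef f n / gd \<kappa> n)" by (rule coef_Abs_ell2)
  then have "f = dmul (gd \<kappa>) (Abs_ell2 (\<lambda>n. coef f n / gd \<kappa> n))"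
    by (intro ell2_eqI) (simp add: coef_G k gd_nz)
  then show "\<exists>\<psi>. f = dmul (gd \<kappa>) \<psi>" by blast
next
  assume "\<exists>\<psi>. f = dmul (gd \<kappa>) \<psi>"
  then obtain \<psi> where f: "f = dmul (gd \<kappa>) \<psi>" by blast
  show "hh f"
    unfolding hh_def
  proof (rule summable_on_le[OF coef_summable])
    fix n
    have "real (Suc n) * (cmod (coef f n))\<^sup>2 = real (Suc n) / (real n + \<kappa>) * (cmod (coef \<psi> n))\<^sup>2"
      using k by (simp add: f coef_G norm_mult cmod_gd power_mult_distrib power_divide)
    also have "\<dots> \<le> 1 * (cmod (coef \<psi> n))\<^sup>2"
      using k by (intro mult_right_mono) auto
    finally show "real (Suc n) * (cmod (coef f n))\<^sup>2 \<le> (cmod (coef \<psi> n))\<^sup>2" by simp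
  qed auto
qed

text \<open>For f = G \<psi>, multiplying row n of L f = h by (n + \<kappa>)^(-1/2) produces \<psi>
  = G (h + \<kappa> f) + Q \<psi>, the equation solved by \<open>neu\<close>. Statements about the
  unbounded L thereby become identities for a bounded operator.\<close>

lemma Lr_iff:
  assumes g: "good a \<kappa>"
  shows "Lr a f h \<longleftrightarrow> f = Rs a \<kappa> (h + cmul (of_real \<kappa>) f)"
proof -
  note k = goodD(2)[OF g]
  have eq: "(of_nat n * coef f n - (\<Sum>\<^sub>\<infinity>m. a (int n - int m) * coef f m) = coef h n) \<longleftrightarrow>
      coef \<psi> n = coef (dmul (gd \<kappa>) (h + cmul (of_real \<kappa>) f) + matop (qmat a \<kappa>) \<psi>) n"
    if f: "f = dmul (gd \<kappa>) \<psi>" for \<psi> n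
  proof -
    let ?s = "\<Sum>\<^sub>\<infinity>m. a (int n - int m) * coef f m"
    have m: "coef (matop (qmat a \<kappa>) \<psi>) n = gd \<kappa> n * ?s"
      by (simp add: coef_matop goodD[OF g] f coef_G k qmat_def mult.assoc infsum_cmult_right')
    have nk: "complex_of_real (real n + \<kappa>) \<noteq> 0" using k by (simp only: of_real_eq_0_iff)
    have inv: "1 / gd \<kappa> n = of_real (real n + \<kappa>) * gd \<kappa> n"
      using gd_sq[OF k, of n] gd_nz[OF k, of n] nk by (simp add: field_simps)
    have psi: "coef \<psi> n = of_real (real n + \<kappa>) * gd \<kappa> n * coef f n"
      using inv gd_nz[OF k, of n] by (simp add: f coef_G k field_simps)
    have "coef \<psi> n = coef (dmul (gd \<kappa>) (h + cmul (of_real \<kappa>) f) + matop (qmat a \<kappa>) \<psi>) n \<longleftrightarrow>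
        gd \<kappa> n * (of_real (real n + \<kappa>) * coef f n) = gd \<kappa> n * (coef h n + of_real \<kappa> * coef f n + ?s)"
      by (simp add: psi coef_G k m algebra_simps)
    also have "\<dots> \<longleftrightarrow> of_real (real n + \<kappa>) * coef f n = coef h n + of_real \<kappa> * coef f n + ?s"
      using gd_nz[OF k, of n] by simp
    also have "\<dots> \<longleftrightarrow> of_nat n * coef f n - ?s = coef h n"
      by (auto simp: algebra_simps)
    finally show ?thesis by simp
  qed
  show ?thesis
  proof
    assume L: "Lr a f h"
    then obtain \<psi> where f: "f = dmul (gd \<kappa>) \<psi>" using hh_iff[OF k] by (auto simp: Lr_def)
    have "\<psi> = dmul (gd \<kappa>) (h + cmul (of_real \<kappa>) f) + matop (qmat a \<kappa>) \<psi>"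
      using L eq[OF f] by (intro ell2_eqI) (auto simp: Lr_def)
    then have "\<psi> = neu (qmat a \<kappa>) (dmul (gd \<kappa>) (h + cmul (of_real \<kappa>) f))"
      by (rule neu_unique[OF goodD(3)[OF g]])
    then show "f = Rs a \<kappa> (h + cmul (of_real \<kappa>) f)" unfolding Rs_def using f by metis
  next
    assume R: "f = Rs a \<kappa> (h + cmul (of_real \<kappa>) f)"
    define \<psi> where "\<psi> = neu (qmat a \<kappa>) (dmul (gd \<kappa>) (h + cmul (of_real \<kappa>) f))"
    have f: "f = dmul (gd \<kappa>) \<psi>" using R unfolding Rs_def \<psi>_def .
    have "\<psi> = dmul (gd \<kappa>) (h + cmul (of_real \<kappa>) f) + matop (qmat a \<kappa>) \<psi>"
      unfolding \<psi>_def by (rule neu_eq[OF goodD(3)[OF g]])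
    then have "coef \<psi> n = coef (dmul (gd \<kappa>) (h + cmul (of_real \<kappa>) f) + matop (qmat a \<kappa>) \<psi>) n" for n
      by simp
    then show "Lr a f h" using eq[OF f] hh_iff[OF k] f unfolding Lr_def by blast
  qed
qed

lemma Lr_Rs: "good a \<kappa> \<Longrightarrow> Lr a (Rs a \<kappa> f) (f - cmul (of_real \<kappa>) (Rs a \<kappa> f))"
  by (simp add: Lr_iff)

lemma Lr_cmul:
  assumes "good a \<kappa>" "Lr a f g" shows "Lr a (cmul c f) (cmul c g)"
proof -
  have "cmul c f = cmul c (Rs a \<kappa> (g + cmul (of_real \<kappa>) f))"
    using assms Lr_iff[OF assms(1)] by metis
  also have "\<dots> = Rs a \<kappa> (cmul c (g + cmul (of_real \<kappa>) f))"
    by (rule bclD(4)[OF bcl_Rs[OF assms(1)], symmetric])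
  also have "cmul c (g + cmul (of_real \<kappa>) f) = cmul c g + cmul (of_real \<kappa>) (cmul c f)"
    by (simp add: cmul_add mult.commute)
  finally show ?thesis by (simp only: Lr_iff[OF assms(1)])
qed

section \<open>Pure coisometries\<close>

text \<open>
  A coisometry \<open>K\<close> on \<open>\<ell>\<^sup>2\<close> with kernel spanned by \<open>bas 0\<close> and without unitary part is unitarily equivalent
  to the backward shift, by \<open>W f = (\<langle>K\<^sup>n f, bas 0\<rangle>)\<^sub>n\<close>.
\<close>

locale pure_coisometry =
  fixes K Ks :: "nat ell2 \<Rightarrow> nat ell2"
  assumes bcl_K: "bcl K" and bcl_Ks: "bcl Ks"
    and K_adj: "cin (K f) g = cin f (Ks g)"
    and K_Ks [simp]: "K (Ks f) = f"
    and Ks_K: "Ks (K f) = f - cmul (coef f 0) (bas 0)"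
    and pure: "(\<And>n. coef ((K ^^ n) f) 0 = 0) \<Longrightarrow> f = 0"
begin

lemma K_bas0 [simp]: "K (bas 0) = 0"
proof -
  have "Ks (K (bas 0)) = 0" by (simp add: Ks_K)
  then have "K (Ks (K (bas 0))) = K 0" by simp
  then show ?thesis by (simp add: bclD[OF bcl_K])
qed

lemma coef_Ks_0 [simp]: "coef (Ks g) 0 = 0"
proof -
  have "cin (bas 0) (Ks g) = cin (K (bas 0)) g" by (simp only: K_adj)
  then show ?thesis by simp
qed

lemma norm_K_sq: "(norm (K f))\<^sup>2 = (norm f)\<^sup>2 - (cmod (coef f 0))\<^sup>2"
proof -
  have "cin (K f) (K f) = cin f f - cnj (coef f 0) * coef f 0"
    by (simp add: K_adj Ks_K cin_diff_right)
  then have "complex_of_real ((norm (K f))\<^sup>2) = of_real ((norm f)\<^sup>2 - (cmod (coef f 0))\<^sup>2)"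
    by (simp only: cin_self_norm of_real_diff complex_norm_square mult.commute)
  then show ?thesis by (simp only: of_real_eq_iff)
qed

lemma norm_Ks [simp]: "norm (Ks f) = norm f"
proof -
  have "cin (Ks f) (Ks f) = cin f f" by (simp flip: K_adj)
  then have "(norm (Ks f))\<^sup>2 = (norm f)\<^sup>2" by (simp only: cin_self_norm of_real_eq_iff)
  then show ?thesis by (simp add: power2_eq_iff_nonneg)
qed

lemma norm_Kn_sq: "(norm ((K ^^ N) f))\<^sup>2 = (norm f)\<^sup>2 - (\<Sum>n<N. (cmod (coef ((K ^^ n) f) 0))\<^sup>2)"
  by (induction N) (auto simp: norm_K_sq)

lemma Kn_adj: "cin ((K ^^ n) f) g = cin f ((Ks ^^ n) g)"
  by (induction n arbitrary: g) (simp_all add: K_adj, simp add: funpow_swap1)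

lemma Kn_Ksn: "(K ^^ n) ((Ks ^^ n) f) = f"
  by (induction n arbitrary: f) (auto simp: funpow_swap1)

definition W :: "nat ell2 \<Rightarrow> nat ell2" where "W f = Abs_ell2 (\<lambda>n. coef ((K ^^ n) f) 0)"

lemma W_summable: "(\<lambda>n. (cmod (coef ((K ^^ n) f) 0))\<^sup>2) summable_on UNIV"
proof -
  have "summable (\<lambda>n. (cmod (coef ((K ^^ n) f) 0))\<^sup>2)"
  proof (rule summableI_nonneg_bounded[where x = "(norm f)\<^sup>2"])
    show "(\<Sum>n<N. (cmod (coef ((K ^^ n) f) 0))\<^sup>2) \<le> (norm f)\<^sup>2" for N
      using norm_Kn_sq[of N f] by (metis diff_ge_0_iff_ge zero_le_power2)
  qed auto
  then show ?thesis by (subst summable_on_UNIV_nonneg_real_iff) auto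
qed

lemma coef_W: "coef (W f) n = coef ((K ^^ n) f) 0"
  unfolding W_def by (simp add: coef_Abs_ell2[OF W_summable])

text \<open>The remainder \<open>K\<^sup>*\<^sup>N K\<^sup>N f\<close> converges to the unitary part of \<open>f\<close>, which vanishes.\<close>

lemma Kn_tendsto_0: "(\<lambda>N. (norm ((K ^^ N) f))\<^sup>2) \<longlonglongrightarrow> 0"
proof -
  define p where "p N = (Ks ^^ N) ((K ^^ N) f)" for N
  have norm_p: "norm (p N) = norm ((K ^^ N) f)" for N
  proof -
    have "norm ((Ks ^^ N) g) = norm g" for g by (induction N) auto
    then show ?thesis by (simp add: p_def)
  qed
  \<comment> \<open>\<open>p N\<close> is the orthogonal projection of f to the range of the N-th
    power of \<open>Ks\<close>. These ranges decrease, so the squared distance of two projections is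
    the difference of their squared norms, and a bounded monotone sequence makes \<open>p\<close>
    Cauchy.\<close>
  have pp: "cin (p N) (p (N + j)) = of_real ((norm (p (N + j)))\<^sup>2)" for N j
  proof -
    have "cin (p (N + j)) (p N) = cin ((K ^^ (N + j)) f) ((K ^^ (N + j)) (p N))"
      unfolding p_def[of "N + j"] by (subst (1) cin_commute, subst Kn_adj[symmetric], subst cin_commute) simp
    also have "(K ^^ (N + j)) (p N) = (K ^^ j) ((K ^^ N) (p N))"
      by (subst add.commute) (simp add: funpow_add)
    also have "\<dots> = (K ^^ (N + j)) f"
      by (subst add.commute) (simp add: p_def Kn_Ksn funpow_add)
    finally have "cin (p (N + j)) (p N) = of_real ((norm (p (N + j)))\<^sup>2)"
      by (simp add: cin_self_norm norm_p)
    then show ?thesis by (subst cin_commute) simp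
  qed
  have dist_sq: "(norm (p N - p (N + j)))\<^sup>2 = (norm (p N))\<^sup>2 - (norm (p (N + j)))\<^sup>2" for N j
  proof -
    have "cin (p (N + j)) (p N) = of_real ((norm (p (N + j)))\<^sup>2)"
      by (subst cin_commute) (simp add: pp)
    then have "cin (p N - p (N + j)) (p N - p (N + j)) = of_real ((norm (p N))\<^sup>2 - (norm (p (N + j)))\<^sup>2)"
      by (simp only: cin_diff_left cin_diff_right pp) (simp add: cin_self_norm)
    then show ?thesis by (simp only: cin_self_norm of_real_eq_iff)
  qed
  define s where "s N = (norm ((K ^^ N) f))\<^sup>2" for N
  have s_dec: "s (N + j) \<le> s N" for N j
    unfolding s_def norm_p[symmetric] using dist_sq[of N j] by (metis diff_ge_0_iff_ge zero_le_power2)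
  have "decseq s" unfolding decseq_def by (metis s_dec le_add_diff_inverse)
  moreover have "s N \<ge> 0" for N by (simp add: s_def)
  ultimately have "Bseq s" by (intro decseq_bounded[of s 0]) auto
  then have "convergent s" using \<open>decseq s\<close> by (intro Bseq_monoseq_convergent) (auto simp: decseq_imp_monoseq)
  then have sC: "Cauchy s" by (rule convergent_Cauchy)
  have "Cauchy p"
  proof (rule metric_CauchyI)
    fix e :: real assume e: "e > 0"
    then have "e\<^sup>2 > 0" by simp
    from metric_CauchyD[OF sC this]
    obtain M where M: "\<And>m n. m \<ge> M \<Longrightarrow> n \<ge> M \<Longrightarrow> dist (s m) (s n) < e\<^sup>2" by blast
    have *: "dist (p m) (p n) < e" if "M \<le> m" "m \<le> n" for m n
    proof -
      have "(dist (p m) (p n))\<^sup>2 = s m - s n"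
        using dist_sq[of m "n - m"] that by (simp add: dist_norm s_def norm_p)
      also have "\<dots> < e\<^sup>2"
      proof -
        have "dist (s m) (s n) < e\<^sup>2" by (rule M) (use that in linarith)+
        then show ?thesis unfolding dist_real_def by linarith
      qed
      finally show ?thesis by (rule power_less_imp_less_base) (use e in simp)
    qed
    show "\<exists>M. \<forall>m\<ge>M. \<forall>n\<ge>M. dist (p m) (p n) < e"
      by (rule exI[of _ M]) (metis * dist_commute nat_le_linear)
  qed
  then obtain l where l: "p \<longlonglongrightarrow> l" using Cauchy_convergent convergent_def by blast
  \<comment> \<open>As soon as N > n, the vector \<open>(K ^^ n) (p N)\<close> lies in the range of
    \<open>Ks\<close>, where coefficient 0 vanishes.\<close>
  have "coef ((K ^^ n) l) 0 = 0" for n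
  proof (rule LIMSEQ_unique)
    show "(\<lambda>N. coef ((K ^^ n) (p N)) 0) \<longlonglongrightarrow> coef ((K ^^ n) l) 0"
      by (intro tendsto_coef bcl_tendsto[OF bcl_funpow[OF bcl_K]] l)
    have "coef ((K ^^ n) (p N)) 0 = 0" if N: "N \<ge> Suc n" for N
    proof -
      obtain j where j: "N = n + Suc j" using N by (metis add_Suc_right le_Suc_ex add_Suc)
      have "(K ^^ n) (p N) = (Ks ^^ Suc j) ((K ^^ N) f)"
        unfolding p_def j funpow_add by (simp only: o_def Kn_Ksn)
      then show ?thesis by simp
    qed
    then show "(\<lambda>N. coef ((K ^^ n) (p N)) 0) \<longlonglongrightarrow> 0"
      by (intro tendsto_eventually eventually_sequentiallyI[of "Suc n"])
  qed
  then have "l = 0" by (rule pure)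
  then have "(\<lambda>N. (norm (p N))\<^sup>2) \<longlonglongrightarrow> (norm (0 :: nat ell2))\<^sup>2" using l by (intro tendsto_intros) simp
  then show ?thesis by (simp add: norm_p)
qed

lemma norm_W [simp]: "norm (W f) = norm f"
proof -
  have "((\<lambda>n. (cmod (coef (W f) n))\<^sup>2) has_sum (norm (W f))\<^sup>2) UNIV"
    unfolding norm_sq_infsum by (rule has_sum_infsum[OF coef_summable])
  then have "(\<lambda>N. \<Sum>n<N. (cmod (coef (W f) n))\<^sup>2) \<longlonglongrightarrow> (norm (W f))\<^sup>2"
    using has_sum_imp_sums by (auto simp: sums_def)
  moreover have "(\<lambda>N. (norm f)\<^sup>2 - (norm ((K ^^ N) f))\<^sup>2) \<longlonglongrightarrow> (norm f)\<^sup>2 - 0"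
    by (intro tendsto_intros Kn_tendsto_0)
  then have "(\<lambda>N. \<Sum>n<N. (cmod (coef (W f) n))\<^sup>2) \<longlonglongrightarrow> (norm f)\<^sup>2"
    by (simp add: norm_Kn_sq coef_W)
  ultimately have "(norm (W f))\<^sup>2 = (norm f)\<^sup>2" by (rule LIMSEQ_unique)
  then show ?thesis by (simp add: power2_eq_iff_nonneg)
qed

lemma W_add: "W (f + g) = W f + W g"
  and W_diff: "W (f - g) = W f - W g"
  and W_cmul: "W (cmul c f) = cmul c (W f)"
  by (rule ell2_eqI; simp add: coef_W bclD[OF bcl_funpow[OF bcl_K]])+

lemma inner_W: "inner (W f) (W g) = inner f g"
  by (simp add: dot_norm flip: W_add)

lemma cin_W: "cin (W f) (W g) = cin f g"
proof (rule complex_eqI)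
  show "Re (cin (W f) (W g)) = Re (cin f g)" using inner_W by (simp add: inner_ell2_def)
  have "Im (cin h k) = Re (cin (cmul (- \<i>) h) k)" for h k :: "nat ell2" by simp
  then show "Im (cin (W f) (W g)) = Im (cin f g)"
    using inner_W[of "cmul (- \<i>) f" g] unfolding inner_ell2_def W_cmul by metis
qed

text \<open>The vectors \<open>(Ks ^^ m) (bas 0)\<close> are carried to the standard basis. An
  operator that \<open>W\<close> intertwines with a second one therefore has, in these vectors, the
  standard matrix of the second one.\<close>

lemma W_bas: "W ((Ks ^^ m) (bas 0)) = bas m"
proof (rule ell2_eqI)
  fix n
  consider "n < m" | "n = m" | "n > m" by linarith
  then show "coef (W ((Ks ^^ m) (bas 0))) n = coef (bas m) n"
  proof cases
    case 1
    then obtain j where j: "m = n + Suc j" by (metis add_Suc_right less_imp_Suc_add)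
    have "(K ^^ n) ((Ks ^^ m) (bas 0)) = (Ks ^^ Suc j) (bas 0)"
      unfolding j funpow_add by (simp only: o_def Kn_Ksn)
    then show ?thesis using 1 by (simp add: coef_W)
  next
    case 2
    then show ?thesis by (simp add: coef_W Kn_Ksn)
  next
    case 3
    then obtain j where j: "n = Suc j + m" by (metis add_Suc_right less_imp_Suc_add add.commute)
    have "(K ^^ n) ((Ks ^^ m) (bas 0)) = (K ^^ Suc j) (bas 0)"
      unfolding j funpow_add by (simp only: o_def Kn_Ksn)
    also have "\<dots> = (K ^^ j) (K (bas 0))" by (simp add: funpow_swap1)
    also have "\<dots> = 0" using bclD(5)[OF bcl_funpow[OF bcl_K]] by simp
    finally show ?thesis using 3 by (simp add: coef_W)
  qed
qed

end

section \<open>The unitary group of the Lax operator\<close>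

lemma has_vector_derivative_quotient:
  fixes f :: "real \<Rightarrow> 'a::real_normed_vector"
  shows "(f has_vector_derivative D) (at x) \<longleftrightarrow> ((\<lambda>h. (f (x + h) - f x) /\<^sub>R h) \<longlongrightarrow> D) (at 0)"
proof -
  have "(f has_vector_derivative D) (at x) \<longleftrightarrow> ((\<lambda>h. norm (f (x + h) - f x - h *\<^sub>R D) / norm h) \<longlongrightarrow> 0) (at 0)"
    by (simp add: has_vector_derivative_def has_derivative_at bounded_linear_scaleR_left)
  also have "\<dots> \<longleftrightarrow> ((\<lambda>h. norm ((f (x + h) - f x) /\<^sub>R h - D)) \<longlongrightarrow> 0) (at 0)"
  proof (rule filterlim_cong[OF refl refl])
    have "norm (f (x + h) - f x - h *\<^sub>R D) / norm h = norm ((f (x + h) - f x) /\<^sub>R h - D)" if "h \<noteq> 0" for h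
    proof -
      have "(f (x + h) - f x) /\<^sub>R h - D = (f (x + h) - f x - h *\<^sub>R D) /\<^sub>R h"
        using that by (simp add: scaleR_diff_right)
      then show ?thesis by (simp add: divide_inverse mult.commute)
    qed
    then show "\<forall>\<^sub>F h in at 0. norm (f (x + h) - f x - h *\<^sub>R D) / norm h = norm ((f (x + h) - f x) /\<^sub>R h - D)"
      by (auto simp: eventually_at intro!: exI[of _ 1])
  qed
  also have "\<dots> \<longleftrightarrow> ((\<lambda>h. (f (x + h) - f x) /\<^sub>R h) \<longlongrightarrow> D) (at 0)"
    by (simp add: tendsto_norm_zero_iff LIM_zero_iff)
  finally show ?thesis .
qed

lemma cmod_cis_minus_1: "cmod (cis x - 1) \<le> \<bar>x\<bar>"
proof -
  have "cmod (cis x - 1) = 2 * \<bar>sin (x / 2)\<bar>"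
    using dist_exp_i_1[of x] by (simp add: cis_conv_exp)
  also have "\<dots> \<le> 2 * \<bar>x / 2\<bar>" by (intro mult_left_mono abs_sin_x_le_abs_x) auto
  finally show ?thesis by simp
qed

lemma cis_derivative_quotient: "((\<lambda>h. (cis ((t + h) * v) - cis (t * v)) /\<^sub>R h) \<longlongrightarrow> \<i> * of_real v * cis (t * v)) (at 0)"
proof -
  have "((\<lambda>t. cis (t * v)) has_vector_derivative \<i> * of_real v * cis (t * v)) (at t)"
    unfolding cis_conv_exp
    by (auto intro!: derivative_eq_intros has_vector_derivative_real_field simp: field_simps)
  then show ?thesis by (simp add: has_vector_derivative_quotient)
qed

locale lax_group = onb \<phi> for \<phi> :: "nat \<Rightarrow> nat ell2" +
  fixes a :: "int \<Rightarrow> complex" and \<kappa> :: real and \<mu> :: "nat \<Rightarrow> real"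
  assumes good: "good a \<kappa>"
    and eig: "Rs a \<kappa> (\<phi> p) = \<mu> p *\<^sub>R \<phi> p"
    and mu_pos: "\<mu> p > 0"
begin

text \<open>The eigenvalue of L at \<phi> p, since the resolvent has the eigenvalue \<mu> p = 1 /
  (\<nu> p + \<kappa>). With it, \<open>E t\<close> is the unitary e^(itL).\<close>

definition \<nu> :: "nat \<Rightarrow> real" where "\<nu> p = 1 / \<mu> p - \<kappa>"

definition E :: "real \<Rightarrow> nat ell2 \<Rightarrow> nat ell2" where
  "E t = fn (\<lambda>p. cis (t * \<nu> p))"

text \<open>The operator of the explicit formula, and its adjoint.\<close>

definition K :: "real \<Rightarrow> nat ell2 \<Rightarrow> nat ell2" where
  "K t f = cmul (cis t) (E (2 * t) (shl f))"

definition Ks :: "real \<Rightarrow> nat ell2 \<Rightarrow> nat ell2" where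
  "Ks t f = cmul (cis (- t)) (shr (E (- 2 * t) f))"

lemma E_bcl: "bcl (E t)"
  unfolding E_def by (rule bcl_fn[where C = 1]) simp

lemma E_E: "E s (E t f) = E (s + t) f"
  unfolding E_def by (subst fn_fn[where C = 1 and D = 1]) (auto simp: cis_mult distrib_right)

lemma E_0 [simp]: "E 0 f = f"
  unfolding E_def by (rule fn_cong_1) simp

lemma E_adj: "cin (E t f) g = cin f (E (- t) g)"
  unfolding E_def by (subst fn_adjoint[where C = 1]) (auto simp: cis_cnj)

lemma norm_E [simp]: "norm (E t f) = norm f"
proof -
  have "cin (E t f) (E t f) = cin f f" by (simp add: E_adj E_E)
  then have "(norm (E t f))\<^sup>2 = (norm f)\<^sup>2" by (simp only: cin_self_norm of_real_eq_iff)
  then show ?thesis by (simp add: power2_eq_iff_nonneg)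
qed

lemma cin_E: "cin (E t f) (\<phi> p) = cis (t * \<nu> p) * cin f (\<phi> p)"
  unfolding E_def by (rule cin_fn[where C = 1]) simp

lemma cin_Rs_phi: "cin (Rs a \<kappa> f) (\<phi> p) = of_real (\<mu> p) * cin f (\<phi> p)"
  by (simp add: Rs_adjoint[OF good] eig scaleR_cmul)

lemma onb_eqI: "(\<And>p. cin f (\<phi> p) = cin g (\<phi> p)) \<Longrightarrow> f = g"
  using complete[of "f - g"] by (simp add: cin_diff_left)

lemma E_Rs: "E t (Rs a \<kappa> f) = Rs a \<kappa> (E t f)"
  by (rule onb_eqI) (simp add: cin_E cin_Rs_phi)

lemma Lr_E:
  assumes "Lr a f g" shows "Lr a (E t f) (E t g)"
proof -
  have "E t f = E t (Rs a \<kappa> (g + cmul (of_real \<kappa>) f))"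
    by (rule arg_cong[OF iffD1[OF Lr_iff[OF good] assms]])
  then show ?thesis
    by (simp only: Lr_iff[OF good] E_Rs bclD[OF E_bcl])
qed

lemma cin_Lr:
  assumes "Lr a f g" shows "cin g (\<phi> p) = of_real (\<nu> p) * cin f (\<phi> p)"
proof -
  have "cin f (\<phi> p) = of_real (\<mu> p) * (cin g (\<phi> p) + of_real \<kappa> * cin f (\<phi> p))"
    using cin_Rs_phi[of "g + cmul (of_real \<kappa>) f" p]
    by (simp only: iffD1[OF Lr_iff[OF good] assms, symmetric] cin_add_left cin_cmul_left)
  then show ?thesis using mu_pos[of p] by (simp add: \<nu>_def field_simps)
qed

lemma E_tendsto: "(f \<longlongrightarrow> g) F \<Longrightarrow> (t \<longlongrightarrow> s) F \<Longrightarrow> ((\<lambda>x. E (t x) (f x)) \<longlongrightarrow> E s g) F"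
  unfolding E_def by (rule fn_tendsto[where C = 1]) (auto intro!: tendsto_intros)

text \<open>In eigencoordinates the difference quotients converge one by one, and |e^(ix) - 1| \<le>
  |x| bounds them by |\<nu> p <f, \<phi> p>| = |<g, \<phi> p>|, which is square-summable because f
  lies in the domain.\<close>

lemma E_derivative:
  assumes L: "Lr a f g"
  shows "((\<lambda>t. E t f) has_vector_derivative cmul \<i> (E t g)) (at t)"
  unfolding has_vector_derivative_quotient
proof -
  have fn: "ana (E s h) = dmul (\<lambda>p. cis (s * \<nu> p)) (ana h)" for s h
    by (simp add: E_def ana_fn)
  have ad: "ana (x - y) = ana x - ana y" for x y
    by (rule ell2_eqI) (simp add: coef_ana cin_diff_left)
  have as: "ana (r *\<^sub>R x) = r *\<^sub>R ana x" for r x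
    by (simp add: scaleR_cmul ana_cmul)
  have "((\<lambda>h. ana ((E (t + h) f - E t f) /\<^sub>R h)) \<longlongrightarrow> ana (cmul \<i> (E t g))) (at 0)"
  proof (rule tendsto_ell2_dominated[where C = 1 and h = "ana g"])
    fix p
    have c: "coef (ana ((E (t + h) f - E t f) /\<^sub>R h)) p = ((cis ((t + h) * \<nu> p) - cis (t * \<nu> p)) /\<^sub>R h) * cin f (\<phi> p)" for h
      by (simp add: coef_ana scaleR_cmul cin_diff_left cin_E scaleR_conv_of_real algebra_simps)
    have "((\<lambda>h. ((cis ((t + h) * \<nu> p) - cis (t * \<nu> p)) /\<^sub>R h) * cin f (\<phi> p)) \<longlongrightarrow>
        (\<i> * of_real (\<nu> p) * cis (t * \<nu> p)) * cin f (\<phi> p)) (at 0)"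
      by (intro tendsto_mult tendsto_const cis_derivative_quotient)
    then show "((\<lambda>h. coef (ana ((E (t + h) f - E t f) /\<^sub>R h)) p) \<longlongrightarrow> coef (ana (cmul \<i> (E t g))) p) (at 0)"
      by (simp only: c) (simp add: coef_ana cin_E cin_Lr[OF L] mult_ac)
  next
    have "cmod (coef (ana ((E (t + h) f - E t f) /\<^sub>R h)) p) \<le> cmod (coef (ana g) p)" for h p
    proof (cases "h = 0")
      case False
      have "cis ((t + h) * \<nu> p) - cis (t * \<nu> p) = cis (t * \<nu> p) * (cis (h * \<nu> p) - 1)"
        by (simp add: distrib_right right_diff_distrib flip: cis_mult)
      then have "cmod (cis ((t + h) * \<nu> p) - cis (t * \<nu> p)) \<le> \<bar>h\<bar> * \<bar>\<nu> p\<bar>"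
        using cmod_cis_minus_1[of "h * \<nu> p"] by (simp add: norm_mult abs_mult)
      then have "cmod (cis ((t + h) * \<nu> p) - cis (t * \<nu> p)) / \<bar>h\<bar> \<le> \<bar>\<nu> p\<bar>"
        using False by (simp add: field_simps)
      then have "cmod (cis ((t + h) * \<nu> p) - cis (t * \<nu> p)) / \<bar>h\<bar> * cmod (cin f (\<phi> p)) \<le> \<bar>\<nu> p\<bar> * cmod (cin f (\<phi> p))"
        by (rule mult_right_mono) simp
      moreover have "coef (ana ((E (t + h) f - E t f) /\<^sub>R h)) p = of_real (1 / h) * (cis ((t + h) * \<nu> p) - cis (t * \<nu> p)) * cin f (\<phi> p)"
        by (simp add: coef_ana scaleR_cmul cin_diff_left cin_E algebra_simps divide_inverse)
      ultimately show ?thesis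
        by (simp add: coef_ana cin_Lr[OF L] norm_mult norm_divide)
    qed (simp add: coef_ana)
    then show "\<forall>\<^sub>F h in at 0. \<forall>p. cmod (coef (ana ((E (t + h) f - E t f) /\<^sub>R h)) p) \<le> 1 * cmod (coef (ana g) p)"
      by (simp add: always_eventually)
  qed
  then have "((\<lambda>h. norm (ana ((E (t + h) f - E t f) /\<^sub>R h) - ana (cmul \<i> (E t g)))) \<longlongrightarrow> 0) (at 0)"
    by (simp add: tendsto_norm_zero_iff LIM_zero_iff)
  then have "((\<lambda>h. norm ((E (t + h) f - E t f) /\<^sub>R h - cmul \<i> (E t g))) \<longlongrightarrow> 0) (at 0)"
    by (simp only: ad[symmetric] norm_ana)
  then show "((\<lambda>h. (E (t + h) f - E t f) /\<^sub>R h) \<longlongrightarrow> cmul \<i> (E t g)) (at 0)"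
    by (simp add: tendsto_norm_zero_iff LIM_zero_iff)
qed

lemma K_bcl: "bcl (K t)"
  unfolding K_def[abs_def] by (rule bcl_comp[OF bcl_cmul bcl_comp[OF E_bcl bcl_shl]])

lemma Ks_bcl: "bcl (Ks t)"
  unfolding Ks_def[abs_def] by (rule bcl_comp[OF bcl_cmul bcl_comp[OF bcl_shr E_bcl]])

lemma K_adj: "cin (K t f) g = cin f (Ks t g)"
proof -
  have "cin (K t f) g = cis t * cin (shl f) (E (- 2 * t) g)"
    by (simp add: K_def E_adj)
  also have "cin (shl f) (E (- 2 * t) g) = cin f (shr (E (- 2 * t) g))"
    by (subst (1 2) cin_commute) (simp add: cin_shr)
  finally show ?thesis by (simp add: Ks_def cis_cnj)
qed

lemma K_Ks: "K t (Ks t f) = f"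
  by (simp add: K_def Ks_def bclD[OF bcl_shl] bclD[OF E_bcl] E_E cis_mult)

lemma Ks_K: "Ks t (K t f) = f - cmul (coef f 0) (bas 0)"
  by (simp add: K_def Ks_def bclD[OF bcl_shr] bclD[OF E_bcl] E_E cis_mult shr_shl)

lemma norm_K: "norm (K t f) \<le> norm f"
  by (simp add: K_def norm_shl_le)

end

lemma lax_group_exists:
  assumes "good a \<kappa>"
  obtains \<phi> \<mu> where "lax_group \<phi> a \<kappa> \<mu>"
proof (rule spectral_theorem[OF posdef_Rs[OF assms] cpt_Rs[OF assms]])
  fix \<phi> :: "nat \<Rightarrow> nat ell2" and \<mu> :: "nat \<Rightarrow> real"
  assume 1: "\<And>p. \<mu> p > 0" "\<And>p. Rs a \<kappa> (\<phi> p) = \<mu> p *\<^sub>R \<phi> p"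
    "\<And>p q. cin (\<phi> p) (\<phi> q) = (if p = q then 1 else 0)"
    and 2: "\<And>f. (\<And>p. cin f (\<phi> p) = 0) \<Longrightarrow> f = 0"
  have "onb \<phi>" by standard (fact 1(3) 2)+
  moreover have "lax_group_axioms \<phi> a \<kappa> \<mu>" by standard (fact assms 1)+
  ultimately have "lax_group \<phi> a \<kappa> \<mu>" by (rule lax_group.intro)
  then show thesis by (rule that)
qed

text \<open>Convergence of resolvents gives strong convergence of the groups; it suffices to test on eigenvectors.\<close>

lemma group_convergence_eigenvector:
  assumes "lax_group \<phi> a \<kappa> \<mu>" "lax_group \<phi>' a' \<kappa> \<mu>'"
  shows "norm (lax_group.E \<phi>' \<kappa> \<mu>' t (Rs a' \<kappa> (\<phi> p)) - cmul (cis (t * lax_group.\<nu> \<kappa> \<mu> p)) (Rs a' \<kappa> (\<phi> p)))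
      \<le> \<bar>t\<bar> / \<mu> p * norm (Rs a \<kappa> (\<phi> p) - Rs a' \<kappa> (\<phi> p))"
proof -
  interpret A: lax_group \<phi> a \<kappa> \<mu> by fact
  interpret B: lax_group \<phi>' a' \<kappa> \<mu>' by fact
  let ?r = "Rs a' \<kappa> (\<phi> p)" let ?v = "A.\<nu> p"
  \<comment> \<open>Duhamel: r = \<open>?r\<close> lies in the domain of the second operator L', and
    (L' - \<nu> p) r = \<phi> p - (\<kappa> + \<nu> p) r = (\<open>Rs a \<kappa> (\<phi> p)\<close>
    - r) / \<mu> p. So the derivative \<open>D\<close> of \<open>G\<close> is as small as the
    difference of the resolvents.\<close>
  define G where "G s = cmul (cis (- (s * ?v))) (B.E s ?r)" for s
  define D where "D s = cmul (cis (- (s * ?v))) (B.E s (cmul (\<i> / of_real (\<mu> p)) (Rs a \<kappa> (\<phi> p) - ?r)))" for s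
  note mp = A.mu_pos[of p]
  have der: "(G has_vector_derivative D s) (at s)" for s
    unfolding has_vector_derivative_quotient
  proof -
    have L: "Lr a' ?r (\<phi> p - cmul (of_real \<kappa>) ?r)" by (rule Lr_Rs[OF B.good])
    note E = B.E_derivative[OF L, of s, unfolded has_vector_derivative_quotient]
    have c: "((\<lambda>h. (cis ((s + h) * (- ?v)) - cis (s * (- ?v))) /\<^sub>R h) \<longlongrightarrow> \<i> * of_real (- ?v) * cis (s * (- ?v))) (at 0)"
      by (rule cis_derivative_quotient)
    have t: "((\<lambda>h. s + h) \<longlongrightarrow> s + 0) (at 0)" by (intro tendsto_intros)
    have Et: "((\<lambda>h. B.E (s + h) ?r) \<longlongrightarrow> B.E s ?r) (at 0)"
      using B.E_tendsto[OF tendsto_const t] by simp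
    have "((\<lambda>h. cmul ((cis ((s + h) * (- ?v)) - cis (s * (- ?v))) /\<^sub>R h) (B.E (s + h) ?r)
        + cmul (cis (s * (- ?v))) ((B.E (s + h) ?r - B.E s ?r) /\<^sub>R h)) \<longlongrightarrow>
        cmul (\<i> * of_real (- ?v) * cis (s * (- ?v))) (B.E s ?r) +
        cmul (cis (s * (- ?v))) (cmul \<i> (B.E s (\<phi> p - cmul (of_real \<kappa>) ?r)))) (at 0)"
      by (intro tendsto_add tendsto_cmul c Et tendsto_const E)
    moreover have "cmul ((cis ((s + h) * (- ?v)) - cis (s * (- ?v))) /\<^sub>R h) (B.E (s + h) ?r)
        + cmul (cis (s * (- ?v))) ((B.E (s + h) ?r - B.E s ?r) /\<^sub>R h) = (G (s + h) - G s) /\<^sub>R h" for h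
      by (rule ell2_eqI) (simp add: G_def scaleR_conv_of_real algebra_simps)
    moreover have "cmul (\<i> * of_real (- ?v) * cis (s * (- ?v))) (B.E s ?r) +
        cmul (cis (s * (- ?v))) (cmul \<i> (B.E s (\<phi> p - cmul (of_real \<kappa>) ?r))) = D s"
    proof -
      have "cmul (\<i> / of_real (\<mu> p)) (Rs a \<kappa> (\<phi> p) - ?r) = cmul \<i> (\<phi> p - cmul (of_real (1 / \<mu> p)) ?r)"
        by (rule ell2_eqI) (use mp in \<open>simp add: A.eig field_simps\<close>)
      then have "D s = cmul (cis (- (s * ?v))) (cmul \<i> (B.E s (\<phi> p - cmul (of_real (1 / \<mu> p)) ?r)))"
        unfolding D_def by (simp only: bclD(4)[OF B.E_bcl])
      also have "\<dots> = cmul (\<i> * of_real (- ?v) * cis (s * (- ?v))) (B.E s ?r) +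
        cmul (cis (s * (- ?v))) (cmul \<i> (B.E s (\<phi> p - cmul (of_real \<kappa>) ?r)))"
        by (rule ell2_eqI) (simp add: bclD[OF B.E_bcl] A.\<nu>_def algebra_simps)
      finally show ?thesis by simp
    qed
    ultimately show "((\<lambda>h. (G (s + h) - G s) /\<^sub>R h) \<longlongrightarrow> D s) (at 0)" by simp
  qed
  have Dn: "norm (D s) \<le> norm (Rs a \<kappa> (\<phi> p) - ?r) / \<mu> p" for s
    using mp by (simp add: D_def norm_divide)
  have "norm (G t - G 0) \<le> norm (Rs a \<kappa> (\<phi> p) - ?r) / \<mu> p * norm (t - 0)"
  proof (rule differentiable_bound[of UNIV G "\<lambda>s h. h *\<^sub>R D s"])
    show "(G has_derivative (\<lambda>h. h *\<^sub>R D s)) (at s within UNIV)" for s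
      using der[of s] by (simp add: has_vector_derivative_def)
    show "onorm (\<lambda>h. h *\<^sub>R D s) \<le> norm (Rs a \<kappa> (\<phi> p) - ?r) / \<mu> p" for s
    proof (rule onorm_le)
      show "norm (h *\<^sub>R D s) \<le> norm (Rs a \<kappa> (\<phi> p) - ?r) / \<mu> p * norm h" for h :: real
        using mult_right_mono[OF Dn[of s] norm_ge_zero[of h]] by (simp add: mult.commute)
    qed
  qed auto
  moreover have "norm (G t - G 0) = norm (B.E t ?r - cmul (cis (t * ?v)) ?r)"
  proof -
    have "B.E t ?r - cmul (cis (t * ?v)) ?r = cmul (cis (t * ?v)) (G t - G 0)"
      by (simp add: G_def cmul_diff cis_mult)
    then show ?thesis by simp
  qed
  ultimately show ?thesis by (simp add: field_simps)
qed

section \<open>The explicit formula for square-summable data\<close>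

text \<open>Makes the losses of order x^(-3) in \<open>K_pure\<close> telescope to a total of order
  x^(-2).\<close>

lemma inverse_cube_le:
  fixes x :: real
  assumes "1 \<le> x" shows "1 / x ^ 3 \<le> 2 / x\<^sup>2 - 2 / (x + 1)\<^sup>2"
proof -
  have "1 * 1 \<le> x * x" using assms by (intro mult_mono) auto
  then have "(x + 1)\<^sup>2 \<le> 2 * x * (2 * x + 1)" by (simp add: power2_eq_square algebra_simps)
  then have "(x + 1)\<^sup>2 / (x ^ 3 * (x + 1)\<^sup>2) \<le> 2 * x * (2 * x + 1) / (x ^ 3 * (x + 1)\<^sup>2)"
    by (rule divide_right_mono) (use assms in simp)
  also have "(x + 1)\<^sup>2 / (x ^ 3 * (x + 1)\<^sup>2) = 1 / x ^ 3" using assms by simp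
  also have "2 * x * (2 * x + 1) / (x ^ 3 * (x + 1)\<^sup>2) = 2 * ((x + 1)\<^sup>2 - x\<^sup>2) / (x\<^sup>2 * (x + 1)\<^sup>2)"
    using assms by (simp add: power2_eq_square power3_eq_cube) (simp add: algebra_simps)
  also have "\<dots> = 2 / x\<^sup>2 - 2 / (x + 1)\<^sup>2"
    using assms by (simp add: diff_divide_distrib right_diff_distrib)
  finally show ?thesis .
qed

text \<open>The projection to nonnegative frequencies. \<open>hext\<close> undoes it for Hermitian
  families, that is, for Fourier coefficients of real functions.\<close>

definition hl :: "int ell2 \<Rightarrow> nat ell2" where "hl A = Abs_ell2 (\<lambda>n. coef A (int n))"

definition hext :: "nat ell2 \<Rightarrow> int ell2" where
  "hext f = Abs_ell2 (\<lambda>k. if k \<ge> 0 then coef f (nat k) else cnj (coef f (nat (- k))))"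

lemma coef_hl [simp]: "coef (hl A) n = coef A (int n)"
proof -
  have "(\<lambda>n. (cmod (coef A (int n)))\<^sup>2) summable_on UNIV"
    using summable_on_reindex[of int UNIV "\<lambda>n. (cmod (coef A n))\<^sup>2"] coef_summable[of A "range int"] by (simp add: o_def)
  then show ?thesis unfolding hl_def by (simp add: coef_Abs_ell2)
qed

lemma int_halves: "(UNIV :: int set) = range int \<union> range (\<lambda>n. - 1 - int n)" "range int \<inter> range (\<lambda>n. - 1 - int n) = {}"
proof -
  have "k \<in> range int \<union> range (\<lambda>n. - 1 - int n)" for k
  proof (cases "k \<ge> 0")
    case True
    then show ?thesis by (metis UnI1 nat_0_le rangeI)
  next
    case False
    then have "k = - 1 - int (nat (- 1 - k))" by simp
    then show ?thesis by blast
  qed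
  then show "(UNIV :: int set) = range int \<union> range (\<lambda>n. - 1 - int n)" by auto
qed auto

lemma has_sum_int_halves:
  fixes f :: "int \<Rightarrow> 'b :: real_normed_vector"
  assumes "((\<lambda>n. f (int n)) has_sum a) UNIV" "((\<lambda>n. f (- 1 - int n)) has_sum b) UNIV"
  shows "(f has_sum (a + b)) UNIV"
  unfolding int_halves(1)
proof (rule has_sum_Un_disjoint)
  show "(f has_sum a) (range int)"
    using has_sum_reindex[of int UNIV f a] assms(1) by (simp add: o_def)
  show "(f has_sum b) (range (\<lambda>n. - 1 - int n))"
    using has_sum_reindex[of "\<lambda>n. - 1 - int n" UNIV f b] assms(2) by (simp add: o_def inj_def)
qed (rule int_halves(2))

lemma hext_has_sum:
  "((\<lambda>k. (cmod (if k \<ge> 0 then coef f (nat k) else cnj (coef f (nat (- k)))))\<^sup>2) has_sum ((norm f)\<^sup>2 + (norm (shl f))\<^sup>2)) UNIV"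
proof (rule has_sum_int_halves)
  have 1: "((\<lambda>i. (cmod (coef g i))\<^sup>2) has_sum (norm g)\<^sup>2) UNIV" for g :: "nat ell2"
    unfolding norm_sq_infsum by (rule has_sum_infsum[OF coef_summable])
  show "((\<lambda>n. (cmod (if int n \<ge> 0 then coef f (nat (int n)) else cnj (coef f (nat (- int n)))))\<^sup>2) has_sum (norm f)\<^sup>2) UNIV"
    using 1[of f] by simp
  have "nat (int n + 1) = Suc n" for n by simp
  then show "((\<lambda>n. (cmod (if - 1 - int n \<ge> 0 then coef f (nat (- 1 - int n)) else cnj (coef f (nat (- (- 1 - int n))))))\<^sup>2) has_sum (norm (shl f))\<^sup>2) UNIV"
    using 1[of "shl f"] by (simp add: coef_shl)
qed

lemma coef_hext: "coef (hext f) k = (if k \<ge> 0 then coef f (nat k) else cnj (coef f (nat (- k))))"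
  unfolding hext_def by (subst coef_Abs_ell2[OF has_sum_imp_summable[OF hext_has_sum]]) simp

lemma norm_hext: "(norm (hext f))\<^sup>2 = (norm f)\<^sup>2 + (norm (shl f))\<^sup>2"
  unfolding norm_sq_infsum[of "hext f"] using infsumI[OF hext_has_sum[of f]] by (simp add: coef_hext)

lemma norm_hext_le: "(norm (hext f))\<^sup>2 \<le> 2 * (norm f)\<^sup>2"
  by (simp add: norm_hext norm_shl)

lemma herm_hext: "Im (coef f 0) = 0 \<Longrightarrow> herm (coef (hext f))"
  unfolding herm_def coef_hext by (auto simp: complex_eq_iff)

lemma hext_hl: "herm (coef A) \<Longrightarrow> hext (hl A) = A"
proof (rule ell2_eqI)
  fix k assume h: "herm (coef A)"
  show "coef (hext (hl A)) k = coef A k"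
  proof (cases "k \<ge> 0")
    case False
    then have "coef A k = cnj (coef A (- k))" using h unfolding herm_def by (metis minus_minus)
    then show ?thesis using False by (simp add: coef_hext)
  qed (simp add: coef_hext)
qed

lemma herm_0: "herm a \<Longrightarrow> Im (a 0) = 0"
  unfolding herm_def by (metis minus_zero complex_cnj_cancel_iff cnj.simps(2) neg_equal_zero)

section \<open>Commutation of the Lax operator with the shift\<close>

lemma toeplitz_row_summable: "(\<lambda>m. (cmod (coef A (n - int m)))\<^sup>2) summable_on UNIV"
  using summable_on_reindex[of "\<lambda>m. n - int m" UNIV "\<lambda>k. (cmod (coef A k))\<^sup>2"] coef_summable[of A "range (\<lambda>m. n - int m)"]
  by (simp add: o_def inj_def)

lemma toeplitz_summable: "(\<lambda>m. coef A (n - int m) * coef f m) summable_on UNIV"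
  by (rule row_prod_summable(2)[OF toeplitz_row_summable])

text \<open>L 1 = - X: column 0 of the Toeplitz matrix is the Hardy part of the datum.\<close>

lemma Lr_bas0: "Lr (coef A) (bas 0) (- hl A)"
  unfolding Lr_def
proof (intro conjI allI)
  show "hh (bas 0)"
    unfolding hh_def by (rule finite_nonzero_values_imp_summable_on) (rule finite_subset[of _ "{0}"], auto)
  show "of_nat n * coef (bas 0) n - (\<Sum>\<^sub>\<infinity>m. coef A (int n - int m) * coef (bas 0) m) = coef (- hl A) n" for n
    by (subst infsum_single[of 0]) auto
qed

lemma hh_shl:
  assumes "hh f" shows "hh (shl f)"
proof -
  have "(\<lambda>n. real (Suc n) * (cmod (coef f n))\<^sup>2) summable_on (range Suc)"
    by (rule summable_on_subset[OF assms[unfolded hh_def]]) simp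
  then have "(\<lambda>n. real (Suc (Suc n)) * (cmod (coef f (Suc n)))\<^sup>2) summable_on UNIV"
    using summable_on_reindex[of Suc UNIV "\<lambda>n. real (Suc n) * (cmod (coef f n))\<^sup>2"] by (simp add: o_def)
  then show ?thesis unfolding hh_def coef_shl
    by (rule summable_on_le) (auto intro: mult_right_mono)
qed

lemma infsum_nat_shift:
  fixes g :: "nat \<Rightarrow> 'b :: banach"
  assumes "g summable_on UNIV"
  shows "infsum g UNIV = g 0 + (\<Sum>\<^sub>\<infinity>n. g (Suc n))"
proof -
  have "(\<lambda>n. g (Suc n)) summable_on UNIV"
    using summable_on_reindex[of Suc UNIV g] summable_on_subset_banach[OF assms, of "range Suc"] by (simp add: o_def)
  from infsumI[OF has_sum_nat_shift[OF has_sum_infsum[OF this]]] show ?thesis .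
qed

lemma infsum_nat_split:
  fixes g :: "nat \<Rightarrow> 'b :: banach"
  assumes "g summable_on UNIV"
  shows "infsum g UNIV = (\<Sum>m<j. g m) + (\<Sum>\<^sub>\<infinity>m. g (m + j))"
proof -
  have r: "range (\<lambda>m. m + j) = {j..}"
    by (auto simp: image_iff) (metis le_add_diff_inverse2)
  have s: "g summable_on {..<j}" "g summable_on {j..}"
    using summable_on_subset_banach[OF assms] by auto
  have "infsum g UNIV = infsum g ({..<j} \<union> {j..})" by (rule arg_cong[of _ _ "infsum g"]) auto
  also have "\<dots> = (\<Sum>m<j. g m) + infsum g {j..}"
    by (subst infsum_Un_disjoint[OF s]) auto
  also have "infsum g {j..} = (\<Sum>\<^sub>\<infinity>m. g (m + j))"
    using infsum_reindex[of "\<lambda>m. m + j" UNIV g] by (simp add: r o_def inj_def)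
  finally show ?thesis .
qed

text \<open>The commutator of L with the backward shift is minus that shift, from D, plus a rank one
  term: shifting the Toeplitz matrix along its diagonal loses exactly the column m = 0.\<close>

lemma Lr_shl:
  assumes L: "Lr (coef A) f g"
  shows "Lr (coef A) (shl f) (shl g - shl f + cmul (coef f 0) (shl (hl A)))"
  unfolding Lr_def
proof (intro conjI allI)
  show "hh (shl f)" using L hh_shl by (simp add: Lr_def)
  fix n
  have eq: "of_nat (Suc n) * coef f (Suc n) - (\<Sum>\<^sub>\<infinity>m. coef A (int (Suc n) - int m) * coef f m) = coef g (Suc n)"
    using L unfolding Lr_def by blast
  have "(\<Sum>\<^sub>\<infinity>m. coef A (int (Suc n) - int m) * coef f m)
      = coef A (int (Suc n)) * coef f 0 + (\<Sum>\<^sub>\<infinity>m. coef A (int n - int m) * coef f (Suc m))"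
    by (subst infsum_nat_shift[OF toeplitz_summable]) simp
  with eq show "of_nat n * coef (shl f) n - (\<Sum>\<^sub>\<infinity>m. coef A (int n - int m) * coef (shl f) m) =
      coef (shl g - shl f + cmul (coef f 0) (shl (hl A))) n"
    by (simp add: coef_shl algebra_simps)
qed

text \<open>The symmetry <L f, 1> = <f, L 1> with L 1 = - X, read off from row 0.\<close>

lemma Lr_coef_0:
  assumes "Lr (coef A) f g" "herm (coef A)" shows "coef g 0 = - cin f (hl A)"
proof -
  have "coef g 0 = - (\<Sum>\<^sub>\<infinity>m. coef A (- int m) * coef f m)"
  proof -
    have "of_nat 0 * coef f 0 - (\<Sum>\<^sub>\<infinity>m. coef A (int 0 - int m) * coef f m) = coef g 0"
      using assms(1) unfolding Lr_def by blast
    then show ?thesis by simp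
  qed
  also have "(\<Sum>\<^sub>\<infinity>m. coef A (- int m) * coef f m) = cin f (hl A)"
    using assms(2) by (simp add: cin_def herm_def mult.commute)
  finally show ?thesis .
qed

section \<open>Square-summable data: the resolvent along powers of \<open>K\<close>, and
  purity\<close>

locale lax_smooth = lax_group \<phi> "coef A" \<kappa> \<mu> for \<phi> and A :: "int ell2" and \<kappa> \<mu>
begin

abbreviation X :: "nat ell2" where "X \<equiv> hl A"

lemma herm_A: "herm (coef A)" using good by (simp add: good_def)

lemma Lr_K:
  assumes "Lr (coef A) f g"
  shows "Lr (coef A) (K t f) (K t g - K t f + cmul (coef f 0) (K t X))"
proof -
  have "Lr (coef A) (cmul (cis t) (E (2 * t) (shl f))) (cmul (cis t) (E (2 * t) (shl g - shl f + cmul (coef f 0) (shl X))))"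
    by (intro Lr_cmul[OF good] Lr_E Lr_shl assms)
  also have "cmul (cis t) (E (2 * t) (shl g - shl f + cmul (coef f 0) (shl X))) = K t g - K t f + cmul (coef f 0) (K t X)"
    by (simp add: K_def bclD[OF E_bcl] cmul_add cmul_diff mult.commute)
  finally show ?thesis by (simp only: K_def)
qed

text \<open>The unknown term R K X, R the resolvent at \<kappa>' + 1, occurs both in the commutation
  formula for f and in that for \<open>bas 0\<close>, where K (\<open>bas 0\<close>) = 0 makes it
  explicit. Eliminating it writes R K f as K of a vector; pairing with K f and using f_0 = 0 removes
  K altogether.\<close>

lemma resolvent_step:
  assumes k: "\<kappa> \<le> \<kappa>'" and f0: "coef f 0 = 0"
  defines "v \<equiv> coef (Rs (coef A) \<kappa>' f) 0" and "\<rho> \<equiv> Re (cin (Rs (coef A) \<kappa>' (bas 0)) (bas 0))"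
  shows "Re (cin (Rs (coef A) (\<kappa>' + 1) (K t f)) (K t f)) = Re (cin (Rs (coef A) \<kappa>' f) f) - (cmod v)\<^sup>2 / \<rho>"
    and "\<rho> \<ge> 3 / (8 * \<kappa>')"
proof -
  let ?a = "coef A"
  have g: "good ?a \<kappa>'" "good ?a (\<kappa>' + 1)" using good_mono[OF good] k by auto
  note k1 = goodD(2)[OF g(1)]
  define e where "e = Rs ?a \<kappa>' (bas 0)"
  have "dmul (gd \<kappa>') (bas 0) = cmul (gd \<kappa>' 0) (bas 0)" by (rule ell2_eqI) (simp add: coef_G k1)
  then have "(norm (dmul (gd \<kappa>') (bas 0)))\<^sup>2 = 1 / \<kappa>'" using k1 by (simp add: cmod_gd power_divide)
  then show rho: "\<rho> \<ge> 3 / (8 * \<kappa>')" using Rs_form(1)[OF g(1), of "bas 0"] by (simp add: \<rho>_def)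
  have rho0: "\<rho> > 0" by (rule less_le_trans[OF _ rho]) (use k1 in simp)
  have "cin e (bas 0) = cnj (cin e (bas 0))"
    unfolding e_def by (subst (2) cin_commute) (simp only: Rs_adjoint[OF g(1)] complex_cnj_cnj)
  then have "Im (coef e 0) = 0" by (simp add: complex_eq_iff)
  then have e0: "coef e 0 = of_real \<rho>" by (simp add: \<rho>_def e_def complex_eq_iff)
  have "shl (bas 0) = 0" by (rule ell2_eqI) (simp add: coef_shl)
  then have K1: "K t (bas 0) = 0" by (simp add: K_def bclD[OF E_bcl])
  \<comment> \<open>By the commutator, (L + \<kappa>' + 1) K r = K (L + \<kappa>') r + r_0 K X: the
    term - K r is absorbed by raising the parameter by 1.\<close>
  have step: "K t (Rs ?a \<kappa>' h) = Rs ?a (\<kappa>' + 1) (K t h + cmul (coef (Rs ?a \<kappa>' h) 0) (K t X))" for h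
  proof -
    let ?r = "Rs ?a \<kappa>' h"
    have "Lr ?a (K t ?r) (K t (h - cmul (of_real \<kappa>') ?r) - K t ?r + cmul (coef ?r 0) (K t X))"
      by (rule Lr_K[OF Lr_Rs[OF g(1)]])
    then have "K t ?r = Rs ?a (\<kappa>' + 1) (K t (h - cmul (of_real \<kappa>') ?r) - K t ?r + cmul (coef ?r 0) (K t X) + cmul (of_real (\<kappa>' + 1)) (K t ?r))"
      by (rule iffD1[OF Lr_iff[OF g(2)]])
    also have "K t (h - cmul (of_real \<kappa>') ?r) - K t ?r + cmul (coef ?r 0) (K t X) + cmul (of_real (\<kappa>' + 1)) (K t ?r)
        = K t h + cmul (coef ?r 0) (K t X)"
      by (simp add: bclD[OF K_bcl] cmul_add_left)
    finally show ?thesis .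
  qed
  let ?R = "Rs ?a (\<kappa>' + 1)" let ?v = "Rs ?a \<kappa>' f"
  have "K t e = cmul (of_real \<rho>) (?R (K t X))"
    using step[of "bas 0"] by (simp add: K1 e0 flip: e_def bclD(4)[OF bcl_Rs[OF g(2)]])
  moreover have "K t ?v = ?R (K t f) + cmul v (?R (K t X))"
    unfolding step by (simp add: v_def bclD[OF bcl_Rs[OF g(2)]])
  ultimately have RK: "?R (K t f) = K t (?v - cmul (v / of_real \<rho>) e)"
    using rho0 by (simp add: bclD[OF K_bcl])
  have "cin (?R (K t f)) (K t f) = cin (?v - cmul (v / of_real \<rho>) e) f"
    unfolding RK K_adj Ks_K by (simp add: f0)
  also have "\<dots> = cin ?v f - v / of_real \<rho> * cin e f" by (simp add: cin_diff_left)
  also have "cin e f = cnj v"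
    unfolding e_def v_def by (simp add: Rs_adjoint[OF g(1)])
  also have "v / of_real \<rho> * cnj v = of_real ((cmod v)\<^sup>2 / \<rho>)"
    by (simp add: complex_norm_square[symmetric] del: of_real_power)
  finally show "Re (cin (?R (K t f)) (K t f)) = Re (cin ?v f) - (cmod v)\<^sup>2 / \<rho>" by simp
qed

text \<open>From L 1 = - X follows \<kappa>' R 1 = 1 + R X. As f_0 = 0, the coefficient is <f, R X>
  / \<kappa>', which gains a power of \<kappa>' over the bound from the norm of R alone.\<close>

lemma resolvent_coef_0_bound:
  assumes k: "\<kappa> \<le> \<kappa>'" and f0: "coef f 0 = 0"
  shows "cmod (coef (Rs (coef A) \<kappa>' f) 0) \<le> 3 / 2 * norm f * norm X / \<kappa>'\<^sup>2"
proof -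
  let ?R = "Rs (coef A) \<kappa>'"
  have g: "good (coef A) \<kappa>'" using good_mono[OF good k] .
  note k1 = goodD(2)[OF g]
  have "bas 0 = ?R (- X + cmul (of_real \<kappa>') (bas 0))" by (rule iffD1[OF Lr_iff[OF g] Lr_bas0])
  also have "\<dots> = cmul (of_real \<kappa>') (?R (bas 0)) - ?R X"
    using bclD(3)[OF bcl_Rs[OF g], of "cmul (of_real \<kappa>') (bas 0)" X] by (simp add: bclD[OF bcl_Rs[OF g]])
  finally have "cmul (of_real \<kappa>') (?R (bas 0)) = bas 0 + ?R X" by (simp add: eq_diff_eq)
  then have "cin f (cmul (of_real \<kappa>') (?R (bas 0))) = cin f (bas 0 + ?R X)" by simp
  then have "of_real \<kappa>' * coef (?R f) 0 = cin f (?R X)"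
    by (simp add: cin_add_right f0 Rs_adjoint[OF g, of f "bas 0", symmetric])
  then have "\<kappa>' * cmod (coef (?R f) 0) = cmod (cin f (?R X))"
    using k1 by (metis abs_of_nonneg norm_mult norm_of_real order_trans zero_le_one)
  also have "\<dots> \<le> norm f * (3 / 2 / \<kappa>' * norm X)"
    by (rule order_trans[OF cin_le mult_left_mono[OF norm_Rs[OF g]]]) simp
  finally show ?thesis using k1 by (simp add: field_simps power2_eq_square)
qed

text \<open>Follow the form of the resolvent at k + i on \<open>(K t ^^ i) f\<close>. Each step
  loses at most M / (k + i)^3, and the values tend to 0 because the vectors stay bounded; so the
  initial value is at most 2 M / k^2. But it dominates a multiple of |f_n|^2 / (n + k), and k ->
  \<infinity> forces f_n = 0.\<close>

lemma K_pure:
  assumes f: "\<And>n. coef ((K t ^^ n) f) 0 = 0"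
  shows "f = 0"
proof -
  let ?a = "coef A"
  \<comment> \<open>6 = (3/2)^2 * 8/3, from the bound on v and the lower bound 3 / (8 \<kappa>') on
    \<rho>.\<close>
  define M where "M = 6 * (norm f)\<^sup>2 * (norm X)\<^sup>2"
  have M0: "M \<ge> 0" by (simp add: M_def)
  have form: "Re (cin (Rs ?a k f) f) \<le> 2 * M / k\<^sup>2" if k: "\<kappa> \<le> k" for k
  proof -
    note k1 = goodD(2)[OF good_mono[OF good k]]
    define ki where "ki i = k + real i" for i
    define c where "c i = Re (cin (Rs ?a (ki i) ((K t ^^ i) f)) ((K t ^^ i) f))" for i
    have gi: "good ?a (ki i)" and ki: "\<kappa> \<le> ki i" "1 \<le> ki i" for i
      using good_mono[OF good, of "ki i"] k k1 by (auto simp: ki_def)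
    have nf: "norm ((K t ^^ i) f) \<le> norm f" for i by (rule norm_funpow_le[of "K t", OF norm_K])
    have dec: "c i - 2 * M / (ki i)\<^sup>2 \<le> c (Suc i) - 2 * M / (ki (Suc i))\<^sup>2" for i
    proof -
      let ?f = "(K t ^^ i) f" let ?x = "ki i"
      define v where "v = coef (Rs ?a ?x ?f) 0"
      define \<rho> where "\<rho> = Re (cin (Rs ?a ?x (bas 0)) (bas 0))"
      have sx: "ki (Suc i) = ?x + 1" by (simp add: ki_def)
      have cS: "c (Suc i) = c i - (cmod v)\<^sup>2 / \<rho>" and rho: "\<rho> \<ge> 3 / (8 * ?x)"
        using resolvent_step(1)[OF ki(1)[of i] f[of i], of t] resolvent_step(2)[OF ki(1)[of i] f[of i]] by (simp_all add: c_def sx v_def \<rho>_def)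
      have x1: "?x \<ge> 1" by (rule ki)
      have "cmod v \<le> 3 / 2 * norm ?f * norm X / ?x\<^sup>2"
        unfolding v_def by (rule resolvent_coef_0_bound[OF ki(1) f])
      also have "\<dots> \<le> 3 / 2 * norm f * norm X / ?x\<^sup>2"
        by (intro divide_right_mono mult_right_mono mult_left_mono nf) auto
      finally have "(cmod v)\<^sup>2 \<le> (3 / 2 * norm f * norm X / ?x\<^sup>2)\<^sup>2" by (intro power_mono) auto
      then have "(cmod v)\<^sup>2 / \<rho> \<le> (3 / 2 * norm f * norm X / ?x\<^sup>2)\<^sup>2 / (3 / (8 * ?x))"
        using rho x1 by (intro frac_le) auto
      also have "\<dots> = M / ?x ^ 3"
        using x1 by (simp add: M_def field_simps power2_eq_square power3_eq_cube)
      also have "\<dots> \<le> 2 * M / ?x\<^sup>2 - 2 * M / (?x + 1)\<^sup>2"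
      proof -
        have "1 / ?x ^ 3 \<le> 2 / ?x\<^sup>2 - 2 / (?x + 1)\<^sup>2" by (rule inverse_cube_le[OF x1])
        then have "M * (1 / ?x ^ 3) \<le> M * (2 / ?x\<^sup>2 - 2 / (?x + 1)\<^sup>2)" by (rule mult_left_mono[OF _ M0])
        then show ?thesis by (simp add: algebra_simps)
      qed
      finally show ?thesis by (simp add: cS sx)
    qed
    \<comment> \<open>Subtracting the telescoping bound makes the sequence nondecreasing; it lies
      below a null sequence, so its first term is at most 0.\<close>
    define s where "s i = c i - 2 * M / (ki i)\<^sup>2" for i
    have "s i \<le> 3 / 2 * (norm f)\<^sup>2 / ki i" for i
    proof -
      have "c i \<le> cmod (cin (Rs ?a (ki i) ((K t ^^ i) f)) ((K t ^^ i) f))" by (simp add: c_def complex_Re_le_cmod)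
      also have "\<dots> \<le> norm (Rs ?a (ki i) ((K t ^^ i) f)) * norm ((K t ^^ i) f)" by (rule cin_le)
      also have "\<dots> \<le> (3 / 2 / ki i * norm f) * norm f"
      proof (rule mult_mono[OF _ nf])
        have "norm (Rs ?a (ki i) ((K t ^^ i) f)) \<le> 3 / 2 / ki i * norm ((K t ^^ i) f)" by (rule norm_Rs[OF gi])
        also have "\<dots> \<le> 3 / 2 / ki i * norm f" using ki(2)[of i] by (intro mult_left_mono nf) simp
        finally show "norm (Rs ?a (ki i) ((K t ^^ i) f)) \<le> 3 / 2 / ki i * norm f" .
      qed (use ki(2)[of i] in auto)
      finally have "c i \<le> 3 / 2 * (norm f)\<^sup>2 / ki i" by (simp add: power2_eq_square)
      moreover have "0 \<le> 2 * M / (ki i)\<^sup>2" using M0 by simp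
      ultimately show ?thesis unfolding s_def by linarith
    qed
    moreover have "(\<lambda>i. 3 / 2 * (norm f)\<^sup>2 / ki i) \<longlonglongrightarrow> 0"
      unfolding ki_def by (intro tendsto_divide_0[OF tendsto_const] filterlim_tendsto_add_at_top[OF tendsto_const] filterlim_at_top_imp_at_infinity filterlim_real_sequentially)
    moreover have "s 0 \<le> s i" for i
      by (rule incseqD[of s]) (auto simp: incseq_Suc_iff s_def dec)
    ultimately have "s 0 \<le> 0"
      by (intro LIMSEQ_le_const[of _ 0 "s 0"]) (auto intro: order_trans)
    then show ?thesis by (simp add: s_def c_def ki_def)
  qed
  have "coef f n = 0" for n
  proof -
    have le: "(cmod (coef f n))\<^sup>2 \<le> 8 / 3 * (2 * M) * ((real n + k) / k\<^sup>2)" if k: "\<kappa> \<le> k" for k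
    proof -
      have g: "good ?a k" by (rule good_mono[OF good k])
      note k1 = goodD(2)[OF g]
      have "(cmod (coef f n))\<^sup>2 / (real n + k) = (cmod (coef (dmul (gd k) f) n))\<^sup>2"
        using k1 by (simp add: coef_G norm_mult cmod_gd power_divide)
      also have "\<dots> \<le> (norm (dmul (gd k) f))\<^sup>2" by (intro power_mono coef_le_norm) auto
      also have "\<dots> \<le> 8 / 3 * Re (cin (Rs ?a k f) f)" using Rs_form(1)[OF g, of f] by simp
      also have "\<dots> \<le> 8 / 3 * (2 * M / k\<^sup>2)" by (intro mult_left_mono form k) simp
      finally show ?thesis using k1 by (simp add: field_simps)
    qed
    have "((\<lambda>k. 8 / 3 * (2 * M) * ((real n + k) / k\<^sup>2)) \<longlongrightarrow> 8 / 3 * (2 * M) * 0) at_top"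
    proof (intro tendsto_mult tendsto_const)
      have "((\<lambda>k::real. real n * (1 / k * (1 / k)) + 1 / k) \<longlongrightarrow> real n * (0 * 0) + 0) at_top"
        by (intro tendsto_intros tendsto_divide_0[OF tendsto_const] filterlim_at_top_imp_at_infinity filterlim_ident)
      moreover have "\<forall>\<^sub>F k in at_top. real n * (1 / k * (1 / k)) + 1 / k = (real n + k) / k\<^sup>2"
        using eventually_gt_at_top[of 0] by eventually_elim (simp add: power2_eq_square field_simps)
      ultimately show "((\<lambda>k. (real n + k) / k\<^sup>2) \<longlongrightarrow> 0) at_top"
        using tendsto_cong by force
    qed
    then have "((\<lambda>k. 8 / 3 * (2 * M) * ((real n + k) / k\<^sup>2)) \<longlongrightarrow> 0) at_top" by simp
    then have "(cmod (coef f n))\<^sup>2 \<le> 0"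
      by (rule tendsto_lowerbound) (use le in \<open>auto intro: eventually_at_top_linorderI[of \<kappa>]\<close>)
    then show ?thesis by simp
  qed
  then show ?thesis by (intro ell2_eqI) simp
qed

sublocale W: pure_coisometry "K t" "Ks t" for t
  by unfold_locales (rule K_bcl Ks_bcl K_adj K_Ks Ks_K K_pure; assumption?)+

end

section \<open>Convolution estimates and regularity\<close>

lemma hsm_swap:
  fixes A :: "'a \<Rightarrow> 'b \<Rightarrow> complex"
  shows "hsm (\<lambda>m n. A n m) \<longleftrightarrow> hsm A" "hs (\<lambda>m n. A n m) = hs A"
proof -
  have b: "bij_betw (\<lambda>(x, y). (y, x)) UNIV (UNIV :: ('a \<times> 'b) set)"
    by (rule bij_betwI[where g = "\<lambda>(x, y). (y, x)"]) auto
  show "hsm (\<lambda>m n. A n m) \<longleftrightarrow> hsm A"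
    unfolding hsm_def using summable_on_reindex_bij_betw[OF b, of "\<lambda>(n, m). (cmod (A n m))\<^sup>2"]
    by (simp add: case_prod_unfold)
  show "hs (\<lambda>m n. A n m) = hs A"
    unfolding hs_def using infsum_reindex_bij_betw[OF b, of "\<lambda>(n, m). (cmod (A n m))\<^sup>2"]
    by (simp add: case_prod_unfold)
qed

lemma hs_rowweight:
  fixes A :: "'a \<Rightarrow> 'b \<Rightarrow> complex"
  assumes rows: "\<And>n. (\<lambda>m. (cmod (c n m))\<^sup>2) summable_on UNIV" "\<And>n. (\<Sum>\<^sub>\<infinity>m. (cmod (c n m))\<^sup>2) \<le> M"
    and r: "r summable_on UNIV" "\<And>n. 0 \<le> r n"
    and le: "\<And>n m. (cmod (A n m))\<^sup>2 \<le> r n * (cmod (c n m))\<^sup>2"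
  shows "hsm A" "hs A \<le> infsum r UNIV * M"
proof -
  have s: "(\<lambda>m. (cmod (A n m))\<^sup>2) summable_on UNIV" for n
    by (rule summable_on_le[OF summable_on_cmult_right[OF rows(1)]]) (use le in auto)
  have l: "(\<Sum>\<^sub>\<infinity>m. (cmod (A n m))\<^sup>2) \<le> r n * M" for n
  proof -
    have "(\<Sum>\<^sub>\<infinity>m. (cmod (A n m))\<^sup>2) \<le> (\<Sum>\<^sub>\<infinity>m. r n * (cmod (c n m))\<^sup>2)"
      by (intro infsum_mono s summable_on_cmult_right rows le)
    also have "\<dots> \<le> r n * M" unfolding infsum_cmult_right' by (intro mult_left_mono rows r)
    finally show ?thesis .
  qed
  have s2: "(\<lambda>n. \<Sum>\<^sub>\<infinity>m. (cmod (A n m))\<^sup>2) summable_on UNIV"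
    by (rule summable_on_le[OF summable_on_cmult_left[OF r(1), of M]]) (auto intro: l infsum_nonneg)
  show h: "hsm A" by (rule hsmI[OF s s2])
  have "hs A = (\<Sum>\<^sub>\<infinity>n. \<Sum>\<^sub>\<infinity>m. (cmod (A n m))\<^sup>2)" by (rule hs_rows(2)[OF h])
  also have "\<dots> \<le> (\<Sum>\<^sub>\<infinity>n. r n * M)" by (intro infsum_mono s2 summable_on_cmult_left r l)
  finally show "hs A \<le> infsum r UNIV * M" by (simp add: infsum_cmult_left')
qed

text \<open>1 + |k| in place of \<open>japanese\<close>: it equals n + 1 on the Hardy side and is
  subadditive, and the two weights differ by a factor of at most 2
  (\<open>japanese_le_jw\<close>).\<close>

definition jw :: "int \<Rightarrow> real" where "jw k = \<bar>real_of_int k\<bar> + 1"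

lemma jw_ge1: "jw k \<ge> 1" by (simp add: jw_def)

lemma jw_int [simp]: "jw (int n) = real n + 1" by (simp add: jw_def)

lemma jw_add: "jw (k + l) \<le> jw k + jw l" by (simp add: jw_def)

lemma nat_powr_summable: "(\<lambda>n. (real n + 1) powr (- 3 / 2)) summable_on UNIV"
proof -
  have "summable (\<lambda>n. real n powr (- 3 / 2))" by (simp add: summable_real_powr_iff)
  then have "summable (\<lambda>n. real (Suc n) powr (- 3 / 2))" by (subst summable_Suc_iff)
  then have "summable (\<lambda>n. (real n + 1) powr (- 3 / 2))" by (simp add: add.commute)
  then show ?thesis by (subst summable_on_UNIV_nonneg_real_iff) auto
qed

lemma jw_powr_summable: "(\<lambda>k. jw k powr (- 3 / 2)) summable_on UNIV"
proof -
  have 1: "(\<lambda>n. jw (int n) powr (- 3 / 2)) summable_on UNIV"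
    using nat_powr_summable by simp
  have "(\<lambda>n. jw (- 1 - int n) powr (- 3 / 2)) summable_on UNIV"
  proof (rule summable_on_le[OF nat_powr_summable])
    show "jw (- 1 - int n) powr (- 3 / 2) \<le> (real n + 1) powr (- 3 / 2)" for n
      by (rule powr_mono2') (auto simp: jw_def)
  qed auto
  from has_sum_int_halves[OF has_sum_infsum[OF 1] has_sum_infsum[OF this]] show ?thesis
    by (rule has_sum_imp_summable)
qed

definition cS :: real where "cS = (\<Sum>\<^sub>\<infinity>k. jw k powr (- 3 / 2))"

lemma cS_nonneg: "cS \<ge> 0" unfolding cS_def by (rule infsum_nonneg) auto

lemma shift_row:
  fixes P :: "int ell2"
  shows "(\<lambda>n. (cmod (coef P (n - k)))\<^sup>2) summable_on UNIV" "(\<Sum>\<^sub>\<infinity>n. (cmod (coef P (n - k)))\<^sup>2) = (norm P)\<^sup>2"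
proof -
  have b: "bij_betw (\<lambda>n. n - k) UNIV UNIV" by (rule bij_betwI[where g = "\<lambda>n. n + k"]) auto
  show "(\<lambda>n. (cmod (coef P (n - k)))\<^sup>2) summable_on UNIV" "(\<Sum>\<^sub>\<infinity>n. (cmod (coef P (n - k)))\<^sup>2) = (norm P)\<^sup>2"
    using summable_on_reindex_bij_betw[OF b, of "\<lambda>n. (cmod (coef P n))\<^sup>2"]
      infsum_reindex_bij_betw[OF b, of "\<lambda>n. (cmod (coef P n))\<^sup>2"] coef_summable[of P]
    by (simp_all add: norm_sq_infsum)
qed

lemma shift_row':
  fixes P :: "int ell2"
  shows "(\<lambda>k. (cmod (coef P (n - k)))\<^sup>2) summable_on UNIV" "(\<Sum>\<^sub>\<infinity>k. (cmod (coef P (n - k)))\<^sup>2) = (norm P)\<^sup>2"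
proof -
  have b: "bij_betw (\<lambda>k. n - k) UNIV UNIV" by (rule bij_betwI[where g = "\<lambda>k. n - k"]) auto
  show "(\<lambda>k. (cmod (coef P (n - k)))\<^sup>2) summable_on UNIV" "(\<Sum>\<^sub>\<infinity>k. (cmod (coef P (n - k)))\<^sup>2) = (norm P)\<^sup>2"
    using summable_on_reindex_bij_betw[OF b, of "\<lambda>n. (cmod (coef P n))\<^sup>2"]
      infsum_reindex_bij_betw[OF b, of "\<lambda>n. (cmod (coef P n))\<^sup>2"] coef_summable[of P]
    by (simp_all add: norm_sq_infsum)
qed

definition cv :: "int ell2 \<Rightarrow> int ell2 \<Rightarrow> int \<Rightarrow> complex" where
  "cv P Q n = (\<Sum>\<^sub>\<infinity>k. coef P (n - k) * coef Q k)"

lemma cv_summable: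
  fixes P Q :: "int ell2"
  shows "(\<lambda>k. coef P (n - k) * coef Q k) summable_on UNIV"
  "(\<lambda>k. cmod (coef P (n - k) * coef Q k)) summable_on UNIV"
proof -
  show "(\<lambda>k. coef P (n - k) * coef Q k) summable_on UNIV"
    by (rule row_prod_summable(2)[OF shift_row'(1)])
  show "(\<lambda>k. cmod (coef P (n - k) * coef Q k)) summable_on UNIV"
    by (rule row_prod_summable(1)[OF shift_row'(1)])
qed

lemma cv_commute: "cv P Q n = cv Q P n"
proof -
  have b: "bij_betw (\<lambda>k. n - k) UNIV UNIV" by (rule bij_betwI[where g = "\<lambda>k. n - k"]) auto
  show ?thesis
    unfolding cv_def using infsum_reindex_bij_betw[OF b, of "\<lambda>k. coef P (n - k) * coef Q k"]
    by (simp add: mult.commute)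
qed

text \<open>Young's inequality \<open>\<ell>\<^sup>2 * \<ell>\<^sup>1 \<subseteq> \<ell>\<^sup>2\<close>, with \<open>\<ell>\<^sup>1\<close> replaced by a weighted \<open>\<ell>\<^sup>2\<close>.\<close>

lemma young:
  assumes "\<And>k. coef Q k = of_real (jw k powr (- 3 / 4)) * coef \<psi> k"
  obtains R where "\<And>n. coef R n = cv P Q n" "norm R \<le> sqrt cS * norm P * norm \<psi>"
proof -
  define A where "A n k = coef P (n - k) * of_real (jw k powr (- 3 / 4))" for n k
  have sq: "(jw k powr (- 3 / 4))\<^sup>2 = jw k powr (- 3 / 2)" for k
    by (simp add: power2_eq_square flip: powr_add)
  have "(cmod (A n k))\<^sup>2 \<le> jw k powr (- 3 / 2) * (cmod (coef P (n - k)))\<^sup>2" for n k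
    unfolding A_def norm_mult power_mult_distrib norm_of_real power2_abs sq by simp
  then have "hsm (\<lambda>k n. A n k)" "hs (\<lambda>k n. A n k) \<le> cS * (norm P)\<^sup>2"
    unfolding cS_def
    using hs_rowweight[of "\<lambda>k n. coef P (n - k)" "(norm P)\<^sup>2" "\<lambda>k. jw k powr (- 3 / 2)" "\<lambda>k n. A n k"]
    by (simp_all add: shift_row jw_powr_summable[simplified])
  then have h: "hsm A" "hs A \<le> (sqrt cS * norm P)\<^sup>2"
    unfolding hsm_swap[of A] by (simp_all add: power_mult_distrib cS_nonneg)
  have "coef (matop A \<psi>) n = cv P Q n" for n
    by (simp add: coef_matop[OF h(1)] cv_def A_def assms mult_ac)
  moreover have "norm (matop A \<psi>) \<le> sqrt cS * norm P * norm \<psi>"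
    by (rule norm_matop_le[OF h]) (simp add: cS_nonneg)
  ultimately show thesis by (rule that)
qed

lemma young1:
  assumes "\<And>k. coef Q1 k = of_real (jw k) * coef Q k"
  obtains R where "\<And>n. coef R n = cv P Q n" "norm R \<le> sqrt cS * norm P * norm Q1"
proof -
  have le: "cmod (of_real (jw k powr (- 1 / 4))) \<le> 1" for k
    using jw_ge1[of k] powr_mono[of "- 1 / 4" 0 "jw k"] by simp
  define \<psi> where "\<psi> = dmul (\<lambda>k. of_real (jw k powr (- 1 / 4))) Q1"
  have c: "coef \<psi> k = of_real (jw k powr (- 1 / 4)) * coef Q1 k" for k
    unfolding \<psi>_def by (rule coef_dmul[OF le])
  have "coef Q k = of_real (jw k powr (- 3 / 4)) * coef \<psi> k" for k
  proof -
    have "jw k powr (- 3 / 4) * (jw k powr (- 1 / 4) * jw k) = jw k powr (- 3 / 4 + - 1 / 4 + 1)"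
      using jw_ge1[of k] by (simp only: powr_add powr_one_gt_zero_iff) simp
    also have "\<dots> = 1" using jw_ge1[of k] by simp
    finally have "complex_of_real (jw k powr (- 3 / 4)) * (of_real (jw k powr (- 1 / 4)) * of_real (jw k)) = 1"
      by (simp flip: of_real_mult)
    then show ?thesis unfolding c assms by (metis mult.assoc mult_1)
  qed
  from young[of Q \<psi> P, OF this] obtain R where R: "\<And>n. coef R n = cv P Q n" "norm R \<le> sqrt cS * norm P * norm \<psi>"
    by blast
  note R(2)
  also have "sqrt cS * norm P * norm \<psi> \<le> sqrt cS * norm P * norm Q1"
  proof (rule mult_left_mono)
    show "norm \<psi> \<le> norm Q1"
      using norm_dmul[of "\<lambda>k. of_real (jw k powr (- 1 / 4))" 1 Q1, OF le] by (simp add: \<psi>_def)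
  qed (simp add: cS_nonneg)
  finally have "norm R \<le> sqrt cS * norm P * norm Q1" .
  with R(1) show thesis by (rule that)
qed

text \<open>H^1 is an algebra: subadditivity of the weight puts it on one factor at a time, and
  Young's inequality bounds both terms. The factors are first replaced by their moduli
  (\<open>av\<close>), so that the convolutions can be compared term by term.\<close>

lemma h1_conv:
  assumes P: "\<And>k. coef P1 k = of_real (jw k) * coef P k" and Q: "\<And>k. coef Q1 k = of_real (jw k) * coef Q k"
  obtains R where "\<And>n. coef R n = of_real (jw n) * cv P Q n" "norm R \<le> 2 * sqrt cS * norm P1 * norm Q1"
proof -
  define av where "av F = Abs_ell2 (\<lambda>k. complex_of_real (cmod (coef F k)))" for F :: "int ell2"
  have av: "coef (av F) k = of_real (cmod (coef F k))" "norm (av F) = norm F" for F k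
  proof -
    have 1: "coef (av F) = (\<lambda>k. of_real (cmod (coef F k)))"
      unfolding av_def by (rule coef_Abs_ell2) (simp add: coef_summable)
    show "coef (av F) k = of_real (cmod (coef F k))" "norm (av F) = norm F" by (simp_all add: 1 norm_infsum)
  qed
  have w: "\<bar>jw k\<bar> = jw k" for k using jw_ge1[of k] by simp
  have P': "coef (av P1) k = of_real (jw k) * coef (av P) k" and Q': "coef (av Q1) k = of_real (jw k) * coef (av Q) k" for k
    by (simp_all add: av P Q norm_mult w)
  have le1: "norm F \<le> norm F1" if "\<And>k. coef F1 k = of_real (jw k) * coef F k" for F F1 :: "int ell2"
    using norm_mono[of F 1 F1] jw_ge1 by (simp add: that norm_mult w mult_left_le_one_le mult_le_cancel_right1)
  obtain R1 where R1: "\<And>n. coef R1 n = cv (av P1) (av Q) n" "norm R1 \<le> sqrt cS * norm (av P1) * norm (av Q1)"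
    using young1[OF Q'] by blast
  obtain R2 where R2: "\<And>n. coef R2 n = cv (av Q1) (av P) n" "norm R2 \<le> sqrt cS * norm (av Q1) * norm (av P1)"
    using young1[OF P'] by blast
  have R2': "coef R2 n = cv (av P) (av Q1) n" for n unfolding R2(1) by (rule cv_commute)
  have re: "(\<lambda>k. cmod (coef F (n - k)) * cmod (coef G k)) summable_on UNIV"
    "cv (av F) (av G) n = of_real (\<Sum>\<^sub>\<infinity>k. cmod (coef F (n - k)) * cmod (coef G k))" for F G :: "int ell2" and n
  proof -
    show s: "(\<lambda>k. cmod (coef F (n - k)) * cmod (coef G k)) summable_on UNIV"
      using cv_summable(2)[of F n G] by (simp add: norm_mult)
    show "cv (av F) (av G) n = of_real (\<Sum>\<^sub>\<infinity>k. cmod (coef F (n - k)) * cmod (coef G k))"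
      unfolding cv_def av using has_sum_of_real[OF has_sum_infsum[OF s], where 'a = complex] by (simp add: infsumI)
  qed
  have bd: "cmod (of_real (jw n) * cv P Q n) \<le> cmod (coef (R1 + R2) n)" for n
  proof -
    let ?p = "\<lambda>F G k. cmod (coef F (n - k)) * cmod (coef G k)"
    have "cmod (cv P Q n) \<le> (\<Sum>\<^sub>\<infinity>k. ?p P Q k)"
      unfolding cv_def using norm_infsum_bound[OF cv_summable(2)[of P n Q]] by (simp add: norm_mult)
    then have "jw n * cmod (cv P Q n) \<le> jw n * (\<Sum>\<^sub>\<infinity>k. ?p P Q k)"
      using jw_ge1[of n] by (intro mult_left_mono) auto
    also have "\<dots> = (\<Sum>\<^sub>\<infinity>k. jw n * ?p P Q k)" by (simp add: infsum_cmult_right')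
    also have "\<dots> \<le> (\<Sum>\<^sub>\<infinity>k. ?p P1 Q k + ?p P Q1 k)"
    proof (intro infsum_mono summable_on_add re(1) summable_on_cmult_right)
      fix k
      have "jw n * ?p P Q k \<le> (jw (n - k) + jw k) * ?p P Q k"
        using jw_add[of "n - k" k] by (intro mult_right_mono) auto
      then show "jw n * ?p P Q k \<le> ?p P1 Q k + ?p P Q1 k"
        by (simp add: P Q norm_mult w algebra_simps)
    qed
    also have "\<dots> = (\<Sum>\<^sub>\<infinity>k. ?p P1 Q k) + (\<Sum>\<^sub>\<infinity>k. ?p P Q1 k)" by (rule infsum_add[OF re(1) re(1)])
    also have "\<dots> \<le> cmod (of_real ((\<Sum>\<^sub>\<infinity>k. ?p P1 Q k) + (\<Sum>\<^sub>\<infinity>k. ?p P Q1 k)) :: complex)"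
      by (simp only: norm_of_real)
    also have "of_real ((\<Sum>\<^sub>\<infinity>k. ?p P1 Q k) + (\<Sum>\<^sub>\<infinity>k. ?p P Q1 k)) = coef (R1 + R2) n"
      by (simp add: R1(1) R2' re(2))
    finally show ?thesis by (simp add: norm_mult w)
  qed
  have "(\<lambda>n. (cmod (of_real (jw n) * cv P Q n))\<^sup>2) summable_on UNIV"
    by (rule summable_on_le[OF coef_summable[of "R1 + R2"]]) (use bd in \<open>auto intro!: power_mono\<close>)
  then have c: "coef (Abs_ell2 (\<lambda>n. of_real (jw n) * cv P Q n)) = (\<lambda>n. of_real (jw n) * cv P Q n)"
    by (rule coef_Abs_ell2)
  show thesis
  proof (rule that)
    show "coef (Abs_ell2 (\<lambda>n. of_real (jw n) * cv P Q n)) n = of_real (jw n) * cv P Q n" for n by (simp only: c)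
    have "norm (Abs_ell2 (\<lambda>n. of_real (jw n) * cv P Q n)) \<le> 1 * norm (R1 + R2)"
      by (rule norm_mono) (simp_all only: c mult_1 bd)
    also have "\<dots> \<le> norm R1 + norm R2" by (simp add: norm_triangle_ineq)
    also have "\<dots> \<le> 2 * sqrt cS * norm P1 * norm Q1"
      using R1(2) R2(2) unfolding av(2) by (simp add: mult.commute mult.left_commute)
    finally show "norm (Abs_ell2 (\<lambda>n. of_real (jw n) * cv P Q n)) \<le> 2 * sqrt cS * norm P1 * norm Q1" .
  qed
qed

text \<open>Extension by 0 turns a Toeplitz row into a convolution over all integers.\<close>

definition zex :: "nat ell2 \<Rightarrow> int ell2" where
  "zex f = Abs_ell2 (\<lambda>k. if k \<ge> 0 then coef f (nat k) else 0)"

lemma zex: "coef (zex f) k = (if k \<ge> 0 then coef f (nat k) else 0)" "norm (zex f) = norm f"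
proof -
  have 1: "((\<lambda>n. (cmod (coef f n))\<^sup>2) has_sum (norm f)\<^sup>2) UNIV"
    unfolding norm_sq_infsum by (rule has_sum_infsum[OF coef_summable])
  have h: "((\<lambda>k. (cmod (if k \<ge> 0 then coef f (nat k) else 0))\<^sup>2) has_sum ((norm f)\<^sup>2 + 0)) UNIV"
    by (rule has_sum_int_halves) (use 1 in simp_all)
  have c: "coef (zex f) = (\<lambda>k. if k \<ge> 0 then coef f (nat k) else 0)"
    unfolding zex_def by (rule coef_Abs_ell2[OF has_sum_imp_summable[OF h]])
  then show "coef (zex f) k = (if k \<ge> 0 then coef f (nat k) else 0)" by simp
  have "(norm (zex f))\<^sup>2 = (norm f)\<^sup>2" using infsumI[OF h] by (simp add: norm_sq_infsum[of "zex f"] c)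
  then show "norm (zex f) = norm f" by (simp add: power2_eq_iff_nonneg)
qed

lemma toeplitz_cv: "(\<Sum>\<^sub>\<infinity>m. coef B (n - int m) * coef f m) = cv B (zex f) n"
proof -
  have "((\<lambda>k. coef B (n - k) * coef (zex f) k) has_sum ((\<Sum>\<^sub>\<infinity>m. coef B (n - int m) * coef f m) + 0)) UNIV"
    by (rule has_sum_int_halves) (use has_sum_infsum[OF toeplitz_summable] in \<open>simp_all add: zex\<close>)
  then show ?thesis unfolding cv_def by (simp add: infsumI)
qed

lemma norm_hl: "norm (hl A) \<le> norm A"
proof (rule norm_le_finite)
  fix F :: "nat set" assume F: "finite F"
  have "(\<Sum>i\<in>F. (cmod (coef (hl A) i))\<^sup>2) = (\<Sum>i\<in>int ` F. (cmod (coef A i))\<^sup>2)"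
    by (simp add: sum.reindex)
  also have "\<dots> \<le> (norm A)\<^sup>2" by (rule finite_sum_le_norm) (use F in simp)
  finally show "(\<Sum>i\<in>F. (cmod (coef (hl A) i))\<^sup>2) \<le> (norm A)\<^sup>2" .
qed simp

section \<open>Elliptic regularity for Toeplitz equations\<close>

definition nS :: real where "nS = (\<Sum>\<^sub>\<infinity>n. (real n + 1) powr (- 3 / 2))"

lemma nS_nonneg: "nS \<ge> 0" unfolding nS_def by (rule infsum_nonneg) auto

lemma toeplitz_row_col:
  fixes B :: "int ell2"
  shows "(\<lambda>m. (cmod (coef B (n - int m)))\<^sup>2) summable_on UNIV" "(\<Sum>\<^sub>\<infinity>m. (cmod (coef B (n - int m)))\<^sup>2) \<le> (norm B)\<^sup>2"
    "(\<lambda>m. (cmod (coef B (int m - n)))\<^sup>2) summable_on UNIV" "(\<Sum>\<^sub>\<infinity>m. (cmod (coef B (int m - n)))\<^sup>2) \<le> (norm B)\<^sup>2"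
proof -
  have *: "(\<lambda>m. (cmod (coef B (\<sigma> m)))\<^sup>2) summable_on UNIV \<and> (\<Sum>\<^sub>\<infinity>m. (cmod (coef B (\<sigma> m)))\<^sup>2) \<le> (norm B)\<^sup>2"
    if i: "inj \<sigma>" for \<sigma> :: "nat \<Rightarrow> int"
  proof
    show "(\<lambda>m. (cmod (coef B (\<sigma> m)))\<^sup>2) summable_on UNIV"
      using summable_on_reindex[OF i, of "\<lambda>k. (cmod (coef B k))\<^sup>2"] coef_summable[of B "range \<sigma>"] by (simp add: o_def)
    have "(\<Sum>\<^sub>\<infinity>m. (cmod (coef B (\<sigma> m)))\<^sup>2) = infsum (\<lambda>k. (cmod (coef B k))\<^sup>2) (range \<sigma>)"
      using infsum_reindex[OF i, of "\<lambda>k. (cmod (coef B k))\<^sup>2"] by (simp add: o_def)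
    also have "\<dots> \<le> (norm B)\<^sup>2"
      unfolding norm_sq_infsum by (rule infsum_mono2) (auto intro: coef_summable)
    finally show "(\<Sum>\<^sub>\<infinity>m. (cmod (coef B (\<sigma> m)))\<^sup>2) \<le> (norm B)\<^sup>2" .
  qed
  show "(\<lambda>m. (cmod (coef B (n - int m)))\<^sup>2) summable_on UNIV" "(\<Sum>\<^sub>\<infinity>m. (cmod (coef B (n - int m)))\<^sup>2) \<le> (norm B)\<^sup>2"
    "(\<lambda>m. (cmod (coef B (int m - n)))\<^sup>2) summable_on UNIV" "(\<Sum>\<^sub>\<infinity>m. (cmod (coef B (int m - n)))\<^sup>2) \<le> (norm B)\<^sup>2"
    using *[of "\<lambda>m. n - int m"] *[of "\<lambda>m. int m - n"] by (simp_all add: inj_def)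
qed

text \<open>\<open>Lr\<close> without the form domain. The equivalence \<open>W\<close> transports
  the Lax equation row by row only; \<open>regularity\<close> restores membership in the domain
  afterwards.\<close>

definition toep_eq :: "int ell2 \<Rightarrow> nat ell2 \<Rightarrow> nat ell2 \<Rightarrow> bool" where
  "toep_eq B w g \<longleftrightarrow> (\<forall>n. of_nat n * coef w n - (\<Sum>\<^sub>\<infinity>m. coef B (int n - int m) * coef w m) = coef g n)"

lemma Lr_toep_eq: "Lr (coef B) w g \<longleftrightarrow> hh w \<and> toep_eq B w g"
  by (simp add: Lr_def toep_eq_def)

text \<open>
  Elliptic regularity. The equation \<open>w = (D + \<kappa>)\<^sup>-\<^sup>1 (g + \<kappa> w + T w)\<close> has a unique solution in \<open>\<ell>\<^sup>2\<close>,
  and one of the form \<open>w = (D + \<kappa>)\<^sup>-\<^sup>3\<^sup>/\<^sup>4 \<phi>\<close>; for the latter \<open>T w\<close> is square-summable.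
\<close>

lemma regularity:
  assumes M: "0 \<le> M"
  obtains C where "0 \<le> C"
    "\<And>B w g. norm B \<le> M \<Longrightarrow> toep_eq B w g \<Longrightarrow> \<exists>w1. (\<forall>n. coef w1 n = of_real (real n + 1) * coef w n) \<and> norm w1 \<le> C * (norm g + norm w)"
proof -
  \<comment> \<open>\<kappa> is taken as the square of z so that \<kappa>^(-1/2) = 1 / z; then z
    \<ge> 9 nS M^2 makes both Hilbert-Schmidt bounds at most 1/9.\<close>
  define z where "z = 1 + 9 * nS * M\<^sup>2"
  define \<kappa> where "\<kappa> = z\<^sup>2"
  have z1: "z \<ge> 1" unfolding z_def using nS_nonneg by simp
  have k1: "\<kappa> \<ge> 1" unfolding \<kappa>_def using z1 by simp
  have kz: "\<kappa> powr (- 1 / 2) = 1 / z"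
  proof -
    have "\<kappa> = z powr 2" using z1 by (simp add: \<kappa>_def)
    then have "\<kappa> powr (- 1 / 2) = (z powr 2) powr (- 1 / 2)" by (rule arg_cong)
    also have "\<dots> = z powr (2 * (- 1 / 2))" by (rule powr_powr)
    also have "2 * (- 1 / 2) = (- 1 :: real)" by simp
    also have "z powr (- 1) = 1 / z" by (rule powr_neg_one) (use z1 in simp)
    finally show ?thesis .
  qed
  have pos: "real n + \<kappa> > 0" "real n + \<kappa> \<ge> 1" for n using k1 by (auto intro: add_nonneg_pos)
  have le1: "(real n + \<kappa>) powr (- 1 / 2) \<le> \<kappa> powr (- 1 / 2)" for n
    using k1 by (intro powr_mono2') auto
  have le2: "(real n + \<kappa>) powr (- 3 / 2) \<le> (real n + 1) powr (- 3 / 2)" for n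
    using k1 by (intro powr_mono2') auto
  define r where "r n = \<kappa> powr (- 1 / 2) * (real n + 1) powr (- 3 / 2)" for n
  have r: "r summable_on UNIV" "r n \<ge> 0" "infsum r UNIV = nS / z" for n
  proof -
    show "r summable_on UNIV"
      unfolding r_def[abs_def] by (rule summable_on_cmult_right[OF nat_powr_summable])
    show "r n \<ge> 0" by (simp add: r_def)
    show "infsum r UNIV = nS / z"
      unfolding r_def[abs_def] infsum_cmult_right' kz nS_def by simp
  qed
  have c9: "nS / z * M\<^sup>2 \<le> 1 / 9" using z1 by (simp add: z_def field_simps)
  define C where "C = (1 + sqrt cS * M * (3 / 2)) * \<kappa>"
  have "C \<ge> 0" unfolding C_def using M k1 cS_nonneg by (intro mult_nonneg_nonneg add_nonneg_nonneg) auto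
  then show thesis
  proof (rule that)
    fix B w g assume B: "norm B \<le> M" and eq: "toep_eq B w g"
    have BM: "(norm B)\<^sup>2 \<le> M\<^sup>2" using B by (intro power_mono) auto
    define M1 where "M1 n m = of_real (1 / (real n + \<kappa>)) * coef B (int n - int m)" for n m
    define M2 where "M2 n m = of_real ((real n + \<kappa>) powr (- 1 / 4)) * coef B (int n - int m) * of_real ((real m + \<kappa>) powr (- 3 / 4))" for n m
    have sq: "((real n + \<kappa>) powr (- 1 / 4))\<^sup>2 = (real n + \<kappa>) powr (- 1 / 2)"
      "((real n + \<kappa>) powr (- 3 / 4))\<^sup>2 = (real n + \<kappa>) powr (- 3 / 2)" for n
      by (simp_all add: power2_eq_square flip: powr_add)
    have "hsm M1 \<and> hs M1 \<le> infsum r UNIV * (norm B)\<^sup>2"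
    proof (intro conjI hs_rowweight[of "\<lambda>n m. coef B (int n - int m)" "(norm B)\<^sup>2" r] toeplitz_row_col r)
      fix n m
      have "(1 / (real n + \<kappa>))\<^sup>2 = (real n + \<kappa>) powr (- 1 / 2) * (real n + \<kappa>) powr (- 3 / 2)"
      proof -
        have "(real n + \<kappa>) powr (- 1 / 2) * (real n + \<kappa>) powr (- 3 / 2) = (real n + \<kappa>) powr (- 1 / 2 + - 3 / 2)"
          by (rule powr_add[symmetric])
        also have "- 1 / 2 + - 3 / 2 = (- 2 :: real)" by simp
        also have "(real n + \<kappa>) powr (- 2) = 1 / (real n + \<kappa>) powr 2" by (rule powr_minus_divide)
        also have "(real n + \<kappa>) powr 2 = (real n + \<kappa>)\<^sup>2" using pos(1)[of n] by simp
        finally show ?thesis by (simp add: power_divide)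
      qed
      also have "\<dots> \<le> r n" unfolding r_def by (intro mult_mono le1 le2) auto
      finally have "(1 / (real n + \<kappa>))\<^sup>2 * (cmod (coef B (int n - int m)))\<^sup>2 \<le> r n * (cmod (coef B (int n - int m)))\<^sup>2"
        by (rule mult_right_mono) simp
      then show "(cmod (M1 n m))\<^sup>2 \<le> r n * (cmod (coef B (int n - int m)))\<^sup>2"
        unfolding M1_def norm_mult power_mult_distrib norm_of_real power2_abs .
      then show "(cmod (M1 n m))\<^sup>2 \<le> r n * (cmod (coef B (int n - int m)))\<^sup>2" .
    qed
    moreover have "infsum r UNIV * (norm B)\<^sup>2 \<le> 1 / 9"
      using order_trans[OF mult_left_mono[OF BM] c9] nS_nonneg z1 by (simp add: r)
    ultimately have sm1: "small M1" by (auto simp: small_def)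
    \<comment> \<open>In \<open>M2\<close> the summable weight of order -3/2 sits on the column
      index, so the row estimate is applied to the transpose.\<close>
    have "hsm (\<lambda>m n. M2 n m) \<and> hs (\<lambda>m n. M2 n m) \<le> infsum r UNIV * (norm B)\<^sup>2"
    proof (intro conjI hs_rowweight[of "\<lambda>m n. coef B (int n - int m)" "(norm B)\<^sup>2" r] toeplitz_row_col r)
      fix n m
      have "(real n + \<kappa>) powr (- 1 / 2) * (real m + \<kappa>) powr (- 3 / 2) \<le> r m"
        unfolding r_def by (intro mult_mono le1 le2) auto
      then have "((real n + \<kappa>) powr (- 1 / 2) * (real m + \<kappa>) powr (- 3 / 2)) * (cmod (coef B (int n - int m)))\<^sup>2
          \<le> r m * (cmod (coef B (int n - int m)))\<^sup>2"
        by (rule mult_right_mono) simp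
      then show "(cmod (M2 n m))\<^sup>2 \<le> r m * (cmod (coef B (int n - int m)))\<^sup>2"
        unfolding M2_def norm_mult power_mult_distrib norm_of_real power2_abs sq by (simp only: mult_ac)
      then show "(cmod (M2 n m))\<^sup>2 \<le> r m * (cmod (coef B (int n - int m)))\<^sup>2" .
    qed
    moreover have "infsum r UNIV * (norm B)\<^sup>2 \<le> 1 / 9"
      using order_trans[OF mult_left_mono[OF BM] c9] nS_nonneg z1 by (simp add: r)
    ultimately have sm2: "small M2" unfolding hsm_swap[of M2] by (auto simp: small_def)
    define h where "h = g + cmul (of_real \<kappa>) w"
    define q where "q p n = complex_of_real ((real n + \<kappa>) powr (- p))" for p :: real and n
    have q1: "cmod (q p n) \<le> 1" if "p \<ge> 0" for p n
      unfolding q_def norm_of_real using powr_mono[of "- p" 0 "real n + \<kappa>"] pos[of n] that by simp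
    define \<phi> where "\<phi> = neu M2 (dmul (q (1 / 4)) h)"
    define w' where "w' = dmul (q (3 / 4)) \<phi>"
    have cq: "coef (dmul (q p) f) n = q p n * coef f n" if "p \<ge> 0" for p f n
      by (rule coef_dmul[OF q1[OF that]])
    have qq: "q p n * q p' n = q (p + p') n" for p p' n
      by (simp add: q_def flip: of_real_mult powr_add)
    have q1': "q 1 n = of_real (1 / (real n + \<kappa>))" for n
      using pos[of n] by (simp add: q_def powr_minus divide_inverse)
    have h1: "hsm M1" "hsm M2" using sm1 sm2 by (auto simp: small_def)
    have m1: "coef (matop M1 f) n = of_real (1 / (real n + \<kappa>)) * (\<Sum>\<^sub>\<infinity>m. coef B (int n - int m) * coef f m)" for f n
      by (simp only: coef_matop[OF h1(1)] M1_def mult.assoc infsum_cmult_right')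
    have "w' = dmul (q 1) h + matop M1 w'"
    proof (rule ell2_eqI)
      fix n
      have "coef \<phi> n = q (1 / 4) n * coef h n + coef (matop M2 \<phi>) n"
        using arg_cong[OF neu_eq[OF sm2, of "dmul (q (1 / 4)) h"], of "\<lambda>f. coef f n"] by (simp add: \<phi>_def cq)
      also have "coef (matop M2 \<phi>) n = q (1 / 4) n * (\<Sum>\<^sub>\<infinity>m. coef B (int n - int m) * coef w' m)"
      proof -
        have "M2 n m = q (1 / 4) n * (coef B (int n - int m) * q (3 / 4) m)" for m
          unfolding M2_def q_def by simp
        then show ?thesis
          by (simp add: coef_matop[OF h1(2)] w'_def cq mult.assoc infsum_cmult_right')
      qed
      finally have "q (3 / 4) n * coef \<phi> n = (q (3 / 4) n * q (1 / 4) n) * (coef h n + (\<Sum>\<^sub>\<infinity>m. coef B (int n - int m) * coef w' m))"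
        by (simp add: algebra_simps)
      then show "coef w' n = coef (dmul (q 1) h + matop M1 w') n"
        by (simp add: w'_def cq qq m1 q1' distrib_left mult.assoc)
    qed
    moreover have "w = dmul (q 1) h + matop M1 w"
    proof (rule ell2_eqI)
      fix n
      have "of_nat n * coef w n - (\<Sum>\<^sub>\<infinity>m. coef B (int n - int m) * coef w m) = coef g n"
        using eq by (simp add: toep_eq_def)
      then have "of_real (real n + \<kappa>) * coef w n = coef h n + (\<Sum>\<^sub>\<infinity>m. coef B (int n - int m) * coef w m)"
        by (simp add: h_def algebra_simps)
      then have "of_real (1 / (real n + \<kappa>)) * (of_real (real n + \<kappa>) * coef w n) =
          of_real (1 / (real n + \<kappa>)) * (coef h n + (\<Sum>\<^sub>\<infinity>m. coef B (int n - int m) * coef w m))"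
        by (rule arg_cong)
      moreover have "of_real (1 / (real n + \<kappa>)) * (of_real (real n + \<kappa>) * coef w n) = coef w n"
        using pos[of n] by (simp add: mult.assoc[symmetric] del: of_real_add of_real_divide flip: of_real_mult)
      ultimately show "coef w n = coef (dmul (q 1) h + matop M1 w) n"
        by (simp add: cq q1' m1 distrib_left mult.assoc)
    qed
    ultimately have ww: "w = w'" using neu_unique[OF sm1] by metis
    \<comment> \<open>Since \<kappa> \<ge> 1, these multipliers are at most 1. They exchange the
      weight n + \<kappa> of the argument for the weight n + 1 of the statement.\<close>
    define \<theta> where "\<theta> p n = complex_of_real (((real n + 1) / (real n + \<kappa>)) powr p)" for p :: real and n
    have \<theta>1: "cmod (\<theta> p n) \<le> 1" if "p \<ge> 0" for p n
      unfolding \<theta>_def norm_of_real using powr_mono2[of p "(real n + 1) / (real n + \<kappa>)" 1] pos[of n] k1 that by simp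
    have n\<theta>: "norm (dmul (\<theta> p) f) \<le> norm f" if "p \<ge> 0" for p f
      using norm_dmul[of "\<theta> p" 1 f, OF \<theta>1[OF that]] by simp
    have z: "coef (zex w) k = of_real (jw k powr (- 3 / 4)) * coef (zex (dmul (\<theta> (3 / 4)) \<phi>)) k" for k
    proof (cases "k \<ge> 0")
      case True
      define n where "n = nat k"
      have k: "k = int n" using True by (simp add: n_def)
      have "(real n + 1) powr (- 3 / 4) * ((real n + 1) / (real n + \<kappa>)) powr (3 / 4) = (real n + \<kappa>) powr (- (3 / 4))"
      proof -
        have "((real n + 1) / (real n + \<kappa>)) powr (3 / 4) = (real n + 1) powr (3 / 4) / (real n + \<kappa>) powr (3 / 4)"
          by (rule powr_divide)
        moreover have "(real n + 1) powr (- 3 / 4) * (real n + 1) powr (3 / 4) = (real n + 1) powr (- 3 / 4 + 3 / 4)"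
          by (rule powr_add[symmetric])
        moreover have "(real n + 1) powr (- 3 / 4 + 3 / 4) = 1" by simp
        ultimately show ?thesis by (simp only: times_divide_eq_right powr_minus_divide)
      qed
      then have "of_real (jw k powr (- 3 / 4)) * \<theta> (3 / 4) n = q (3 / 4) n"
        unfolding \<theta>_def q_def k by (simp del: minus_divide_left flip: of_real_mult)
      then show ?thesis
        using True by (simp add: zex ww w'_def cq coef_dmul[OF \<theta>1] n_def[symmetric] mult.assoc[symmetric] del: of_real_mult)
    qed (simp add: zex)
    obtain R where R: "\<And>n. coef R n = cv B (zex w) n" "norm R \<le> sqrt cS * norm B * norm (zex (dmul (\<theta> (3 / 4)) \<phi>))"
      using young[OF z] by blast
    define w1 where "w1 = dmul (\<theta> 1) (h + hl R)"
    have "coef w1 n = of_real (real n + 1) * coef w n" for n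
    proof -
      have "of_nat n * coef w n - (\<Sum>\<^sub>\<infinity>m. coef B (int n - int m) * coef w m) = coef g n"
        using eq by (simp add: toep_eq_def)
      then have "of_real (real n + \<kappa>) * coef w n = coef h n + coef R (int n)"
        unfolding toeplitz_cv by (simp add: h_def R algebra_simps)
      then have "coef w1 n = \<theta> 1 n * of_real (real n + \<kappa>) * coef w n"
        by (simp add: w1_def coef_dmul[OF \<theta>1] mult.assoc)
      also have "\<theta> 1 n * of_real (real n + \<kappa>) = of_real (real n + 1)"
      proof -
        have "((real n + 1) / (real n + \<kappa>)) powr 1 * (real n + \<kappa>) = real n + 1" using pos[of n] by simp
        then show ?thesis unfolding \<theta>_def of_real_mult[symmetric] by (rule arg_cong)
      qed
      finally show ?thesis .
    qed
    moreover have "norm w1 \<le> C * (norm g + norm w)"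
    proof -
      have "norm \<phi> \<le> 3 / 2 * norm (dmul (q (1 / 4)) h)" unfolding \<phi>_def by (rule norm_neu(1)[OF sm2])
      also have "\<dots> \<le> 3 / 2 * norm h"
        using norm_dmul[of "q (1 / 4)" 1 h, OF q1] by simp
      finally have p: "norm \<phi> \<le> 3 / 2 * norm h" .
      have "norm R \<le> sqrt cS * norm B * norm (dmul (\<theta> (3 / 4)) \<phi>)" using R(2) by (simp add: zex)
      also have "\<dots> \<le> sqrt cS * M * (3 / 2 * norm h)"
        by (intro mult_mono B order_trans[OF n\<theta> p] mult_nonneg_nonneg) (auto simp: cS_nonneg M)
      finally have "norm (hl R) \<le> sqrt cS * M * (3 / 2 * norm h)" using norm_hl[of R] by linarith
      then have "norm (h + hl R) \<le> (1 + sqrt cS * M * (3 / 2)) * norm h"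
        using norm_triangle_ineq[of h "hl R"] by (simp add: algebra_simps)
      then have "norm w1 \<le> (1 + sqrt cS * M * (3 / 2)) * norm h"
        using n\<theta>[of 1 "h + hl R"] by (simp add: w1_def)
      also have "norm h \<le> \<kappa> * (norm g + norm w)"
      proof -
        have "norm h \<le> norm g + \<kappa> * norm w"
          unfolding h_def using norm_triangle_ineq[of g "cmul (of_real \<kappa>) w"] k1 by simp
        moreover have "norm g \<le> \<kappa> * norm g" using k1 by (simp add: mult_le_cancel_right1)
        ultimately show ?thesis by (simp add: distrib_left)
      qed
      then have "(1 + sqrt cS * M * (3 / 2)) * norm h \<le> (1 + sqrt cS * M * (3 / 2)) * (\<kappa> * (norm g + norm w))"
        using M cS_nonneg by (intro mult_left_mono) auto
      finally show ?thesis by (simp add: C_def mult.assoc)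
    qed
    ultimately show "\<exists>w1. (\<forall>n. coef w1 n = of_real (real n + 1) * coef w n) \<and> norm w1 \<le> C * (norm g + norm w)"
      by blast
  qed
qed

lemma hh_weight1:
  assumes "\<And>n. coef w1 n = of_real (real n + 1) * coef w n" shows "hh w"
  unfolding hh_def
proof (rule summable_on_le[OF coef_summable[of w1]])
  fix n
  have "(real n + 1) * 1 \<le> (real n + 1)\<^sup>2" unfolding power2_eq_square by (rule mult_left_mono) auto
  then have "real (Suc n) \<le> (real n + 1)\<^sup>2" by (simp only: mult_1_right of_nat_Suc add.commute)
  then have "real (Suc n) * (cmod (coef w n))\<^sup>2 \<le> (real n + 1)\<^sup>2 * (cmod (coef w n))\<^sup>2"
    by (rule mult_right_mono) simp
  also have "\<dots> = (cmod (coef w1 n))\<^sup>2"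
    unfolding assms norm_mult power_mult_distrib norm_of_real power2_abs ..
  finally show "real (Suc n) * (cmod (coef w n))\<^sup>2 \<le> (cmod (coef w1 n))\<^sup>2" .
qed auto

lemma toep_eq_imp_Lr:
  assumes "toep_eq B w g" shows "Lr (coef B) w g"
proof -
  obtain C where "\<exists>w1. (\<forall>n. coef w1 n = of_real (real n + 1) * coef w n) \<and> norm w1 \<le> C * (norm g + norm w)"
    using regularity[of "norm B"] assms by (metis norm_ge_zero order_refl)
  then have "hh w" using hh_weight1 by blast
  then show ?thesis using assms by (simp add: Lr_toep_eq)
qed

lemma Lr_finite_support:
  assumes A: "finite {k. coef A k \<noteq> 0}" and f: "finite {n. coef f n \<noteq> 0}"
  obtains g where "Lr (coef A) f g" "finite {n. coef g n \<noteq> 0}"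
proof -
  define c where "c n = of_nat n * coef f n - (\<Sum>\<^sub>\<infinity>m. coef A (int n - int m) * coef f m)" for n
  let ?F = "{n. coef f n \<noteq> 0}" let ?A = "{k. coef A k \<noteq> 0}"
  have "{n. c n \<noteq> 0} \<subseteq> ?F \<union> nat ` ((\<lambda>(k, m). k + int m) ` (?A \<times> ?F))"
  proof
    fix n assume "n \<in> {n. c n \<noteq> 0}"
    then have cn: "c n \<noteq> 0" by simp
    show "n \<in> ?F \<union> nat ` ((\<lambda>(k, m). k + int m) ` (?A \<times> ?F))"
    proof (rule ccontr)
      assume n: "n \<notin> ?F \<union> nat ` ((\<lambda>(k, m). k + int m) ` (?A \<times> ?F))"
      have "coef A (int n - int m) * coef f m = 0" for m
      proof (rule ccontr)
        assume "coef A (int n - int m) * coef f m \<noteq> 0"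
        then have "(int n - int m, m) \<in> ?A \<times> ?F" by auto
        then have "int n \<in> (\<lambda>(k, m). k + int m) ` (?A \<times> ?F)" by force
        then have "nat (int n) \<in> nat ` ((\<lambda>(k, m). k + int m) ` (?A \<times> ?F))" by (rule imageI)
        then show False using n by simp
      qed
      then have "(\<Sum>\<^sub>\<infinity>m. coef A (int n - int m) * coef f m) = 0" by (rule infsum_0)
      then have "c n = 0" using n by (simp add: c_def)
      with cn show False ..
    qed
  qed
  then have fc: "finite {n. c n \<noteq> 0}"
    by (rule finite_subset) (use A f in auto)
  then have "(\<lambda>n. (cmod (c n))\<^sup>2) summable_on UNIV"
    by (intro finite_nonzero_values_imp_summable_on) simp
  then have c: "coef (Abs_ell2 c) = c" by (rule coef_Abs_ell2)
  have "finite {n \<in> UNIV. real (Suc n) * (cmod (coef f n))\<^sup>2 \<noteq> 0}"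
    by (rule finite_subset[OF _ f]) auto
  then have "hh f" unfolding hh_def by (rule finite_nonzero_values_imp_summable_on)
  then have "Lr (coef A) f (Abs_ell2 c)" by (simp add: Lr_def c c_def)
  moreover have "finite {n. coef (Abs_ell2 c) n \<noteq> 0}" using fc by (simp add: c)
  ultimately show thesis by (rule that)
qed

section \<open>The explicit formula intertwines the Lax operators\<close>

context lax_smooth
begin

text \<open>So far only the right-hand side of the explicit formula. That \<open>B\<close>, its
  Hermitian extension, evolves by the equation is established by differentiation in
  \<open>B_derivative\<close>.\<close>

definition U :: "real \<Rightarrow> nat ell2" where "U t = W.W t X"

definition B :: "real \<Rightarrow> int ell2" where "B t = hext (U t)"

lemma coef_U: "coef (U t) n = coef ((K t ^^ n) X) 0"
  by (simp add: U_def W.coef_W)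

lemma Im_U0: "Im (coef (U t) 0) = 0"
  using herm_0[OF herm_A] by (simp add: coef_U)

lemma herm_B: "herm (coef (B t))"
  unfolding B_def by (rule herm_hext[OF Im_U0])

lemma norm_U: "norm (U t) = norm X" by (simp add: U_def)

lemma norm_B: "norm (B t) \<le> sqrt 2 * norm X"
proof (rule power2_le_imp_le)
  show "(norm (B t))\<^sup>2 \<le> (sqrt 2 * norm X)\<^sup>2"
    using norm_hext_le[of "U t"] by (simp add: B_def norm_U power_mult_distrib)
qed simp

lemma coef_W_K: "coef (W.W t ((K t ^^ j) f)) m = coef (W.W t f) (m + j)"
  by (simp add: W.coef_W funpow_add)

text \<open>Every commutator leaves a rank one term, a coefficient of \<open>W f\<close> times a
  power of K applied to X. Taken at coefficient 0, the sum becomes a finite convolution of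
  \<open>W f\<close> with \<open>U\<close>.\<close>

lemma Lr_Kn:
  assumes L: "Lr (coef A) f g"
  shows "Lr (coef A) ((K t ^^ j) f) ((K t ^^ j) g - cmul (of_nat j) ((K t ^^ j) f)
    + (\<Sum>i<j. cmul (coef (W.W t f) (j - Suc i)) ((K t ^^ Suc i) X)))"
proof (induction j)
  case (Suc j)
  let ?K = "K t" let ?w = "coef (W.W t f)"
  let ?g = "(?K ^^ j) g - cmul (of_nat j) ((?K ^^ j) f) + (\<Sum>i<j. cmul (?w (j - Suc i)) ((?K ^^ Suc i) X))"
  have "Lr (coef A) (?K ((?K ^^ j) f)) (?K ?g - ?K ((?K ^^ j) f) + cmul (coef ((?K ^^ j) f) 0) (?K X))"
    by (rule Lr_K[OF Suc])
  also have "?K ?g - ?K ((?K ^^ j) f) + cmul (coef ((?K ^^ j) f) 0) (?K X) =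
      (?K ^^ Suc j) g - cmul (of_nat (Suc j)) ((?K ^^ Suc j) f) + (\<Sum>i<Suc j. cmul (?w (Suc j - Suc i)) ((?K ^^ Suc i) X))"
  proof -
    have "?K ?g = (?K ^^ Suc j) g - cmul (of_nat j) ((?K ^^ Suc j) f) + (\<Sum>i<j. cmul (?w (j - Suc i)) ((?K ^^ Suc (Suc i)) X))"
      by (simp add: bclD[OF K_bcl] bcl_sum[OF K_bcl])
    moreover have "(\<Sum>i<Suc j. cmul (?w (Suc j - Suc i)) ((?K ^^ Suc i) X)) =
        cmul (?w j) (?K X) + (\<Sum>i<j. cmul (?w (j - Suc i)) ((?K ^^ Suc (Suc i)) X))"
      by (subst sum.lessThan_Suc_shift) simp
    ultimately show ?thesis by (simp add: W.coef_W cmul_add_left)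
  qed
  finally show ?case by simp
qed (use L in simp)

text \<open>Coefficient 0 of L K^j f is computed twice. By symmetry of L it is - <K^j f, X>, which
  by unitarity of \<open>W\<close> is the part m \<ge> j of row j of the Toeplitz matrix of
  \<open>B t\<close>; by \<open>Lr_Kn\<close> it contains the part m < j. Equating the two gives the
  whole row.\<close>

lemma W_toep_eq:
  assumes L: "Lr (coef A) f g"
  shows "toep_eq (B t) (W.W t f) (W.W t g)"
  unfolding toep_eq_def
proof
  fix j
  let ?w = "coef (W.W t f)" let ?u = "coef (U t)"
  let ?G = "(K t ^^ j) g - cmul (of_nat j) ((K t ^^ j) f) + (\<Sum>i<j. cmul (?w (j - Suc i)) ((K t ^^ Suc i) X))"
  have csum: "coef (sum h I) 0 = (\<Sum>i\<in>I. coef (h i) 0)" for h :: "nat \<Rightarrow> nat ell2" and I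
    by (induction I rule: infinite_finite_induct) auto
  have "- cin ((K t ^^ j) f) X = coef ?G 0"
    by (rule Lr_coef_0[OF Lr_Kn[OF L] herm_A, symmetric])
  also have "\<dots> = coef (W.W t g) j - of_nat j * ?w j + (\<Sum>i<j. ?w (j - Suc i) * ?u (Suc i))"
    by (simp add: csum W.coef_W coef_U)
  also have "(\<Sum>i<j. ?w (j - Suc i) * ?u (Suc i)) = (\<Sum>m<j. ?w m * ?u (j - m))"
    by (subst sum.nat_diff_reindex[symmetric]) (rule sum.cong, auto simp: Suc_diff_Suc)
  finally have 1: "of_nat j * ?w j - (\<Sum>m<j. ?w m * ?u (j - m)) - cin ((K t ^^ j) f) X = coef (W.W t g) j"
    by (simp add: algebra_simps)
  have 2: "cin ((K t ^^ j) f) X = (\<Sum>\<^sub>\<infinity>m. cnj (?u m) * ?w (m + j))"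
  proof -
    have "cin ((K t ^^ j) f) X = cin (W.W t ((K t ^^ j) f)) (W.W t X)" by (simp add: W.cin_W)
    then show ?thesis by (simp add: cin_def coef_W_K U_def mult.commute)
  qed
  have "(\<Sum>\<^sub>\<infinity>m. coef (B t) (int j - int m) * ?w m) =
      (\<Sum>m<j. coef (B t) (int j - int m) * ?w m) + (\<Sum>\<^sub>\<infinity>m. coef (B t) (int j - int (m + j)) * ?w (m + j))"
    by (rule infsum_nat_split[OF toeplitz_summable])
  also have "(\<Sum>m<j. coef (B t) (int j - int m) * ?w m) = (\<Sum>m<j. ?w m * ?u (j - m))"
    by (rule sum.cong) (auto simp: B_def coef_hext nat_diff_distrib)
  also have "(\<Sum>\<^sub>\<infinity>m. coef (B t) (int j - int (m + j)) * ?w (m + j)) = (\<Sum>\<^sub>\<infinity>m. cnj (?u m) * ?w (m + j))"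
  proof -
    have "coef (B t) (int j - int (m + j)) = cnj (?u m)" for m
      using Im_U0[of t] by (auto simp: B_def coef_hext complex_eq_iff)
    then show ?thesis by simp
  qed
  finally have 3: "(\<Sum>\<^sub>\<infinity>m. coef (B t) (int j - int m) * ?w m) =
      (\<Sum>m<j. ?w m * ?u (j - m)) + (\<Sum>\<^sub>\<infinity>m. cnj (?u m) * ?w (m + j))" .
  show "of_nat j * ?w j - (\<Sum>\<^sub>\<infinity>m. coef (B t) (int j - int m) * ?w m) = coef (W.W t g) j"
    using 1 unfolding 2 3 by (simp only: diff_diff_eq)
qed

lemma Lr_W: "Lr (coef A) f g \<Longrightarrow> Lr (coef (B t)) (W.W t f) (W.W t g)"
  by (rule toep_eq_imp_Lr[OF W_toep_eq])

lemma W_Rs: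
  assumes "good (coef A) k" "good (coef (B t)) k"
  shows "W.W t (Rs (coef A) k f) = Rs (coef (B t)) k (W.W t f)"
proof -
  let ?r = "Rs (coef A) k f"
  have "Lr (coef (B t)) (W.W t ?r) (W.W t (f - cmul (of_real k) ?r))"
    by (rule Lr_W[OF Lr_Rs[OF assms(1)]])
  then have "W.W t ?r = Rs (coef (B t)) k (W.W t (f - cmul (of_real k) ?r) + cmul (of_real k) (W.W t ?r))"
    by (rule iffD1[OF Lr_iff[OF assms(2)]])
  then show ?thesis by (simp add: W.W_diff W.W_cmul)
qed

lemma resolvent_form_conserved:
  assumes "good (coef A) k" "good (coef (B t)) k"
  shows "cin (Rs (coef (B t)) k (U t)) (U t) = cin (Rs (coef A) k X) X"
  unfolding U_def W_Rs[OF assms, symmetric] W.cin_W ..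

text \<open>The form of the explicit formula that passes to the limit: the right-hand side involves
  the datum only through its resolvent and its group, not through the vector X.\<close>

lemma resolvent_entries:
  assumes "good (coef A) k" "good (coef (B t)) k"
  shows "cin (Rs (coef (B t)) k (bas m)) (bas n) = cin (Rs (coef A) k ((Ks t ^^ m) (bas 0))) ((Ks t ^^ n) (bas 0))"
  unfolding W.W_bas[symmetric, of m t] W.W_bas[symmetric, of n t] W_Rs[OF assms, symmetric] W.cin_W ..

end

text \<open>The equation gives (n + 1) u = G + u + B * u in coefficients. Multiplying once more by n
  + 1 stays in l^2 because B * u is a product in the algebra H^1.\<close>

lemma weight_twice:
  fixes B1 B :: "int ell2" and u u1 G G1 :: "nat ell2"
  assumes eq: "toep_eq B u G"
    and u1: "\<And>n. coef u1 n = of_real (real n + 1) * coef u n"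
    and G1: "\<And>n. coef G1 n = of_real (real n + 1) * coef G n"
    and B1: "\<And>k. coef B1 k = of_real (jw k) * coef B k"
  obtains u2 where "\<And>n. coef u2 n = of_real ((real n + 1)\<^sup>2) * coef u n"
    "norm u2 \<le> norm G1 + norm u1 + 2 * sqrt cS * norm B1 * norm u1"
proof -
  have z: "coef (zex u1) k = of_real (jw k) * coef (zex u) k" for k
    by (cases "k \<ge> 0") (auto simp: zex u1 jw_def)
  obtain R where R: "\<And>n. coef R n = of_real (jw n) * cv B (zex u) n" "norm R \<le> 2 * sqrt cS * norm B1 * norm (zex u1)"
    using h1_conv[of B1 B "zex u1" "zex u"] B1 z by metis
  have "coef (G1 + u1 + hl R) n = of_real ((real n + 1)\<^sup>2) * coef u n" for n
  proof -
    have "of_nat n * coef u n - cv B (zex u) (int n) = coef G n"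
      using eq unfolding toep_eq_def toeplitz_cv by blast
    then have "(of_real (real n + 1)) * coef u n = coef G n + coef u n + cv B (zex u) (int n)"
      by (simp add: algebra_simps)
    then have "of_real (real n + 1) * (of_real (real n + 1) * coef u n) = of_real (real n + 1) * (coef G n + coef u n + cv B (zex u) (int n))"
      by (rule arg_cong)
    also have "of_real (real n + 1) * (of_real (real n + 1) * coef u n) = of_real ((real n + 1)\<^sup>2) * coef u n"
      by (simp add: power2_eq_square mult.assoc)
    finally show ?thesis by (simp add: R(1) u1 G1 distrib_left)
  qed
  moreover have "norm (G1 + u1 + hl R) \<le> norm G1 + norm u1 + 2 * sqrt cS * norm B1 * norm u1"
    using norm_triangle_ineq[of "G1 + u1" "hl R"] norm_triangle_ineq[of G1 u1] norm_hl[of R] R(2)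
    by (simp add: zex)
  ultimately show thesis by (rule that)
qed

context lax_smooth
begin

text \<open>The bound does not depend on t because Y = L X and Z = L Y are fixed finitely supported
  vectors whose norms \<open>W\<close> preserves: regularity applied to the transported equations
  bounds \<open>U t\<close> and \<open>W Y\<close> in H^1, and then \<open>weight_twice\<close>
  bounds \<open>U t\<close> in H^2.\<close>

lemma U_h2:
  assumes fin: "finite {k. coef A k \<noteq> 0}"
  obtains C where "\<And>t. \<exists>u2. (\<forall>n. coef u2 n = of_real ((real n + 1)\<^sup>2) * coef (U t) n) \<and> norm u2 \<le> C"
proof -
  have "{n. coef X n \<noteq> 0} \<subseteq> nat ` {k. coef A k \<noteq> 0}" by force
  then have fX: "finite {n. coef X n \<noteq> 0}" using fin finite_surj by blast
  obtain Y where Y: "Lr (coef A) X Y" "finite {n. coef Y n \<noteq> 0}" by (rule Lr_finite_support[OF fin fX])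
  obtain Z where Z: "Lr (coef A) Y Z" by (rule Lr_finite_support[OF fin Y(2)])
  obtain C where C: "0 \<le> C" "\<And>B w g. norm B \<le> sqrt 2 * norm X \<Longrightarrow> toep_eq B w g \<Longrightarrow>
      \<exists>w1. (\<forall>n. coef w1 n = of_real (real n + 1) * coef w n) \<and> norm w1 \<le> C * (norm g + norm w)"
    using regularity[of "sqrt 2 * norm X"] by (metis mult_nonneg_nonneg norm_ge_zero real_sqrt_ge_zero zero_le_numeral)
  define a where "a = C * (norm Y + norm X)"
  define b where "b = C * (norm Z + norm Y)"
  have "\<exists>u2. (\<forall>n. coef u2 n = of_real ((real n + 1)\<^sup>2) * coef (U t) n) \<and> norm u2 \<le> b + a + 2 * sqrt cS * (sqrt 2 * a) * a" for t
  proof -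
    obtain u1 where u1: "\<And>n. coef u1 n = of_real (real n + 1) * coef (U t) n" "norm u1 \<le> a"
      using C(2)[OF norm_B W_toep_eq[OF Y(1)]] by (auto simp: a_def U_def)
    obtain G1 where G1: "\<And>n. coef G1 n = of_real (real n + 1) * coef (W.W t Y) n" "norm G1 \<le> b"
      using C(2)[OF norm_B W_toep_eq[OF Z]] by (auto simp: b_def)
    have B1: "coef (hext u1) k = of_real (jw k) * coef (B t) k" for k
      by (auto simp: coef_hext B_def u1 jw_def)
    have nB1: "norm (hext u1) \<le> sqrt 2 * a"
    proof (rule power2_le_imp_le)
      have "(norm (hext u1))\<^sup>2 \<le> 2 * (norm u1)\<^sup>2" by (rule norm_hext_le)
      also have "\<dots> \<le> 2 * a\<^sup>2" using u1(2) by (intro mult_left_mono power_mono) auto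
      finally show "(norm (hext u1))\<^sup>2 \<le> (sqrt 2 * a)\<^sup>2" by (simp add: power_mult_distrib)
      show "0 \<le> sqrt 2 * a" using order_trans[OF norm_ge_zero u1(2)] by simp
    qed
    have eq: "toep_eq (B t) (U t) (W.W t Y)" unfolding U_def by (rule W_toep_eq[OF Y(1)])
    from weight_twice[OF eq u1(1) G1(1) B1]
    obtain u2 where u2: "\<And>n. coef u2 n = of_real ((real n + 1)\<^sup>2) * coef (U t) n"
      "norm u2 \<le> norm G1 + norm u1 + 2 * sqrt cS * norm (hext u1) * norm u1" by blast
    have "2 * sqrt cS * norm (hext u1) * norm u1 \<le> 2 * sqrt cS * (sqrt 2 * a) * a"
      using order_trans[OF norm_ge_zero u1(2)] cS_nonneg by (intro mult_mono nB1 u1(2) mult_nonneg_nonneg order_refl) auto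
    then have "norm u2 \<le> b + a + 2 * sqrt cS * (sqrt 2 * a) * a"
      using u2(2) u1(2) G1(2) by linarith
    then show ?thesis using u2(1) by blast
  qed
  then show thesis by (rule that)
qed

end

section \<open>The evolution of the Fourier coefficients\<close>

lemma bounded_bilinear_cmul: "bounded_bilinear cmul"
  by (rule bounded_bilinear.intro)
    (auto simp: cmul_add cmul_add_left scaleR_cmul scaleR_conv_of_real mult.commute intro!: exI[of _ 1])

lemma herm_cv: "herm (coef P) \<Longrightarrow> herm (coef Q) \<Longrightarrow> herm (cv P Q)"
  unfolding herm_def
proof
  fix n assume h: "\<forall>n. coef P (- n) = cnj (coef P n)" "\<forall>n. coef Q (- n) = cnj (coef Q n)"
  have b: "bij_betw uminus UNIV (UNIV :: int set)" by (rule bij_betwI[where g = uminus]) auto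
  have "cv P Q (- n) = (\<Sum>\<^sub>\<infinity>k. coef P (- n - (- k)) * coef Q (- k))"
    unfolding cv_def using infsum_reindex_bij_betw[OF b, of "\<lambda>k. coef P (- n - k) * coef Q k"] by simp
  also have "\<dots> = (\<Sum>\<^sub>\<infinity>k. cnj (coef P (n - k) * coef Q k))"
  proof (rule infsum_cong)
    fix k
    show "coef P (- n - (- k)) * coef Q (- k) = cnj (coef P (n - k) * coef Q k)"
      using h(1)[rule_format, of "n - k"] h(2) by simp
  qed
  also have "\<dots> = cnj (cv P Q n)" by (simp add: cv_def flip: infsum_cnj)
  finally show "cv P Q (- n) = cnj (cv P Q n)" .
qed

text \<open>Symmetrization under l -> n - l, whose two weights add up to n. It produces the
  derivative of a square from the weighted sums in \<open>Kn_derivative\<close>.\<close>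

lemma weighted_sum_symmetric:
  fixes u :: "nat \<Rightarrow> complex"
  shows "2 * (\<Sum>i<n. of_nat (Suc i) * (u (n - Suc i) * u (Suc i))) = of_nat n * (\<Sum>l\<le>n. u l * u (n - l))"
proof -
  have 1: "(\<Sum>i<n. of_nat (Suc i) * (u (n - Suc i) * u (Suc i))) = (\<Sum>l\<le>n. of_nat l * (u l * u (n - l)))"
    using sum.lessThan_Suc_shift[of "\<lambda>l. of_nat l * (u l * u (n - l))" n]
    by (simp add: lessThan_Suc_atMost mult.commute)
  have 2: "(\<Sum>l\<le>n. of_nat l * (u l * u (n - l))) = (\<Sum>l\<le>n. of_nat (n - l) * (u l * u (n - l)))"
    using sum.nat_diff_reindex[of "\<lambda>l. of_nat l * (u l * u (n - l))" "Suc n"]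
    by (simp add: lessThan_Suc_atMost mult.commute[of "u (n - _)"])
  have "2 * (\<Sum>l\<le>n. of_nat l * (u l * u (n - l))) = (\<Sum>l\<le>n. (of_nat l + of_nat (n - l)) * (u l * u (n - l)))"
    unfolding distrib_right sum.distrib 2[symmetric] by simp
  also have "\<dots> = (\<Sum>l\<le>n. of_nat n * (u l * u (n - l)))"
    by (rule sum.cong) (auto simp: of_nat_diff)
  finally show ?thesis unfolding 1 by (simp add: sum_distrib_left)
qed

context lax_smooth
begin

lemma K_tendsto: "(f \<longlongrightarrow> g) F \<Longrightarrow> (t \<longlongrightarrow> s) F \<Longrightarrow> ((\<lambda>x. K (t x) (f x)) \<longlongrightarrow> K s g) F"
  unfolding K_def
  by (intro tendsto_cmul E_tendsto bcl_tendsto[OF bcl_shl] tendsto_intros isCont_tendsto_compose[of s cis])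
    (auto intro: continuous_intros)

text \<open>Differentiating e^(it) e^(2itL) contributes i K f + 2 i L K f, and L K f = K g - K f +
  f_0 K X by the commutator; hence the coefficient - i of K f.\<close>

lemma K_derivative:
  assumes f: "(f has_vector_derivative f') (at t)" and L: "Lr (coef A) (f t) g"
  shows "((\<lambda>t. K t (f t)) has_vector_derivative
    K t f' - cmul \<i> (K t (f t)) + cmul (2 * \<i>) (K t g + cmul (coef (f t) 0) (K t X))) (at t)"
proof -
  let ?v = "shl (f t)" let ?g = "shl g - shl (f t) + cmul (coef (f t) 0) (shl X)"
  have Lv: "Lr (coef A) ?v ?g" by (rule Lr_shl[OF L])
  have "((\<lambda>s. E s ?v) \<circ> (\<lambda>s. 2 * s) has_vector_derivative (2 *\<^sub>R cmul \<i> (E (2 * t) ?g))) (at t)"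
    by (intro vector_diff_chain_at E_derivative[OF Lv]) (auto intro!: derivative_eq_intros)
  then have d1: "((\<lambda>s. E (2 * s) ?v) has_vector_derivative (2 *\<^sub>R cmul \<i> (E (2 * t) ?g))) (at t)"
    by (simp add: o_def)
  have d2: "(cis has_vector_derivative \<i> * cis t) (at t)"
    using cis_derivative_quotient[of t 1] by (simp add: has_vector_derivative_quotient)
  have d3: "((\<lambda>s. K s (f t)) has_vector_derivative
      cmul (cis t) (2 *\<^sub>R cmul \<i> (E (2 * t) ?g)) + cmul (\<i> * cis t) (E (2 * t) ?v)) (at t)"
    unfolding K_def by (rule bounded_bilinear.has_vector_derivative[OF bounded_bilinear_cmul d2 d1])
  have "((\<lambda>h. K (t + h) ((f (t + h) - f t) /\<^sub>R h) + (K (t + h) (f t) - K t (f t)) /\<^sub>R h) \<longlongrightarrow>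
      K t f' + (cmul (cis t) (2 *\<^sub>R cmul \<i> (E (2 * t) ?g)) + cmul (\<i> * cis t) (E (2 * t) ?v))) (at 0)"
  proof (rule tendsto_add)
    have "((\<lambda>h. t + h) \<longlongrightarrow> t + 0) (at 0)" by (intro tendsto_intros)
    then show "((\<lambda>h. K (t + h) ((f (t + h) - f t) /\<^sub>R h)) \<longlongrightarrow> K t f') (at 0)"
      using K_tendsto[OF f[unfolded has_vector_derivative_quotient]] by simp
  qed (rule d3[unfolded has_vector_derivative_quotient])
  moreover have "K (t + h) ((f (t + h) - f t) /\<^sub>R h) + (K (t + h) (f t) - K t (f t)) /\<^sub>R h =
      (K (t + h) (f (t + h)) - K t (f t)) /\<^sub>R h" for h
    by (simp add: scaleR_cmul bclD[OF K_bcl] cmul_diff)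
  moreover have "K t f' + (cmul (cis t) (2 *\<^sub>R cmul \<i> (E (2 * t) ?g)) + cmul (\<i> * cis t) (E (2 * t) ?v)) =
      K t f' - cmul \<i> (K t (f t)) + cmul (2 * \<i>) (K t g + cmul (coef (f t) 0) (K t X))"
    by (rule ell2_eqI) (simp add: K_def bclD[OF E_bcl] algebra_simps)
  ultimately show ?thesis unfolding has_vector_derivative_quotient by simp
qed

text \<open>By induction, with \<open>Lr_Kn\<close> supplying L K^n X at each step. The commutators
  add - i (2 n + 1) each time, and these odd numbers sum to the square.\<close>

lemma Kn_derivative:
  assumes L: "Lr (coef A) X Y"
  shows "((\<lambda>t. (K t ^^ n) X) has_vector_derivative
    cmul (- \<i> * (of_nat n)\<^sup>2) ((K t ^^ n) X) + cmul (2 * \<i> * of_nat n) ((K t ^^ n) Y)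
    + cmul (2 * \<i>) (\<Sum>i<n. cmul (of_nat (Suc i) * coef (U t) (n - Suc i)) ((K t ^^ Suc i) X))) (at t)"
proof (induction n)
  case 0
  show ?case by simp
next
  case (Suc n)
  let ?F = "\<lambda>n. (K t ^^ n) X" let ?u = "coef (U t)"
  let ?S = "\<lambda>n. \<Sum>i<n. cmul (of_nat (Suc i) * ?u (n - Suc i)) (?F (Suc i))"
  let ?P = "\<lambda>n. \<Sum>i<n. cmul (?u (n - Suc i)) (?F (Suc i))"
  let ?f' = "cmul (- \<i> * (of_nat n)\<^sup>2) (?F n) + cmul (2 * \<i> * of_nat n) ((K t ^^ n) Y) + cmul (2 * \<i>) (?S n)"
  let ?g = "(K t ^^ n) Y - cmul (of_nat n) (?F n) + ?P n"
  have Lg: "Lr (coef A) (?F n) ?g" using Lr_Kn[OF L, where j = n and t = t] by (simp add: U_def)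
  have "((\<lambda>t. (K t ^^ Suc n) X) has_vector_derivative
      K t ?f' - cmul \<i> (K t (?F n)) + cmul (2 * \<i>) (K t ?g + cmul (coef (?F n) 0) (K t X))) (at t)"
    using K_derivative[OF Suc Lg] by simp
  also have "K t ?f' - cmul \<i> (K t (?F n)) + cmul (2 * \<i>) (K t ?g + cmul (coef (?F n) 0) (K t X)) =
      cmul (- \<i> * (of_nat (Suc n))\<^sup>2) (?F (Suc n)) + cmul (2 * \<i> * of_nat (Suc n)) ((K t ^^ Suc n) Y)
      + cmul (2 * \<i>) (?S (Suc n))"
  proof -
    have KS: "K t (?S n) = (\<Sum>i<n. cmul (of_nat (Suc i) * ?u (n - Suc i)) (?F (Suc (Suc i))))"
      and KP: "K t (?P n) = (\<Sum>i<n. cmul (?u (n - Suc i)) (?F (Suc (Suc i))))"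
      by (simp_all add: bcl_sum[OF K_bcl] bclD[OF K_bcl])
    have SS: "?S (Suc n) = cmul (?u n) (?F (Suc 0)) + (K t (?S n) + K t (?P n))"
      unfolding KS KP sum.distrib[symmetric] by (subst sum.lessThan_Suc_shift) (simp add: cmul_add_left[symmetric] algebra_simps)
    have Kf: "K t ?f' = cmul (- \<i> * (of_nat n)\<^sup>2) (?F (Suc n)) + cmul (2 * \<i> * of_nat n) ((K t ^^ Suc n) Y) + cmul (2 * \<i>) (K t (?S n))"
      and Kg: "K t ?g = (K t ^^ Suc n) Y - cmul (of_nat n) (?F (Suc n)) + K t (?P n)"
      by (simp_all only: bclD[OF K_bcl] funpow.simps o_def)
    have c0: "coef (?F n) 0 = ?u n" by (simp add: coef_U)
    show ?thesis
      unfolding Kf Kg SS c0 by (rule ell2_eqI) (simp add: algebra_simps power2_eq_square)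
  qed
  finally show ?case .
qed

text \<open>The terms k \<ge> 0 of the convolution form the full Toeplitz row; reindexing the terms
  k < 0 yields the part m > n of the same row, that is, the row minus a finite sum.\<close>

lemma cv_B_B:
  "cv (B t) (B t) (int n) = 2 * (\<Sum>\<^sub>\<infinity>m. coef (B t) (int n - int m) * coef (U t) m) - (\<Sum>l\<le>n. coef (U t) l * coef (U t) (n - l))"
proof -
  let ?b = "coef (B t)" let ?u = "coef (U t)"
  have b: "?b (int m) = ?u m" "?b (- int m) = cnj (?u m)" for m
    using Im_U0[of t] by (auto simp: B_def coef_hext complex_eq_iff)
  define T where "T = (\<Sum>\<^sub>\<infinity>m. ?b (int n - int m) * ?u m)"
  have split: "T = (\<Sum>m<Suc n. ?b (int n - int m) * ?u m) + (\<Sum>\<^sub>\<infinity>m. ?b (int n - int (m + Suc n)) * ?u (m + Suc n))"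
    unfolding T_def by (rule infsum_nat_split[OF toeplitz_summable])
  have fin: "(\<Sum>m<Suc n. ?b (int n - int m) * ?u m) = (\<Sum>l\<le>n. ?u l * ?u (n - l))"
    unfolding lessThan_Suc_atMost
    by (rule sum.cong) (auto simp: b of_nat_diff[symmetric] mult.commute simp del: of_nat_diff)
  have s: "(\<lambda>m. ?b (- 1 - int m) * ?u (m + Suc n)) summable_on UNIV"
  proof -
    have "(\<lambda>m. ?b (int n - int m) * ?u m) summable_on range (\<lambda>m. m + Suc n)"
      by (rule summable_on_subset_banach[OF toeplitz_summable]) simp
    then show ?thesis
      using summable_on_reindex[of "\<lambda>m. m + Suc n" UNIV "\<lambda>m. ?b (int n - int m) * ?u m"]
      by (simp add: o_def inj_def algebra_simps)
  qed
  have "((\<lambda>k. ?b (int n - k) * ?b k) has_sum (T + (\<Sum>\<^sub>\<infinity>m. ?b (- 1 - int m) * ?u (m + Suc n)))) UNIV"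
  proof (rule has_sum_int_halves)
    show "((\<lambda>m. ?b (int n - int m) * ?b (int m)) has_sum T) UNIV"
      unfolding b(1) T_def by (rule has_sum_infsum[OF toeplitz_summable])
    have "?b (int n - (- 1 - int m)) = ?u (m + Suc n)" for m
      using b(1)[of "m + Suc n"] by (simp add: algebra_simps)
    then show "((\<lambda>m. ?b (int n - (- 1 - int m)) * ?b (- 1 - int m)) has_sum (\<Sum>\<^sub>\<infinity>m. ?b (- 1 - int m) * ?u (m + Suc n))) UNIV"
      using has_sum_infsum[OF s] by (simp add: mult.commute)
  qed
  then have "cv (B t) (B t) (int n) = T + (\<Sum>\<^sub>\<infinity>m. ?b (- 1 - int m) * ?u (m + Suc n))"
    unfolding cv_def by (rule infsumI)
  moreover have "?b (int n - int (m + Suc n)) = ?b (- 1 - int m)" for m by (simp add: algebra_simps)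
  ultimately show ?thesis using split unfolding fin T_def[symmetric] by simp
qed

text \<open>Coefficient 0 of \<open>Kn_derivative\<close>. The transported Lax equation for Y = L X
  turns - i n^2 into + i n^2, and its Toeplitz row combines with the symmetrized sum to the
  convolution square.\<close>

lemma U_derivative:
  assumes L: "Lr (coef A) X Y"
  shows "((\<lambda>t. coef (U t) n) has_vector_derivative
    \<i> * of_nat n * of_nat n * coef (U t) n - \<i> * of_nat n * cv (B t) (B t) (int n)) (at t)"
proof -
  let ?u = "coef (U t)"
  let ?S = "\<Sum>i<n. of_nat (Suc i) * (?u (n - Suc i) * ?u (Suc i))"
  let ?T = "\<Sum>\<^sub>\<infinity>m. coef (B t) (int n - int m) * ?u m"
  have csum: "coef (sum h I) 0 = (\<Sum>i\<in>I. coef (h i) 0)" for h :: "nat \<Rightarrow> nat ell2" and I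
    by (induction I rule: infinite_finite_induct) auto
  have "((\<lambda>t. coef (U t) n) has_vector_derivative
      - \<i> * (of_nat n)\<^sup>2 * ?u n + 2 * \<i> * of_nat n * coef (W.W t Y) n + 2 * \<i> * ?S) (at t)"
    using bounded_linear.has_vector_derivative[OF bounded_linear_coef[of 0] Kn_derivative[OF L, of n t]]
    by (simp add: coef_U csum W.coef_W mult.assoc)
  moreover have "coef (W.W t Y) n = of_nat n * ?u n - ?T"
    using W_toep_eq[OF L, of t] by (simp add: toep_eq_def U_def)
  moreover have "- \<i> * (of_nat n)\<^sup>2 * ?u n + 2 * \<i> * of_nat n * (of_nat n * ?u n - ?T) + 2 * \<i> * ?S =
      \<i> * of_nat n * of_nat n * ?u n - \<i> * of_nat n * cv (B t) (B t) (int n)"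
  proof -
    have "2 * \<i> * ?S = \<i> * (2 * ?S)" by simp
    also have "\<dots> = \<i> * (of_nat n * (\<Sum>l\<le>n. ?u l * ?u (n - l)))" by (simp only: weighted_sum_symmetric)
    finally show ?thesis unfolding cv_B_B by (simp add: algebra_simps power2_eq_square)
  qed
  ultimately show ?thesis by simp
qed

lemma B_derivative:
  assumes L: "Lr (coef A) X Y"
  shows "((\<lambda>t. coef (B t) k) has_vector_derivative
    \<i> * of_int k * of_int \<bar>k\<bar> * coef (B t) k - \<i> * of_int k * cv (B t) (B t) k) (at t)"
proof (cases "k \<ge> 0")
  case True
  then show ?thesis using U_derivative[OF L, of "nat k" t] by (simp add: B_def coef_hext)
next
  case False
  define n where "n = nat (- k)"
  have k: "k = - int n" using False by (simp add: n_def)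
  have c: "coef (B t) k = cnj (coef (U t) n)" for t
    using False by (simp add: B_def coef_hext n_def)
  have h: "cv (B t) (B t) k = cnj (cv (B t) (B t) (int n))"
    using herm_cv[OF herm_B herm_B] unfolding k herm_def by blast
  have "((\<lambda>t. cnj (coef (U t) n)) has_vector_derivative
      cnj (\<i> * of_nat n * of_nat n * coef (U t) n - \<i> * of_nat n * cv (B t) (B t) (int n))) (at t)"
    by (rule bounded_linear.has_vector_derivative[OF bounded_linear_cnj U_derivative[OF L]])
  then show ?thesis unfolding c h by (simp add: k)
qed

lemma B_0: "B 0 = A"
proof -
  have K0: "K 0 = shl" by (rule ext) (simp add: K_def)
  have s: "coef ((shl ^^ n) f) m = coef f (m + n)" for n m and f :: "nat ell2"
    by (induction n arbitrary: m) (auto simp: coef_shl)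
  have "U 0 = X" by (rule ell2_eqI) (simp add: coef_U K0 s)
  then show ?thesis by (simp add: B_def hext_hl[OF herm_A])
qed

end

section \<open>Distributions with given Fourier coefficients\<close>

definition fser :: "(int \<Rightarrow> complex) \<Rightarrow> real \<Rightarrow> complex" where
  "fser c x = (\<Sum>\<^sub>\<infinity>k. c k * cis (of_int k * x))"

lemma fser_uniform_limit:
  assumes c: "(\<lambda>k. cmod (c k)) summable_on UNIV"
  shows "uniform_limit S (\<lambda>F x. \<Sum>k\<in>F. c k * cis (of_int k * x)) (fser c) (finite_subsets_at_top UNIV)"
proof (rule uniform_limitI)
  fix e :: real assume e: "e > 0"
  have "((\<lambda>F. \<Sum>k\<in>F. cmod (c k)) \<longlongrightarrow> (\<Sum>\<^sub>\<infinity>k. cmod (c k))) (finite_subsets_at_top UNIV)"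
    by (rule infsum_tendsto[OF c])
  then have "\<forall>\<^sub>F F in finite_subsets_at_top UNIV. (\<Sum>\<^sub>\<infinity>k. cmod (c k)) - e < (\<Sum>k\<in>F. cmod (c k))"
    by (rule order_tendstoD) (use e in simp)
  moreover have "\<forall>\<^sub>F F in finite_subsets_at_top UNIV. finite F"
    by (rule eventually_finite_subsets_at_top_weakI) simp
  ultimately show "\<forall>\<^sub>F F in finite_subsets_at_top UNIV. \<forall>x\<in>S. dist (\<Sum>k\<in>F. c k * cis (of_int k * x)) (fser c x) < e"
  proof eventually_elim
    case (elim F)
    show ?case
    proof
      fix x
      let ?f = "\<lambda>k. c k * cis (of_int k * x)"
      have n: "(\<lambda>k. norm (?f k)) summable_on A" for A
        using summable_on_subset_banach[OF c, of A] by (simp add: norm_mult)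
      have s: "?f summable_on A" for A by (rule abs_summable_summable[OF n])
      have "infsum ?f UNIV = infsum ?f (F \<union> - F)" by (rule arg_cong[of _ _ "infsum ?f"]) auto
      also have "\<dots> = sum ?f F + infsum ?f (- F)"
        using elim(2) by (subst infsum_Un_disjoint[OF s s]) auto
      finally have "dist (sum ?f F) (fser c x) = norm (infsum ?f (- F))"
        by (simp add: fser_def dist_norm norm_minus_commute)
      also have "\<dots> \<le> (\<Sum>\<^sub>\<infinity>k\<in>- F. cmod (c k))"
        using norm_infsum_bound[OF n[of "- F"]] by (simp add: norm_mult)
      also have "\<dots> < e"
      proof -
        have cs: "(\<lambda>k. cmod (c k)) summable_on A" for A by (rule summable_on_subset_banach[OF c]) simp
        have "(\<Sum>\<^sub>\<infinity>k. cmod (c k)) = (\<Sum>\<^sub>\<infinity>k\<in>F \<union> - F. cmod (c k))" by (rule arg_cong[of _ _ "infsum _"]) auto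
        also have "\<dots> = (\<Sum>k\<in>F. cmod (c k)) + (\<Sum>\<^sub>\<infinity>k\<in>- F. cmod (c k))"
          using elim(2) by (subst infsum_Un_disjoint[OF cs cs]) auto
        finally show ?thesis using elim(1) by simp
      qed
      finally show "dist (sum ?f F) (fser c x) < e" .
    qed
  qed
qed

lemma cis_continuous: "continuous_on S (\<lambda>x. cis (of_int k * x))"
  by (rule test_fun_continuous0[OF test_fun_cis1])

lemma fser_periodic_continuous:
  assumes c: "(\<lambda>k. cmod (c k)) summable_on UNIV" shows "periodic_continuous (fser c)"
  unfolding periodic_continuous_def
proof (intro conjI allI)
  show "continuous_on UNIV (fser c)"
    by (rule uniform_limit_theorem[OF _ fser_uniform_limit[OF c]])
      (auto intro!: always_eventually continuous_intros cis_continuous)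
  show "fser c (x + 2 * pi) = fser c x" for x
    unfolding fser_def cis_2pi_int ..
qed

lemma fser_integral:
  assumes c: "(\<lambda>k. cmod (c k)) summable_on UNIV" and g: "continuous_on {0..2 * pi} g"
  shows "((\<lambda>k. c k * integral {0..2 * pi} (\<lambda>x. cis (of_int k * x) * g x)) has_sum
    integral {0..2 * pi} (\<lambda>x. fser c x * g x)) UNIV"
proof -
  let ?I = "{0..2 * pi}"
  have bg: "bounded (g ` ?I)" by (intro compact_imp_bounded compact_continuous_image g) simp
  have cf: "continuous_on ?I (fser c)"
    using fser_periodic_continuous[OF c] continuous_on_subset unfolding periodic_continuous_def by blast
  have bf: "bounded (fser c ` ?I)" by (intro compact_imp_bounded compact_continuous_image cf) simp
  have "uniform_limit ?I (\<lambda>F x. (\<Sum>k\<in>F. c k * cis (of_int k * x)) * g x) (\<lambda>x. fser c x * g x) (finite_subsets_at_top UNIV)"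
    by (rule uniform_lim_mult[OF fser_uniform_limit[OF c] uniform_limit_const bf bg])
  then have u: "uniform_limit (cbox 0 (2 * pi)) (\<lambda>F x. (\<Sum>k\<in>F. c k * cis (of_int k * x)) * g x) (\<lambda>x. fser c x * g x) (finite_subsets_at_top UNIV)"
    by simp
  have ct: "continuous_on (cbox 0 (2 * pi)) (\<lambda>x. (\<Sum>k\<in>F. c k * cis (of_int k * x)) * g x)" for F
    using g by (auto intro!: continuous_intros cis_continuous)
  obtain I J where IJ: "\<And>F. ((\<lambda>x. (\<Sum>k\<in>F. c k * cis (of_int k * x)) * g x) has_integral I F) (cbox 0 (2 * pi))"
    "((\<lambda>x. fser c x * g x) has_integral J) (cbox 0 (2 * pi))" "(I \<longlongrightarrow> J) (finite_subsets_at_top UNIV)"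
    by (rule uniform_limit_integral_cbox[OF u ct]) auto
  have i: "(\<lambda>x. cis (of_int k * x) * g x) integrable_on ?I" for k
    by (intro integrable_continuous_interval continuous_intros cis_continuous g)
  have "I F = (\<Sum>k\<in>F. c k * integral ?I (\<lambda>x. cis (of_int k * x) * g x))" if "finite F" for F
  proof -
    have "((\<lambda>x. \<Sum>k\<in>F. c k * (cis (of_int k * x) * g x)) has_integral (\<Sum>k\<in>F. c k * integral ?I (\<lambda>x. cis (of_int k * x) * g x))) ?I"
      by (intro has_integral_sum that has_integral_mult_right integrable_integral i)
    then have "((\<lambda>x. (\<Sum>k\<in>F. c k * cis (of_int k * x)) * g x) has_integral (\<Sum>k\<in>F. c k * integral ?I (\<lambda>x. cis (of_int k * x) * g x))) (cbox 0 (2 * pi))"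
      by (simp add: sum_distrib_right mult.assoc)
    then show ?thesis using IJ(1) has_integral_unique by blast
  qed
  then have "\<forall>\<^sub>F F in finite_subsets_at_top UNIV. I F = (\<Sum>k\<in>F. c k * integral ?I (\<lambda>x. cis (of_int k * x) * g x))"
    by (intro eventually_finite_subsets_at_top_weakI) auto
  then have "((\<lambda>F. \<Sum>k\<in>F. c k * integral ?I (\<lambda>x. cis (of_int k * x) * g x)) \<longlongrightarrow> J) (finite_subsets_at_top UNIV)"
    using IJ(3) tendsto_cong by blast
  moreover have "J = integral ?I (\<lambda>x. fser c x * g x)" using IJ(2) by (simp add: integral_unique)
  ultimately show ?thesis by (simp add: has_sum_def)
qed

lemma fourier_distr_of_fun:
  "periodic_continuous h \<Longrightarrow> fourier (distr_of_fun h) n = integral {0..2 * pi} (\<lambda>x. h x * cis (- of_int n * x)) / (2 * pi)"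
  using test_fun_cis1[of "- n"] by (simp add: fourier_def distr_of_fun.rep_eq)

lemma fourier_fser:
  assumes c: "(\<lambda>k. cmod (c k)) summable_on UNIV"
  shows "fourier (distr_of_fun (fser c)) n = c n"
proof -
  have "((\<lambda>k. c k * mode_integral k (\<lambda>x. cis (- of_int n * x))) has_sum integral {0..2 * pi} (\<lambda>x. fser c x * cis (- of_int n * x))) UNIV"
    unfolding mode_integral_def using cis_continuous[of _ "- n"] by (intro fser_integral c) simp
  then have "(\<Sum>\<^sub>\<infinity>k. c k * mode_integral k (\<lambda>x. cis (- of_int n * x))) = integral {0..2 * pi} (\<lambda>x. fser c x * cis (- of_int n * x))"
    by (rule infsumI)
  moreover have "(\<Sum>\<^sub>\<infinity>k. c k * mode_integral k (\<lambda>x. cis (- of_int n * x))) = c n * (2 * pi)"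
    unfolding mode_integral_cis by (subst infsum_single[of n]) auto
  ultimately show ?thesis by (simp add: fourier_distr_of_fun[OF fser_periodic_continuous[OF c]])
qed

lemma fourier_square:
  assumes c: "(\<lambda>k. cmod (fourier u k)) summable_on UNIV"
  shows "fourier (distr_square u) n = (\<Sum>\<^sub>\<infinity>k. fourier u (n - k) * fourier u k)"
proof -
  let ?c = "fourier u"
  note h = fser_periodic_continuous[OF c]
  have "distr_of_fun (fser ?c) = u" by (rule fourier_inject) (rule fourier_fser[OF c])
  then have "distr_density u = fser ?c" using distr_density_of_fun[OF h] by simp
  then have sq: "distr_square u = distr_of_fun (\<lambda>x. fser ?c x * fser ?c x)"
    by (simp add: distr_square_def power2_eq_square)
  have pc: "periodic_continuous (\<lambda>x. fser ?c x * fser ?c x)"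
    using h by (auto simp: periodic_continuous_def intro!: continuous_intros)
  have ct: "continuous_on {0..2 * pi} (fser ?c)"
    using h continuous_on_subset unfolding periodic_continuous_def by blast
  have "((\<lambda>k. ?c k * integral {0..2 * pi} (\<lambda>x. cis (of_int k * x) * (fser ?c x * cis (- of_int n * x)))) has_sum
      integral {0..2 * pi} (\<lambda>x. fser ?c x * (fser ?c x * cis (- of_int n * x)))) UNIV"
    using cis_continuous[of _ "- n"] by (intro fser_integral c continuous_intros ct)
  moreover have "integral {0..2 * pi} (\<lambda>x. cis (of_int k * x) * (fser ?c x * cis (- of_int n * x))) = 2 * pi * ?c (n - k)" for k
  proof -
    have "(\<lambda>x. cis (of_int k * x) * (fser ?c x * cis (- of_int n * x))) = (\<lambda>x. fser ?c x * cis (- of_int (n - k) * x))"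
    proof
      fix x
      have "cis (of_int k * x) * cis (- of_int n * x) = cis (- of_int (n - k) * x)"
        by (simp add: cis_mult algebra_simps)
      then show "cis (of_int k * x) * (fser ?c x * cis (- of_int n * x)) = fser ?c x * cis (- of_int (n - k) * x)"
        by (metis mult.left_commute)
    qed
    then show ?thesis
      using fourier_distr_of_fun[OF h, of "n - k"] fourier_fser[OF c, of "n - k"] by (simp add: field_simps)
  qed
  ultimately have "((\<lambda>k. ?c k * (2 * pi * ?c (n - k))) has_sum integral {0..2 * pi} (\<lambda>x. fser ?c x * fser ?c x * cis (- of_int n * x))) UNIV"
    by (simp add: mult.assoc)
  then have "(\<Sum>\<^sub>\<infinity>k. (2 * pi) * (?c (n - k) * ?c k)) = integral {0..2 * pi} (\<lambda>x. fser ?c x * fser ?c x * cis (- of_int n * x))"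
    by (intro infsumI) (simp add: mult_ac)
  then show ?thesis
    unfolding sq fourier_distr_of_fun[OF pc] infsum_cmult_right' by (simp add: field_simps)
qed

lemma fourier_deriv: "fourier (distr_deriv u) n = \<i> * of_int n * fourier u n"
proof -
  have v: "vderiv (\<lambda>x. cis (- of_int n * x)) = (\<lambda>x. (- \<i> * of_int n) * cis (- of_int n * x))"
    using test_fun_cis(2)[of 1 1 "- n"] by simp
  have "pairing u (\<lambda>x. (- \<i> * of_int n) * cis (- of_int n * x)) = (- \<i> * of_int n) * pairing u (\<lambda>x. cis (- of_int n * x))"
    using is_distrD(2)[of "pairing u" "\<lambda>x. cis (- of_int n * x)" "- \<i> * of_int n"] test_fun_cis1[of "- n"] pairing[of u] by simp
  then have "- pairing u (vderiv (\<lambda>x. cis (- of_int n * x))) = \<i> * of_int n * pairing u (\<lambda>x. cis (- of_int n * x))"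
    unfolding v by simp
  then show ?thesis using test_fun_cis1[of "- n"]
    by (simp add: fourier_def distr_deriv.rep_eq)
qed

lemma fourier_add: "fourier (u + v) n = fourier u n + fourier v n"
  by (simp add: fourier_def plus_distr.rep_eq add_divide_distrib)

lemma fourier_scaleR: "fourier (r *\<^sub>R u) n = of_real r * fourier u n"
  by (simp add: fourier_def scaleR_distr.rep_eq scaleR_conv_of_real)

text \<open>For the converse, the conjugate distribution \<open>u'\<close> has the coefficients
  \<open>cnj (fourier u (- n))\<close>; if these are the coefficients of u, injectivity of the
  Fourier transform identifies the two.\<close>

lemma real_valued_iff: "real_valued u \<longleftrightarrow> herm (fourier u)"
proof
  assume r: "real_valued u"
  show "herm (fourier u)" unfolding herm_def
  proof
    fix n
    have "pairing u (\<lambda>x. cnj (cis (- of_int n * x))) = cnj (pairing u (\<lambda>x. cis (- of_int n * x)))"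
      using r test_fun_cis1[of "- n"] by (simp add: real_valued_def)
    then show "fourier u (- n) = cnj (fourier u n)" by (simp add: fourier_def cis_cnj)
  qed
next
  assume h: "herm (fourier u)"
  define u' where "u' f = cnj (pairing u (\<lambda>x. cnj (f x)))" for f
  have d: "is_distr (pairing u)" using pairing by simp
  have tc: "(\<lambda>x. cnj (f x)) \<in> test_fun" "(vderiv ^^ k) (\<lambda>x. cnj (f x)) = (\<lambda>x. cnj ((vderiv ^^ k) f x))"
    if "f \<in> test_fun" for f k
    by (rule test_funI[where D = "\<lambda>k x. cnj ((vderiv ^^ k) f x)"];
      use that test_fun_derivative[OF that] in \<open>auto simp: test_fun_periodic
        intro!: bounded_linear.has_vector_derivative[OF bounded_linear_cnj]\<close>)+
  have tc': "(\<lambda>x. cnj (f x)) \<in> test_fun \<longleftrightarrow> f \<in> test_fun" for f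
    using tc(1)[of f] tc(1)[of "\<lambda>x. cnj (f x)"] by auto
  obtain C N where C: "C \<ge> 0"
    "\<And>f M. f \<in> test_fun \<Longrightarrow> M \<ge> N \<Longrightarrow> cmod (pairing u f) \<le> C * (\<Sum>k\<le>M. sup_deriv k f)"
    using is_distr_boundE[OF d] by metis
  have "is_distr u'"
  proof (rule is_distrI[where C = C and N = N])
    fix f assume f: "f \<in> test_fun"
    have "cmod (u' f) \<le> C * (\<Sum>k\<le>N. sup_deriv k (\<lambda>x. cnj (f x)))"
      unfolding u'_def complex_mod_cnj by (rule C(2)[OF tc(1)[OF f]]) simp
    then show "cmod (u' f) \<le> C * (\<Sum>k\<le>N. sup_deriv k f)"
      by (simp add: sup_deriv_def tc(2)[OF f])
  next
    fix f g assume "f \<in> test_fun" "g \<in> test_fun"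
    then show "u' (\<lambda>x. f x + g x) = u' f + u' g"
      using is_distrD(1)[OF d tc(1) tc(1)] by (simp add: u'_def)
  next
    fix c f assume "f \<in> test_fun"
    then show "u' (\<lambda>x. c * f x) = c * u' f"
      using is_distrD(2)[OF d tc(1), of f "cnj c"] by (simp add: u'_def)
  next
    fix f assume "f \<notin> test_fun"
    then show "u' f = 0" using tc' is_distrD(3)[OF d] by (simp add: u'_def)
  qed
  then have p: "pairing (Abs_distr u') = u'" by (simp add: Abs_distr_inverse)
  have "Abs_distr u' = u"
  proof (rule fourier_inject)
    fix n
    have "pairing u (\<lambda>x. cis (- (- of_int n) * x)) = 2 * pi * fourier u (- n)" by (simp add: fourier_def)
    then have "u' (\<lambda>x. cis (- of_int n * x)) = 2 * pi * fourier u n"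
      using h by (simp add: u'_def cis_cnj herm_def)
    then show "fourier (Abs_distr u') n = fourier u n" by (simp add: fourier_def[of "Abs_distr u'"] p)
  qed
  then have "pairing u f = cnj (pairing u (\<lambda>x. cnj (f x)))" for f using p u'_def by metis
  then show "real_valued u" unfolding real_valued_def by (metis complex_cnj_cnj)
qed

lemma jw_powr_32_summable: "(\<lambda>k. C * jw k powr (- 3 / 2)) summable_on UNIV"
  by (rule summable_on_cmult_right[OF jw_powr_summable])

text \<open>Division by - k^2 leaves coefficients of order |k|^(-3/2), an absolutely convergent
  series; its second derivative has the required nonzero modes, and a constant supplies mode 0. The
  exponent 1/2 accommodates H^(-s) for s < 1/2.\<close>

lemma distr_of_coefs:
  fixes c :: "int \<Rightarrow> complex"
  assumes c: "\<And>k. cmod (c k) \<le> C * jw k powr (1 / 2)"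
  obtains u where "\<And>k. fourier u k = c k"
proof -
  define d where "d k = (if k = 0 then 0 else - c k / (of_int k)\<^sup>2)" for k
  define e where "e k = (if k = 0 then c 0 else 0)" for k :: int
  have C0: "C \<ge> 0"
  proof -
    have "0 \<le> C * jw 0 powr (1 / 2)" by (rule order_trans[OF norm_ge_zero c])
    then show ?thesis by (simp add: jw_def)
  qed
  have d: "(\<lambda>k. cmod (d k)) summable_on UNIV"
  proof (rule summable_on_le[OF jw_powr_32_summable[of "4 * C"]])
    fix k
    show "cmod (d k) \<le> 4 * C * jw k powr (- 3 / 2)"
    proof (cases "k = 0")
      case False
      then have k1: "1 \<le> \<bar>real_of_int k\<bar>" by linarith
      have "jw k \<le> 2 * \<bar>real_of_int k\<bar>" using k1 by (simp add: jw_def)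
      then have "(jw k)\<^sup>2 \<le> (2 * \<bar>real_of_int k\<bar>)\<^sup>2" using jw_ge1[of k] by (intro power_mono) auto
      then have q: "(jw k)\<^sup>2 \<le> 4 * (real_of_int k)\<^sup>2" by (simp add: power_mult_distrib)
      have "cmod (d k) = cmod (c k) / (real_of_int k)\<^sup>2" using False by (simp add: d_def norm_divide norm_power)
      also have "\<dots> \<le> (C * jw k powr (1 / 2)) / ((jw k)\<^sup>2 / 4)"
        using q c[of k] jw_ge1[of k] C0 by (intro frac_le) auto
      also have "\<dots> = 4 * C * (jw k powr (1 / 2) / jw k powr 2)" using jw_ge1[of k] by simp
      also have "jw k powr (1 / 2) / jw k powr 2 = jw k powr (1 / 2 - 2)" by (rule powr_diff[symmetric])
      also have "1 / 2 - 2 = (- 3 / 2 :: real)" by simp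
      finally show ?thesis .
    qed (use C0 in \<open>simp add: d_def\<close>)
  qed simp
  have e: "(\<lambda>k. cmod (e k)) summable_on UNIV"
    by (rule finite_nonzero_values_imp_summable_on) (rule finite_subset[of _ "{0}"], auto simp: e_def)
  have "fourier (distr_deriv (distr_deriv (distr_of_fun (fser d))) + distr_of_fun (fser e)) k = c k" for k
    by (auto simp: fourier_add fourier_deriv fourier_fser[OF d] fourier_fser[OF e] d_def e_def power2_eq_square)
  then show thesis by (rule that)
qed

section \<open>Sobolev spaces as weighted square-summable families\<close>

text \<open>An isometry from the Sobolev space to l^2, through which convergence in
  \<open>sobolev_top\<close> becomes norm convergence.\<close>

definition emb :: "real \<Rightarrow> distr \<Rightarrow> int ell2" where
  "emb \<sigma> u = Abs_ell2 (\<lambda>k. of_real (japanese k powr \<sigma>) * fourier u k)"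

lemma japanese_ge1: "japanese k \<ge> 1" by (simp add: japanese_def)

lemma japanese_le_jw: "japanese k \<le> jw k" "jw k \<le> 2 * japanese k"
  by (simp_all add: japanese_def jw_def)

lemma weight_sq: "(cmod (of_real (japanese k powr \<sigma>) * c))\<^sup>2 = japanese k powr (2 * \<sigma>) * (cmod c)\<^sup>2"
  by (simp add: norm_mult power_mult_distrib power2_eq_square flip: powr_add)

lemma sobolev_iff:
  "u \<in> sobolev \<sigma> \<longleftrightarrow> herm (fourier u) \<and> (\<lambda>k. (cmod (of_real (japanese k powr \<sigma>) * fourier u k))\<^sup>2) summable_on UNIV"
  unfolding sobolev_def weight_sq by (simp add: real_valued_iff)

lemma coef_emb: "u \<in> sobolev \<sigma> \<Longrightarrow> coef (emb \<sigma> u) k = of_real (japanese k powr \<sigma>) * fourier u k"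
  unfolding emb_def by (subst coef_Abs_ell2) (auto simp: sobolev_iff)

lemma norm_emb: "u \<in> sobolev \<sigma> \<Longrightarrow> sobolev_norm \<sigma> u = norm (emb \<sigma> u)"
  unfolding sobolev_norm_def norm_infsum weight_sq[symmetric] by (simp add: coef_emb)

lemma herm_diff: "herm a \<Longrightarrow> herm b \<Longrightarrow> herm (\<lambda>k. a k - b k)"
  by (simp add: herm_def)

lemma sobolev_dominated:
  assumes "herm (fourier u)" "\<And>k. cmod (of_real (japanese k powr \<sigma>) * fourier u k) \<le> C * cmod (coef g k)"
  shows "u \<in> sobolev \<sigma>"
  unfolding sobolev_iff
proof (intro conjI assms(1) summable_on_le[OF summable_on_cmult_right[OF coef_summable[of g], of "C\<^sup>2"]])
  show "(cmod (of_real (japanese k powr \<sigma>) * fourier u k))\<^sup>2 \<le> C\<^sup>2 * (cmod (coef g k))\<^sup>2" for k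
    using power_mono[OF assms(2)[of k] norm_ge_zero, where n = 2] by (simp add: power_mult_distrib)
qed auto

lemma sobolev_diff:
  assumes "u \<in> sobolev \<sigma>" "v \<in> sobolev \<sigma>"
  shows "u - v \<in> sobolev \<sigma>" "emb \<sigma> (u - v) = emb \<sigma> u - emb \<sigma> v"
proof -
  have "cmod (of_real (japanese k powr \<sigma>) * fourier (u - v) k) \<le> 1 * cmod (coef (emb \<sigma> u - emb \<sigma> v) k)" for k
    by (simp add: coef_emb assms fourier_diff right_diff_distrib)
  moreover have "herm (fourier (u - v))"
    using herm_diff[of "fourier u" "fourier v"] assms by (simp add: sobolev_iff fourier_diff[abs_def])
  ultimately show d: "u - v \<in> sobolev \<sigma>" by (intro sobolev_dominated)
  show "emb \<sigma> (u - v) = emb \<sigma> u - emb \<sigma> v"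
    by (rule ell2_eqI) (simp add: coef_emb assms d fourier_diff right_diff_distrib)
qed

lemma sobolev_norm_diff:
  "u \<in> sobolev \<sigma> \<Longrightarrow> v \<in> sobolev \<sigma> \<Longrightarrow> sobolev_norm \<sigma> (u - v) = norm (emb \<sigma> u - emb \<sigma> v)"
  by (simp add: norm_emb sobolev_diff)

lemma limitin_sobolev:
  "limitin (sobolev_top \<sigma>) f l F \<longleftrightarrow>
    l \<in> sobolev \<sigma> \<and> (\<forall>\<^sub>F x in F. f x \<in> sobolev \<sigma>) \<and> ((\<lambda>x. sobolev_norm \<sigma> (f x - l)) \<longlongrightarrow> 0) F"
  unfolding mtopology_of_def mspace_sobolev mdist_sobolev
  by (rule Metric_space.limitin_metric_dist_null[OF sobolev_Metric_space])

lemma limitin_sobolevI: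
  assumes "l \<in> sobolev \<sigma>" "\<And>x. f x \<in> sobolev \<sigma>" "((\<lambda>x. emb \<sigma> (f x)) \<longlongrightarrow> emb \<sigma> l) F"
  shows "limitin (sobolev_top \<sigma>) f l F"
proof -
  have "((\<lambda>x. norm (emb \<sigma> (f x) - emb \<sigma> l)) \<longlongrightarrow> 0) F"
    using assms(3) by (simp add: tendsto_norm_zero_iff LIM_zero_iff)
  then show ?thesis using assms(1,2) by (simp add: limitin_sobolev sobolev_norm_diff)
qed

lemma continuous_map_sobolevI:
  assumes "\<And>t. f t \<in> sobolev \<sigma>" "\<And>t. ((\<lambda>s. emb \<sigma> (f s)) \<longlongrightarrow> emb \<sigma> (f t)) (at t)"
  shows "continuous_map euclideanreal (sobolev_top \<sigma>) f"
proof -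
  interpret Metric_space "sobolev \<sigma>" "\<lambda>u v. sobolev_norm \<sigma> (u - v)" by (rule sobolev_Metric_space)
  have "continuous_map euclideanreal mtopology f"
    unfolding continuous_map_to_metric
  proof (intro ballI allI impI)
    fix t e :: real assume e: "e > 0"
    have "\<forall>\<^sub>F s in at t. dist (emb \<sigma> (f s)) (emb \<sigma> (f t)) < e" by (rule tendstoD[OF assms(2) e])
    then obtain U where U: "open U" "t \<in> U" "\<And>s. s \<in> U \<Longrightarrow> s \<noteq> t \<Longrightarrow> dist (emb \<sigma> (f s)) (emb \<sigma> (f t)) < e"
      unfolding eventually_at_topological by blast
    have "f s \<in> mball (f t) e" if "s \<in> U" for s
    proof -
      have "dist (emb \<sigma> (f s)) (emb \<sigma> (f t)) < e" using U(3)[OF that] e by (cases "s = t") auto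
      then show ?thesis
        using assms(1) by (simp add: sobolev_norm_diff dist_norm norm_minus_commute)
    qed
    then show "\<exists>U. openin euclideanreal U \<and> t \<in> U \<and> (\<forall>y\<in>U. f y \<in> mball (f t) e)"
      using U(1,2) by (metis open_openin)
  qed
  then show ?thesis by (simp add: mtopology_of_def)
qed

text \<open>The compact embedding at work: \<epsilon> is the ratio of a weaker weight to a stronger
  one, and boundedness in the stronger norm upgrades coordinatewise convergence to convergence in
  the weaker one.\<close>

lemma weighted_tendsto:
  fixes h g :: "'b \<Rightarrow> 'a ell2"
  assumes le: "\<And>x k. cmod (coef (h x) k) \<le> \<epsilon> k * cmod (coef (g x) k)"
    and eps: "\<And>k. 0 \<le> \<epsilon> k" "\<And>e. e > 0 \<Longrightarrow> finite {k. \<epsilon> k > e}"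
    and M: "\<And>x. norm (g x) \<le> M"
    and co: "\<And>k. ((\<lambda>x. coef (h x) k) \<longlongrightarrow> coef l k) F"
  shows "(h \<longlongrightarrow> l) F"
proof (rule tendsto_ell2_tails[OF co])
  fix e :: real assume e: "e > 0"
  have p: "M\<^sup>2 + 1 > 0" by (simp add: add_nonneg_pos)
  define d where "d = sqrt (e / (M\<^sup>2 + 1))"
  have d: "d > 0" "d\<^sup>2 = e / (M\<^sup>2 + 1)" using e p by (auto simp: d_def)
  let ?A = "{k. \<epsilon> k > d}"
  have "(\<Sum>\<^sub>\<infinity>k\<in>- ?A. (cmod (coef (h x) k))\<^sup>2) \<le> e" for x
  proof -
    have "(\<Sum>\<^sub>\<infinity>k\<in>- ?A. (cmod (coef (h x) k))\<^sup>2) \<le> (\<Sum>\<^sub>\<infinity>k\<in>- ?A. d\<^sup>2 * (cmod (coef (g x) k))\<^sup>2)"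
    proof (intro infsum_mono coef_summable summable_on_cmult_right)
      fix k assume "k \<in> - ?A"
      then have "\<epsilon> k * cmod (coef (g x) k) \<le> d * cmod (coef (g x) k)" by (intro mult_right_mono) auto
      then have "cmod (coef (h x) k) \<le> d * cmod (coef (g x) k)" using le[of x k] by linarith
      from power_mono[OF this norm_ge_zero, where n = 2]
      show "(cmod (coef (h x) k))\<^sup>2 \<le> d\<^sup>2 * (cmod (coef (g x) k))\<^sup>2" by (simp add: power_mult_distrib)
    qed
    also have "\<dots> = d\<^sup>2 * (\<Sum>\<^sub>\<infinity>k\<in>- ?A. (cmod (coef (g x) k))\<^sup>2)" by (rule infsum_cmult_right')
    also have "\<dots> \<le> d\<^sup>2 * (norm (g x))\<^sup>2"
      unfolding norm_sq_infsum by (intro mult_left_mono infsum_mono2 coef_summable) auto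
    also have "\<dots> \<le> d\<^sup>2 * M\<^sup>2" by (intro mult_left_mono power_mono M) auto
    also have "\<dots> \<le> e" using p e unfolding d(2) by (simp add: field_simps)
    finally show ?thesis .
  qed
  then show "\<exists>A. finite A \<and> (\<forall>\<^sub>F x in F. (\<Sum>\<^sub>\<infinity>k\<in>- A. (cmod (coef (h x) k))\<^sup>2) \<le> e)"
    using eps(2)[OF d(1)] by (intro exI[of _ ?A]) simp
qed

lemma japanese_decay:
  assumes e: "e > 0" and p: "p > 0" shows "finite {k. japanese k powr (- p) > e}"
proof -
  obtain N :: nat where N: "real N > e powr (- 1 / p)" using reals_Archimedean2 by blast
  have "k \<in> {- int N..int N}" if "japanese k powr (- p) > e" for k
  proof -
    have j: "japanese k > 0" using japanese_ge1[of k] by linarith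
    have "(japanese k powr (- p)) powr (- 1 / p) < e powr (- 1 / p)"
      using that e p by (intro powr_less_mono2_neg) auto
    then have "japanese k < e powr (- 1 / p)" using j p by (simp add: powr_powr)
    then have "\<bar>real_of_int k\<bar> < real N" using N by (simp add: japanese_def)
    then show ?thesis by (simp add: abs_less_iff)
  qed
  then have "{k. japanese k powr (- p) > e} \<subseteq> {- int N..int N}" by blast
  then show ?thesis by (rule finite_subset) simp
qed

lemma cv_le: "cmod (cv P Q n) \<le> norm P * norm Q"
proof (rule power2_le_imp_le)
  show "(cmod (cv P Q n))\<^sup>2 \<le> (norm P * norm Q)\<^sup>2"
    using row_prod_summable(3)[OF shift_row'(1)[of P n], of Q] by (simp add: cv_def shift_row'(2) power_mult_distrib)
qed simp

lemma bounded_bilinear_cv: "bounded_bilinear (\<lambda>P Q. cv P Q n)"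
proof (rule bounded_bilinear.intro)
  fix P P' Q Q' :: "int ell2" and r :: real
  show "cv (P + P') Q n = cv P Q n + cv P' Q n" "cv P (Q + Q') n = cv P Q n + cv P Q' n"
    unfolding cv_def by (simp_all add: distrib_left distrib_right infsum_add cv_summable)
  show "cv (r *\<^sub>R P) Q n = r *\<^sub>R cv P Q n" "cv P (r *\<^sub>R Q) n = r *\<^sub>R cv P Q n"
    unfolding cv_def by (simp_all add: mult.assoc mult.left_commute infsum_cmult_right' scaleR_conv_of_real)
  show "\<exists>K. \<forall>P Q. norm (cv P Q n) \<le> norm P * norm Q * K"
    using cv_le by (intro exI[of _ 1]) simp
qed

section \<open>Classical solutions\<close>

context lax_smooth
begin

text \<open>7/4 lies between the 3/2 demanded by \<open>bo_solution\<close> and the 2 for which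
  \<open>U_h2\<close> gives bounds uniform in time. The gap 1/4 lets coordinatewise continuity imply
  continuity in H^(7/4). The time derivative is bounded in l^2, and the target exponent 7/4 - 2 = -
  1/4 leaves the same gap there.\<close>

lemma classical_solution:
  assumes fin: "finite {k. coef A k \<noteq> 0}"
  obtains v where "bo_classical_solution (7 / 4) v" "\<And>t k. fourier (v t) k = coef (B t) k"
    "\<And>t. (B \<longlongrightarrow> B t) (at t)"
proof -
  have "{n. coef X n \<noteq> 0} \<subseteq> nat ` {k. coef A k \<noteq> 0}" by force
  then have fX: "finite {n. coef X n \<noteq> 0}" using fin finite_surj by blast
  obtain Y where Y: "Lr (coef A) X Y" by (rule Lr_finite_support[OF fin fX])
  obtain C where C: "\<And>t. \<exists>u2. (\<forall>n. coef u2 n = of_real ((real n + 1)\<^sup>2) * coef (U t) n) \<and> norm u2 \<le> C"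
    using U_h2[OF fin] by blast
  have "\<exists>g. (\<forall>k. coef g k = of_real ((jw k)\<^sup>2) * coef (B t) k) \<and> norm g \<le> 2 * C" for t
  proof -
    obtain u2 where u2: "\<And>n. coef u2 n = of_real ((real n + 1)\<^sup>2) * coef (U t) n" "norm u2 \<le> C" using C by blast
    have C0: "C \<ge> 0" using order_trans[OF norm_ge_zero u2(2)] .
    have "coef (hext u2) k = of_real ((jw k)\<^sup>2) * coef (B t) k" for k
      by (auto simp: coef_hext B_def u2 jw_def)
    moreover have "norm (hext u2) \<le> 2 * C"
    proof (rule power2_le_imp_le)
      have "(norm (hext u2))\<^sup>2 \<le> 2 * (norm u2)\<^sup>2" by (rule norm_hext_le)
      also have "\<dots> \<le> 4 * C\<^sup>2"
        using power_mono[OF u2(2) norm_ge_zero, where n = 2] zero_le_power2[of C] by linarith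
      finally show "(norm (hext u2))\<^sup>2 \<le> (2 * C)\<^sup>2" by (simp add: power_mult_distrib)
    qed (use C0 in simp)
    ultimately show ?thesis by blast
  qed
  then obtain g where g: "\<And>t k. coef (g t) k = of_real ((jw k)\<^sup>2) * coef (B t) k" "\<And>t. norm (g t) \<le> 2 * C" by metis
  have C0: "C \<ge> 0" using order_trans[OF norm_ge_zero g(2)[of 0]] by simp
  let ?b = "\<lambda>t. coef (B t)"
  define b' where "b' t k = \<i> * of_int k * of_int \<bar>k\<bar> * ?b t k - \<i> * of_int k * cv (B t) (B t) k" for t k
  have db: "((\<lambda>t. ?b t k) has_vector_derivative b' t k) (at t)" for t k
    unfolding b'_def by (rule B_derivative[OF Y])
  have cmod_g: "cmod (coef (g t) k) = (jw k)\<^sup>2 * cmod (?b t k)" for t k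
    by (simp add: g(1) norm_mult norm_power)
  have jw2: "(jw k)\<^sup>2 \<ge> jw k" "(jw k)\<^sup>2 \<ge> 1" for k
    using jw_ge1[of k] self_le_power[of "jw k" 2] by (auto simp: one_le_power)
  have "\<exists>g1. (\<forall>k. coef g1 k = of_real (jw k) * ?b t k) \<and> norm g1 \<le> 2 * C" for t
  proof -
    have le: "cmod (of_real (1 / jw k)) \<le> 1" for k
      unfolding norm_of_real using jw_ge1[of k] by simp
    have "coef (dmul (\<lambda>k. of_real (1 / jw k)) (g t)) k = of_real (jw k) * ?b t k" for k
    proof -
      have "1 / jw k * (jw k)\<^sup>2 = jw k" using jw_ge1[of k] by (simp add: power2_eq_square)
      then have "complex_of_real (1 / jw k) * of_real ((jw k)\<^sup>2) = of_real (jw k)" by (simp only: of_real_mult[symmetric])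
      then show ?thesis unfolding coef_dmul[OF le] g(1) by (simp only: mult.assoc[symmetric])
    qed
    moreover have "norm (dmul (\<lambda>k. of_real (1 / jw k)) (g t)) \<le> 2 * C"
      using norm_dmul[of "\<lambda>k. of_real (1 / jw k)" 1 "g t", OF le] g(2)[of t] by linarith
    ultimately show ?thesis by blast
  qed
  then obtain g1 where g1: "\<And>t k. coef (g1 t) k = of_real (jw k) * ?b t k" "\<And>t. norm (g1 t) \<le> 2 * C" by metis
  define C' where "C' = 2 * C + 2 * sqrt cS * (2 * C) * (2 * C)"
  have "\<exists>q. (\<forall>k. coef q k = b' t k) \<and> norm q \<le> C'" for t
  proof -
    obtain R where R: "\<And>n. coef R n = of_real (jw n) * cv (B t) (B t) n" "norm R \<le> 2 * sqrt cS * norm (g1 t) * norm (g1 t)"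
      using h1_conv[OF g1(1) g1(1)] by blast
    define m1 where "m1 k = \<i> * of_int k * of_int \<bar>k\<bar> / of_real ((jw k)\<^sup>2)" for k
    define m2 where "m2 k = \<i> * of_int k / of_real (jw k)" for k
    have k: "\<bar>real_of_int k\<bar> \<le> jw k" for k by (simp add: jw_def)
    have l1: "cmod (m1 k) \<le> 1" and l2: "cmod (m2 k) \<le> 1" for k
      using mult_mono[OF k k, of k k] jw_ge1[of k] k[of k]
      by (simp_all add: m1_def m2_def norm_mult norm_divide norm_power power2_eq_square divide_le_eq_1)
    have jz: "complex_of_real (jw k) \<noteq> 0" for k using jw_ge1[of k] by simp
    define q where "q = dmul m1 (g t) - dmul m2 R"
    have "coef q k = b' t k" for k
      using jz[of k] by (simp add: q_def coef_dmul[OF l1] coef_dmul[OF l2] g(1) R(1) m1_def m2_def b'_def)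
    moreover have "norm q \<le> C'"
    proof -
      have "norm q \<le> norm (dmul m1 (g t)) + norm (dmul m2 R)" unfolding q_def by (rule norm_triangle_ineq4)
      also have "\<dots> \<le> norm (g t) + norm R"
        using norm_dmul[of m1, OF l1, of "g t"] norm_dmul[of m2, OF l2, of R] by simp
      also have "norm R \<le> 2 * sqrt cS * (2 * C) * (2 * C)"
        using cS_nonneg C0 by (intro order_trans[OF R(2)] mult_mono g1 mult_nonneg_nonneg order_refl) auto
      finally show ?thesis using g(2)[of t] by (simp add: C'_def)
    qed
    ultimately show ?thesis by blast
  qed
  then obtain q where q: "\<And>t k. coef (q t) k = b' t k" "\<And>t. norm (q t) \<le> C'" by metis
  let ?eps = "\<lambda>k. japanese k powr (- (1 / 4))"
  note eps = powr_ge_zero[of "japanese _" "- (1 / 4)"] japanese_decay[of _ "1 / 4"]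
  have cb: "((\<lambda>s. ?b s k) \<longlongrightarrow> ?b t k) (at t)" for t k
    using has_vector_derivative_continuous[OF db[of k t]] by (simp add: continuous_within)
  have jp: "1 \<le> ?eps k * (jw k)\<^sup>2" "japanese k powr (7 / 4) \<le> ?eps k * (jw k)\<^sup>2" for k
  proof -
    have j: "japanese k > 0" using japanese_ge1[of k] by linarith
    have "japanese k powr (7 / 4) = ?eps k * japanese k powr 2" by (simp flip: powr_add)
    also have "japanese k powr 2 = (japanese k)\<^sup>2" using j by simp
    finally have *: "japanese k powr (7 / 4) = ?eps k * (japanese k)\<^sup>2" .
    show 2: "japanese k powr (7 / 4) \<le> ?eps k * (jw k)\<^sup>2"
      unfolding * using j japanese_le_jw(1)[of k] by (intro mult_left_mono power_mono) auto
    show "1 \<le> ?eps k * (jw k)\<^sup>2"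
      using 2 ge_one_powr_ge_zero[OF japanese_ge1, of "7 / 4" k] by simp
  qed
  have Bc: "(B \<longlongrightarrow> B t) (at t)" for t
  proof (rule weighted_tendsto[where g = g and \<epsilon> = ?eps and M = "2 * C"])
    show "cmod (?b s k) \<le> ?eps k * cmod (coef (g s) k)" for s k
      using mult_right_mono[OF jp(1)[of k] norm_ge_zero[of "?b s k"]] by (simp add: cmod_g mult.assoc)
  qed (use eps g(2) cb in auto)
  have b_bound: "cmod (?b t k) \<le> 2 * C * jw k powr (- 3 / 2)" for t k
  proof -
    have "jw k powr 2 * cmod (?b t k) \<le> 2 * C"
      using coef_le_norm[of "g t" k] g(2)[of t] jw_ge1[of k] by (simp add: cmod_g)
    then have "jw k powr (- 2) * (jw k powr 2 * cmod (?b t k)) \<le> jw k powr (- 2) * (2 * C)"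
      by (rule mult_left_mono) simp
    also have "jw k powr (- 2) * (jw k powr 2 * cmod (?b t k)) = cmod (?b t k)"
    proof -
      have "jw k powr (- 2) * jw k powr 2 = jw k powr (- 2 + 2)" by (rule powr_add[symmetric])
      also have "\<dots> = 1" using jw_ge1[of k] by simp
      finally show ?thesis unfolding mult.assoc[symmetric] by simp
    qed
    also have "jw k powr (- 2) * (2 * C) \<le> jw k powr (- 3 / 2) * (2 * C)"
      using jw_ge1[of k] C0 by (intro mult_right_mono powr_mono) auto
    finally show ?thesis by (simp add: mult.commute)
  qed
  have b_sum: "(\<lambda>k. cmod (?b t k)) summable_on UNIV" for t
    by (rule summable_on_le[OF jw_powr_32_summable[of "2 * C"]]) (use b_bound in auto)
  have "\<exists>u. \<forall>k. fourier u k = c k" if "\<And>k. cmod (c k) \<le> D" "D \<ge> 0" for c D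
  proof -
    have "cmod (c k) \<le> D * jw k powr (1 / 2)" for k
    proof -
      have "D * 1 \<le> D * jw k powr (1 / 2)"
        using that(2) by (intro mult_left_mono ge_one_powr_ge_zero jw_ge1) auto
      then show ?thesis using that(1)[of k] by linarith
    qed
    then show ?thesis using distr_of_coefs[of c D] by metis
  qed note ex = this
  have C'0: "C' \<ge> 0" using order_trans[OF norm_ge_zero q(2)] .
  have "\<exists>u. \<forall>k. fourier u k = ?b t k" for t
    by (rule ex[OF coef_le_norm norm_ge_zero])
  then obtain v where v: "\<And>t k. fourier (v t) k = ?b t k" by metis
  have "\<exists>u. \<forall>k. fourier u k = b' t k" for t
    using ex[of "b' t" C', OF _ C'0] order_trans[OF coef_le_norm q(2)] q(1) by metis
  then obtain v' where v': "\<And>t k. fourier (v' t) k = b' t k" by metis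
  have vf: "fourier (v t) = ?b t" "fourier (v' t) = b' t" for t using v v' by auto
  have hb: "herm (?b t)" for t by (rule herm_B)
  have hb': "herm (b' t)" for t
    using hb[of t] herm_cv[OF hb hb, of t t] by (auto simp: herm_def b'_def)
  have vs: "v t \<in> sobolev (7 / 4)" for t
  proof (rule sobolev_dominated[where C = 1 and g = "g t"])
    have "japanese k powr (7 / 4) \<le> 1 * (jw k)\<^sup>2" for k
    proof -
      have "?eps k \<le> 1" using japanese_ge1[of k] powr_mono[of "- (1 / 4)" 0 "japanese k"] by simp
      then have "?eps k * (jw k)\<^sup>2 \<le> 1 * (jw k)\<^sup>2" by (rule mult_right_mono) simp
      then show ?thesis using jp(2)[of k] by linarith
    qed
    then show "cmod (of_real (japanese k powr (7 / 4)) * fourier (v t) k) \<le> 1 * cmod (coef (g t) k)" for k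
      by (simp add: norm_mult v cmod_g mult_right_mono)
  qed (simp add: vf hb)
  have ve: "japanese k powr (- (1 / 4)) \<le> 1" for k
    using japanese_ge1[of k] powr_mono[of "- (1 / 4)" 0 "japanese k"] by simp
  have v's: "v' t \<in> sobolev (- (1 / 4))" for t
    by (rule sobolev_dominated[where C = 1 and g = "q t"])
      (simp_all add: vf hb' norm_mult q(1) mult_left_le_one_le ve)
  have vs': "v t \<in> sobolev (- (1 / 4))" for t
    by (rule sobolev_dominated[where C = 1 and g = "B t"])
      (simp_all add: vf hb norm_mult mult_left_le_one_le ve)
  have cont1: "continuous_map euclideanreal (sobolev_top (7 / 4)) v"
  proof (rule continuous_map_sobolevI[OF vs])
    fix t
    show "((\<lambda>s. emb (7 / 4) (v s)) \<longlongrightarrow> emb (7 / 4) (v t)) (at t)"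
    proof (rule weighted_tendsto[where g = g and \<epsilon> = ?eps and M = "2 * C"])
      show "cmod (coef (emb (7 / 4) (v s)) k) \<le> ?eps k * cmod (coef (g s) k)" for s k
        using mult_right_mono[OF jp(2)[of k] norm_ge_zero[of "?b s k"]]
        by (simp add: coef_emb[OF vs] v norm_mult cmod_g mult.assoc)
      show "((\<lambda>s. coef (emb (7 / 4) (v s)) k) \<longlongrightarrow> coef (emb (7 / 4) (v t)) k) (at t)" for k
        unfolding coef_emb[OF vs] v by (intro tendsto_mult tendsto_const cb)
    qed (use eps g(2) in auto)
  qed
  have cont2: "continuous_map euclideanreal (sobolev_top (- (1 / 4))) v'"
  proof (rule continuous_map_sobolevI[OF v's])
    fix t
    have cb': "((\<lambda>s. b' s k) \<longlongrightarrow> b' t k) (at t)" for k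
      unfolding b'_def by (intro tendsto_intros cb bounded_bilinear.tendsto[OF bounded_bilinear_cv Bc Bc])
    show "((\<lambda>s. emb (- (1 / 4)) (v' s)) \<longlongrightarrow> emb (- (1 / 4)) (v' t)) (at t)"
    proof (rule weighted_tendsto[where g = q and \<epsilon> = ?eps and M = C'])
      show "cmod (coef (emb (- (1 / 4)) (v' s)) k) \<le> ?eps k * cmod (coef (q s) k)" for s k
        by (simp add: coef_emb[OF v's] v' norm_mult q(1))
      show "((\<lambda>s. coef (emb (- (1 / 4)) (v' s)) k) \<longlongrightarrow> coef (emb (- (1 / 4)) (v' t)) k) (at t)" for k
        unfolding coef_emb[OF v's] v' by (intro tendsto_mult tendsto_const cb')
    qed (use eps q(2) in auto)
  qed
  have lip: "norm (B (t + h) - B t) \<le> C' * \<bar>h\<bar>" for t h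
  proof (rule norm_le_finite)
    fix F :: "int set" assume F: "finite F"
    \<comment> \<open>Coordinatewise derivatives combine to a derivative in norm for a finite
      truncation; the mean value bound C' does not depend on F, so it passes to the whole
      vector.\<close>
    define p where "p f = (\<Sum>k\<in>F. cmul (f k) (bas k))" for f :: "int \<Rightarrow> complex"
    have cp: "coef (p f) k = (if k \<in> F then f k else 0)" for f k
    proof -
      have "coef (\<Sum>k\<in>I. cmul (f k) (bas k)) j = (if j \<in> I then f j else 0)" if "finite I" for I :: "int set" and j
        using that by (induction I) auto
      then show ?thesis using F by (simp add: p_def)
    qed
    have pd: "((\<lambda>s. p (?b s)) has_vector_derivative p (b' s)) (at s)" for s
      unfolding p_def
      by (intro has_vector_derivative_sum bounded_linear.has_vector_derivative[OF _ db]
          bounded_bilinear.bounded_linear_left[OF bounded_bilinear_cmul])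
    have pn: "norm (p (b' s)) \<le> C'" for s
    proof -
      have "norm (p (b' s)) \<le> 1 * norm (q s)" by (rule norm_mono) (auto simp: cp q(1))
      then show ?thesis using q(2)[of s] by simp
    qed
    have "norm (p (?b (t + h)) - p (?b t)) \<le> C' * norm ((t + h) - t)"
    proof (rule differentiable_bound[of UNIV "\<lambda>s. p (?b s)" "\<lambda>s h. h *\<^sub>R p (b' s)"])
      show "((\<lambda>s. p (?b s)) has_derivative (\<lambda>h. h *\<^sub>R p (b' s))) (at s within UNIV)" for s
        using pd[of s] by (simp add: has_vector_derivative_def)
      show "onorm (\<lambda>h. h *\<^sub>R p (b' s)) \<le> C'" for s
      proof (rule onorm_le)
        show "norm (h *\<^sub>R p (b' s)) \<le> C' * norm h" for h :: real
          using mult_right_mono[OF pn[of s] norm_ge_zero[of h]] by (simp add: mult.commute)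
      qed
    qed auto
    then have n: "norm (p (?b (t + h)) - p (?b t)) \<le> C' * \<bar>h\<bar>" by simp
    have "(\<Sum>k\<in>F. (cmod (coef (B (t + h) - B t) k))\<^sup>2) = (\<Sum>k\<in>F. (cmod (coef (p (?b (t + h)) - p (?b t)) k))\<^sup>2)"
      by (rule sum.cong) (auto simp: cp)
    also have "\<dots> \<le> (norm (p (?b (t + h)) - p (?b t)))\<^sup>2" by (rule finite_sum_le_norm[OF F])
    also have "\<dots> \<le> (C' * \<bar>h\<bar>)\<^sup>2" by (intro power_mono n) auto
    finally show "(\<Sum>k\<in>F. (cmod (coef (B (t + h) - B t) k))\<^sup>2) \<le> (C' * \<bar>h\<bar>)\<^sup>2" .
  qed (use C'0 in simp)
  have lim: "limitin (sobolev_top (- (1 / 4))) (\<lambda>h. (v (t + h) - v t) /\<^sub>R h) (v' t) (at 0)" for t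
  proof -
    define Q where "Q h = (B (t + h) - B t) /\<^sub>R h" for h
    have fQ: "fourier ((v (t + h) - v t) /\<^sub>R h) k = coef (Q h) k" for h k
      by (simp add: Q_def fourier_scaleR fourier_diff v)
    have Qn: "norm (Q h) \<le> C'" for h
    proof (cases "h = 0")
      case False
      then have "norm (Q h) = norm (B (t + h) - B t) / \<bar>h\<bar>" by (simp add: Q_def divide_inverse mult.commute)
      also have "\<dots> \<le> C'" using lip[of t h] False by (simp add: field_simps)
      finally show ?thesis .
    qed (simp add: Q_def C'0)
    have s: "(v (t + h) - v t) /\<^sub>R h \<in> sobolev (- (1 / 4))" for h
    proof (rule sobolev_dominated[where C = 1 and g = "Q h"])
      have "herm (coef (Q h))" using hb[of t] hb[of "t + h"] by (auto simp: Q_def herm_def)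
      then show "herm (fourier ((v (t + h) - v t) /\<^sub>R h))" by (simp add: fQ[abs_def])
    qed (simp add: fQ norm_mult mult_left_le_one_le ve)
    show ?thesis
    proof (rule limitin_sobolevI[OF v's s])
      show "((\<lambda>h. emb (- (1 / 4)) ((v (t + h) - v t) /\<^sub>R h)) \<longlongrightarrow> emb (- (1 / 4)) (v' t)) (at 0)"
      proof (rule weighted_tendsto[where g = Q and \<epsilon> = ?eps and M = C'])
        show "cmod (coef (emb (- (1 / 4)) ((v (t + h) - v t) /\<^sub>R h)) k) \<le> ?eps k * cmod (coef (Q h) k)" for h k
          by (simp add: coef_emb[OF s] fQ norm_mult)
        have "((\<lambda>h. coef (Q h) k) \<longlongrightarrow> b' t k) (at 0)" for k
          using db[of k t] unfolding has_vector_derivative_quotient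
          by (simp add: Q_def scaleR_conv_of_real)
        then show "((\<lambda>h. coef (emb (- (1 / 4)) ((v (t + h) - v t) /\<^sub>R h)) k) \<longlongrightarrow> coef (emb (- (1 / 4)) (v' t)) k) (at 0)" for k
          unfolding coef_emb[OF s] coef_emb[OF v's] v' fQ by (intro tendsto_mult tendsto_const)
      qed (use eps Qn in auto)
    qed
  qed
  have eq: "v' t = hilbert (distr_deriv (distr_deriv (v t))) - distr_deriv (distr_square (v t))" for t
  proof (rule fourier_inject)
    fix k
    have "fourier (distr_square (v t)) k = cv (B t) (B t) k"
      using fourier_square[of "v t" k] b_sum by (simp add: v cv_def)
    moreover have "- \<i> * of_int (sgn k) * (\<i> * of_int k * (\<i> * of_int k * ?b t k)) = \<i> * of_int k * of_int \<bar>k\<bar> * ?b t k"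
      by (simp add: abs_sgn mult_ac)
    ultimately show "fourier (v' t) k = fourier (hilbert (distr_deriv (distr_deriv (v t))) - distr_deriv (distr_square (v t))) k"
      by (simp add: v' b'_def fourier_diff fourier_hilbert fourier_deriv v)
  qed
  have sg: "7 / 4 - 2 = - (1 / 4 :: real)" by simp
  have "bo_classical_solution (7 / 4) v"
    unfolding bo_classical_solution_def sg using cont1 cont2 lim eq by blast
  then show thesis using v Bc by (rule that)
qed

end

section \<open>Tightness of the orbits of the smooth flow\<close>

text \<open>The square of an H^(-s) norm in which frequencies below \<kappa> all weigh about as much
  as \<kappa>. For fixed \<kappa> it is equivalent to the usual one, but for fixed a in H^(-s) it
  tends to 0 as \<kappa> grows (\<open>wN_tendsto_0\<close>).\<close>

definition wN :: "real \<Rightarrow> real \<Rightarrow> (int \<Rightarrow> complex) \<Rightarrow> real" where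
  "wN s \<kappa> a = (\<Sum>\<^sub>\<infinity>k. (\<bar>real_of_int k\<bar> + \<kappa>) powr (- 2 * s) * (cmod (a k))\<^sup>2)"

definition cs :: "real \<Rightarrow> real" where
  "cs s = (\<Sum>\<^sub>\<infinity>j. (real j + 1) powr (2 * s - 2))"

definition wsum :: "real \<Rightarrow> (int \<Rightarrow> complex) \<Rightarrow> bool" where
  "wsum s a \<longleftrightarrow> (\<lambda>k. jw k powr (- 2 * s) * (cmod (a k))\<^sup>2) summable_on UNIV"

lemma powr_add_eq: "a = b + c \<Longrightarrow> (x :: real) powr b * x powr c = x powr a"
  by (simp only: powr_add)

lemma wN_summable:
  assumes "wsum s a" "1 \<le> \<kappa>" "0 \<le> s"
  shows "(\<lambda>k. (\<bar>real_of_int k\<bar> + \<kappa>) powr (- 2 * s) * (cmod (a k))\<^sup>2) summable_on UNIV"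
  by (rule summable_on_le[OF assms(1)[unfolded wsum_def]])
    (use assms in \<open>auto simp: jw_def intro!: mult_right_mono powr_mono2'\<close>)

lemma wN_nonneg: "wN s \<kappa> a \<ge> 0"
  unfolding wN_def by (rule infsum_nonneg) auto

lemma cs_summable:
  assumes "s < 1 / 2" shows "(\<lambda>j. (real j + 1) powr (2 * s - 2)) summable_on UNIV"
proof -
  have "summable (\<lambda>n. real n powr (2 * s - 2))" using assms by (simp add: summable_real_powr_iff)
  then have "summable (\<lambda>n. real (Suc n) powr (2 * s - 2))" by (subst summable_Suc_iff)
  then have "summable (\<lambda>n. (real n + 1) powr (2 * s - 2))" by (simp add: add.commute)
  then show ?thesis by (subst summable_on_UNIV_nonneg_real_iff) auto
qed

lemma wN_mono:
  assumes b: "wsum s b" and k: "1 \<le> \<kappa>" and s: "0 \<le> s" and le: "\<And>k. cmod (a k) \<le> cmod (b k)"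
  shows "wN s \<kappa> a \<le> wN s \<kappa> b"
proof -
  have le': "(\<bar>real_of_int k\<bar> + \<kappa>) powr (- 2 * s) * (cmod (a k))\<^sup>2 \<le> (\<bar>real_of_int k\<bar> + \<kappa>) powr (- 2 * s) * (cmod (b k))\<^sup>2" for k
    by (intro mult_left_mono power_mono le) auto
  show ?thesis
    unfolding wN_def
    by (intro infsum_mono le' wN_summable[OF b k s] summable_on_le[OF wN_summable[OF b k s]]) auto
qed

lemma hsm_bij:
  fixes A :: "'a \<Rightarrow> 'b \<Rightarrow> complex" and A' :: "'c \<Rightarrow> 'd \<Rightarrow> complex"
  assumes b: "bij_betw \<psi> UNIV UNIV" and eq: "\<And>p. (\<lambda>(n, m). A n m) (\<psi> p) = (\<lambda>(k, j). A' k j) p"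
  shows "hsm A \<longleftrightarrow> hsm A'" "hs A = hs A'"
proof -
  have e: "(\<lambda>(n, m). (cmod (A n m))\<^sup>2) (\<psi> p) = (\<lambda>(k, j). (cmod (A' k j))\<^sup>2) p" for p
    using eq[of p] by (simp add: case_prod_unfold)
  show "hsm A \<longleftrightarrow> hsm A'"
    unfolding hsm_def using summable_on_reindex_bij_betw[OF b, of "\<lambda>(n, m). (cmod (A n m))\<^sup>2"] by (simp add: e)
  show "hs A = hs A'"
    unfolding hs_def using infsum_reindex_bij_betw[OF b, of "\<lambda>(n, m). (cmod (A n m))\<^sup>2"] by (simp add: e)
qed

text \<open>In the sum over \<open>n, m\<close> one substitutes \<open>k = n - m\<close> and \<open>j = min n m\<close>.\<close>

lemma qmat_bound:
  assumes s: "0 \<le> s" "s < 1 / 2" and k: "1 \<le> \<kappa>" and a: "wsum s a"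
  shows "hsm (qmat a \<kappa>)" "hs (qmat a \<kappa>) \<le> wN s \<kappa> a * cs s"
proof -
  define \<psi> where "\<psi> = (\<lambda>(k :: int, j :: nat). (j + nat k, j + nat (- k)))"
  have b: "bij_betw \<psi> UNIV UNIV"
    by (rule bij_betwI[where g = "\<lambda>(n, m). (int n - int m, min n m)"])
      (auto simp: \<psi>_def nat_minus_as_int split: prod.splits)
  define A' where "A' k j = qmat a \<kappa> (j + nat k) (j + nat (- k))" for k j
  define c where "c k j = complex_of_real ((real j + 1) powr (s - 1))" for k :: int and j :: nat
  define r where "r k = (\<bar>real_of_int k\<bar> + \<kappa>) powr (- 2 * s) * (cmod (a k))\<^sup>2" for k
  have c2: "(cmod (c k j))\<^sup>2 = (real j + 1) powr (2 * s - 2)" for k j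
    by (simp add: c_def power2_eq_square flip: powr_add)
  have le: "(cmod (A' k j))\<^sup>2 \<le> r k * (cmod (c k j))\<^sup>2" for k j
  proof -
    let ?x = "real j + \<bar>real_of_int k\<bar> + \<kappa>" and ?y = "real j + \<kappa>"
    have pos: "?x > 0" "?y > 0" using k by (auto intro: add_nonneg_pos)
    have d: "int (j + nat k) - int (j + nat (- k)) = k" by simp
    have xy: "(real (j + nat k) + \<kappa>) * (real (j + nat (- k)) + \<kappa>) = ?x * ?y"
      by (cases "k \<ge> 0") (auto simp: algebra_simps)
    have "(cmod (A' k j))\<^sup>2 = (1 / sqrt (real (j + nat k) + \<kappa>))\<^sup>2 * (cmod (a k))\<^sup>2 * (1 / sqrt (real (j + nat (- k)) + \<kappa>))\<^sup>2"
      unfolding A'_def qmat_def d norm_mult cmod_gd[OF k] power_mult_distrib ..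
    also have "\<dots> = (cmod (a k))\<^sup>2 / ((real (j + nat k) + \<kappa>) * (real (j + nat (- k)) + \<kappa>))"
      using k by (simp add: power_divide)
    also have "\<dots> = (1 / ?x * (1 / ?y)) * (cmod (a k))\<^sup>2" unfolding xy by simp
    \<comment> \<open>1 / x is split as x^(-2s) x^(2s-1). The first factor keeps the weight of
      frequency k; in the second x is lowered to y = j + \<kappa>, as 2 s - 1 < 0. With 1 / y this
      leaves the exponent 2 s - 2 < -1, summable in j.\<close>
    also have "\<dots> \<le> ((\<bar>real_of_int k\<bar> + \<kappa>) powr (- 2 * s) * (real j + 1) powr (2 * s - 2)) * (cmod (a k))\<^sup>2"
    proof (rule mult_right_mono)
      have "1 / ?x = ?x powr (- 1)" using pos by (simp add: powr_minus_divide)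
      also have "\<dots> = ?x powr (- 2 * s) * ?x powr (2 * s - 1)" by (simp flip: powr_add)
      also have "\<dots> \<le> (\<bar>real_of_int k\<bar> + \<kappa>) powr (- 2 * s) * ?y powr (2 * s - 1)"
        using s k by (intro mult_mono powr_mono2') auto
      finally have "1 / ?x * (1 / ?y) \<le> ((\<bar>real_of_int k\<bar> + \<kappa>) powr (- 2 * s) * ?y powr (2 * s - 1)) * (1 / ?y)"
        using pos by (intro mult_right_mono) auto
      also have "\<dots> = (\<bar>real_of_int k\<bar> + \<kappa>) powr (- 2 * s) * (?y powr (2 * s - 1) * ?y powr (- 1))"
        using pos by (simp add: powr_minus_divide)
      also have "?y powr (2 * s - 1) * ?y powr (- 1) = ?y powr (2 * s - 2)" by (rule powr_add_eq) simp
      also have "(\<bar>real_of_int k\<bar> + \<kappa>) powr (- 2 * s) * ?y powr (2 * s - 2) \<le> (\<bar>real_of_int k\<bar> + \<kappa>) powr (- 2 * s) * (real j + 1) powr (2 * s - 2)"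
        using s k by (intro mult_left_mono powr_mono2') auto
      finally show "1 / ?x * (1 / ?y) \<le> (\<bar>real_of_int k\<bar> + \<kappa>) powr (- 2 * s) * (real j + 1) powr (2 * s - 2)" .
    qed simp
    also have "\<dots> = r k * (cmod (c k j))\<^sup>2" by (simp only: r_def c2 mult_ac)
    finally show ?thesis .
  qed
  have rows: "(\<lambda>j. (cmod (c k j))\<^sup>2) summable_on UNIV" "(\<Sum>\<^sub>\<infinity>j. (cmod (c k j))\<^sup>2) \<le> cs s" for k
    unfolding c2 cs_def using cs_summable[OF s(2)] by auto
  have rs: "r summable_on UNIV" "\<And>k. 0 \<le> r k"
    unfolding r_def[abs_def] using wN_summable[OF a k s(1)] by auto
  note A' = hs_rowweight[OF rows rs le]
  have eq: "(\<lambda>(n, m). qmat a \<kappa> n m) (\<psi> p) = (\<lambda>(k, j). A' k j) p" for p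
    by (cases p) (simp add: \<psi>_def A'_def)
  show "hsm (qmat a \<kappa>)" "hs (qmat a \<kappa>) \<le> wN s \<kappa> a * cs s"
    using A' hsm_bij[OF b eq] by (simp_all add: wN_def r_def[abs_def])
qed

lemma wN_good:
  assumes "0 \<le> s" "s < 1 / 2" "1 \<le> \<kappa>" "wsum s a" "herm a" "wN s \<kappa> a * cs s \<le> 1 / 9"
  shows "good a \<kappa>"
  using qmat_bound[OF assms(1-4)] assms by (simp add: good_def small_def)

lemma wsum_ell2: "0 \<le> s \<Longrightarrow> wsum s (coef A)"
  unfolding wsum_def
proof (rule summable_on_le[OF coef_summable[of A]])
  fix k assume s: "0 \<le> s"
  have "jw k powr (- 2 * s) \<le> jw k powr 0" using s jw_ge1[of k] by (intro powr_mono) auto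
  then have "jw k powr (- 2 * s) \<le> 1" using jw_ge1[of k] by simp
  then show "jw k powr (- 2 * s) * (cmod (coef A k))\<^sup>2 \<le> (cmod (coef A k))\<^sup>2"
    by (intro mult_left_le_one_le) auto
qed auto

subsection \<open>A dyadic decomposition of the weight\<close>

lemma dyadic_scale:
  fixes x \<kappa> :: real
  assumes "0 < \<kappa>" "\<kappa> \<le> x"
  obtains i where "2 ^ i * \<kappa> \<le> x" "x < 2 ^ Suc i * \<kappa>"
proof -
  obtain n :: nat where "x / \<kappa> < 2 ^ n" using real_arch_pow[of 2] by force
  then have "\<exists>n. x < 2 ^ n * \<kappa>" using assms by (auto simp: field_simps)
  define m where "m = (LEAST n. x < 2 ^ n * \<kappa>)"
  have m: "x < 2 ^ m * \<kappa>" unfolding m_def by (rule LeastI_ex) fact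
  then have "m \<noteq> 0" using assms by (cases m) auto
  then obtain i where i: "m = Suc i" by (cases m) auto
  then have "\<not> x < 2 ^ i * \<kappa>" using not_less_Least[of i "\<lambda>n. x < 2 ^ n * \<kappa>"] by (simp add: m_def)
  then show thesis using that[of i] m i by simp
qed

text \<open>A dyadic version of the integral of k^(-2s) / (n + k) over k \<ge> \<kappa>, which is
  comparable to (n + \<kappa>)^(-2s). For the lower bound the one scale just below n + \<kappa>
  suffices, provided J is large enough to include it.\<close>

definition dyS :: "real \<Rightarrow> real \<Rightarrow> nat \<Rightarrow> nat \<Rightarrow> real" where
  "dyS s \<kappa> J n = (\<Sum>j<J. (2 ^ j * \<kappa>) powr (1 - 2 * s) / (real n + 2 ^ j * \<kappa>))"

lemma dyS_lower:
  assumes s: "0 \<le> s" "s < 1 / 2" and k: "0 < \<kappa>" and J: "real n + \<kappa> < 2 ^ J * \<kappa>"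
  shows "(real n + \<kappa>) powr (- 2 * s) / 4 \<le> dyS s \<kappa> J n"
proof -
  let ?x = "real n + \<kappa>"
  obtain i where i: "2 ^ i * \<kappa> \<le> ?x" "?x < 2 ^ Suc i * \<kappa>"
    by (rule dyadic_scale[of \<kappa> ?x]) (use k in auto)
  have "2 ^ i * \<kappa> < 2 ^ J * \<kappa>" using i(1) J by linarith
  then have iJ: "i < J" using k by simp
  let ?y = "2 ^ i * \<kappa>"
  have y: "?y > 0" "?x > 0" using k by (auto intro: add_nonneg_pos)
  have "?x powr (- 2 * s) / 4 = (?x powr (1 - 2 * s) * ?x powr (- 1)) / 4"
    by (subst powr_add_eq[of "- 2 * s"]) simp_all
  also have "?x powr (- 1) = 1 / ?x" using y(2) by (simp only: powr_minus_divide powr_one)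
  also have "?x powr (1 - 2 * s) * (1 / ?x) / 4 = ?x powr (1 - 2 * s) / 2 / (2 * ?x)" by simp
  also have "\<dots> \<le> ?y powr (1 - 2 * s) / (real n + ?y)"
  proof (rule frac_le)
    have "(?x / 2) powr (1 - 2 * s) \<le> ?y powr (1 - 2 * s)"
      using i(2) y s by (intro powr_mono2) auto
    moreover have "?x powr (1 - 2 * s) / 2 \<le> (?x / 2) powr (1 - 2 * s)"
    proof -
      have "2 powr (1 - 2 * s) \<le> (2 :: real) powr 1" using s by (intro powr_mono) auto
      then have "?x powr (1 - 2 * s) / 2 \<le> ?x powr (1 - 2 * s) / 2 powr (1 - 2 * s)"
        by (intro divide_left_mono) auto
      then show ?thesis by (simp add: powr_divide)
    qed
    ultimately show "?x powr (1 - 2 * s) / 2 \<le> ?y powr (1 - 2 * s)" by linarith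
    have "real n \<le> ?x" using k by simp
    then show "real n + ?y \<le> 2 * ?x" using i(1) by (simp only: mult_2 add_mono)
  qed (use y in auto)
  also have "\<dots> \<le> dyS s \<kappa> J n"
    unfolding dyS_def using iJ k by (intro member_le_sum) auto
  finally show ?thesis .
qed

text \<open>The geometric series over the scales below n + \<kappa>, with ratio 2^(2s-1), and above
  it, with ratio 2^(-2s). Both ratios are less than 1 exactly when 0 < s < 1/2.\<close>

definition dyD :: "real \<Rightarrow> real" where
  "dyD s = 1 / (1 - 2 powr (- (1 - 2 * s))) + 1 / (1 - 2 powr (- 2 * s))"

lemma geometric_le:
  fixes \<rho> :: real
  assumes "0 \<le> \<rho>" "\<rho> < 1" shows "(\<Sum>l<n. \<rho> ^ l) \<le> 1 / (1 - \<rho>)"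
proof -
  have "(\<Sum>l<n. \<rho> ^ l) \<le> (\<Sum>l. \<rho> ^ l)"
    by (rule sum_le_suminf) (use assms in \<open>auto intro: summable_geometric\<close>)
  then show ?thesis using assms by (simp add: suminf_geometric)
qed

lemma dyS_upper:
  assumes s: "0 < s" "s < 1 / 2" and k: "0 < \<kappa>"
  shows "dyS s \<kappa> J n \<le> dyD s * (real n + \<kappa>) powr (- 2 * s)"
proof -
  let ?x = "real n + \<kappa>"
  define \<rho>1 :: real where "\<rho>1 = 2 powr (- (1 - 2 * s))"
  define \<rho>2 :: real where "\<rho>2 = 2 powr (- 2 * s)"
  have r1: "0 \<le> \<rho>1" "\<rho>1 < 1" and r2: "0 \<le> \<rho>2" "\<rho>2 < 1"
    using s powr_less_mono[of "- (1 - 2 * s)" 0 2] powr_less_mono[of "- 2 * s" 0 2] by (auto simp: \<rho>1_def \<rho>2_def)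
  have rp: "(2 ^ l) powr (- (1 - 2 * s)) = \<rho>1 ^ l" "(2 ^ l) powr (- 2 * s) = \<rho>2 ^ l" for l :: nat
    unfolding \<rho>1_def \<rho>2_def by (simp_all add: powr_realpow[symmetric] powr_powr mult.commute)
  obtain i where i: "2 ^ i * \<kappa> \<le> ?x" "?x < 2 ^ Suc i * \<kappa>"
    by (rule dyadic_scale[of \<kappa> ?x]) (use k in auto)
  have x: "?x > 0" using k by (auto intro: add_nonneg_pos)
  define f where "f j = (2 ^ j * \<kappa>) powr (1 - 2 * s) / (real n + 2 ^ j * \<kappa>)" for j
  have f0: "f j \<ge> 0" for j using k by (simp add: f_def)
  have ky: "\<kappa> \<le> 2 ^ j * \<kappa>" for j using k by simp
  have low: "f j \<le> \<rho>1 ^ (i - j) * ?x powr (- 2 * s)" if "j \<le> i" for j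
  proof -
    let ?y = "2 ^ j * \<kappa>"
    have y: "?y > 0" using k by simp
    have "2 ^ (i - j) * ?y \<le> ?x" using i(1) that by (simp add: mult.assoc[symmetric] flip: power_add)
    then have "?y \<le> ?x / 2 ^ (i - j)" by (simp add: field_simps)
    then have "?y powr (1 - 2 * s) \<le> (?x / 2 ^ (i - j)) powr (1 - 2 * s)"
      using y s by (intro powr_mono2) auto
    also have "\<dots> = ?x powr (1 - 2 * s) * \<rho>1 ^ (i - j)"
      unfolding rp(1)[symmetric] powr_minus_divide[of _ "1 - 2 * s"] by (simp add: powr_divide)
    finally have "f j \<le> (?x powr (1 - 2 * s) * \<rho>1 ^ (i - j)) / ?x"
      unfolding f_def using ky[of j] x y r1 by (intro frac_le mult_nonneg_nonneg) auto
    also have "\<dots> = \<rho>1 ^ (i - j) * (?x powr (1 - 2 * s) * ?x powr (- 1))" using x by (simp add: powr_minus_divide)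
    also have "?x powr (1 - 2 * s) * ?x powr (- 1) = ?x powr (- 2 * s)" by (rule powr_add_eq) simp
    finally show ?thesis .
  qed
  have high: "f (Suc i + l) \<le> \<rho>2 ^ l * ?x powr (- 2 * s)" for l
  proof -
    let ?y = "2 ^ (Suc i + l) * \<kappa>"
    have y: "?y > 0" using k by simp
    have yx: "2 ^ l * ?x \<le> ?y"
    proof -
      have "2 ^ l * ?x \<le> 2 ^ l * (2 ^ Suc i * \<kappa>)" using i(2) by (intro mult_left_mono) auto
      also have "\<dots> = ?y" by (simp add: power_add)
      finally show ?thesis .
    qed
    have "f (Suc i + l) \<le> ?y powr (1 - 2 * s) / ?y"
      unfolding f_def using y by (intro frac_le) auto
    also have "\<dots> = ?y powr (1 - 2 * s) * ?y powr (- 1)" using y by (simp add: powr_minus_divide)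
    also have "\<dots> = ?y powr (- 2 * s)" by (rule powr_add_eq) simp
    also have "\<dots> \<le> (2 ^ l * ?x) powr (- 2 * s)"
      using yx x s by (intro powr_mono2') auto
    also have "\<dots> = \<rho>2 ^ l * ?x powr (- 2 * s)"
      unfolding rp(2)[symmetric] using x by (intro powr_mult)
    finally show ?thesis .
  qed
  have "dyS s \<kappa> J n = (\<Sum>j<J. f j)" by (simp add: dyS_def f_def)
  also have "\<dots> \<le> (\<Sum>j<Suc i + J. f j)" by (rule sum_mono2) (use f0 in auto)
  also have "\<dots> = (\<Sum>j<Suc i. f j) + (\<Sum>l<J. f (Suc i + l))"
    by (simp only: lessThan_atLeast0) (subst sum.atLeastLessThan_concat[symmetric, of 0 "Suc i"], simp, simp,
       subst sum.atLeastLessThan_shift_0[of _ "Suc i" "Suc i + J"], simp add: add.commute)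
  also have "(\<Sum>j<Suc i. f j) \<le> (\<Sum>j<Suc i. \<rho>1 ^ (i - j) * ?x powr (- 2 * s))"
    by (intro sum_mono low) auto
  also have "\<dots> = (\<Sum>j<Suc i. \<rho>1 ^ j) * ?x powr (- 2 * s)"
    using sum.nat_diff_reindex[of "\<lambda>j. \<rho>1 ^ j" "Suc i"] by (simp add: sum_distrib_right[symmetric])
  also have "(\<Sum>l<J. f (Suc i + l)) \<le> (\<Sum>l<J. \<rho>2 ^ l) * ?x powr (- 2 * s)"
    unfolding sum_distrib_right by (intro sum_mono high)
  also have "(\<Sum>j<Suc i. \<rho>1 ^ j) * ?x powr (- 2 * s) + (\<Sum>l<J. \<rho>2 ^ l) * ?x powr (- 2 * s) \<le>
      1 / (1 - \<rho>1) * ?x powr (- 2 * s) + 1 / (1 - \<rho>2) * ?x powr (- 2 * s)"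
    by (intro add_mono mult_right_mono geometric_le r1 r2) auto
  also have "\<dots> = dyD s * ?x powr (- 2 * s)"
    by (simp add: dyD_def \<rho>1_def \<rho>2_def distrib_right)
  finally show ?thesis by simp
qed

definition wP :: "real \<Rightarrow> real \<Rightarrow> nat ell2 \<Rightarrow> real" where
  "wP s \<kappa> u = (\<Sum>\<^sub>\<infinity>n. (real n + \<kappa>) powr (- 2 * s) * (cmod (coef u n))\<^sup>2)"

lemma wP_summable:
  assumes "0 \<le> s" "1 \<le> \<kappa>"
  shows "(\<lambda>n. (real n + \<kappa>) powr (- 2 * s) * (cmod (coef u n))\<^sup>2) summable_on UNIV"
proof (rule summable_on_le[OF coef_summable[of u]])
  fix n
  have "(real n + \<kappa>) powr (- 2 * s) \<le> 1" using powr_mono[of "- 2 * s" 0 "real n + \<kappa>"] assms by simp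
  then show "(real n + \<kappa>) powr (- 2 * s) * (cmod (coef u n))\<^sup>2 \<le> (cmod (coef u n))\<^sup>2"
    by (intro mult_left_le_one_le) auto
qed auto

text \<open>Summing the hypotheses over j with weights (\<open>2 ^ j * \<kappa>\<close>)^(1 - 2s)
  converts them into a comparison of negative Sobolev norms. One factor 4 of 16 is that of
  \<open>dyS_lower\<close>, the other that of the hypothesis.\<close>

lemma dyadic_comparison:
  assumes s: "0 < s" "s < 1 / 2" and k: "1 \<le> \<kappa>"
    and le: "\<And>j. (norm (dmul (gd (2 ^ j * \<kappa>)) u))\<^sup>2 \<le> 4 * (norm (dmul (gd (2 ^ j * \<kappa>)) w))\<^sup>2"
  shows "wP s \<kappa> u \<le> 16 * dyD s * wP s \<kappa> w"
  unfolding wP_def[of s \<kappa> u]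
proof (rule infsum_le_finite_sums)
  have s0: "0 \<le> s" using s by simp
  have k0: "0 < \<kappa>" using k by simp
  show "(\<lambda>n. (real n + \<kappa>) powr (- 2 * s) * (cmod (coef u n))\<^sup>2) summable_on UNIV"
    by (rule wP_summable[OF s0 k])
  fix F :: "nat set" assume F: "finite F"
  define kj where "kj j = 2 ^ j * \<kappa>" for j
  have kj: "1 \<le> kj j" for j
  proof -
    have "1 * 1 \<le> 2 ^ j * \<kappa>" using k by (intro mult_mono) auto
    then show ?thesis by (simp add: kj_def)
  qed
  obtain N where N: "n \<in> F \<Longrightarrow> n \<le> N" for n using F unfolding finite_nat_set_iff_bounded_le by auto
  \<comment> \<open>Enough scales to exceed every index of the finite set F; the upper bound
    \<open>dyS_upper\<close> does not depend on J.\<close>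
  obtain J :: nat where J0: "(real N + \<kappa>) / \<kappa> < 2 ^ J" using real_arch_pow[of 2] by force
  have J: "real n + \<kappa> < 2 ^ J * \<kappa>" if "n \<in> F" for n
  proof -
    have "real N + \<kappa> < 2 ^ J * \<kappa>" using J0 k0 by (simp add: field_simps)
    then show ?thesis using N[OF that] by simp
  qed
  have G: "(norm (dmul (gd (kj j)) h))\<^sup>2 = (\<Sum>\<^sub>\<infinity>n. (cmod (coef h n))\<^sup>2 / (real n + kj j))" for j h
    by (rule norm_G_sq[OF kj])
  have Gs: "(\<lambda>n. (cmod (coef h n))\<^sup>2 / (real n + kj j)) summable_on UNIV" for j h
  proof (rule summable_on_le[OF coef_summable[of h]])
    fix n
    have "1 \<le> real n + kj j" using kj[of j] by simp
    then show "(cmod (coef h n))\<^sup>2 / (real n + kj j) \<le> (cmod (coef h n))\<^sup>2"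
      by (simp add: divide_le_eq mult_le_cancel_left1)
    show "0 \<le> (cmod (coef h n))\<^sup>2 / (real n + kj j)" using \<open>1 \<le> real n + kj j\<close> by simp
  qed
  have "(\<Sum>n\<in>F. (real n + \<kappa>) powr (- 2 * s) * (cmod (coef u n))\<^sup>2) \<le> (\<Sum>n\<in>F. 4 * dyS s \<kappa> J n * (cmod (coef u n))\<^sup>2)"
    using dyS_lower[OF s0 s(2) k0 J] by (intro sum_mono mult_right_mono) (auto simp: mult.commute)
  also have "\<dots> = 4 * (\<Sum>j<J. kj j powr (1 - 2 * s) * (\<Sum>n\<in>F. (cmod (coef u n))\<^sup>2 / (real n + kj j)))"
    unfolding dyS_def kj_def[symmetric] sum_distrib_left sum_distrib_right
    by (subst sum.swap) (simp add: mult_ac)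
  also have "\<dots> \<le> 4 * (\<Sum>j<J. kj j powr (1 - 2 * s) * (4 * (norm (dmul (gd (kj j)) w))\<^sup>2))"
  proof (intro mult_left_mono sum_mono)
    fix j
    have "(\<Sum>n\<in>F. (cmod (coef u n))\<^sup>2 / (real n + kj j)) \<le> (norm (dmul (gd (kj j)) u))\<^sup>2"
      unfolding G
    proof (rule finite_sum_le_infsum[OF Gs F])
      show "0 \<le> (cmod (coef u n))\<^sup>2 / (real n + kj j)" for n using kj[of j] by simp
    qed simp
    then show "(\<Sum>n\<in>F. (cmod (coef u n))\<^sup>2 / (real n + kj j)) \<le> 4 * (norm (dmul (gd (kj j)) w))\<^sup>2"
      using le[of j] unfolding kj_def by linarith
  qed auto
  also have "\<dots> = 16 * (\<Sum>\<^sub>\<infinity>n. dyS s \<kappa> J n * (cmod (coef w n))\<^sup>2)"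
  proof -
    have "(\<Sum>j<J. kj j powr (1 - 2 * s) * (norm (dmul (gd (kj j)) w))\<^sup>2) =
        (\<Sum>j<J. \<Sum>\<^sub>\<infinity>n. kj j powr (1 - 2 * s) * ((cmod (coef w n))\<^sup>2 / (real n + kj j)))"
      by (simp only: G infsum_cmult_right')
    also have "\<dots> = (\<Sum>\<^sub>\<infinity>n. \<Sum>j<J. kj j powr (1 - 2 * s) * ((cmod (coef w n))\<^sup>2 / (real n + kj j)))"
    proof (induction J)
      case (Suc J)
      have "(\<lambda>n. \<Sum>j<J. kj j powr (1 - 2 * s) * ((cmod (coef w n))\<^sup>2 / (real n + kj j))) summable_on UNIV"
        by (induction J) (simp_all add: summable_on_add summable_on_cmult_right[OF Gs, unfolded times_divide_eq_right])
      from infsum_add[OF this summable_on_cmult_right[OF Gs]] show ?case using Suc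
        by (simp only: sum.lessThan_Suc)
    qed simp
    also have "\<dots> = (\<Sum>\<^sub>\<infinity>n. dyS s \<kappa> J n * (cmod (coef w n))\<^sup>2)"
      unfolding dyS_def kj_def[symmetric] sum_distrib_right by simp
    finally show ?thesis by (simp add: sum_distrib_left[symmetric] mult.left_commute)
  qed
  also have "\<dots> \<le> 16 * (\<Sum>\<^sub>\<infinity>n. dyD s * ((real n + \<kappa>) powr (- 2 * s) * (cmod (coef w n))\<^sup>2))"
  proof (intro mult_left_mono infsum_mono)
    have d0: "dyS s \<kappa> J n \<ge> 0" for n
      unfolding dyS_def using k0 by (intro sum_nonneg divide_nonneg_nonneg) auto
    have d: "dyS s \<kappa> J n * (cmod (coef w n))\<^sup>2 \<le> dyD s * ((real n + \<kappa>) powr (- 2 * s) * (cmod (coef w n))\<^sup>2)" for n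
      using mult_right_mono[OF dyS_upper[OF s k0, of J n] zero_le_power2[of "cmod (coef w n)"]] by (simp add: mult.assoc)
    show s2: "(\<lambda>n. dyD s * ((real n + \<kappa>) powr (- 2 * s) * (cmod (coef w n))\<^sup>2)) summable_on UNIV"
      by (intro summable_on_cmult_right wP_summable s0 k)
    show "(\<lambda>n. dyS s \<kappa> J n * (cmod (coef w n))\<^sup>2) summable_on UNIV"
      by (rule summable_on_le[OF s2]) (use d d0 in auto)
    show "dyS s \<kappa> J n * (cmod (coef w n))\<^sup>2 \<le> dyD s * ((real n + \<kappa>) powr (- 2 * s) * (cmod (coef w n))\<^sup>2)" for n by (rule d)
  qed auto
  also have "\<dots> = 16 * dyD s * wP s \<kappa> w" by (simp add: infsum_cmult_right' wP_def)
  finally show "(\<Sum>n\<in>F. (real n + \<kappa>) powr (- 2 * s) * (cmod (coef u n))\<^sup>2) \<le> 16 * dyD s * wP s \<kappa> w" .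
qed

section \<open>Control of the weighted norm for all times\<close>

lemma wN_eq_norm:
  assumes "1 \<le> \<kappa>" "0 \<le> s"
  shows "wN s \<kappa> (coef A) = (norm (dmul (\<lambda>k. of_real ((\<bar>real_of_int k\<bar> + \<kappa>) powr (- s))) A))\<^sup>2"
    and "\<And>k :: int. cmod (of_real ((\<bar>real_of_int k\<bar> + \<kappa>) powr (- s))) \<le> 1"
proof -
  show le: "cmod (of_real ((\<bar>real_of_int k\<bar> + \<kappa>) powr (- s))) \<le> 1" for k
    using powr_mono[of "- s" 0 "\<bar>real_of_int k\<bar> + \<kappa>"] assms by simp
  have "(\<bar>real_of_int k\<bar> + \<kappa>) powr (- 2 * s) = ((\<bar>real_of_int k\<bar> + \<kappa>) powr (- s))\<^sup>2" for k
    unfolding power2_eq_square by (subst powr_add_eq[of "- 2 * s"]) simp_all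
  then show "wN s \<kappa> (coef A) = (norm (dmul (\<lambda>k. of_real ((\<bar>real_of_int k\<bar> + \<kappa>) powr (- s))) A))\<^sup>2"
    by (simp add: norm_sq_infsum coef_dmul[OF le] norm_mult power_mult_distrib wN_def)
qed

lemma wP_halves:
  assumes "1 \<le> \<kappa>" "0 \<le> s"
  shows "wP s \<kappa> (hl A) \<le> wN s \<kappa> (coef A)" "wN s \<kappa> (coef (hext u)) \<le> 2 * wP s \<kappa> u"
proof -
  let ?w = "\<lambda>k. (\<bar>real_of_int k\<bar> + \<kappa>) powr (- 2 * s)"
  let ?f = "\<lambda>k. ?w k * (cmod (coef A k))\<^sup>2"
  show "wP s \<kappa> (hl A) \<le> wN s \<kappa> (coef A)"
    unfolding wP_def[of s \<kappa> "hl A"]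
  proof (rule infsum_le_finite_sums[OF wP_summable[OF assms(2,1)]])
    fix F :: "nat set" assume F: "finite F"
    have "(\<Sum>n\<in>F. (real n + \<kappa>) powr (- 2 * s) * (cmod (coef (hl A) n))\<^sup>2) = (\<Sum>k\<in>int ` F. ?f k)"
      by (simp add: sum.reindex)
    also have "\<dots> \<le> wN s \<kappa> (coef A)"
      unfolding wN_def by (rule finite_sum_le_infsum[OF wN_summable[OF wsum_ell2[OF assms(2)] assms]]) (use F in auto)
    finally show "(\<Sum>n\<in>F. (real n + \<kappa>) powr (- 2 * s) * (cmod (coef (hl A) n))\<^sup>2) \<le> wN s \<kappa> (coef A)" .
  qed
  let ?g = "\<lambda>n. (real n + \<kappa>) powr (- 2 * s) * (cmod (coef u n))\<^sup>2"
  let ?h = "\<lambda>k. ?w k * (cmod (coef (hext u) k))\<^sup>2"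
  note g = wP_summable[OF assms(2,1), of u]
  have g': "(\<lambda>n. ?g (Suc n)) summable_on UNIV"
    using summable_on_reindex[of Suc UNIV ?g] summable_on_subset_banach[OF g, of "range Suc"] by (simp add: o_def)
  have n: "nat (int n + 1) = Suc n" for n by simp
  have "(?h has_sum (wP s \<kappa> u + (\<Sum>\<^sub>\<infinity>n. ?g (Suc n)))) UNIV"
  proof (rule has_sum_int_halves)
    show "((\<lambda>n. ?h (int n)) has_sum wP s \<kappa> u) UNIV"
      using has_sum_infsum[OF g] by (simp add: coef_hext wP_def)
    have "?h (- 1 - int n) = ?g (Suc n)" for n
    proof -
      have "\<bar>real_of_int (- 1 - int n)\<bar> = real (Suc n)" by simp
      moreover have "coef (hext u) (- 1 - int n) = cnj (coef u (Suc n))" by (simp add: coef_hext n)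
      ultimately show ?thesis by (simp only: complex_mod_cnj)
    qed
    then show "((\<lambda>n. ?h (- 1 - int n)) has_sum (\<Sum>\<^sub>\<infinity>n. ?g (Suc n))) UNIV"
      using has_sum_infsum[OF g'] by simp
  qed
  then have "wN s \<kappa> (coef (hext u)) = wP s \<kappa> u + (\<Sum>\<^sub>\<infinity>n. ?g (Suc n))"
    unfolding wN_def by (rule infsumI)
  moreover have "wP s \<kappa> u = ?g 0 + (\<Sum>\<^sub>\<infinity>n. ?g (Suc n))"
    unfolding wP_def by (rule infsum_nat_shift[OF g])
  moreover have "0 \<le> ?g 0" by simp
  ultimately show "wN s \<kappa> (coef (hext u)) \<le> 2 * wP s \<kappa> u" by linarith
qed

lemma dyD_ge_1:
  assumes "0 < s" "s < 1 / 2" shows "1 \<le> dyD s"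
proof -
  have r: "2 powr (- (1 - 2 * s)) < (1 :: real)" "2 powr (- 2 * s) < (1 :: real)"
    using assms powr_less_mono[of "- (1 - 2 * s)" 0 2] powr_less_mono[of "- 2 * s" 0 2] by auto
  have "1 \<le> 1 / (1 - 2 powr (- (1 - 2 * s)) :: real)" "0 \<le> 1 / (1 - 2 powr (- 2 * s) :: real)"
    using r by (auto simp: le_divide_eq)
  then show ?thesis by (simp only: dyD_def)
qed

lemma cs_ge_1: "s < 1 / 2 \<Longrightarrow> 1 \<le> cs s"
  unfolding cs_def using finite_sum_le_infsum[OF cs_summable, of s "{0}"] by simp

text \<open>
  As long as the weighted norm of the solution stays below a fixed threshold, the conserved resolvent
  forms at the scales \<open>2 ^ j * k\<close> control it by the initial weighted norm, which is far below that
  threshold; by continuity in time the threshold is never reached.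
\<close>

lemma (in lax_smooth) flow_tight:
  assumes fin: "finite {k. coef A k \<noteq> 0}" and s: "0 < s" "s < 1 / 2" and k: "\<kappa> \<le> k"
    and small: "cs s * (64 * dyD s * wN s k (coef A)) \<le> 1 / 18"
  shows "wN s k (coef (B t)) \<le> 32 * dyD s * wN s k (coef A)"
proof -
  have k1: "1 \<le> k" using goodD(2)[OF good] k by linarith
  have s0: "0 \<le> s" using s by simp
  let ?N = "wN s k (coef A)"
  define P where "P t = wN s k (coef (B t))" for t
  have c0: "0 < cs s" using cs_ge_1[OF s(2)] by linarith
  have d1: "1 \<le> dyD s" by (rule dyD_ge_1[OF s])
  have N0: "0 \<le> ?N" by (rule wN_nonneg)
  have up: "P t \<le> 32 * dyD s * ?N" if le: "P t \<le> 1 / (9 * cs s)" for t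
  proof -
    have "good (coef (B t)) k"
      by (rule wN_good[OF s0 s(2) k1 wsum_ell2[OF s0] herm_B]) (use le c0 in \<open>simp add: P_def field_simps\<close>)
    then have gB: "good (coef (B t)) (2 ^ j * k)" and gA: "good (coef A) (2 ^ j * k)" for j
      using good_mono[of _ _ "2 ^ j * k"] good_mono[OF good k] k1 by auto
    have "wP s k (U t) \<le> 16 * dyD s * wP s k X"
    proof (rule dyadic_comparison[OF s k1])
      fix j
      have "3 / 8 * (norm (dmul (gd (2 ^ j * k)) (U t)))\<^sup>2 \<le> Re (cin (Rs (coef (B t)) (2 ^ j * k) (U t)) (U t))"
        by (rule Rs_form(1)[OF gB])
      also have "\<dots> \<le> cmod (cin (Rs (coef A) (2 ^ j * k) X) X)"
        unfolding resolvent_form_conserved[OF gA gB] by (rule complex_Re_le_cmod)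
      also have "\<dots> \<le> 3 / 2 * (norm (dmul (gd (2 ^ j * k)) X))\<^sup>2" by (rule Rs_form(2)[OF gA])
      finally show "(norm (dmul (gd (2 ^ j * k)) (U t)))\<^sup>2 \<le> 4 * (norm (dmul (gd (2 ^ j * k)) X))\<^sup>2" by simp
    qed
    also have "\<dots> \<le> 16 * dyD s * ?N"
      by (rule mult_left_mono[OF wP_halves(1)[OF k1 s0]]) (use d1 in simp)
    \<comment> \<open>32 = 2 * 16: the Hermitian extension at most doubles the Hardy half.\<close>
    finally show ?thesis
      using wP_halves(2)[OF k1 s0, of "U t"] by (simp add: P_def B_def)
  qed
  \<comment> \<open>The hypothesis leaves the a priori bound at most 1/36 against the threshold 1/9,
    both divided by \<open>cs s\<close>: a strict gap, which the continuous function P cannot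
    cross.\<close>
  have low: "32 * dyD s * ?N < 1 / (9 * cs s)"
  proof -
    have "cs s * (32 * dyD s * ?N) \<le> 1 / 36" using small by simp
    then have "32 * dyD s * ?N \<le> 1 / 36 / cs s" using c0 by (simp add: field_simps)
    also have "\<dots> < 1 / (9 * cs s)" using c0 by (simp add: field_simps)
    finally show ?thesis .
  qed
  have P0: "P 0 \<le> 32 * dyD s * ?N"
  proof -
    have "1 * ?N \<le> 32 * dyD s * ?N" using d1 N0 by (intro mult_right_mono) auto
    then show ?thesis by (simp add: P_def B_0)
  qed
  have Bc: "(B \<longlongrightarrow> B t) (at t)" for t by (rule classical_solution[OF fin])
  have "(P \<longlongrightarrow> P t) (at t)" for t
    unfolding P_def[abs_def] wN_eq_norm(1)[OF k1 s0]
    by (intro tendsto_power tendsto_norm bcl_tendsto[OF bcl_dmul[OF wN_eq_norm(2)[OF k1 s0]] Bc])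
  then have "continuous_on UNIV P" by (simp add: continuous_on_def)
  then have con: "connected (range P)" by (rule connected_continuous_image) simp
  have "P t \<le> 1 / (9 * cs s)"
  proof (rule ccontr)
    assume "\<not> ?thesis"
    then have "1 / (9 * cs s) \<in> range P"
      using connectedD_interval[OF con, of "P 0" "P t" "1 / (9 * cs s)"] P0 low by simp
    then obtain t' where t': "P t' = 1 / (9 * cs s)" by auto
    then show False using up[of t'] low by simp
  qed
  then show ?thesis using up by (simp add: P_def)
qed

section \<open>Weighted norms on Sobolev spaces\<close>

lemma weight_le:
  assumes "0 \<le> s" "1 \<le> \<kappa>"
  shows "(\<bar>real_of_int k\<bar> + \<kappa>) powr (- 2 * s) \<le> japanese k powr (- 2 * s)"
  using assms japanese_ge1[of k] by (intro powr_mono2') (auto simp: japanese_def)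

lemma weight_ge:
  assumes s: "0 \<le> s" "s < 1 / 2" and k: "1 \<le> \<kappa>" and c: "1 \<le> c" "\<bar>real_of_int k\<bar> + \<kappa> \<le> c * japanese k"
  shows "japanese k powr (- 2 * s) \<le> c * (\<bar>real_of_int k\<bar> + \<kappa>) powr (- 2 * s)"
proof -
  have j: "japanese k > 0" "\<bar>real_of_int k\<bar> + \<kappa> > 0" using japanese_ge1[of k] k by (auto simp: add_nonneg_pos)
  have "(c * japanese k) powr (- 2 * s) \<le> (\<bar>real_of_int k\<bar> + \<kappa>) powr (- 2 * s)"
    using s j c by (intro powr_mono2') auto
  then have "c powr (2 * s) * (c powr (- 2 * s) * japanese k powr (- 2 * s)) \<le> c powr (2 * s) * (\<bar>real_of_int k\<bar> + \<kappa>) powr (- 2 * s)"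
    unfolding powr_mult by (intro mult_left_mono) auto
  moreover have "c powr (2 * s) * c powr (- 2 * s) = 1"
    using c by (subst powr_add_eq[of 0]) auto
  ultimately have "japanese k powr (- 2 * s) \<le> c powr (2 * s) * (\<bar>real_of_int k\<bar> + \<kappa>) powr (- 2 * s)"
    by (simp add: mult.assoc[symmetric])
  also have "c powr (2 * s) \<le> c powr 1" using s c by (intro powr_mono) auto
  then have "c powr (2 * s) * (\<bar>real_of_int k\<bar> + \<kappa>) powr (- 2 * s) \<le> c * (\<bar>real_of_int k\<bar> + \<kappa>) powr (- 2 * s)"
    using c by (intro mult_right_mono) auto
  finally show ?thesis .
qed

lemma emb_sq: "u \<in> sobolev (- s) \<Longrightarrow> (cmod (coef (emb (- s) u) k))\<^sup>2 = japanese k powr (- 2 * s) * (cmod (fourier u k))\<^sup>2"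
  using weight_sq[of k "- s" "fourier u k"] by (simp add: coef_emb)

lemma sobolev_wsum:
  assumes "u \<in> sobolev (- s)" "0 \<le> s" shows "wsum s (fourier u)"
  unfolding wsum_def
proof (rule summable_on_le[OF coef_summable[of "emb (- s) u"]])
  show "jw k powr (- 2 * s) * (cmod (fourier u k))\<^sup>2 \<le> (cmod (coef (emb (- s) u) k))\<^sup>2" for k
    unfolding emb_sq[OF assms(1)] jw_def using weight_le[of s 1 k] assms(2) by (intro mult_right_mono) auto
qed auto

lemma wN_le_emb:
  assumes u: "u \<in> sobolev (- s)" and s: "0 \<le> s" and k: "1 \<le> \<kappa>"
  shows "wN s \<kappa> (fourier u) \<le> (norm (emb (- s) u))\<^sup>2"
  unfolding wN_def norm_sq_infsum
proof (rule infsum_mono[OF wN_summable[OF sobolev_wsum[OF u s] k s] coef_summable])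
  show "(\<bar>real_of_int j\<bar> + \<kappa>) powr (- 2 * s) * (cmod (fourier u j))\<^sup>2 \<le> (cmod (coef (emb (- s) u) j))\<^sup>2" for j
    unfolding emb_sq[OF u] by (intro mult_right_mono weight_le s k) simp
qed

text \<open>Taken over all frequencies, with c = 1 + \<kappa>, it bounds the H^(-s) norm. Taken over
  the frequencies of modulus at least \<kappa>, it holds with c = 2 whatever \<kappa> is, and this
  gives tightness.\<close>

lemma emb_tail_le_wN:
  assumes u: "u \<in> sobolev (- s)" and s: "0 \<le> s" "s < 1 / 2" and k: "1 \<le> \<kappa>"
    and c: "1 \<le> c" "\<And>j. j \<in> A \<Longrightarrow> \<bar>real_of_int j\<bar> + \<kappa> \<le> c * japanese j"
  shows "(\<Sum>\<^sub>\<infinity>j\<in>A. (cmod (coef (emb (- s) u) j))\<^sup>2) \<le> c * wN s \<kappa> (fourier u)"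
proof -
  let ?f = "\<lambda>j. (\<bar>real_of_int j\<bar> + \<kappa>) powr (- 2 * s) * (cmod (fourier u j))\<^sup>2"
  have sf: "?f summable_on UNIV" by (rule wN_summable[OF sobolev_wsum[OF u s(1)] k s(1)])
  have "(\<Sum>\<^sub>\<infinity>j\<in>A. (cmod (coef (emb (- s) u) j))\<^sup>2) \<le> (\<Sum>\<^sub>\<infinity>j. c * ?f j)"
  proof (rule infsum_mono_neutral[OF coef_summable summable_on_cmult_right[OF sf]])
    show "(cmod (coef (emb (- s) u) j))\<^sup>2 \<le> c * ?f j" if "j \<in> A \<inter> UNIV" for j
      unfolding emb_sq[OF u] mult.assoc[symmetric] using that by (intro mult_right_mono weight_ge s k c) auto
  qed (use c(1) in auto)
  also have "\<dots> = c * wN s \<kappa> (fourier u)" by (simp only: infsum_cmult_right' wN_def)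
  finally show ?thesis .
qed

lemma norm_emb_le_wN:
  assumes "u \<in> sobolev (- s)" "0 \<le> s" "s < 1 / 2" "1 \<le> \<kappa>"
  shows "(norm (emb (- s) u))\<^sup>2 \<le> (1 + \<kappa>) * wN s \<kappa> (fourier u)"
  unfolding norm_sq_infsum
proof (rule emb_tail_le_wN[OF assms])
  show "\<bar>real_of_int j\<bar> + \<kappa> \<le> (1 + \<kappa>) * japanese j" for j
  proof -
    have "\<bar>real_of_int j\<bar> \<le> japanese j" "\<kappa> * 1 \<le> \<kappa> * japanese j"
      using japanese_ge1[of j] assms(4) by (auto simp: japanese_def)
    then show ?thesis by (simp add: distrib_right)
  qed
qed (use assms in simp)

lemma wN_antimono:
  assumes "wsum s a" "0 \<le> s" "1 \<le> \<kappa>" "\<kappa> \<le> \<kappa>'"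
  shows "wN s \<kappa>' a \<le> wN s \<kappa> a"
  unfolding wN_def
proof (rule infsum_mono)
  show "(\<bar>real_of_int k\<bar> + \<kappa>') powr (- 2 * s) * (cmod (a k))\<^sup>2 \<le> (\<bar>real_of_int k\<bar> + \<kappa>) powr (- 2 * s) * (cmod (a k))\<^sup>2" for k
    using assms by (intro mult_right_mono powr_mono2') auto
qed (rule wN_summable; use assms in simp)+

lemma wN_tendsto_0:
  assumes u: "u \<in> sobolev (- s)" and s: "0 < s"
  shows "((\<lambda>\<kappa>. wN s \<kappa> (fourier u)) \<longlongrightarrow> 0) at_top"
proof -
  \<comment> \<open>\<open>max 1\<close> keeps the multiplier bounded by 1 for every real parameter;
    the limit sees only parameters at least 1.\<close>
  let ?m = "\<lambda>\<kappa> k. of_real ((\<bar>real_of_int k\<bar> + \<kappa>) powr (- s) / japanese k powr (- s)) :: complex"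
  have le: "cmod (?m (max 1 \<kappa>) k) \<le> 1" for \<kappa> :: real and k
  proof -
    have "(\<bar>real_of_int k\<bar> + max 1 \<kappa>) powr (- s) \<le> japanese k powr (- s)"
      using weight_le[of "s / 2" "max 1 \<kappa>" k] s by simp
    then show ?thesis unfolding norm_of_real using japanese_ge1[of k] by simp
  qed
  define h where "h \<kappa> = dmul (?m (max 1 \<kappa>)) (emb (- s) u)" for \<kappa>
  have ch: "coef (h \<kappa>) k = of_real ((\<bar>real_of_int k\<bar> + max 1 \<kappa>) powr (- s)) * fourier u k" for \<kappa> k
    unfolding h_def coef_dmul[OF le] coef_emb[OF u] using japanese_ge1[of k] by simp
  have "(h \<longlongrightarrow> 0) at_top"
  proof (rule tendsto_ell2_dominated[where C = 1 and h = "emb (- s) u"])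
    fix k
    have "((\<lambda>\<kappa>. (\<bar>real_of_int k\<bar> + max 1 \<kappa>) powr (- s)) \<longlongrightarrow> 0) at_top"
    proof (rule tendsto_neg_powr)
      show "- s < 0" using s by simp
      have "\<forall>\<^sub>F \<kappa> in at_top. \<kappa> \<le> \<bar>real_of_int k\<bar> + max 1 \<kappa>" by (rule always_eventually) auto
      then show "filterlim (\<lambda>\<kappa>. \<bar>real_of_int k\<bar> + max 1 \<kappa>) at_top at_top"
        by (rule filterlim_at_top_mono[OF filterlim_ident])
    qed
    then have "((\<lambda>\<kappa>. complex_of_real ((\<bar>real_of_int k\<bar> + max 1 \<kappa>) powr (- s)) * fourier u k) \<longlongrightarrow> of_real 0 * fourier u k) at_top"
      by (intro tendsto_mult tendsto_of_real tendsto_const)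
    then show "((\<lambda>\<kappa>. coef (h \<kappa>) k) \<longlongrightarrow> coef 0 k) at_top" unfolding ch by simp
    show "\<forall>\<^sub>F \<kappa> in at_top. \<forall>i. cmod (coef (h \<kappa>) i) \<le> 1 * cmod (coef (emb (- s) u) i)"
      unfolding h_def coef_dmul[OF le] norm_mult by (intro always_eventually allI mult_right_mono le) simp
  qed
  then have "((\<lambda>\<kappa>. (norm (h \<kappa>))\<^sup>2) \<longlongrightarrow> (norm (0 :: int ell2))\<^sup>2) at_top"
    by (intro tendsto_power tendsto_norm)
  moreover have "(norm (h \<kappa>))\<^sup>2 = wN s \<kappa> (fourier u)" if "\<kappa> \<ge> 1" for \<kappa>
  proof -
    have "(\<bar>real_of_int k\<bar> + \<kappa>) powr (- 2 * s) = ((\<bar>real_of_int k\<bar> + \<kappa>) powr (- s))\<^sup>2" for k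
      unfolding power2_eq_square by (subst powr_add_eq[of "- 2 * s"]) simp_all
    then show ?thesis
      using that by (simp add: norm_sq_infsum ch norm_mult power_mult_distrib wN_def)
  qed
  then have "\<forall>\<^sub>F \<kappa> in at_top. (norm (h \<kappa>))\<^sup>2 = wN s \<kappa> (fourier u)"
    by (rule eventually_mono[OF eventually_ge_at_top[of 1]])
  ultimately show ?thesis using tendsto_cong by force
qed

text \<open>The Hilbert-Schmidt norm of Q is linear in the datum and bounded by its H^(-s) norm,
  with a constant independent of \<kappa>.\<close>

lemma Rs_sobolev_lipschitz:
  assumes s: "0 \<le> s" "s < 1 / 2" and uv: "u \<in> sobolev (- s)" "v \<in> sobolev (- s)"
    and g: "good (fourier u) \<kappa>" "good (fourier v) \<kappa>"
  shows "norm (Rs (fourier u) \<kappa> f - Rs (fourier v) \<kappa> f) \<le> 9 / 4 * (sqrt (cs s) * norm (emb (- s) u - emb (- s) v)) * norm f"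
proof (rule Rs_perturb[OF g])
  note k = goodD(2)[OF g(1)]
  note d = sobolev_diff[OF uv]
  have f: "(\<lambda>k. fourier u k - fourier v k) = fourier (u - v)" by (simp add: fourier_diff fun_eq_iff)
  have w: "wsum s (fourier (u - v))" by (rule sobolev_wsum[OF d(1) s(1)])
  show "hsm (qmat (\<lambda>k. fourier u k - fourier v k) \<kappa>)"
    unfolding f by (rule qmat_bound(1)[OF s k w])
  have c: "0 \<le> cs s" using cs_ge_1[OF s(2)] by simp
  have "hs (qmat (\<lambda>k. fourier u k - fourier v k) \<kappa>) \<le> wN s \<kappa> (fourier (u - v)) * cs s"
    unfolding f by (rule qmat_bound(2)[OF s k w])
  also have "\<dots> \<le> (norm (emb (- s) (u - v)))\<^sup>2 * cs s"
    by (rule mult_right_mono[OF wN_le_emb[OF d(1) s(1) k] c])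
  also have "\<dots> = (sqrt (cs s) * norm (emb (- s) u - emb (- s) v))\<^sup>2"
    using c by (simp add: d(2) power_mult_distrib)
  finally show "hs (qmat (\<lambda>k. fourier u k - fourier v k) \<kappa>) \<le> (sqrt (cs s) * norm (emb (- s) u - emb (- s) v))\<^sup>2" .
  show "0 \<le> sqrt (cs s) * norm (emb (- s) u - emb (- s) v)" using c by simp
qed

lemma Rs_sobolev_tendsto:
  assumes s: "0 \<le> s" "s < 1 / 2" and uv: "\<And>x. u x \<in> sobolev (- s)" "v \<in> sobolev (- s)"
    and g: "\<And>x. good (fourier (u x)) \<kappa>" "good (fourier v) \<kappa>"
    and lim: "((\<lambda>x. emb (- s) (u x)) \<longlongrightarrow> emb (- s) v) F" and f: "(f \<longlongrightarrow> h) F"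
  shows "((\<lambda>x. Rs (fourier (u x)) \<kappa> (f x)) \<longlongrightarrow> Rs (fourier v) \<kappa> h) F"
proof -
  have "((\<lambda>x. Rs (fourier (u x)) \<kappa> (f x) - Rs (fourier v) \<kappa> (f x)) \<longlongrightarrow> 0) F"
  proof (rule Lim_null_comparison)
    show "\<forall>\<^sub>F x in F. norm (Rs (fourier (u x)) \<kappa> (f x) - Rs (fourier v) \<kappa> (f x))
        \<le> 9 / 4 * (sqrt (cs s) * norm (emb (- s) (u x) - emb (- s) v)) * norm (f x)"
      by (intro always_eventually allI Rs_sobolev_lipschitz s uv g)
    have "((\<lambda>x. 9 / 4 * (sqrt (cs s) * norm (emb (- s) (u x) - emb (- s) v)) * norm (f x))
        \<longlongrightarrow> 9 / 4 * (sqrt (cs s) * norm (emb (- s) v - emb (- s) v)) * norm h) F"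
      by (intro tendsto_intros lim f)
    then show "((\<lambda>x. 9 / 4 * (sqrt (cs s) * norm (emb (- s) (u x) - emb (- s) v)) * norm (f x)) \<longlongrightarrow> 0) F" by simp
  qed
  moreover have "((\<lambda>x. Rs (fourier v) \<kappa> (f x)) \<longlongrightarrow> Rs (fourier v) \<kappa> h) F"
    by (rule bcl_tendsto[OF bcl_Rs[OF g(2)] f])
  ultimately show ?thesis using tendsto_add by fastforce
qed

lemma fourier_tendsto:
  assumes "\<And>x. u x \<in> sobolev \<sigma>" "v \<in> sobolev \<sigma>" "((\<lambda>x. emb \<sigma> (u x)) \<longlongrightarrow> emb \<sigma> v) F"
  shows "((\<lambda>x. fourier (u x) k) \<longlongrightarrow> fourier v k) F"
proof -
  have "((\<lambda>x. coef (emb \<sigma> (u x)) k / of_real (japanese k powr \<sigma>)) \<longlongrightarrow> coef (emb \<sigma> v) k / of_real (japanese k powr \<sigma>)) F"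
    using japanese_ge1[of k] by (intro tendsto_divide tendsto_coef assms tendsto_const) auto
  then show ?thesis using japanese_ge1[of k] by (simp add: coef_emb assms)
qed

text \<open>The limit has coefficients of order at most |k|^s, within the reach of
  \<open>distr_of_coefs\<close> since s < 1/2, and the symmetry of real distributions passes to the
  limit.\<close>

lemma emb_closed:
  fixes u :: "nat \<Rightarrow> distr"
  assumes s: "0 \<le> s" "s < 1 / 2" and u: "\<And>j. u j \<in> sobolev (- s)" and lim: "(\<lambda>j. emb (- s) (u j)) \<longlonglongrightarrow> l"
  obtains v where "v \<in> sobolev (- s)" "emb (- s) v = l"
proof -
  have jp: "japanese k powr s > 0" "japanese k powr (- s) * japanese k powr s = 1" for k
    using japanese_ge1[of k] by (auto simp: powr_add_eq[of 0])
  define c where "c k = of_real (japanese k powr s) * coef l k" for k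
  have lc: "of_real (japanese k powr (- s)) * c k = coef l k" for k
    unfolding c_def mult.assoc[symmetric] of_real_mult[symmetric] jp(2) by simp
  have "cmod (c k) \<le> norm l * jw k powr (1 / 2)" for k
  proof -
    have "japanese k powr s \<le> jw k powr s"
      using s japanese_le_jw(1)[of k] japanese_ge1[of k] by (intro powr_mono2) auto
    also have "\<dots> \<le> jw k powr (1 / 2)" using s jw_ge1[of k] by (intro powr_mono) auto
    finally show ?thesis
      using coef_le_norm[of l k] by (simp add: c_def norm_mult mult.commute mult_mono)
  qed
  from distr_of_coefs[OF this] obtain v where v: "\<And>k. fourier v k = c k" by blast
  have "herm (fourier v)"
    unfolding herm_def
  proof
    fix k
    have j: "japanese (- k) = japanese k" by (simp add: japanese_def)
    have "coef (emb (- s) (u j)) (- k) = cnj (coef (emb (- s) (u j)) k)" for j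
      using u[of j] by (simp add: coef_emb sobolev_iff herm_def j)
    then have "(\<lambda>j. coef (emb (- s) (u j)) (- k)) \<longlonglongrightarrow> cnj (coef l k)"
      using tendsto_cnj[OF tendsto_coef[OF lim, of k]] by simp
    with tendsto_coef[OF lim, of "- k"] have "coef l (- k) = cnj (coef l k)" by (rule LIMSEQ_unique)
    then show "fourier v (- k) = cnj (fourier v k)" by (simp add: v c_def j)
  qed
  then have vs: "v \<in> sobolev (- s)"
    by (rule sobolev_dominated[where C = 1 and g = l]) (simp add: v lc)
  moreover have "emb (- s) v = l" by (rule ell2_eqI) (simp add: coef_emb[OF vs] v lc)
  ultimately show thesis by (rule that)
qed

section \<open>Passing to the limit in the explicit formula\<close>

text \<open>For contractions, convergence on an orthonormal basis extends to finite combinations and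
  then by a three-term estimate to every vector.\<close>

lemma (in onb) strong_limit:
  fixes T :: "nat \<Rightarrow> 'a ell2 \<Rightarrow> 'a ell2"
  assumes T: "\<And>j. bcl (T j)" "\<And>j f. norm (T j f) \<le> norm f" and S: "bcl S"
    and lim: "\<And>p. (\<lambda>j. T j (\<phi> p)) \<longlonglongrightarrow> S (\<phi> p)" and f: "f \<longlonglongrightarrow> g"
  shows "(\<lambda>j. T j (f j)) \<longlonglongrightarrow> S g"
proof -
  have "(\<lambda>j. T j g) \<longlonglongrightarrow> S g"
  proof (rule LIMSEQ_I)
    fix e :: real assume e: "e > 0"
    let ?p = "\<lambda>n. part (ana g) {..<n}"
    have p: "?p \<longlonglongrightarrow> g" using part_tendsto[of "ana g"] by simp
    have "\<forall>\<^sub>F n in sequentially. dist (?p n) g < e / 3 \<and> dist (S (?p n)) (S g) < e / 3"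
      using e by (intro eventually_conj tendstoD p bcl_tendsto[OF S p]) auto
    then obtain n where n: "norm (?p n - g) < e / 3" "norm (S (?p n) - S g) < e / 3"
      unfolding dist_norm using eventually_happens' sequentially_bot by blast
    have "(\<lambda>j. T j (?p n)) \<longlonglongrightarrow> S (?p n)"
      unfolding part_def bcl_sum[OF T(1)] bcl_sum[OF S] bclD(4)[OF T(1)] bclD(4)[OF S]
      by (intro tendsto_sum tendsto_cmul tendsto_const lim)
    then obtain N where N: "\<And>j. j \<ge> N \<Longrightarrow> norm (T j (?p n) - S (?p n)) < e / 3"
      using LIMSEQ_D[of _ _ "e / 3"] e by fastforce
    have "norm (T j g - S g) < e" if "j \<ge> N" for j
    proof -
      have eq: "T j g - S g = - T j (?p n - g) + (T j (?p n) - S (?p n)) + (S (?p n) - S g)"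
        by (simp add: bclD(3)[OF T(1)])
      have "norm (T j g - S g) \<le> norm (T j (?p n - g)) + norm (T j (?p n) - S (?p n)) + norm (S (?p n) - S g)"
        unfolding eq by (intro order_trans[OF norm_triangle_ineq] add_mono order_refl) simp
      also have "\<dots> < e" using T(2)[of j "?p n - g"] n N[OF that] by linarith
      finally show ?thesis .
    qed
    then show "\<exists>N. \<forall>j\<ge>N. norm (T j g - S g) < e" by blast
  qed
  moreover have "(\<lambda>j. T j (f j) - T j g) \<longlonglongrightarrow> 0"
  proof (rule Lim_null_comparison)
    show "\<forall>\<^sub>F j in sequentially. norm (T j (f j) - T j g) \<le> norm (f j - g)"
      using T(2)[of _ "f _ - g"] by (intro always_eventually allI) (simp add: bclD(3)[OF T(1)])
    show "(\<lambda>j. norm (f j - g)) \<longlonglongrightarrow> 0" using f by (simp add: LIM_zero tendsto_norm_zero)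
  qed
  ultimately show ?thesis using tendsto_add by fastforce
qed

text \<open>The eigenvector \<phi> p of the limit operator need not lie in the domain of the
  approximating ones. The test vectors \<open>Rs (\<alpha> j) \<kappa> (\<phi> p)\<close> do, and
  they converge to \<mu> p \<phi> p with \<mu> p > 0.\<close>

lemma lax_group_limit:
  assumes l: "lax_group \<phi> a \<kappa> \<mu>" "\<And>j. lax_group (\<Phi> j) (\<alpha> j) \<kappa> (M j)"
    and R: "\<And>f. (\<lambda>j. Rs (\<alpha> j) \<kappa> f) \<longlonglongrightarrow> Rs a \<kappa> f" and f: "f \<longlonglongrightarrow> g"
  shows "(\<lambda>j. lax_group.E (\<Phi> j) \<kappa> (M j) t (f j)) \<longlonglongrightarrow> lax_group.E \<phi> \<kappa> \<mu> t g"
proof -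
  interpret A: lax_group \<phi> a \<kappa> \<mu> by (rule l)
  let ?E = "\<lambda>j. lax_group.E (\<Phi> j) \<kappa> (M j) t"
  have E: "bcl (?E j)" "norm (?E j h) = norm h" for j h
    using lax_group.E_bcl[OF l(2)] lax_group.norm_E[OF l(2)] by auto
  show ?thesis
  proof (rule A.strong_limit[OF E(1) _ A.E_bcl _ f])
    fix p
    let ?c = "cis (t * A.\<nu> p)" let ?r = "\<lambda>j. Rs (\<alpha> j) \<kappa> (\<phi> p)" let ?\<mu> = "complex_of_real (\<mu> p)"
    have m: "?\<mu> \<noteq> 0" using A.mu_pos[of p] by simp
    have r: "?r \<longlonglongrightarrow> cmul ?\<mu> (\<phi> p)" using R[of "\<phi> p"] by (simp add: A.eig scaleR_cmul)
    have "(\<lambda>j. ?E j (?r j) - cmul ?c (?r j)) \<longlonglongrightarrow> 0"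
    proof (rule Lim_null_comparison)
      show "\<forall>\<^sub>F j in sequentially. norm (?E j (?r j) - cmul ?c (?r j)) \<le> \<bar>t\<bar> / \<mu> p * norm (Rs a \<kappa> (\<phi> p) - ?r j)"
        by (intro always_eventually allI group_convergence_eigenvector l)
      have "(\<lambda>j. \<bar>t\<bar> / \<mu> p * norm (Rs a \<kappa> (\<phi> p) - ?r j)) \<longlonglongrightarrow> \<bar>t\<bar> / \<mu> p * norm (Rs a \<kappa> (\<phi> p) - Rs a \<kappa> (\<phi> p))"
        by (intro tendsto_intros R)
      then show "(\<lambda>j. \<bar>t\<bar> / \<mu> p * norm (Rs a \<kappa> (\<phi> p) - ?r j)) \<longlonglongrightarrow> 0" by simp
    qed
    moreover have "(\<lambda>j. ?E j (cmul ?\<mu> (\<phi> p) - ?r j)) \<longlonglongrightarrow> 0"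
    proof (rule Lim_null_comparison)
      show "\<forall>\<^sub>F j in sequentially. norm (?E j (cmul ?\<mu> (\<phi> p) - ?r j)) \<le> norm (cmul ?\<mu> (\<phi> p) - ?r j)"
        unfolding E(2) by simp
      have "(\<lambda>j. norm (cmul ?\<mu> (\<phi> p) - ?r j)) \<longlonglongrightarrow> norm (cmul ?\<mu> (\<phi> p) - cmul ?\<mu> (\<phi> p))"
        by (intro tendsto_intros r)
      then show "(\<lambda>j. norm (cmul ?\<mu> (\<phi> p) - ?r j)) \<longlonglongrightarrow> 0" by simp
    qed
    ultimately have "(\<lambda>j. (?E j (cmul ?\<mu> (\<phi> p) - ?r j) + (?E j (?r j) - cmul ?c (?r j))) + cmul ?c (?r j)) \<longlonglongrightarrow> (0 + 0) + cmul ?c (cmul ?\<mu> (\<phi> p))"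
      by (intro tendsto_intros r)
    then have "(\<lambda>j. cmul ?\<mu> (?E j (\<phi> p))) \<longlonglongrightarrow> cmul ?\<mu> (cmul ?c (\<phi> p))"
      by (simp add: bclD(3,4)[OF E(1)] mult.commute)
    then have "(\<lambda>j. cmul (1 / ?\<mu>) (cmul ?\<mu> (?E j (\<phi> p)))) \<longlonglongrightarrow> cmul (1 / ?\<mu>) (cmul ?\<mu> (cmul ?c (\<phi> p)))"
      by (rule tendsto_cmul[OF tendsto_const])
    moreover have "1 / ?\<mu> * ?\<mu> = 1" using m by simp
    then have "cmul (1 / ?\<mu>) (cmul ?\<mu> h) = h" for h :: "nat ell2" by (simp only: cmul_cmul cmul_1)
    ultimately have "(\<lambda>j. ?E j (\<phi> p)) \<longlonglongrightarrow> cmul ?c (\<phi> p)" by (simp only:)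
    moreover have "cmul ?c (\<phi> p) = A.E t (\<phi> p)"
      by (rule A.onb_eqI) (auto simp: A.cin_E A.ortho)
    ultimately show "(\<lambda>j. ?E j (\<phi> p)) \<longlonglongrightarrow> A.E t (\<phi> p)" by simp
  qed (simp add: E(2))
qed

lemma lax_group_Ks_limit:
  assumes l: "lax_group \<phi> a \<kappa> \<mu>" "\<And>j. lax_group (\<Phi> j) (\<alpha> j) \<kappa> (M j)"
    and R: "\<And>f. (\<lambda>j. Rs (\<alpha> j) \<kappa> f) \<longlonglongrightarrow> Rs a \<kappa> f"
  shows "(\<lambda>j. (lax_group.Ks (\<Phi> j) \<kappa> (M j) t ^^ m) f) \<longlonglongrightarrow> (lax_group.Ks \<phi> \<kappa> \<mu> t ^^ m) f"
proof (induction m)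
  case (Suc m)
  then show ?case
    unfolding funpow.simps o_def lax_group.Ks_def[OF l(1)] lax_group.Ks_def[OF l(2)]
    by (intro tendsto_cmul tendsto_const bcl_tendsto[OF bcl_shr] lax_group_limit[OF l R])
qed simp

lemma wN_limit_le:
  assumes s: "0 \<le> s" and k: "1 \<le> k" and u: "\<And>j. u j \<in> sobolev (- s)" and v: "v \<in> sobolev (- s)"
    and lim: "(\<lambda>j :: nat. emb (- s) (u j)) \<longlonglongrightarrow> emb (- s) v" and le: "\<And>j. wN s k (fourier (u j)) \<le> D"
  shows "wN s k (fourier v) \<le> D"
  unfolding wN_def
proof (rule infsum_le_finite_sums[OF wN_summable[OF sobolev_wsum[OF v s] k s]])
  let ?f = "\<lambda>u i. (\<bar>real_of_int i\<bar> + k) powr (- 2 * s) * (cmod (fourier u i))\<^sup>2"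
  fix F :: "int set" assume F: "finite F"
  show "(\<Sum>i\<in>F. ?f v i) \<le> D"
  proof (rule LIMSEQ_le_const2)
    show "(\<lambda>j. \<Sum>i\<in>F. ?f (u j) i) \<longlonglongrightarrow> (\<Sum>i\<in>F. ?f v i)"
      by (intro tendsto_intros fourier_tendsto[OF u v lim])
    have "(\<Sum>i\<in>F. ?f (u j) i) \<le> D" for j
      using finite_sum_le_infsum[OF wN_summable[OF sobolev_wsum[OF u s] k s] F, of j] le[of j] by (simp add: wN_def)
    then show "\<exists>N. \<forall>j\<ge>N. (\<Sum>i\<in>F. ?f (u j) i) \<le> D" by blast
  qed
qed

lemma (in lax_smooth) B_mean: "coef (B t) 0 = coef A 0"
  by (simp add: B_def coef_hext coef_U)

text \<open>One \<kappa> serves the whole orbit. The threshold is that of \<open>flow_tight\<close>: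
  by \<open>wN_antimono\<close> it persists for larger parameters, and by
  \<open>good_of_bound\<close> the resulting bound keeps the resolvent at \<kappa> available at
  every time.\<close>

locale bo_orbit = lax_group \<phi> "fourier v0" \<kappa> \<mu> for \<phi> v0 \<kappa> \<mu> +
  fixes s :: real and \<gamma> :: "real \<Rightarrow> distr"
  assumes s: "0 < s" "s < 1 / 2" and v0: "v0 \<in> sobolev (- s)" and bo: "bo_solution s v0 \<gamma>"
    and threshold: "cs s * (64 * dyD s * wN s \<kappa> (fourier v0)) \<le> 1 / 18"
begin

lemma s0: "0 \<le> s" using s by simp

lemma k1: "1 \<le> \<kappa>" using goodD(2)[OF good] .

lemma cs0: "0 < cs s" using cs_ge_1[OF s(2)] by linarith

lemma wsum_v0: "wsum s (fourier v0)" by (rule sobolev_wsum[OF v0 s0])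

lemma gamma_sobolev: "\<gamma> t \<in> sobolev (- s)"
  using bo continuous_map_image_subset_topspace[of euclideanreal "sobolev_top (- s)" \<gamma>]
  by (auto simp: bo_solution_def)

lemma threshold': "\<kappa> \<le> k \<Longrightarrow> cs s * (64 * dyD s * wN s k (fourier v0)) \<le> 1 / 18"
  using mult_left_mono[OF mult_left_mono[OF wN_antimono[OF wsum_v0 s0 k1, of k]], of "64 * dyD s" "cs s"]
    dyD_ge_1[OF s] cs0 threshold by linarith

lemma good_of_bound:
  assumes u: "u \<in> sobolev (- s)" and le: "wN s \<kappa> (fourier u) \<le> 32 * dyD s * wN s \<kappa> (fourier v0)"
  shows "good (fourier u) \<kappa>"
proof (rule wN_good[OF s0 s(2) k1 sobolev_wsum[OF u s0]])
  show "herm (fourier u)" using u by (simp add: sobolev_iff)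
  have "cs s * wN s \<kappa> (fourier u) \<le> cs s * (32 * dyD s * wN s \<kappa> (fourier v0))"
    using cs0 le by (intro mult_left_mono) auto
  then have "cs s * wN s \<kappa> (fourier u) \<le> 1 / 9" using threshold by linarith
  then show "wN s \<kappa> (fourier u) * cs s \<le> 1 / 9" by (simp only: mult.commute)
qed

text \<open>Truncation can only lower \<open>wN\<close>, so all approximating data share the
  \<kappa> of v0. The classical solutions built from them by the explicit formula form an admissible
  family in \<open>bo\<close>, which forces their convergence to \<gamma>.\<close>

lemma smooth_approximation:
  obtains A \<Phi> M w where "\<And>j. lax_smooth (\<Phi> j) (A j) \<kappa> (M j)" "\<And>j. finite {k. coef (A j) k \<noteq> 0}"
    "\<And>j k. coef (A j) k = (if \<bar>k\<bar> \<le> int j then fourier v0 k else 0)"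
    "\<And>j t. w j t \<in> sobolev (- s)" "\<And>j t. fourier (w j t) = coef (lax_smooth.B (\<Phi> j) (A j) \<kappa> (M j) t)"
    "\<And>t. (\<lambda>j :: nat. emb (- s) (w j t)) \<longlonglongrightarrow> emb (- s) (\<gamma> t)"
proof -
  have hv: "herm (fourier v0)" using v0 by (simp add: sobolev_iff)
  define A :: "nat \<Rightarrow> int ell2" where "A j = Abs_ell2 (\<lambda>k. if \<bar>k\<bar> \<le> int j then fourier v0 k else 0)" for j
  have fin: "finite {k. \<bar>k\<bar> \<le> int j}" for j
    by (rule finite_subset[of _ "{- int j..int j}"]) auto
  have A: "coef (A j) k = (if \<bar>k\<bar> \<le> int j then fourier v0 k else 0)" for j k
  proof -
    have "(\<lambda>k. (cmod (if \<bar>k\<bar> \<le> int j then fourier v0 k else 0))\<^sup>2) summable_on UNIV"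
      by (rule finite_nonzero_values_imp_summable_on) (rule finite_subset[OF _ fin[of j]], auto)
    then show ?thesis by (simp add: A_def coef_Abs_ell2)
  qed
  have finA: "finite {k. coef (A j) k \<noteq> 0}" for j
    by (rule finite_subset[OF _ fin[of j]]) (auto simp: A)
  have hA: "herm (coef (A j))" for j using hv by (auto simp: herm_def A)
  have wA: "wN s k (coef (A j)) \<le> wN s k (fourier v0)" if "1 \<le> k" for j k
    by (rule wN_mono[OF wsum_v0 that s0]) (simp add: A)
  have gA: "good (coef (A j)) \<kappa>" for j
  proof (rule wN_good[OF s0 s(2) k1 wsum_ell2[OF s0] hA])
    have "1 * wN s \<kappa> (fourier v0) \<le> 64 * dyD s * wN s \<kappa> (fourier v0)"
      using dyD_ge_1[OF s] wN_nonneg by (intro mult_right_mono) auto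
    then have "cs s * wN s \<kappa> (coef (A j)) \<le> cs s * (64 * dyD s * wN s \<kappa> (fourier v0))"
      using wA[OF k1, of j] cs0 by (intro mult_left_mono) auto
    then have "cs s * wN s \<kappa> (coef (A j)) \<le> 1 / 9" using threshold by linarith
    then show "wN s \<kappa> (coef (A j)) * cs s \<le> 1 / 9" by (simp only: mult.commute)
  qed
  have "\<exists>\<Phi> M. lax_smooth \<Phi> (A j) \<kappa> M" for j
    using lax_group_exists[OF gA] lax_smooth.intro by metis
  then obtain \<Phi> M where l: "\<And>j. lax_smooth (\<Phi> j) (A j) \<kappa> (M j)" by metis
  let ?B = "\<lambda>j. lax_smooth.B (\<Phi> j) (A j) \<kappa> (M j)"
  have "\<exists>v. bo_classical_solution (7 / 4) v \<and> (\<forall>t. fourier (v t) = coef (?B j t))" for j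
    by (rule lax_smooth.classical_solution[OF l finA, of j]) (auto simp: fun_eq_iff)
  then obtain w where w: "\<And>j. bo_classical_solution (7 / 4) (w j)" "\<And>j t. fourier (w j t) = coef (?B j t)" by metis
  have ws: "w j t \<in> sobolev (- s)" for j t
  proof (rule sobolev_dominated[where C = 1 and g = "?B j t"])
    show "herm (fourier (w j t))" unfolding w(2) by (rule lax_smooth.herm_B[OF l])
    have "japanese k powr (- s) \<le> 1" for k
      using powr_mono[of "- s" 0 "japanese k"] japanese_ge1[of k] s0 by simp
    then show "cmod (of_real (japanese k powr (- s)) * fourier (w j t) k) \<le> 1 * cmod (coef (?B j t) k)" for k
      by (simp add: w(2) norm_mult mult_left_le_one_le)
  qed
  have w0: "fourier (w j 0) = coef (A j)" for j unfolding w(2) lax_smooth.B_0[OF l] ..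
  have "(\<lambda>j. emb (- s) (w j 0)) \<longlonglongrightarrow> emb (- s) v0"
  proof (rule tendsto_ell2_dominated[where C = 1 and h = "emb (- s) v0"])
    fix k
    have "\<forall>\<^sub>F j in sequentially. coef (emb (- s) (w j 0)) k = coef (emb (- s) v0) k"
      using eventually_ge_at_top[of "nat \<bar>k\<bar>"]
      by (rule eventually_mono) (auto simp: coef_emb ws v0 w0 A nat_le_iff)
    then show "(\<lambda>j. coef (emb (- s) (w j 0)) k) \<longlonglongrightarrow> coef (emb (- s) v0) k" by (rule tendsto_eventually)
    show "\<forall>\<^sub>F j in sequentially. \<forall>i. cmod (coef (emb (- s) (w j 0)) i) \<le> 1 * cmod (coef (emb (- s) v0) i)"
      by (intro always_eventually allI) (simp add: coef_emb ws v0 w0 A)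
  qed
  then have "limitin (sobolev_top (- s)) (\<lambda>j. w j 0) v0 sequentially"
    by (rule limitin_sobolevI[OF v0 ws])
  have conv: "\<forall>\<^sub>F j in sequentially. \<forall>t\<in>{- T..T}. sobolev_norm (- s) (w j t - \<gamma> t) < e" if "T > 0" "e > 0" for T e
  proof -
    have "(3 / 2 :: real) < 7 / 4" by simp
    with bo w(1) that \<open>limitin (sobolev_top (- s)) (\<lambda>j. w j 0) v0 sequentially\<close> show ?thesis
      unfolding bo_solution_def by blast
  qed
  have "(\<lambda>j. emb (- s) (w j t)) \<longlonglongrightarrow> emb (- s) (\<gamma> t)" for t
  proof (rule tendstoI)
    fix e :: real assume "e > 0"
    \<comment> \<open>The interval with end points \<bar>t\<bar> + 1 and its negative contains t and
      has positive length also for t = 0.\<close>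
    then have "\<forall>\<^sub>F j in sequentially. \<forall>r\<in>{- (\<bar>t\<bar> + 1)..\<bar>t\<bar> + 1}. sobolev_norm (- s) (w j r - \<gamma> r) < e"
      by (intro conv) auto
    then show "\<forall>\<^sub>F j in sequentially. dist (emb (- s) (w j t)) (emb (- s) (\<gamma> t)) < e"
    proof (rule eventually_mono)
      fix j assume "\<forall>r\<in>{- (\<bar>t\<bar> + 1)..\<bar>t\<bar> + 1}. sobolev_norm (- s) (w j r - \<gamma> r) < e"
      moreover have "t \<in> {- (\<bar>t\<bar> + 1)..\<bar>t\<bar> + 1}" by auto
      ultimately have "sobolev_norm (- s) (w j t - \<gamma> t) < e" by blast
      then show "dist (emb (- s) (w j t)) (emb (- s) (\<gamma> t)) < e"
        by (simp add: dist_norm sobolev_norm_diff ws gamma_sobolev)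
    qed
  qed
  with l finA A ws w(2) show thesis by (rule that)
qed

text \<open>The last conclusion is the explicit formula for the rough solution.\<close>

lemma orbit_properties:
  shows gamma_wN: "\<kappa> \<le> k \<Longrightarrow> wN s k (fourier (\<gamma> t)) \<le> 32 * dyD s * wN s k (fourier v0)"
    and gamma_good: "good (fourier (\<gamma> t)) \<kappa>"
    and gamma_mean: "fourier (\<gamma> t) 0 = fourier v0 0"
    and gamma_resolvent: "cin (Rs (fourier (\<gamma> t)) \<kappa> (bas m)) (bas n) =
      cin (Rs (fourier v0) \<kappa> ((Ks t ^^ m) (bas 0))) ((Ks t ^^ n) (bas 0))"
proof -
  obtain A \<Phi> M w where l: "\<And>j. lax_smooth (\<Phi> j) (A j) \<kappa> (M j)" and fin: "\<And>j. finite {k. coef (A j) k \<noteq> 0}"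
    and A: "\<And>j k. coef (A j) k = (if \<bar>k\<bar> \<le> int j then fourier v0 k else 0)"
    and ws: "\<And>j t. w j t \<in> sobolev (- s)" and w: "\<And>j t. fourier (w j t) = coef (lax_smooth.B (\<Phi> j) (A j) \<kappa> (M j) t)"
    and lim: "\<And>t. (\<lambda>j :: nat. emb (- s) (w j t)) \<longlonglongrightarrow> emb (- s) (\<gamma> t)"
    by (rule smooth_approximation) blast
  have g0: "\<gamma> 0 = v0" using bo by (simp add: bo_solution_def)
  have w0: "fourier (w j 0) = coef (A j)" for j unfolding w lax_smooth.B_0[OF l] ..
  have wA: "wN s k (coef (A j)) \<le> wN s k (fourier v0)" if "1 \<le> k" for j k
    by (rule wN_mono[OF wsum_v0 that s0]) (simp add: A)
  have wB: "wN s k (fourier (w j t)) \<le> 32 * dyD s * wN s k (fourier v0)" if k: "\<kappa> \<le> k" for j k t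
  proof -
    have k': "1 \<le> k" using k k1 by simp
    have d: "0 \<le> dyD s" using dyD_ge_1[OF s] by simp
    have "cs s * (64 * dyD s * wN s k (coef (A j))) \<le> cs s * (64 * dyD s * wN s k (fourier v0))"
      using cs0 d wA[OF k', of j] by (intro mult_left_mono) auto
    then have "cs s * (64 * dyD s * wN s k (coef (A j))) \<le> 1 / 18" using threshold'[OF k] by linarith
    then have "wN s k (fourier (w j t)) \<le> 32 * dyD s * wN s k (coef (A j))"
      unfolding w by (rule lax_smooth.flow_tight[OF l fin s k])
    also have "\<dots> \<le> 32 * dyD s * wN s k (fourier v0)" using d wA[OF k', of j] by (intro mult_left_mono) auto
    finally show ?thesis .
  qed
  show wg: "wN s k (fourier (\<gamma> t)) \<le> 32 * dyD s * wN s k (fourier v0)" if k: "\<kappa> \<le> k" for t k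
    by (rule wN_limit_le[OF s0 _ ws gamma_sobolev lim wB[OF k]]) (use k k1 in simp)
  show gg: "good (fourier (\<gamma> t)) \<kappa>" for t
    by (rule good_of_bound[OF gamma_sobolev wg]) simp
  have gw: "good (fourier (w j t)) \<kappa>" for j t
    by (rule good_of_bound[OF ws wB]) simp
  have "fourier (w j t) 0 = fourier v0 0" for j
    unfolding w lax_smooth.B_mean[OF l] by (simp add: A)
  then show "fourier (\<gamma> t) 0 = fourier v0 0"
    using fourier_tendsto[OF ws gamma_sobolev lim, of t 0] LIMSEQ_unique[OF tendsto_const] by fastforce
  have gr: "lax_group (\<Phi> j) (coef (A j)) \<kappa> (M j)" for j using l[of j] by (simp add: lax_smooth_def)
  have R0: "(\<lambda>j. Rs (coef (A j)) \<kappa> (f j)) \<longlonglongrightarrow> Rs (fourier v0) \<kappa> g" if "f \<longlonglongrightarrow> g" for f g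
    using Rs_sobolev_tendsto[OF s0 s(2) ws gamma_sobolev gw gg lim that, of 0] by (simp add: w0 g0)
  note Kl = lax_group_Ks_limit[OF lax_group_axioms gr R0[OF tendsto_const], where t = t]
  let ?c = "\<lambda>j. cin (Rs (fourier (w j t)) \<kappa> (bas m)) (bas n)"
  have "?c \<longlonglongrightarrow> cin (Rs (fourier (\<gamma> t)) \<kappa> (bas m)) (bas n)"
    by (intro tendsto_cin Rs_sobolev_tendsto[OF s0 s(2) ws gamma_sobolev gw gg lim] tendsto_const)
  moreover have "?c j = cin (Rs (coef (A j)) \<kappa> ((lax_group.Ks (\<Phi> j) \<kappa> (M j) t ^^ m) (bas 0)))
      ((lax_group.Ks (\<Phi> j) \<kappa> (M j) t ^^ n) (bas 0))" for j
    unfolding w by (rule lax_smooth.resolvent_entries[OF l]) (use gw[of j 0] gw[of j t] in \<open>simp_all add: w lax_smooth.B_0[OF l]\<close>)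
  moreover have "(\<lambda>j. cin (Rs (coef (A j)) \<kappa> ((lax_group.Ks (\<Phi> j) \<kappa> (M j) t ^^ m) (bas 0)))
      ((lax_group.Ks (\<Phi> j) \<kappa> (M j) t ^^ n) (bas 0))) \<longlonglongrightarrow> cin (Rs (fourier v0) \<kappa> ((Ks t ^^ m) (bas 0))) ((Ks t ^^ n) (bas 0))"
    by (intro tendsto_cin R0 Kl)
  ultimately show "cin (Rs (fourier (\<gamma> t)) \<kappa> (bas m)) (bas n) =
      cin (Rs (fourier v0) \<kappa> ((Ks t ^^ m) (bas 0))) ((Ks t ^^ n) (bas 0))"
    using LIMSEQ_unique by simp
qed

end

section \<open>Recurrence of the orbit\<close>

context bo_orbit
begin

lemma gamma_norm: "norm (emb (- s) (\<gamma> t)) \<le> sqrt ((1 + \<kappa>) * (32 * dyD s * wN s \<kappa> (fourier v0)))"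
proof (rule real_le_rsqrt)
  have "(1 + \<kappa>) * wN s \<kappa> (fourier (\<gamma> t)) \<le> (1 + \<kappa>) * (32 * dyD s * wN s \<kappa> (fourier v0))"
    using k1 gamma_wN[of \<kappa>] by (intro mult_left_mono) auto
  then show "(norm (emb (- s) (\<gamma> t)))\<^sup>2 \<le> (1 + \<kappa>) * (32 * dyD s * wN s \<kappa> (fourier v0))"
    using norm_emb_le_wN[OF gamma_sobolev s0 s(2) k1, of t] by linarith
qed

text \<open>\<open>gamma_wN\<close> holds at every k \<ge> \<kappa> with the same constant, and its
  right-hand side vanishes as k grows; so the tails of the orbit are small uniformly in time. The
  limit inherits the bound at \<kappa>, hence has a resolvent there.\<close>

lemma orbit_precompact:
  fixes t :: "nat \<Rightarrow> real"
  obtains r x where "strict_mono r" "x \<in> sobolev (- s)" "(\<lambda>j. emb (- s) (\<gamma> (t (r j)))) \<longlonglongrightarrow> emb (- s) x"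
    "good (fourier x) \<kappa>"
proof -
  have d1: "dyD s \<ge> 1" by (rule dyD_ge_1[OF s])
  have tails: "\<exists>A. finite A \<and> (\<forall>j. (\<Sum>\<^sub>\<infinity>i\<in>- A. (cmod (coef (emb (- s) (\<gamma> (t j))) i))\<^sup>2) \<le> e)" if e: "e > 0" for e
  proof -
    \<comment> \<open>64 = 2 * 32: the constant 2 of the tail estimate times the 32 of the orbit
      bound.\<close>
    have "0 < e / (64 * dyD s)" using e d1 by simp
    then have "\<forall>\<^sub>F k in at_top. wN s k (fourier v0) < e / (64 * dyD s)"
      by (rule order_tendstoD(2)[OF wN_tendsto_0[OF v0 s(1)]])
    then have "\<forall>\<^sub>F k in at_top. wN s k (fourier v0) < e / (64 * dyD s) \<and> k \<ge> \<kappa>"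
      by (intro eventually_conj eventually_ge_at_top)
    then obtain k where k: "wN s k (fourier v0) < e / (64 * dyD s)" "k \<ge> \<kappa>"
      using eventually_happens'[OF trivial_limit_at_top_linorder] by blast
    have k': "1 \<le> k" using k(2) k1 by linarith
    have "finite {i :: int. \<bar>real_of_int i\<bar> < k}"
    proof (rule finite_subset)
      show "{i :: int. \<bar>real_of_int i\<bar> < k} \<subseteq> {- \<lceil>k\<rceil>..\<lceil>k\<rceil>}"
      proof
        fix i assume "i \<in> {i :: int. \<bar>real_of_int i\<bar> < k}"
        then have "real_of_int i < k" "real_of_int (- i) < k" by (auto simp: abs_less_iff)
        then have "real_of_int i \<le> of_int \<lceil>k\<rceil>" "real_of_int (- i) \<le> of_int \<lceil>k\<rceil>"
          using le_of_int_ceiling[of k] by linarith+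
        then show "i \<in> {- \<lceil>k\<rceil>..\<lceil>k\<rceil>}" unfolding of_int_le_iff by auto
      qed
    qed simp
    moreover have "(\<Sum>\<^sub>\<infinity>i\<in>- {i. \<bar>real_of_int i\<bar> < k}. (cmod (coef (emb (- s) (\<gamma> (t j))) i))\<^sup>2) \<le> e" for j
    proof -
      have "(\<Sum>\<^sub>\<infinity>i\<in>- {i. \<bar>real_of_int i\<bar> < k}. (cmod (coef (emb (- s) (\<gamma> (t j))) i))\<^sup>2) \<le> 2 * wN s k (fourier (\<gamma> (t j)))"
        by (rule emb_tail_le_wN[OF gamma_sobolev s0 s(2) k']) (auto simp: japanese_def)
      also have "\<dots> \<le> 2 * (32 * dyD s * wN s k (fourier v0))"
        by (rule mult_left_mono[OF gamma_wN[OF k(2)]]) simp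
      also have "\<dots> \<le> e" using k(1) d1 by (simp add: field_simps)
      finally show ?thesis .
    qed
    ultimately show ?thesis by blast
  qed
  obtain r l where r: "strict_mono r" "(\<lambda>j. emb (- s) (\<gamma> (t (r j)))) \<longlonglongrightarrow> l"
    by (rule ell2_precompact[OF gamma_norm tails])
  from emb_closed[OF s0 s(2) gamma_sobolev r(2)] obtain x where x: "x \<in> sobolev (- s)" "emb (- s) x = l" by blast
  have lim: "(\<lambda>j. emb (- s) (\<gamma> (t (r j)))) \<longlonglongrightarrow> emb (- s) x" using r(2) x(2) by simp
  have "good (fourier x) \<kappa>"
    by (rule good_of_bound[OF x(1) wN_limit_le[OF s0 k1 gamma_sobolev x(1) lim gamma_wN]]) simp
  with r(1) x(1) lim show thesis by (rule that)
qed

text \<open>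
  The time dependence of the explicit formula factors through the point with coordinates
  \<open>cis t\<close> and \<open>cis (2 * t * \<nu> p)\<close> of an infinite torus, on which it is continuous.
\<close>

definition torus_Ks :: "complex \<Rightarrow> (nat \<Rightarrow> complex) \<Rightarrow> nat ell2 \<Rightarrow> nat ell2" where
  "torus_Ks z \<theta> f = cmul (cnj z) (shr (fn (\<lambda>p. cnj (\<theta> p)) f))"

lemma Ks_torus_limit:
  assumes z: "(\<lambda>j. cis (T j)) \<longlonglongrightarrow> z" and th: "\<And>p. (\<lambda>j. cis (2 * T j * \<nu> p)) \<longlonglongrightarrow> \<theta> p"
  shows "(\<lambda>j :: nat. (Ks (T j) ^^ m) f) \<longlonglongrightarrow> (torus_Ks z \<theta> ^^ m) f"
proof (induction m)
  case (Suc m)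
  have th1: "cmod (cnj (\<theta> p)) \<le> 1" for p
    using tendsto_norm[OF th[of p]] LIMSEQ_unique[OF _ tendsto_const[of 1]] by (simp add: LIMSEQ_const_iff)
  have Ks: "Ks (T j) h = cmul (cnj (cis (T j))) (shr (fn (\<lambda>p. cnj (cis (2 * T j * \<nu> p))) h))" for j h
    by (simp add: Ks_def E_def cis_cnj)
  have Suc_m: "(Ks (T j) ^^ Suc m) f = cmul (cnj (cis (T j))) (shr (fn (\<lambda>p. cnj (cis (2 * T j * \<nu> p))) ((Ks (T j) ^^ m) f)))" for j
    by (simp only: funpow.simps o_apply Ks[of j "(Ks (T j) ^^ m) f"])
  show ?case
    unfolding Suc_m unfolding funpow.simps o_apply torus_Ks_def[of z \<theta> "(torus_Ks z \<theta> ^^ m) f"]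
    by (intro tendsto_cmul tendsto_cnj z bcl_tendsto[OF bcl_shr] fn_tendsto[where C = 1] th th1 Suc) simp
qed simp

lemma limit_resolvent:
  assumes x: "x \<in> sobolev (- s)" "good (fourier x) \<kappa>" and lim: "(\<lambda>j :: nat. emb (- s) (\<gamma> (T j))) \<longlonglongrightarrow> emb (- s) x"
    and T: "(\<lambda>j. cis (T j)) \<longlonglongrightarrow> z" "\<And>p. (\<lambda>j. cis (2 * T j * \<nu> p)) \<longlonglongrightarrow> \<theta> p"
  shows "coef (Rs (fourier x) \<kappa> (bas m)) n =
    cin (Rs (fourier v0) \<kappa> ((torus_Ks z \<theta> ^^ m) (bas 0))) ((torus_Ks z \<theta> ^^ n) (bas 0))"
proof (rule LIMSEQ_unique)
  let ?c = "\<lambda>j. cin (Rs (fourier (\<gamma> (T j))) \<kappa> (bas m)) (bas n)"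
  have "?c \<longlonglongrightarrow> cin (Rs (fourier x) \<kappa> (bas m)) (bas n)"
    by (intro tendsto_cin Rs_sobolev_tendsto[OF s0 s(2) gamma_sobolev x(1) gamma_good x(2) lim] tendsto_const)
  then show "?c \<longlonglongrightarrow> coef (Rs (fourier x) \<kappa> (bas m)) n" by simp
  show "?c \<longlonglongrightarrow> cin (Rs (fourier v0) \<kappa> ((torus_Ks z \<theta> ^^ m) (bas 0))) ((torus_Ks z \<theta> ^^ n) (bas 0))"
    unfolding gamma_resolvent by (intro tendsto_cin bcl_tendsto[OF bcl_Rs[OF good]] Ks_torus_limit T)
qed

text \<open>Otherwise two limit points of the orbit with the same torus point would differ.\<close>

lemma orbit_recurrence:
  fixes t \<sigma> :: "nat \<Rightarrow> real"
  assumes \<sigma>: "(\<lambda>j. cis (\<sigma> j)) \<longlonglongrightarrow> 1" "\<And>p. (\<lambda>j. cis (2 * \<sigma> j * \<nu> p)) \<longlonglongrightarrow> 1" and e: "e > 0"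
  shows "\<exists>j. norm (emb (- s) (\<gamma> (t j + \<sigma> j)) - emb (- s) (\<gamma> (t j))) < e"
proof (rule ccontr)
  assume "\<not> ?thesis"
  then have far: "e \<le> norm (emb (- s) (\<gamma> (t j + \<sigma> j)) - emb (- s) (\<gamma> (t j)))" for j by (simp add: not_less)
  \<comment> \<open>The torus coordinates of the time t j: index 0 for \<open>cis (t j)\<close>,
    index p + 1 for the eigenvalue \<nu> p.\<close>
  define X where "X j i = (case i of 0 \<Rightarrow> cis (t j) | Suc p \<Rightarrow> cis (2 * t j * \<nu> p))" for j i
  have "bounded (range (\<lambda>j. X j i))" for i
    unfolding bounded_iff by (rule exI[of _ 1]) (auto simp: X_def split: nat.split)
  from coordinatewise_subsequence[of X, OF this] obtain r1
    where r1: "strict_mono r1" "\<And>i. convergent (\<lambda>j. X (r1 j) i)" by blast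
  obtain r2 x where r2: "strict_mono r2" and x: "x \<in> sobolev (- s)"
    "(\<lambda>j. emb (- s) (\<gamma> (t (r1 (r2 j))))) \<longlonglongrightarrow> emb (- s) x" "good (fourier x) \<kappa>"
    using orbit_precompact[of "\<lambda>j. t (r1 j)"] by blast
  obtain r3 y where r3: "strict_mono r3" and y: "y \<in> sobolev (- s)"
    "(\<lambda>j. emb (- s) (\<gamma> (t (r1 (r2 (r3 j))) + \<sigma> (r1 (r2 (r3 j)))))) \<longlonglongrightarrow> emb (- s) y" "good (fourier y) \<kappa>"
    using orbit_precompact[of "\<lambda>j. t (r1 (r2 j)) + \<sigma> (r1 (r2 j))"] by blast
  define R where "R j = r1 (r2 (r3 j))" for j
  have R: "strict_mono R" using r1(1) r2 r3 by (simp add: R_def strict_mono_def)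
  have x': "(\<lambda>j. emb (- s) (\<gamma> (t (R j)))) \<longlonglongrightarrow> emb (- s) x"
    using LIMSEQ_subseq_LIMSEQ[OF x(2) r3] by (simp add: o_def R_def)
  have y': "(\<lambda>j. emb (- s) (\<gamma> (t (R j) + \<sigma> (R j)))) \<longlonglongrightarrow> emb (- s) y"
    using y(2) by (simp add: R_def)
  define L where "L i = lim (\<lambda>j. X (r1 j) i)" for i
  have "strict_mono (\<lambda>j. r2 (r3 j))" using r2 r3 by (simp add: strict_mono_def)
  from LIMSEQ_subseq_LIMSEQ[OF _ this] have L: "(\<lambda>j. X (R j) i) \<longlonglongrightarrow> L i" for i
    using r1(2)[of i] by (simp add: convergent_LIMSEQ_iff L_def o_def R_def)
  have T: "(\<lambda>j. cis (t (R j))) \<longlonglongrightarrow> L 0" "(\<lambda>j. cis (2 * t (R j) * \<nu> p)) \<longlonglongrightarrow> L (Suc p)" for p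
    using L[of 0] L[of "Suc p"] by (simp_all add: X_def)
  have S: "(\<lambda>j. cis (\<sigma> (R j))) \<longlonglongrightarrow> 1" "(\<lambda>j. cis (2 * \<sigma> (R j) * \<nu> p)) \<longlonglongrightarrow> 1" for p
    using LIMSEQ_subseq_LIMSEQ[OF \<sigma>(1) R] LIMSEQ_subseq_LIMSEQ[OF \<sigma>(2) R] by (simp_all add: o_def)
  \<comment> \<open>The shift \<sigma> is negligible on the torus, so the shifted times have the
    same torus limit, and x and y have equal resolvent matrices.\<close>
  have T': "(\<lambda>j. cis (t (R j) + \<sigma> (R j))) \<longlonglongrightarrow> L 0" "(\<lambda>j. cis (2 * (t (R j) + \<sigma> (R j)) * \<nu> p)) \<longlonglongrightarrow> L (Suc p)" for p
    using tendsto_mult[OF T(1) S(1)] tendsto_mult[OF T(2) S(2), of p p]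
    by (simp_all add: cis_mult distrib_left distrib_right)
  have "fourier x = fourier y"
    by (rule Rs_determines[OF x(3) y(3)])
      (simp only: limit_resolvent[OF x(1,3) x' T] limit_resolvent[OF y(1,3) y' T'])
  then have "x = y" by (intro fourier_inject) simp
  then have "(\<lambda>j. norm (emb (- s) (\<gamma> (t (R j) + \<sigma> (R j))) - emb (- s) (\<gamma> (t (R j))))) \<longlonglongrightarrow> norm (emb (- s) y - emb (- s) y)"
    using x' y' by (intro tendsto_norm tendsto_diff) auto
  then have "e \<le> norm (emb (- s) y - emb (- s) y)"
    by (rule LIMSEQ_le_const) (use far in auto)
  then show False using e by simp
qed

text \<open>Along a subsequence the torus coordinates of \<tau> converge, so differences of late
  members tend to the identity of the torus. Uniformity in t holds because
  \<open>orbit_recurrence\<close> allows an arbitrary base point for each shift: a failure of the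
  Cauchy property would provide base points contradicting it.\<close>

lemma translates_precompact:
  fixes \<tau> :: "nat \<Rightarrow> real"
  obtains r :: "nat \<Rightarrow> nat" where "strict_mono r"
    "\<And>e. e > 0 \<Longrightarrow> \<exists>N. \<forall>i\<ge>N. \<forall>j\<ge>N. \<forall>t. norm (emb (- s) (\<gamma> (t + \<tau> (r i))) - emb (- s) (\<gamma> (t + \<tau> (r j)))) < e"
proof -
  define X where "X j i = (case i of 0 \<Rightarrow> cis (\<tau> j) | Suc p \<Rightarrow> cis (2 * \<tau> j * \<nu> p))" for j i
  have "bounded (range (\<lambda>j. X j i))" for i
    unfolding bounded_iff by (rule exI[of _ 1]) (auto simp: X_def split: nat.split)
  from coordinatewise_subsequence[of X, OF this] obtain r
    where r: "strict_mono r" "\<And>i. convergent (\<lambda>j. X (r j) i)" by blast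
  have one: "(\<lambda>n. X (r (I n)) i * cnj (X (r (J n)) i)) \<longlonglongrightarrow> 1"
    if I: "\<And>n. I n \<ge> n" and J: "\<And>n. J n \<ge> n" for I J :: "nat \<Rightarrow> nat" and i
  proof -
    obtain l where l: "(\<lambda>j. X (r j) i) \<longlonglongrightarrow> l" using r(2)[of i] by (auto simp: convergent_def)
    have F: "filterlim I sequentially sequentially" "filterlim J sequentially sequentially"
      using I J by (auto intro: filterlim_at_top_mono[OF filterlim_ident] always_eventually)
    have "cmod (X j i) = 1" for j by (simp add: X_def split: nat.split)
    then have "cmod l = 1" using tendsto_norm[OF l] by (simp add: LIMSEQ_const_iff)
    then have "l * cnj l = 1" by (simp add: complex_norm_square[symmetric])
    moreover have "(\<lambda>n. X (r (I n)) i * cnj (X (r (J n)) i)) \<longlonglongrightarrow> l * cnj l"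
      by (intro tendsto_mult tendsto_cnj filterlim_compose[OF l] F)
    ultimately show ?thesis by simp
  qed
  have "\<exists>N. \<forall>i\<ge>N. \<forall>j\<ge>N. \<forall>t. norm (emb (- s) (\<gamma> (t + \<tau> (r i))) - emb (- s) (\<gamma> (t + \<tau> (r j)))) < e" if e: "e > 0" for e
  proof (rule ccontr)
    assume "\<not> ?thesis"
    then have "\<forall>n. \<exists>i j t. i \<ge> n \<and> j \<ge> n \<and> e \<le> norm (emb (- s) (\<gamma> (t + \<tau> (r i))) - emb (- s) (\<gamma> (t + \<tau> (r j))))"
      by (simp add: not_less)
    then obtain I J t where IJ: "\<And>n. I n \<ge> n" "\<And>n. J n \<ge> n"
      and far: "\<And>n. e \<le> norm (emb (- s) (\<gamma> (t n + \<tau> (r (I n)))) - emb (- s) (\<gamma> (t n + \<tau> (r (J n)))))" by metis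
    let ?\<sigma> = "\<lambda>n. \<tau> (r (I n)) - \<tau> (r (J n))"
    have "\<exists>n. norm (emb (- s) (\<gamma> ((t n + \<tau> (r (J n))) + ?\<sigma> n)) - emb (- s) (\<gamma> (t n + \<tau> (r (J n))))) < e"
    proof (rule orbit_recurrence[OF _ _ e])
      show "(\<lambda>n. cis (?\<sigma> n)) \<longlonglongrightarrow> 1" using one[OF IJ, of 0] by (simp add: X_def cis_cnj cis_mult)
      show "(\<lambda>n. cis (2 * ?\<sigma> n * \<nu> p)) \<longlonglongrightarrow> 1" for p
        using one[OF IJ, of "Suc p"] by (simp add: X_def cis_cnj cis_mult algebra_simps)
    qed
    then show False using far by (auto simp: not_less[symmetric])
  qed
  with r(1) show thesis by (rule that)
qed

end

section \<open>Almost periodicity\<close>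

lemma sobolev_mcomplete:
  assumes s: "0 \<le> s" "s < 1 / 2"
  shows "Metric_space.mcomplete (sobolev (- s)) (\<lambda>u v. sobolev_norm (- s) (u - v))"
proof -
  interpret M: Metric_space "sobolev (- s)" "\<lambda>u v. sobolev_norm (- s) (u - v)" by (rule sobolev_Metric_space)
  show ?thesis
    unfolding M.mcomplete_def
  proof (intro allI impI)
    fix u assume c: "M.MCauchy u"
    then have u: "u j \<in> sobolev (- s)" for j by (auto simp: M.MCauchy_def)
    have "Cauchy (\<lambda>j. emb (- s) (u j))"
      using c by (simp add: M.MCauchy_def Cauchy_def dist_norm sobolev_norm_diff u)
    then obtain l where l: "(\<lambda>j. emb (- s) (u j)) \<longlonglongrightarrow> l" using Cauchy_convergent convergent_def by blast
    from emb_closed[OF s u l] obtain v where "v \<in> sobolev (- s)" "emb (- s) v = l" by blast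
    then have "limitin (sobolev_top (- s)) u v sequentially" using u l by (intro limitin_sobolevI) auto
    then show "\<exists>v. limitin M.mtopology u v sequentially" by (auto simp: mtopology_of_def)
  qed
qed

lemma closedin_sobolev_mean: "closedin (sobolev_top \<sigma>) (sobolev_mean \<sigma> c)"
proof -
  interpret M: Metric_space "sobolev \<sigma>" "\<lambda>u v. sobolev_norm \<sigma> (u - v)" by (rule sobolev_Metric_space)
  have "closedin M.mtopology (sobolev_mean \<sigma> c)"
    unfolding M.metric_closedin_iff_sequentially_closed
  proof (intro conjI allI impI)
    show "sobolev_mean \<sigma> c \<subseteq> sobolev \<sigma>" by (auto simp: sobolev_mean_def)
    fix u l assume "range u \<subseteq> sobolev_mean \<sigma> c \<and> limitin M.mtopology u l sequentially"
    then have u: "\<And>j. u j \<in> sobolev \<sigma>" "\<And>j. fourier (u j) 0 = of_real c" and l: "limitin (sobolev_top \<sigma>) u l sequentially"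
      by (auto simp: sobolev_mean_def mtopology_of_def)
    have ls: "l \<in> sobolev \<sigma>" using l by (simp add: limitin_sobolev)
    have "(\<lambda>j. emb \<sigma> (u j)) \<longlonglongrightarrow> emb \<sigma> l"
      using l ls by (simp add: limitin_sobolev sobolev_norm_diff u tendsto_norm_zero_iff LIM_zero_iff)
    from fourier_tendsto[OF u(1) ls this, of 0] have "fourier l 0 = of_real c"
      by (simp add: u LIMSEQ_const_iff)
    with ls show "l \<in> sobolev_mean \<sigma> c" by (simp add: sobolev_mean_def)
  qed
  then show ?thesis by (simp add: mtopology_of_def)
qed

context bo_orbit
begin

text \<open>The mean is conserved and its level set is closed, so the closure of the orbit in H^(-s)
  already lies in the affine subspace.\<close>

lemma orbit_relatively_compact:
  assumes c: "fourier v0 0 = of_real c"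
  shows "relatively_compact_in (subtopology (sobolev_top (- s)) (sobolev_mean (- s) c)) (range \<gamma>)"
proof -
  interpret M: Metric_space "sobolev (- s)" "\<lambda>u v. sobolev_norm (- s) (u - v)" by (rule sobolev_Metric_space)
  have top: "sobolev_top (- s) = M.mtopology" by (simp add: mtopology_of_def)
  have sub: "range \<gamma> \<subseteq> sobolev_mean (- s) c" using gamma_sobolev gamma_mean c by (auto simp: sobolev_mean_def)
  have "M.mtotally_bounded (range \<gamma>)"
    unfolding M.mtotally_bounded_sequentially
  proof (intro conjI allI impI)
    show "range \<gamma> \<subseteq> sobolev (- s)" using gamma_sobolev by auto
    fix u :: "nat \<Rightarrow> distr" assume "range u \<subseteq> range \<gamma>"
    then have "\<forall>j. \<exists>t. u j = \<gamma> t" by auto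
    then obtain t where t: "\<And>j. u j = \<gamma> (t j)" by metis
    obtain r x where r: "strict_mono r" "x \<in> sobolev (- s)" "(\<lambda>j. emb (- s) (\<gamma> (t (r j)))) \<longlonglongrightarrow> emb (- s) x"
      by (rule orbit_precompact)
    then have "limitin M.mtopology (u \<circ> r) x sequentially"
      unfolding top[symmetric] using gamma_sobolev by (intro limitin_sobolevI) (simp_all add: t)
    then have "M.MCauchy (u \<circ> r)" using gamma_sobolev by (intro M.convergent_imp_MCauchy) (auto simp: t)
    with r(1) show "\<exists>r. strict_mono r \<and> M.MCauchy (u \<circ> r)" by blast
  qed
  then have cpt: "compactin (sobolev_top (- s)) (sobolev_top (- s) closure_of range \<gamma>)"
    unfolding top using M.mtotally_bounded_eq_compact_closure_of[OF sobolev_mcomplete[OF s0 s(2)]] by blast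
  have "sobolev_top (- s) closure_of range \<gamma> \<subseteq> sobolev_mean (- s) c"
    by (rule closure_of_minimal[OF sub closedin_sobolev_mean])
  moreover have "sobolev_mean (- s) c \<subseteq> sobolev (- s)" by (auto simp: sobolev_mean_def)
  ultimately show ?thesis
    using cpt sub
    by (simp add: relatively_compact_in_def closure_of_subtopology compactin_subtopology Int_absorb1 inf.absorb2)
qed

text \<open>In the complete space of bounded continuous maps, relative compactness of the translates
  amounts to total boundedness, hence to the Cauchy subsequences of
  \<open>translates_precompact\<close>.\<close>

lemma orbit_almost_periodic: "almost_periodic (sobolev_metric (- s)) \<gamma>"
proof -
  interpret M: Metric_space "sobolev (- s)" "\<lambda>u v. sobolev_norm (- s) (u - v)" by (rule sobolev_Metric_space)
  have Self: "M.Self = sobolev_metric (- s)" by (simp add: M.Self_def sobolev_metric_def)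
  let ?C = "cfunspace euclideanreal (sobolev_metric (- s))"
  interpret C: Metric_space "mspace ?C" "mdist ?C" by (rule Metric_space_mspace_mdist)
  have mc: "C.mcomplete"
    using M.mcomplete_cfunspace[OF sobolev_mcomplete[OF s0 s(2)], of euclideanreal] by (simp add: Self mcomplete_of_def)
  have bounded: "M.mbounded (range \<gamma>)"
    unfolding M.mbounded_alt
  proof
    show "range \<gamma> \<subseteq> sobolev (- s)" using gamma_sobolev by auto
    let ?b = "sqrt ((1 + \<kappa>) * (32 * dyD s * wN s \<kappa> (fourier v0)))"
    have "sobolev_norm (- s) (\<gamma> t - \<gamma> r) \<le> 2 * ?b" for t r
      using norm_triangle_ineq4[of "emb (- s) (\<gamma> t)" "emb (- s) (\<gamma> r)"] gamma_norm[of t] gamma_norm[of r]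
      by (simp add: sobolev_norm_diff gamma_sobolev)
    then show "\<exists>B. \<forall>x\<in>range \<gamma>. \<forall>y\<in>range \<gamma>. sobolev_norm (- s) (x - y) \<le> B" by blast
  qed
  have cont: "continuous_map euclideanreal (sobolev_top (- s)) \<gamma>" using bo by (simp add: bo_solution_def)
  have mem: "(\<lambda>t. \<gamma> (t + \<tau>)) \<in> mspace ?C" for \<tau>
  proof -
    have "continuous_map euclideanreal (sobolev_top (- s)) (\<gamma> \<circ> (\<lambda>t. t + \<tau>))"
      by (rule continuous_map_compose[OF _ cont]) (auto intro: continuous_intros)
    moreover have "M.mbounded (range (\<lambda>t. \<gamma> (t + \<tau>)))"
      by (rule M.mbounded_subset[OF bounded]) auto
    ultimately show ?thesis using gamma_sobolev by (simp add: o_def)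
  qed
  have "C.mtotally_bounded (range (\<lambda>\<tau> t. \<gamma> (t + \<tau>)))"
    unfolding C.mtotally_bounded_sequentially
  proof (intro conjI allI impI)
    show "range (\<lambda>\<tau> t. \<gamma> (t + \<tau>)) \<subseteq> mspace ?C" using mem by blast
    fix u :: "nat \<Rightarrow> real \<Rightarrow> distr" assume "range u \<subseteq> range (\<lambda>\<tau> t. \<gamma> (t + \<tau>))"
    then have "\<forall>j. \<exists>\<tau>. u j = (\<lambda>t. \<gamma> (t + \<tau>))" by blast
    then obtain \<tau> where u: "\<And>j. u j = (\<lambda>t. \<gamma> (t + \<tau> j))" by metis
    from translates_precompact[of \<tau>] obtain r :: "nat \<Rightarrow> nat" where r: "strict_mono r"
      "\<And>e. e > 0 \<Longrightarrow> \<exists>N. \<forall>i\<ge>N. \<forall>j\<ge>N. \<forall>t. norm (emb (- s) (\<gamma> (t + \<tau> (r i))) - emb (- s) (\<gamma> (t + \<tau> (r j)))) < e"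
      by blast
    have "C.MCauchy (u \<circ> r)"
      unfolding C.MCauchy_def
    proof (intro conjI allI impI)
      show "range (u \<circ> r) \<subseteq> mspace ?C" unfolding o_def u using mem by blast
      fix e :: real assume "e > 0"
      then have "e / 2 > 0" by simp
      from r(2)[OF this] obtain N where
        N: "\<And>i j t. i \<ge> N \<Longrightarrow> j \<ge> N \<Longrightarrow> norm (emb (- s) (\<gamma> (t + \<tau> (r i))) - emb (- s) (\<gamma> (t + \<tau> (r j)))) < e / 2" by blast
      have "mdist ?C ((u \<circ> r) i) ((u \<circ> r) j) < e" if "N \<le> i" "N \<le> j" for i j
      proof -
        have "mdist ?C ((u \<circ> r) i) ((u \<circ> r) j) \<le> e / 2"
          by (rule mdist_cfunspace_le)
            (use N[OF that] \<open>e > 0\<close> in \<open>auto simp: u sobolev_norm_diff gamma_sobolev intro: less_imp_le\<close>)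
        then show ?thesis using \<open>e > 0\<close> by simp
      qed
      then show "\<exists>N. \<forall>i j. N \<le> i \<longrightarrow> N \<le> j \<longrightarrow> mdist ?C ((u \<circ> r) i) ((u \<circ> r) j) < e" by blast
    qed
    with r(1) show "\<exists>r. strict_mono r \<and> C.MCauchy (u \<circ> r)" by blast
  qed
  then have "range (\<lambda>\<tau> t. \<gamma> (t + \<tau>)) \<subseteq> mspace ?C \<and>
      compactin C.mtopology (C.mtopology closure_of range (\<lambda>\<tau> t. \<gamma> (t + \<tau>)))"
    by (rule iffD1[OF C.mtotally_bounded_eq_compact_closure_of[OF mc]])
  then have "relatively_compact_in (mtopology_of ?C) (range (\<lambda>\<tau> t. \<gamma> (t + \<tau>)))"
    unfolding relatively_compact_in_def mtopology_of_def C.topspace_mtopology .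
  then show ?thesis
    unfolding almost_periodic_def using mem[of 0] by simp
qed

end

theorem theorem2:
  fixes s c :: real and v0 :: distr and \<gamma> :: "real \<Rightarrow> distr"
  assumes "0 < s" and "s < 1 / 2"
    and "v0 \<in> sobolev_mean (- s) c"
    and "bo_solution s v0 \<gamma>"
  shows "relatively_compact_in (subtopology (sobolev_top (- s)) (sobolev_mean (- s) c)) (range \<gamma>) \<and>
         almost_periodic (sobolev_metric (- s)) \<gamma>"
proof -
  have vS: "v0 \<in> sobolev (- s)" "fourier v0 0 = of_real c" using assms(3) by (auto simp: sobolev_mean_def)
  have d1: "1 \<le> dyD s" and c1: "1 \<le> cs s" using dyD_ge_1 cs_ge_1 assms(1,2) by auto
  \<comment> \<open>The value below which \<open>wN\<close> meets the threshold of
    \<open>bo_orbit\<close>; it is reached by enlarging \<kappa>, whatever the size of the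
    datum.\<close>
  have p: "0 < 1 / (18 * 64 * cs s * dyD s)" using d1 c1 by simp
  have "\<forall>\<^sub>F \<kappa> in at_top. wN s \<kappa> (fourier v0) < 1 / (18 * 64 * cs s * dyD s) \<and> \<kappa> \<ge> 1"
    by (intro eventually_conj eventually_ge_at_top order_tendstoD(2)[OF wN_tendsto_0[OF vS(1) assms(1)] p])
  then obtain \<kappa> where k: "wN s \<kappa> (fourier v0) < 1 / (18 * 64 * cs s * dyD s)" "1 \<le> \<kappa>"
    using eventually_happens'[OF trivial_limit_at_top_linorder] by blast
  have threshold: "cs s * (64 * dyD s * wN s \<kappa> (fourier v0)) \<le> 1 / 18"
    using k(1) d1 c1 by (simp add: field_simps)
  have "1 * wN s \<kappa> (fourier v0) \<le> 64 * dyD s * wN s \<kappa> (fourier v0)"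
    using d1 wN_nonneg by (intro mult_right_mono) auto
  then have "cs s * wN s \<kappa> (fourier v0) \<le> cs s * (64 * dyD s * wN s \<kappa> (fourier v0))"
    using c1 by (intro mult_left_mono) auto
  then have "cs s * wN s \<kappa> (fourier v0) \<le> 1 / 9" using threshold by linarith
  then have "wN s \<kappa> (fourier v0) * cs s \<le> 1 / 9" by (simp only: mult.commute)
  then have "good (fourier v0) \<kappa>"
    using assms(1,2) vS(1) k(2) by (intro wN_good[of s] sobolev_wsum) (auto simp: sobolev_iff)
  then obtain \<phi> \<mu> where "lax_group \<phi> (fourier v0) \<kappa> \<mu>" by (rule lax_group_exists)
  then interpret bo_orbit \<phi> v0 \<kappa> \<mu> s \<gamma>
    by (intro bo_orbit.intro bo_orbit_axioms.intro) (use assms vS threshold in auto)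
  show ?thesis using orbit_relatively_compact[OF vS(2)] orbit_almost_periodic by blast
qed

end
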